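(* Let $(u_0,\tau_0,f_0)\in H^1(\Omega)^3$ with $u_0(0)=u_0(1)=0$, $f_0\ge 0$ and $f_0\not\equiv 0$. Let $(u,\tau,f)$ be the unique global solution of $$\rho\,\partial_t u=\eta\,\partial_{yy}u+\partial_y\tau,\qquad \lambda\,\partial_t\tau=G\,\partial_y u-f\tau,\qquad \partial_t f=(-1+\xi|\tau|)f^2-\nu f^3,$$ with initial conditions $(u_0,\tau_0,f_0)$ and homogeneous boundary conditions $u(t,0)=u(t,1)=0$ for all $t\ge 0$. Let $$\beta=\operatorname{meas}\{y\in\Omega : f_0(y)>0\}.$$ Then for every $\alpha\in(0,1)$ there exist a constant $\kappa_\alpha$ independent of time and a time $t_0$, both depending on the domain, the initial data, the coefficients of the system and $\alpha$, such that for all $t>t_0$ $$\|u(t,\cdot)\|_{H^1}+\|\tau(t,\cdot)\|_{L^2}\le \kappa_\alpha(1+t)^{-\frac{\beta}{\lambda}(1-\alpha)},$$ and, for all $t>t_0$ and $y\in\Omega$, $$\frac{1}{\frac{1}{f(t_0,y)}+(1+\alpha)(t-t_0)}\le f(t,y)\le\frac{1}{\frac{1}{f(t_0,y)}+(1-\alpha)(t-t_0)}.$$ In addition, there exists another constant $\kappa_\alpha$ (independent of time) such that, for all $t>t_0$, $$\|u(t,\cdot)\|_{H^1}+\|(\tau-\overline{\tau})(t,\cdot)\|_{L^2}\le\kappa_\alpha(1+t)^{-1-\frac{\beta}{\lambda}(1-\alpha)},$$ $$\big\|\big(\eta\,\partial_y u+\tau-\overline{\tau}\big)(t,\cdot)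\big\|_{L^2}\le\kappa_\alpha(1+t)^{-2-\frac{\beta}{\lambda}(1-\alpha)}.$$
   Context: $\Omega=[0,1]$ with space variable $y$; $t\ge0$ is time; $\rho,\eta,\lambda,G,\xi,\nu$ are positive constants; $u,\tau,f$ are real-valued functions of $(t,y)$. For such initial data there is a unique global solution $(u,\tau,f)$ with, for every $T>0$, $(u,\tau,f)\in (C([0,T];H^1)\cap L^2([0,T];H^2))\times C([0,T];H^1)\times C([0,T];H^1)$ and $(\partial_t u,\partial_t\tau,\partial_t f)\in L^2([0,T];L^2)\times C([0,T];L^2)\times C([0,T];L^2)$; moreover $f\ge 0$. This is the solution meant in the statement. The spatial average is $\overline{\tau}(t)=\int_\Omega\tau(t,y)\,dy$. Convention: where $f(t_0,y)=0$, one sets $1/f(t_0,y)=+\infty$ and both bounds on $f(t,y)$ are read as $0$. All function spaces in $y$ are over $\Omega$. *)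

theory Defs
  imports "HOL-Analysis.Analysis"
begin

abbreviation Omega :: "real measure" where
  "Omega \<equiv> lebesgue_on {0..1}"

subsection \<open>Lebesgue and Sobolev spaces on the unit interval\<close>

text \<open>Elements of the spaces are functions, not classes modulo null sets. Values outside
  \<open>{0..1}\<close> are irrelevant throughout.\<close>

definition L2 :: "(real \<Rightarrow> real) set" where
  "L2 = {v. v \<in> borel_measurable Omega \<and> integrable Omega (\<lambda>y. (v y)\<^sup>2)}"

definition L2_norm :: "(real \<Rightarrow> real) \<Rightarrow> real" where
  "L2_norm v = sqrt (LINT y|Omega. (v y)\<^sup>2)"

definition L2_inner :: "(real \<Rightarrow> real) \<Rightarrow> (real \<Rightarrow> real) \<Rightarrow> real" where
  "L2_inner v w = (LINT y|Omega. v y * w y)"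

definition test_functions :: "real \<Rightarrow> real \<Rightarrow> (real \<Rightarrow> real) set" where
  "test_functions a b = {\<phi>. (\<forall>k x. (deriv ^^ k) \<phi> field_differentiable (at x)) \<and>
     closure {x. \<phi> x \<noteq> 0} \<subseteq> {a<..<b}}"

definition has_weak_deriv :: "real \<Rightarrow> real \<Rightarrow> nat \<Rightarrow> (real \<Rightarrow> real) \<Rightarrow> (real \<Rightarrow> real) \<Rightarrow> bool" where
  "has_weak_deriv a b k v g \<longleftrightarrow> (\<forall>\<phi>\<in>test_functions a b.
     (LINT x|lebesgue_on {a..b}. v x * (deriv ^^ k) \<phi> x)
       = (- 1) ^ k * (LINT x|lebesgue_on {a..b}. g x * \<phi> x))"

definition sobolev :: "nat \<Rightarrow> (real \<Rightarrow> real) set" where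
  "sobolev k = {v \<in> L2. \<forall>j\<le>k. \<exists>g\<in>L2. has_weak_deriv 0 1 j v g}"

text \<open>The weak derivative is determined only up to a null set, so the choice below picks a
  representative; \<open>weak_D\<close> is used only in norms and in equations holding almost everywhere.\<close>

definition weak_D :: "nat \<Rightarrow> (real \<Rightarrow> real) \<Rightarrow> real \<Rightarrow> real" where
  "weak_D k v = (SOME g. g \<in> L2 \<and> has_weak_deriv 0 1 k v g)"

definition sobolev_norm :: "nat \<Rightarrow> (real \<Rightarrow> real) \<Rightarrow> real" where
  "sobolev_norm k v = sqrt (\<Sum>j\<le>k. (L2_norm (weak_D j v))\<^sup>2)"

text \<open>Pointwise values of an \<open>H\<^sup>1\<close> function (boundary values, bounds for every \<open>y\<close>) are those of
  its continuous representative, hence the continuity requirement.\<close>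

definition H1 :: "(real \<Rightarrow> real) set" where
  "H1 = {v \<in> sobolev 1. continuous_on {0..1} v}"

subsection \<open>Functions of time with values in a function space\<close>

text \<open>A space is passed as a carrier \<open>X\<close> together with its (semi)norm \<open>N\<close>; a function of
  \<open>(t, y)\<close> is curried, with time first.\<close>

definition C_time ::
  "real \<Rightarrow> (real \<Rightarrow> real) set \<Rightarrow> ((real \<Rightarrow> real) \<Rightarrow> real) \<Rightarrow> (real \<Rightarrow> real \<Rightarrow> real) set" where
  "C_time T X N = {w. (\<forall>t\<in>{0..T}. w t \<in> X) \<and>
     (\<forall>t\<in>{0..T}. ((\<lambda>s. N (\<lambda>y. w s y - w t y)) \<longlongrightarrow> 0) (at t within {0..T}))}"

text \<open>Bochner measurability: almost everywhere limit of simple functions with values in \<open>X\<close>.\<close>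

definition strongly_measurable ::
  "real \<Rightarrow> (real \<Rightarrow> real) set \<Rightarrow> ((real \<Rightarrow> real) \<Rightarrow> real) \<Rightarrow> (real \<Rightarrow> real \<Rightarrow> real) \<Rightarrow> bool" where
  "strongly_measurable T X N w \<longleftrightarrow> (\<exists>s :: nat \<Rightarrow> real \<Rightarrow> real \<Rightarrow> real.
     (\<forall>n. simple_function (lebesgue_on {0..T}) (s n) \<and> s n ` {0..T} \<subseteq> X) \<and>
     (AE t in lebesgue_on {0..T}. (\<lambda>n. N (\<lambda>y. s n t y - w t y)) \<longlonglongrightarrow> 0))"

definition L2_time ::
  "real \<Rightarrow> (real \<Rightarrow> real) set \<Rightarrow> ((real \<Rightarrow> real) \<Rightarrow> real) \<Rightarrow> (real \<Rightarrow> real \<Rightarrow> real) set" where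
  "L2_time T X N = {w. (AE t in lebesgue_on {0..T}. w t \<in> X) \<and> strongly_measurable T X N w \<and>
     integrable (lebesgue_on {0..T}) (\<lambda>t. (N (w t))\<^sup>2)}"

text \<open>Weak time derivative of an \<open>L\<^sup>2\<close>-valued function. The identity between \<open>L\<^sup>2\<close>-valued Bochner
  integrals \<open>\<integral> w(t) \<phi>'(t) dt = - \<integral> w'(t) \<phi>(t) dt\<close> is expressed by pairing with every
  \<open>\<psi> \<in> L\<^sup>2\<close>.\<close>

definition has_weak_time_deriv ::
  "real \<Rightarrow> (real \<Rightarrow> real \<Rightarrow> real) \<Rightarrow> (real \<Rightarrow> real \<Rightarrow> real) \<Rightarrow> bool" where
  "has_weak_time_deriv T w w' \<longleftrightarrow>
     (\<forall>\<psi>\<in>L2. has_weak_deriv 0 T 1 (\<lambda>t. L2_inner (w t) \<psi>) (\<lambda>t. L2_inner (w' t) \<psi>))"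

subsection \<open>The system\<close>

definition global_solution ::
  "real \<Rightarrow> real \<Rightarrow> real \<Rightarrow> real \<Rightarrow> real \<Rightarrow> real \<Rightarrow>
   (real \<Rightarrow> real) \<Rightarrow> (real \<Rightarrow> real) \<Rightarrow> (real \<Rightarrow> real) \<Rightarrow>
   (real \<Rightarrow> real \<Rightarrow> real) \<Rightarrow> (real \<Rightarrow> real \<Rightarrow> real) \<Rightarrow> (real \<Rightarrow> real \<Rightarrow> real) \<Rightarrow> bool" where
  "global_solution \<rho> \<eta> lam G \<xi> \<nu> u0 \<tau>0 f0 u \<tau> f \<longleftrightarrow>
     (\<exists>ut \<tau>t ft. \<forall>T>0.
        u \<in> C_time T H1 (sobolev_norm 1) \<inter> L2_time T (sobolev 2) (sobolev_norm 2) \<and>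
        \<tau> \<in> C_time T H1 (sobolev_norm 1) \<and>
        f \<in> C_time T H1 (sobolev_norm 1) \<and>
        has_weak_time_deriv T u ut \<and> ut \<in> L2_time T L2 L2_norm \<and>
        has_weak_time_deriv T \<tau> \<tau>t \<and> \<tau>t \<in> C_time T L2 L2_norm \<and>
        has_weak_time_deriv T f ft \<and> ft \<in> C_time T L2 L2_norm \<and>
        (AE t in lebesgue_on {0..T}.
          (AE y in Omega. \<rho> * ut t y = \<eta> * weak_D 2 (u t) y + weak_D 1 (\<tau> t) y) \<and>
          (AE y in Omega. lam * \<tau>t t y = G * weak_D 1 (u t) y - f t y * \<tau> t y) \<and>
          (AE y in Omega. ft t y = (- 1 + \<xi> * \<bar>\<tau> t y\<bar>) * (f t y)\<^sup>2 - \<nu> * (f t y) ^ 3))) \<and>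
     (\<forall>y\<in>{0..1}. u 0 y = u0 y \<and> \<tau> 0 y = \<tau>0 y \<and> f 0 y = f0 y) \<and>
     (\<forall>t\<ge>0. u t 0 = 0 \<and> u t 1 = 0)"

definition space_avg :: "(real \<Rightarrow> real) \<Rightarrow> real" where
  "space_avg v = (LINT y|Omega. v y)"

text \<open>The quantity \<open>1 / (1 / w + c)\<close>, with \<open>1 / 0\<close> read as \<open>+\<infinity>\<close> when \<open>w = 0\<close>
  (whereas \<open>1 / 0 = 0\<close> in HOL).\<close>

definition recip_bound :: "real \<Rightarrow> real \<Rightarrow> real" where
  "recip_bound w c = (if w = 0 then 0 else 1 / (1 / w + c))"

end

theory Submission imports Defs "HOL-Computational_Algebra.Polynomial" begin

text \<open>
Write \<open>\<lambda>\<close> for \<open>lam\<close>, and integrate the momentum equation once in space. With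
\<open>v = \<rho> (primitive of u with mean zero)\<close> it reads
\<open>\<partial>\<^sub>t v = \<eta> \<partial>\<^sub>y u + \<tau> - mean \<tau>\<close>: the boundary values of \<open>u\<close> make the right-hand side mean free. So the third
estimate of the theorem is about the speed of \<open>v\<close>, and the second one is about the distance of the state
to the stationary states of the system without \<open>f\<close>, which are \<open>u = 0\<close> with constant \<open>\<tau>\<close>.

The linear part relaxes exponentially to these states. Indeed \<open>w = \<tau> - mean \<tau> - c v\<close> with
\<open>c = G / (\<lambda> \<eta>)\<close> obeys an ordinary differential equation with damping \<open>c\<close>, in which \<open>\<partial>\<^sub>y u\<close> does not
occur, and the system for \<open>v\<close> and the primitive \<open>\<theta>\<close> of \<open>\<tau> - mean \<tau>\<close> has a dissipative energy. A
combination \<open>F\<close> of both is comparable to \<open>\<parallel>v\<parallel>\<^sup>2 + \<parallel>w\<parallel>\<^sup>2\<close> and satisfies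
\<open>F' \<le> K \<parallel>f \<tau>\<parallel>\<^sup>2 - \<delta> F\<close> (lemma \<open>F_decay\<close>). What remains is slow: \<open>\<lambda> (mean \<tau>)' = - mean (f \<tau>)\<close>.

Where \<open>f\<close> does not vanish, \<open>(1 / f)' = 1 - \<xi> \<bar>\<tau>\<bar> + \<nu> f\<close>. This is bounded, so \<open>f\<close> is at least a multiple of
\<open>f(0) / (1 + t)\<close>; with the energy of \<open>(u, \<tau>)\<close> this gives some algebraic decay of \<open>\<parallel>\<tau>\<parallel>\<close>
(\<open>E_algebraic_decay\<close>), and the pointwise equation turns it into uniform convergence \<open>\<tau> \<rightarrow> 0\<close>
(\<open>\<tau>_small\<close>). Hence \<open>(1 / f)' \<rightarrow> 1\<close> uniformly, which is the two-sided bound on \<open>f\<close>, and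
\<open>mean f \<ge> \<beta> (1 - 3 a) / (1 + t)\<close> eventually, for every small \<open>a\<close> (\<open>mean_f_lower\<close>).

Since \<open>\<tau>\<close> is almost constant in space, \<open>\<lambda> (mean \<tau>)' \<approx> - (\<beta> / t) mean \<tau>\<close>, whence the rate
\<open>t\<close> to the power \<open>- \<beta> / \<lambda>\<close>, up to the loss \<open>\<alpha>\<close> (\<open>N_decay\<close>). The force \<open>f \<tau>\<close> is smaller by a factor \<open>1 / t\<close>,
and by the damping so are \<open>v\<close> and \<open>\<tau> - mean \<tau>\<close> (\<open>F_rate\<close>). Its time derivative is smaller by another
factor \<open>1 / t\<close>, and the difference quotients in time satisfy the same linear system (\<open>dq_flow\<close>), so
\<open>\<partial>\<^sub>t v = \<eta> \<partial>\<^sub>y u + \<tau> - mean \<tau>\<close> gains that factor as well (\<open>dq_rate\<close>). This bound and the one on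
\<open>\<tau> - mean \<tau>\<close> control \<open>\<partial>\<^sub>y u\<close>.

The solution has weak derivatives only. Therefore the equations are first brought into a form
without derivatives in time, in which the increments over every time interval are integrals of continuous
functions (\<open>global_solution_imp_aging_flow\<close>). Energy identities hold for averages over short time intervals
and pass to the limit as inequalities, and integral inequalities are exploited by a comparison principle.
\<close>

section \<open>Smooth bump functions\<close>

text \<open>For \<open>P = 1\<close> and \<open>k = 0\<close> this is the classical bump function. The factors in front of the
  exponential make the class closed under differentiation, so that smoothness follows by induction.\<close>

definition bump_with :: "real poly \<Rightarrow> nat \<Rightarrow> real \<Rightarrow> real" where
  "bump_with P k x = (if \<bar>x\<bar> < 1
     then poly P x * inverse (1 - x\<^sup>2) ^ k * exp (- inverse (1 - x\<^sup>2)) else 0)"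

lemma power_exp_bound:
  fixes W :: real assumes "W > 0" shows "W ^ k * exp (- W) \<le> fact (k + 2) * inverse W ^ 2"
proof -
  have "W ^ (k + 2) / fact (k + 2) \<le> exp W"
  proof -
    have s: "summable (\<lambda>n. W ^ n /\<^sub>R fact n)" by (rule summable_exp_generic)
    have "(\<Sum>n\<in>{k+2}. W ^ n /\<^sub>R fact n) \<le> (\<Sum>n. W ^ n /\<^sub>R fact n)"
      by (rule sum_le_suminf[OF s]) (use assms in auto)
    then show ?thesis by (simp add: exp_def divide_inverse mult.commute)
  qed
  then have "W ^ (k + 2) \<le> fact (k+2) * exp W" by (simp add: divide_simps mult.commute)
  then have "W ^ k * W\<^sup>2 * exp (-W) \<le> fact (k+2)"
    by (simp add: exp_minus divide_simps power_add power2_eq_square mult_ac)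
  then show ?thesis using assms by (simp add: power_inverse divide_simps mult.commute mult.left_commute)
qed

text \<open>The exponential beats every power of \<open>1 / (1 - x\<^sup>2)\<close>; a quadratic bound is all that
  differentiability at \<open>\<plusminus>1\<close> takes.\<close>

lemma bump_with_quadratic:
  assumes "\<bar>x0\<bar> = 1"
  shows "\<exists>C. \<forall>x. \<bar>bump_with P k x\<bar> \<le> C * (x - x0)\<^sup>2"
proof -
  have "bounded (poly P ` {-1..1})"
    by (intro compact_imp_bounded compact_continuous_image continuous_intros) auto
  then obtain M where M: "\<And>x. x \<in> {-1..1} \<Longrightarrow> \<bar>poly P x\<bar> \<le> M" unfolding bounded_iff by force
  have M0: "M \<ge> 0" using M[of 0] by auto
  have "\<bar>bump_with P k x\<bar> \<le> (M * fact (k+2) * 4) * (x - x0)\<^sup>2" for x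
  proof (cases "\<bar>x\<bar> < 1")
    case True
    let ?W = "inverse (1 - x\<^sup>2)"
    have x2: "x\<^sup>2 < 1" using True by (simp add: abs_square_less_1)
    then have W: "?W > 0" by simp
    have "(1 - x\<^sup>2) = (1 - \<bar>x\<bar>) * (1 + \<bar>x\<bar>)" by (simp add: algebra_simps power2_eq_square)
    also have "\<dots> \<le> \<bar>x - x0\<bar> * 2" using True assms by (intro mult_mono) auto
    finally have "(1 - x\<^sup>2)^2 \<le> (\<bar>x - x0\<bar> * 2)^2" using x2 by (intro power_mono) auto
    then have q: "(1 - x\<^sup>2)\<^sup>2 \<le> 4 * (x - x0)\<^sup>2" by (simp add: power_mult_distrib)
    have "\<bar>bump_with P k x\<bar> = \<bar>poly P x\<bar> * (?W ^ k * exp (- ?W))"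
      using True W x2 by (simp add: bump_with_def abs_mult)
    also have "\<dots> \<le> M * (fact (k+2) * (inverse ?W) ^ 2)"
    proof (rule mult_mono)
      show "\<bar>poly P x\<bar> \<le> M" by (rule M) (use True in \<open>auto simp: abs_less_iff\<close>)
      show "?W ^ k * exp (- ?W) \<le> fact (k+2) * (inverse ?W)\<^sup>2" by (rule power_exp_bound[OF W])
    qed (use M0 x2 in auto)
    also have "\<dots> = M * fact (k+2) * (1 - x\<^sup>2)^2" by simp
    also have "\<dots> \<le> M * fact (k+2) * (4 * (x - x0)\<^sup>2)" using M0 q by (intro mult_left_mono) auto
    finally show ?thesis by simp
  qed (use M0 in \<open>simp add: bump_with_def\<close>)
  then show ?thesis by blast
qed

lemma quadratic_imp_DERIV_0:
  fixes F :: "real \<Rightarrow> real"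
  assumes "\<And>x. \<bar>F x\<bar> \<le> C * (x - x0)\<^sup>2"
  shows "(F has_real_derivative 0) (at x0)"
proof -
  have F0: "F x0 = 0" using assms[of x0] by simp
  have "((\<lambda>h. F (x0 + h) / h) \<longlongrightarrow> 0) (at 0)"
  proof (rule Lim_null_comparison[where g="\<lambda>h. \<bar>C\<bar> * \<bar>h\<bar>"])
    have "norm (F (x0 + h) / h) \<le> \<bar>C\<bar> * \<bar>h\<bar>" if "h \<noteq> 0" for h
    proof -
      have "\<bar>F (x0 + h)\<bar> \<le> \<bar>C\<bar> * h\<^sup>2"
        using assms[of "x0 + h"] mult_right_mono[of C "\<bar>C\<bar>" "h\<^sup>2"] abs_ge_self[of C] by simp
      also have "\<dots> = \<bar>C\<bar> * \<bar>h\<bar> * \<bar>h\<bar>" by (simp add: power2_eq_square)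
      finally show ?thesis using that by (simp add: abs_divide divide_simps)
    qed
    then show "\<forall>\<^sub>F h in at 0. norm (F (x0 + h) / h) \<le> \<bar>C\<bar> * \<bar>h\<bar>"
      by (auto simp: eventually_at_filter)
    show "((\<lambda>h. \<bar>C\<bar> * \<bar>h\<bar>) \<longlongrightarrow> 0) (at 0)" by (auto intro!: tendsto_eq_intros)
  qed
  then show ?thesis by (simp add: DERIV_def F0)
qed

lemma bump_with_deriv:
  "\<exists>Q. \<forall>x. (bump_with P k has_real_derivative bump_with Q (k + 2) x) (at x)"
proof -
  \<comment> \<open>the numerator of the derivative over the common denominator \<open>(1 - x\<^sup>2)\<close> to the power \<open>k + 2\<close>\<close>
  define Q where "Q = pderiv P * [:1,0,-1:]^2 + [:0, 2 * of_nat k:] * P * [:1,0,-1:] - [:0,2:] * P"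
  have "(bump_with P k has_real_derivative bump_with Q (k + 2) x) (at x)" for x
  proof -
    consider "\<bar>x\<bar> < 1" | "\<bar>x\<bar> > 1" | "\<bar>x\<bar> = 1" by linarith
    then show ?thesis
    proof cases
      case 1
      then have x2: "x\<^sup>2 < 1" by (simp add: abs_square_less_1)
      define W where "W = inverse (1 - x\<^sup>2)"
      have W: "W > 0" "(1 - x\<^sup>2) * W = 1" using x2 by (auto simp: W_def)
      have Wd: "((\<lambda>x. inverse (1 - x\<^sup>2)) has_real_derivative 2 * x * W\<^sup>2) (at x)"
        using x2 by (auto intro!: derivative_eq_intros simp: W_def power2_eq_square)
      have Wk: "((\<lambda>x. inverse (1 - x\<^sup>2)^k) has_real_derivative of_nat k * (2 * x * W\<^sup>2) * W^(k-1)) (at x)"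
        by (rule DERIV_cong[OF DERIV_power[OF Wd]]) (simp add: W_def)
      have "((\<lambda>x. poly P x * inverse (1 - x\<^sup>2) ^ k * exp (- inverse (1 - x\<^sup>2))) has_real_derivative
         (poly (pderiv P) x * W^k + of_nat k * (2 * x * W\<^sup>2) * W^(k-1) * poly P x) * exp (- W)
          + exp (-W) * (- (2 * x * W\<^sup>2)) * (poly P x * W^k)) (at x)"
        unfolding W_def
        by (rule DERIV_mult[OF DERIV_mult[OF poly_DERIV Wk[unfolded W_def]] DERIV_fun_exp[OF DERIV_minus[OF Wd[unfolded W_def]]]])
      also have "(poly (pderiv P) x * W^k + of_nat k * (2 * x * W\<^sup>2) * W^(k-1) * poly P x) * exp (- W)
          + exp (-W) * (- (2 * x * W\<^sup>2)) * (poly P x * W^k) = bump_with Q (k+2) x"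
      proof -
        have e: "of_nat k * W^2 * W^(k-1) = of_nat k * W^(k+2) * (1 - x\<^sup>2)"
        proof (cases k)
          case (Suc j)
          have "W^(k+2) * (1 - x\<^sup>2) = W^2 * W^(k-1) * ((1-x\<^sup>2) * W)" by (simp add: Suc power2_eq_square)
          then show ?thesis using W(2) by simp
        qed simp
        have e2: "W^k = W^(k+2) * (1 - x\<^sup>2)^2"
        proof -
          have "W^(k+2) * (1 - x\<^sup>2)^2 = W^k * ((1-x\<^sup>2) * W)^2" by (simp add: power2_eq_square power_add algebra_simps)
          then show ?thesis using W(2) by simp
        qed
        have "bump_with Q (k+2) x = poly Q x * W^(k+2) * exp (-W)"
          using 1 by (simp add: bump_with_def W_def)
        also have "poly Q x = poly (pderiv P) x * (1 - x\<^sup>2)^2 + 2 * of_nat k * x * poly P x * (1 - x\<^sup>2) - 2 * x * poly P x"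
          by (simp add: Q_def power2_eq_square algebra_simps)
        also have "(\<dots>) * W^(k+2) = poly (pderiv P) x * (W^(k+2) * (1 - x\<^sup>2)^2)
            + 2 * x * poly P x * (of_nat k * W^(k+2) * (1 - x\<^sup>2)) - 2 * x * poly P x * W^(k+2)"
          by (simp add: algebra_simps)
        finally have "bump_with Q (k+2) x = (poly (pderiv P) x * W^k
            + 2 * x * poly P x * (of_nat k * W^2 * W^(k-1)) - 2 * x * poly P x * W^(k+2)) * exp (-W)"
          by (simp only: e2[symmetric] e[symmetric])
        then show ?thesis by (simp only:) (simp add: algebra_simps power_add power2_eq_square)
      qed
      finally have d: "((\<lambda>x. poly P x * inverse (1 - x\<^sup>2) ^ k * exp (- inverse (1 - x\<^sup>2))) has_real_derivative
         bump_with Q (k+2) x) (at x)" .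
      show ?thesis
        by (rule DERIV_cong_ev[THEN iffD1, OF refl _ refl d])
           (use 1 in \<open>auto simp: bump_with_def eventually_nhds intro!: exI[of _ "{-1<..<1}"]\<close>)
    next
      case 2
      have d: "((\<lambda>x. 0) has_real_derivative bump_with Q (k+2) x) (at x)"
        using 2 by (simp add: bump_with_def)
      have "open {x::real. \<bar>x\<bar> > 1}" by (intro open_Collect_less continuous_intros)
      then show ?thesis
        by (intro DERIV_cong_ev[THEN iffD1, OF refl _ refl d])
           (use 2 in \<open>auto simp: bump_with_def eventually_nhds intro!: exI[of _ "{x. \<bar>x\<bar> > 1}"]\<close>)
    next
      case 3
      obtain C where "\<And>x'. \<bar>bump_with P k x'\<bar> \<le> C * (x' - x)\<^sup>2" using bump_with_quadratic[OF 3] by blast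
      from quadratic_imp_DERIV_0[OF this] show ?thesis using 3 by (simp add: bump_with_def[of Q])
    qed
  qed
  then show ?thesis by blast
qed

definition smooth :: "(real \<Rightarrow> real) \<Rightarrow> bool" where
  "smooth \<phi> \<longleftrightarrow> (\<forall>k x. (deriv ^^ k) \<phi> field_differentiable (at x))"

lemma deriv_funpow_Suc: "(deriv ^^ Suc k) \<phi> = (deriv ^^ k) (deriv \<phi>)"
  by (simp add: funpow_swap1)

lemma smooth_antiderivative:
  assumes "\<And>x. (F has_real_derivative g x) (at x)" "smooth g" shows "smooth F" "deriv F = g"
proof -
  show d: "deriv F = g" using assms(1) DERIV_imp_deriv by blast
  have "(deriv ^^ k) F field_differentiable (at x)" for k x
  proof (cases k)
    case 0 then show ?thesis using assms(1) by (auto simp: field_differentiable_def)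
  next
    case (Suc j) then show ?thesis using assms(2) by (simp only: deriv_funpow_Suc d) (simp add: smooth_def)
  qed
  then show "smooth F" by (auto simp: smooth_def)
qed

lemma smooth_deriv: "smooth \<phi> \<Longrightarrow> smooth (deriv \<phi>)"
  unfolding smooth_def by (metis deriv_funpow_Suc)

lemma smooth_DERIV: "smooth \<phi> \<Longrightarrow> (\<phi> has_real_derivative deriv \<phi> x) (at x)"
  unfolding smooth_def using field_differentiable_derivI by (metis funpow_0)

lemma smooth_continuous: "smooth \<phi> \<Longrightarrow> continuous_on S \<phi>"
  by (meson DERIV_isCont continuous_at_imp_continuous_on smooth_DERIV)

lemma smooth_add:
  assumes "smooth \<phi>" "smooth \<psi>" shows "smooth (\<lambda>x. \<phi> x + \<psi> x)"
proof -
  have "(deriv ^^ k) (\<lambda>x. \<phi> x + \<psi> x) = (\<lambda>x. (deriv ^^ k) \<phi> x + (deriv ^^ k) \<psi> x)" for k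
  proof (induction k)
    case (Suc k)
    show ?case unfolding funpow.simps o_def Suc
      using assms by (intro ext deriv_add) (auto simp: smooth_def)
  qed simp
  then show ?thesis using assms by (auto simp: smooth_def intro!: field_differentiable_add)
qed

lemma smooth_affine:
  assumes "smooth \<phi>" shows "smooth (\<lambda>x. a * \<phi> (b * x + c))"
proof -
  have d: "((\<lambda>x. \<psi> * (deriv ^^ k) \<phi> (b * x + c)) has_real_derivative \<psi> * b * (deriv ^^ Suc k) \<phi> (b * x + c)) (at x)" for \<psi> k x
  proof -
    have k: "((deriv ^^ k) \<phi> has_real_derivative (deriv ^^ Suc k) \<phi> (b * x + c)) (at (b * x + c))"
      using assms by (auto simp: smooth_def intro: field_differentiable_derivI)
    have l: "((\<lambda>x. b * x + c) has_real_derivative b) (at x)" by (auto intro!: derivative_eq_intros)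
    from DERIV_chain2[where g="\<lambda>x. b * x + c" and x=x and Db=b and s=UNIV, OF k l]
    have "((\<lambda>x. (deriv ^^ k) \<phi> (b * x + c)) has_real_derivative (deriv ^^ Suc k) \<phi> (b * x + c) * b) (at x)"
      by simp
    from DERIV_cmult[OF this, of \<psi>] show ?thesis by (simp add: mult_ac)
  qed
  have "(deriv ^^ k) (\<lambda>x. a * \<phi> (b * x + c)) = (\<lambda>x. (a * b ^ k) * (deriv ^^ k) \<phi> (b * x + c))" for k
  proof (induction k)
    case (Suc k)
    show ?case unfolding funpow.simps(2)[of k] o_def Suc
      using DERIV_imp_deriv[OF d[of "a * b ^ k" k]] by (auto simp: mult_ac fun_eq_iff)
  qed simp
  then show ?thesis using d by (auto simp: smooth_def field_differentiable_def intro!: exI)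
qed

lemma smooth_bump_with: "smooth (bump_with P k)"
proof -
  have "\<exists>Q j. (deriv ^^ n) (bump_with P k) = bump_with Q j" for n
  proof (induction n)
    case 0 then show ?case by auto
  next
    case (Suc n)
    then obtain Q j where e: "(deriv ^^ n) (bump_with P k) = bump_with Q j" by blast
    obtain Q' where "\<And>x. (bump_with Q j has_real_derivative bump_with Q' (j + 2) x) (at x)"
      using bump_with_deriv by blast
    then have "deriv (bump_with Q j) = bump_with Q' (j + 2)" using DERIV_imp_deriv by blast
    then show ?case by (auto simp: e)
  qed
  then show ?thesis unfolding smooth_def field_differentiable_def by (metis bump_with_deriv)
qed

text \<open>\<open>B1\<close> is a smooth step from \<open>0\<close> to \<open>1\<close> and \<open>B2\<close> a smooth version of the positive part: their
  rescalings are combined to test functions with prescribed first or second derivative.\<close>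

lemma smooth_bump_exists:
  obtains B B1 B2 :: "real \<Rightarrow> real" and m :: real where
    "smooth B" "\<And>x. (B1 has_real_derivative B x) (at x)" "\<And>x. (B2 has_real_derivative B1 x) (at x)"
    "\<And>x. B x \<ge> 0" "\<And>x. \<bar>x\<bar> \<ge> 1 \<Longrightarrow> B x = 0"
    "\<And>x. x \<le> -1 \<Longrightarrow> B1 x = 0" "\<And>x. x \<ge> 1 \<Longrightarrow> B1 x = 1" "\<And>x. 0 \<le> B1 x \<and> B1 x \<le> 1"
    "\<And>x. x \<le> -1 \<Longrightarrow> B2 x = 0" "\<And>x. x \<ge> 1 \<Longrightarrow> B2 x = x - m"
proof -
  have anti: "\<exists>F. (\<forall>x. (F has_real_derivative g x) (at x)) \<and> (\<forall>x\<le>-1. F x = 0)"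
    if sm: "smooth g" and z: "\<forall>x\<le>-1. g x = 0" for g
  proof -
    have c: "continuous_on S g" for S using sm by (rule smooth_continuous)
    define F where "F x = integral {-2..x} g" for x
    have F: "(F has_real_derivative g x) (at x)" if "x > -2" for x
    proof -
      have "(F has_real_derivative g x) (at x within {-2..x+1})"
        unfolding F_def using that by (intro integral_has_real_derivative c) auto
      moreover have "at x within {-2..x+1} = at x" using that by (intro at_within_interior) auto
      ultimately show ?thesis by simp
    qed
    have F0: "F x = 0" if "x \<le> -1" for x
    proof -
      have "F x = integral {-2..x} (\<lambda>_. 0)" unfolding F_def using z that by (intro integral_cong) auto
      then show ?thesis by simp
    qed
    have "(F has_real_derivative g x) (at x)" for x
    proof (cases "x > -2")
      case False
      have "((\<lambda>_. 0) has_real_derivative g x) (at x)" using z False by simp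
      then show ?thesis
        by (rule DERIV_cong_ev[THEN iffD1, OF refl _ refl, rotated])
          (use False F0 in \<open>auto simp: eventually_nhds intro!: exI[of _ "{..< -1}"]\<close>)
    qed (use F in auto)
    then show ?thesis using F0 by blast
  qed
  let ?b = "bump_with 1 0"
  have b: "smooth ?b" by (rule smooth_bump_with)
  obtain F where F: "\<And>x. (F has_real_derivative ?b x) (at x)" "\<And>x. x \<le> -1 \<Longrightarrow> F x = 0"
    using anti[OF b] by (auto simp: bump_with_def)
  have bnn: "?b x \<ge> 0" for x by (simp add: bump_with_def)
  have mono: "F x \<le> F y" if "x \<le> y" for x y
    using that
  proof (rule DERIV_nonneg_imp_nondecreasing)
    show "\<exists>d. DERIV F z :> d \<and> 0 \<le> d" for z using F(1)[of z] bnn[of z] by blast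
  qed
  have F1: "F 1 > 0"
  proof -
    have "\<exists>z>-1. z < 1 \<and> F 1 - F (-1) = (1 - (-1)) * ?b z"
      by (rule MVT2) (use F(1) in auto)
    then obtain z where z: "z > -1" "z < 1" "F 1 - F (-1) = (1 - (-1)) * ?b z" by blast
    moreover have "?b z > 0" using z by (auto simp: bump_with_def)
    ultimately show ?thesis using F(2)[of "-1"] by simp
  qed
  have Fc: "F x = F 1" if "x \<ge> 1" for x
  proof (rule DERIV_isconst2[of 1 "x+1"])
    show "continuous_on {1..x+1} F" using F(1) by (meson DERIV_isCont continuous_at_imp_continuous_on)
    show "DERIV F y :> 0" if "1 < y" "y < x + 1" for y using F(1)[of y] that by (simp add: bump_with_def)
  qed (use that in auto)
  define B where "B x = ?b x / F 1" for x
  define B1 where "B1 x = F x / F 1" for x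
  have sB: "smooth B"
    using smooth_affine[OF b, of "1 / F 1" 1 0] by (simp add: B_def[abs_def])
  have dB1: "(B1 has_real_derivative B x) (at x)" for x
    unfolding B1_def[abs_def] B_def by (intro DERIV_cdivide F)
  have sB1: "smooth B1" by (rule smooth_antiderivative(1)[OF dB1 sB])
  have B1z: "B1 x = 0" if "x \<le> -1" for x using F(2) that by (simp add: B1_def)
  have B1o: "B1 x = 1" if "x \<ge> 1" for x using Fc[OF that] F1 by (simp add: B1_def)
  obtain B2 where B2: "\<And>x. (B2 has_real_derivative B1 x) (at x)" "\<And>x. x \<le> -1 \<Longrightarrow> B2 x = 0"
    using anti[OF sB1] B1z by auto
  have B2c: "B2 x - x = B2 1 - 1" if "x \<ge> 1" for x
  proof (rule DERIV_isconst2[of 1 "x+1" "\<lambda>x. B2 x - x"])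
    show "continuous_on {1..x+1} (\<lambda>x. B2 x - x)"
      using B2(1) by (intro continuous_intros) (meson DERIV_isCont continuous_at_imp_continuous_on)
    show "DERIV (\<lambda>x. B2 x - x) y :> 0" if "1 < y" "y < x + 1" for y
      using B2(1)[of y] B1o[of y] that by (auto intro!: derivative_eq_intros)
  qed (use that in auto)
  show ?thesis
  proof (rule that[of B B1 B2 "1 - B2 1"])
    show "0 \<le> B1 x \<and> B1 x \<le> 1" for x
      using mono[of "-1" x] mono[of x 1] F(2)[of "-1"] F(2)[of x] Fc[of x] F1
      by (cases "x \<le> -1"; cases "x \<ge> 1") (auto simp: B1_def)
    show "B2 x = x - (1 - B2 1)" if "x \<ge> 1" for x using B2c[OF that] by simp
    show "B x \<ge> 0" for x using bnn F1 by (simp add: B_def)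
    show "B x = 0" if "\<bar>x\<bar> \<ge> 1" for x using that by (simp add: B_def bump_with_def)
  qed (use sB dB1 B2 B1z B1o in auto)
qed

section \<open>Weak derivatives of continuous functions\<close>

lemma LINT_continuous:
  fixes f :: "real \<Rightarrow> real"
  assumes "continuous_on {a..b} f"
  shows "integrable (lebesgue_on {a..b}) f" "(LINT x|lebesgue_on {a..b}. f x) = integral {a..b} f"
proof -
  show i: "integrable (lebesgue_on {a..b}) f" using assms by (rule continuous_imp_integrable_real)
  show "(LINT x|lebesgue_on {a..b}. f x) = integral {a..b} f"
    by (rule lebesgue_integral_eq_integral[OF i]) simp
qed

lemma test_functionsI:
  assumes "smooth \<phi>" "\<And>x. x \<notin> {a'..b'} \<Longrightarrow> \<phi> x = 0" "a < a'" "b' < b"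
  shows "\<phi> \<in> test_functions a b"
proof -
  have "closure {x. \<phi> x \<noteq> 0} \<subseteq> {a'..b'}" 
  proof (rule closure_minimal)
    show "{x. \<phi> x \<noteq> 0} \<subseteq> {a'..b'}" using assms(2) by blast
  qed simp
  then show ?thesis using assms by (auto simp: test_functions_def smooth_def)
qed

text \<open>The kernels \<open>M B (M (y - c))\<close> with \<open>M = n + 1\<close> have total mass one, by their antiderivative
  \<open>B1\<close>, and support within distance \<open>1 / M\<close> of \<open>c\<close>.\<close>

lemma approximate_identity:
  fixes B B1 h :: "real \<Rightarrow> real"
  assumes cB: "\<And>S. continuous_on S B" and dB1: "\<And>x. (B1 has_real_derivative B x) (at x)"
    and B0: "\<And>x. B x \<ge> 0" and Bs: "\<And>x. \<bar>x\<bar> \<ge> 1 \<Longrightarrow> B x = 0"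
    and l: "\<And>x. x \<le> -1 \<Longrightarrow> B1 x = 0" and r: "\<And>x. x \<ge> 1 \<Longrightarrow> B1 x = 1"
    and h: "continuous_on {a..b} h" and c: "a < c" "c < b"
  shows "(\<lambda>n. integral {a..b} (\<lambda>y. h y * (real (Suc n) * B (real (Suc n) * (y - c))))) \<longlonglongrightarrow> h c"
proof (rule LIMSEQ_I)
  fix e :: real assume e: "e > 0"
  have "continuous_on {a..b} h \<and> c \<in> {a..b} \<and> e / 2 > 0" using h c e by auto
  then obtain d where d: "d > 0" "\<And>y. y \<in> {a..b} \<Longrightarrow> dist y c < d \<Longrightarrow> dist (h y) (h c) < e / 2"
    unfolding continuous_on_iff by blast
  obtain N :: nat where N: "1 / real (Suc N) < min d (min (c - a) (b - c))"
    using d(1) c nat_approx_posE[of "min d (min (c - a) (b - c))"] by auto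
  have "norm (integral {a..b} (\<lambda>y. h y * (real (Suc n) * B (real (Suc n) * (y - c)))) - h c) < e"
    if n: "n \<ge> N" for n
  proof -
    define M where "M = real (Suc n)"
    have M: "M > 0" by (simp add: M_def)
    have iM: "1 / M \<le> 1 / real (Suc N)" using n by (simp add: M_def divide_simps)
    then have Md: "1 / M < d" "1 / M < c - a" "1 / M < b - c" using N by auto
    let ?K = "\<lambda>y. M * B (M * (y - c))"
    have cK: "continuous_on {a..b} ?K"
      by (intro continuous_intros continuous_on_compose2[OF cB[of UNIV]]) auto
    have "(?K has_integral (B1 (M * (b - c)) - B1 (M * (a - c)))) {a..b}"
    proof (rule fundamental_theorem_of_calculus)
      show "((\<lambda>y. B1 (M * (y - c))) has_vector_derivative ?K y) (at y within {a..b})" for y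
      proof -
        have lin: "((\<lambda>y. M * (y - c)) has_real_derivative M) (at y)" by (auto intro!: derivative_eq_intros)
        have "((\<lambda>y. B1 (M * (y - c))) has_real_derivative (B (M * (y - c)) * M)) (at y)"
          using DERIV_chain2[where g="\<lambda>y. M * (y - c)" and s=UNIV, OF dB1 lin] .
        then show ?thesis
          by (auto simp: has_real_derivative_iff_has_vector_derivative mult.commute intro: has_vector_derivative_at_within)
      qed
    qed (use c in auto)
    moreover have "B1 (M * (b - c)) = 1" "B1 (M * (a - c)) = 0"
      using Md M by (auto intro!: l r simp: field_simps)
    ultimately have K1: "(?K has_integral 1) {a..b}" by simp
    have "norm (integral {a..b} (\<lambda>y. (h y - h c) * ?K y)) \<le> integral {a..b} (\<lambda>y. e / 2 * ?K y)"
    proof (rule integral_norm_bound_integral)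
      show "(\<lambda>y. (h y - h c) * ?K y) integrable_on {a..b}" "(\<lambda>y. e / 2 * ?K y) integrable_on {a..b}"
        by (intro integrable_continuous_real continuous_intros h cK)+
      show "norm ((h y - h c) * ?K y) \<le> e / 2 * ?K y" if y: "y \<in> {a..b}" for y
      proof (cases "\<bar>M * (y - c)\<bar> \<ge> 1")
        case False
        then have "M * \<bar>y - c\<bar> < 1" using M by (simp add: abs_mult)
        then have "\<bar>y - c\<bar> < 1 / M" using M by (simp add: pos_less_divide_eq mult.commute)
        then have "\<bar>h y - h c\<bar> < e / 2" using d(2)[OF y] Md by (simp add: dist_real_def)
        then show ?thesis using M B0 mult_right_mono[of "\<bar>h y - h c\<bar>" "e / 2" "M * B (M * (y - c))"] by (simp add: abs_mult)
      qed (use Bs in simp)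
    qed
    also have "\<dots> = e / 2" using integral_unique[OF has_integral_mult_right[OF K1, of "e/2"]] by simp
    finally have "norm (integral {a..b} (\<lambda>y. (h y - h c) * ?K y)) \<le> e / 2" .
    moreover have "integral {a..b} (\<lambda>y. (h y - h c) * ?K y) = integral {a..b} (\<lambda>y. h y * ?K y) - h c"
    proof -
      have "integral {a..b} (\<lambda>y. (h y - h c) * ?K y) = integral {a..b} (\<lambda>y. h y * ?K y - h c * ?K y)"
        by (simp add: left_diff_distrib)
      also have "\<dots> = integral {a..b} (\<lambda>y. h y * ?K y) - integral {a..b} (\<lambda>y. h c * ?K y)"
        by (intro integral_diff integrable_continuous_real continuous_intros h cK)
      also have "integral {a..b} (\<lambda>y. h c * ?K y) = h c" using integral_unique[OF has_integral_mult_right[OF K1, of "h c"]] by simp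
      finally show ?thesis .
    qed
    ultimately show ?thesis using e by (simp add: M_def)
  qed
  then show "\<exists>no. \<forall>n\<ge>no. norm (integral {a..b} (\<lambda>y. h y * (real (Suc n) * B (real (Suc n) * (y - c)))) - h c) < e" by blast
qed

lemma smooth_scaled:
  assumes "smooth \<phi>" shows "smooth (\<lambda>y. k * \<phi> (M * (y - c)))"
  using smooth_affine[OF assms, of k M "- M * c"] by (simp add: algebra_simps)

lemma DERIV_scaled:
  assumes "\<And>x. (\<phi> has_real_derivative \<psi> x) (at x)"
  shows "((\<lambda>y. k * \<phi> (M * (y - c))) has_real_derivative k * (M * \<psi> (M * (y - c)))) (at y)"
proof -
  have lin: "((\<lambda>y. M * (y - c)) has_real_derivative M) (at y)" by (auto intro!: derivative_eq_intros)
  have "((\<lambda>y. \<phi> (M * (y - c))) has_real_derivative (\<psi> (M * (y - c)) * M)) (at y)"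
    using DERIV_chain2[where g="\<lambda>y. M * (y - c)" and s=UNIV, OF assms lin] .
  from DERIV_cmult[OF this] show ?thesis by (simp add: mult.commute)
qed

text \<open>Testing with the kernels above yields the value at every inner point.\<close>

lemma continuous_orthogonal_test_functions:
  fixes h :: "real \<Rightarrow> real"
  assumes "a < b" and h: "continuous_on {a..b} h"
    and ort: "\<And>\<phi>. \<phi> \<in> test_functions a b \<Longrightarrow> integral {a..b} (\<lambda>y. h y * \<phi> y) = 0"
    and x: "x \<in> {a..b}"
  shows "h x = 0"
proof -
  obtain B B1 B2 :: "real \<Rightarrow> real" and m where B: "smooth B" "\<And>x. (B1 has_real_derivative B x) (at x)"
    "\<And>x. B x \<ge> 0" "\<And>x. \<bar>x\<bar> \<ge> 1 \<Longrightarrow> B x = 0"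
    "\<And>x. x \<le> -1 \<Longrightarrow> B1 x = 0" "\<And>x. x \<ge> 1 \<Longrightarrow> B1 x = 1"
    using smooth_bump_exists by metis
  have int: "h c = 0" if c: "c \<in> {a<..<b}" for c
  proof (rule LIMSEQ_unique)
    show "(\<lambda>n. integral {a..b} (\<lambda>y. h y * (real (Suc n) * B (real (Suc n) * (y - c))))) \<longlonglongrightarrow> h c"
      using c by (intro approximate_identity[OF smooth_continuous[OF B(1)] B(2-6) h]) auto
    obtain N :: nat where N: "1 / real (Suc N) < min (c - a) (b - c)"
      using c nat_approx_posE[of "min (c - a) (b - c)"] by auto
    have "integral {a..b} (\<lambda>y. h y * (real (Suc n) * B (real (Suc n) * (y - c)))) = 0" if n: "n \<ge> N" for n
    proof (rule ort, rule test_functionsI[where a'="c - 1 / real (Suc n)" and b'="c + 1 / real (Suc n)"])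
      show "smooth (\<lambda>y. real (Suc n) * B (real (Suc n) * (y - c)))" by (rule smooth_scaled[OF B(1)])
      have "1 / real (Suc n) \<le> 1 / real (Suc N)" using n by (simp add: divide_simps)
      then show "a < c - 1 / real (Suc n)" "c + 1 / real (Suc n) < b" using N by auto
      show "real (Suc n) * B (real (Suc n) * (y - c)) = 0" if "y \<notin> {c - 1 / real (Suc n)..c + 1 / real (Suc n)}" for y
      proof -
        have "\<bar>y - c\<bar> > 1 / real (Suc n)" using that by auto
        then have "real (Suc n) * \<bar>y - c\<bar> \<ge> 1" by (simp add: pos_divide_less_eq mult.commute)
        then have "\<bar>real (Suc n) * (y - c)\<bar> \<ge> 1" by (simp add: abs_mult)
        then show ?thesis using B(4) by simp
      qed
    qed
    then show "(\<lambda>n. integral {a..b} (\<lambda>y. h y * (real (Suc n) * B (real (Suc n) * (y - c))))) \<longlonglongrightarrow> 0"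
      by (intro tendsto_eventually) (auto simp: eventually_sequentially)
  qed
  have cl: "closure {a<..<b} = {a..b}" using assms(1) by simp
  show ?thesis
    using continuous_constant_on_closure[of "{a<..<b}" h 0 x] int h x unfolding cl by blast
qed

text \<open>Instead of regularising \<open>h\<close>, one tests with a smoothed hat function with corners \<open>c < e < d\<close>:
  its second derivative consists of three narrow bumps with weights \<open>1 - x\<close>, \<open>-1\<close> and \<open>x\<close>, so in the limit
  \<open>h\<close> satisfies the defining relation of an affine function for these three points. The end points are
  reached by continuity.\<close>

lemma weak_second_deriv_zero_imp_affine:
  fixes h :: "real \<Rightarrow> real"
  assumes h: "continuous_on {0..1} h"
    and ort: "\<And>\<phi>. \<phi> \<in> test_functions 0 1 \<Longrightarrow> integral {0..1} (\<lambda>y. h y * deriv (deriv \<phi>) y) = 0"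
    and x: "x \<in> {0..1}"
  shows "h x = (1 - x) * h 0 + x * h 1"
proof -
  obtain B B1 B2 :: "real \<Rightarrow> real" and m where B: "smooth B" "\<And>x. (B1 has_real_derivative B x) (at x)"
    "\<And>x. B x \<ge> 0" "\<And>x. \<bar>x\<bar> \<ge> 1 \<Longrightarrow> B x = 0"
    "\<And>x. x \<le> -1 \<Longrightarrow> B1 x = 0" "\<And>x. x \<ge> 1 \<Longrightarrow> B1 x = 1"
    and B2: "\<And>x. (B2 has_real_derivative B1 x) (at x)" "\<And>x. x \<le> -1 \<Longrightarrow> B2 x = 0" "\<And>x. x \<ge> 1 \<Longrightarrow> B2 x = x - m"
    using smooth_bump_exists by metis
  have sB1: "smooth B1" by (rule smooth_antiderivative(1)[OF B(2,1)])
  have sB2: "smooth B2" by (rule smooth_antiderivative(1)[OF B2(1) sB1])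
  have aff: "h e = (1 - x) * h c + x * h d" if cd: "0 < c" "c < d" "d < 1" and e: "e = (1 - x) * c + x * d" for c d e
  proof -
    have ced: "c \<le> e" "e \<le> d"
    proof -
      have "e = c + x * (d - c)" by (simp add: e algebra_simps)
      then show "c \<le> e" using x cd mult_nonneg_nonneg[of x "d - c"] by auto
      have "e = d - (1 - x) * (d - c)" by (simp add: e algebra_simps)
      then show "e \<le> d" using x cd mult_nonneg_nonneg[of "1-x" "d - c"] by auto
    qed
    let ?I = "\<lambda>p n. integral {0..1} (\<lambda>y. h y * (real (Suc n) * B (real (Suc n) * (y - p))))"
    have lim: "?I p \<longlonglongrightarrow> h p" if "p \<in> {c, d, e}" for p
      using that cd ced by (intro approximate_identity[OF smooth_continuous[OF B(1)] B(2-6) h]) auto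
    have L: "(\<lambda>n. (1 - x) * ?I c n + x * ?I d n + (-1) * ?I e n) \<longlonglongrightarrow> (1 - x) * h c + x * h d + (-1) * h e"
      by (intro tendsto_add tendsto_mult tendsto_const lim) auto
    obtain N :: nat where N: "1 / real (Suc N) < min c (1 - d)"
      using cd nat_approx_posE[of "min c (1 - d)"] by auto
    have z: "(1 - x) * ?I c n + x * ?I d n + (-1) * ?I e n = 0" if n: "n \<ge> N" for n
    proof -
      define M where "M = real (Suc n)"
      have M: "M > 0" by (simp add: M_def)
      have "1 / M \<le> 1 / real (Suc N)" using n by (simp add: M_def divide_simps)
      then have Mb: "0 < c - 1 / M" "d + 1 / M < 1" using N by auto
      define \<phi> where "\<phi> y = (1 - x) / M * B2 (M * (y - c)) + x / M * B2 (M * (y - d)) + (- 1 / M) * B2 (M * (y - e))" for y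
      define \<phi>1 where "\<phi>1 y = (1 - x) * B1 (M * (y - c)) + x * B1 (M * (y - d)) + (- 1) * B1 (M * (y - e))" for y
      define \<phi>2 where "\<phi>2 y = (1 - x) * (M * B (M * (y - c))) + x * (M * B (M * (y - d))) + (- 1) * (M * B (M * (y - e)))" for y
      have s1: "smooth \<phi>" unfolding \<phi>_def[abs_def] by (intro smooth_add smooth_scaled sB2)
      have "(\<phi> has_real_derivative \<phi>1 y) (at y)" for y
      proof -
        have "(\<phi> has_real_derivative (1 - x) / M * (M * B1 (M * (y - c))) + x / M * (M * B1 (M * (y - d))) + (- 1 / M) * (M * B1 (M * (y - e)))) (at y)"
          unfolding \<phi>_def[abs_def] by (intro DERIV_add DERIV_scaled B2(1))
        then show ?thesis using M by (simp add: \<phi>1_def)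
      qed
      then have d1: "deriv \<phi> = \<phi>1" using DERIV_imp_deriv by blast
      have "(\<phi>1 has_real_derivative \<phi>2 y) (at y)" for y
        unfolding \<phi>1_def[abs_def] \<phi>2_def by (intro DERIV_add DERIV_scaled B(2))
      then have d2: "deriv \<phi>1 = \<phi>2" using DERIV_imp_deriv by blast
      have "\<phi> \<in> test_functions 0 1"
      proof (rule test_functionsI[OF s1 _ Mb])
        fix y assume y: "y \<notin> {c - 1/M..d + 1/M}"
        show "\<phi> y = 0"
        proof (cases "y < c - 1 / M")
          case True
          have "M * (y - p) \<le> -1" if "p \<in> {c,d,e}" for p
          proof -
            have "y - p \<le> - 1 / M" using True that cd ced by auto
            then show ?thesis using M by (simp add: field_simps)
          qed
          then show ?thesis by (simp add: \<phi>_def B2(2))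
        next
          case False
          then have y: "y > d + 1 / M" using y by auto
          have "M * (y - p) \<ge> 1" if "p \<in> {c,d,e}" for p
          proof -
            have "y - p \<ge> 1 / M" using y that cd ced by auto
            then show ?thesis using M by (simp add: field_simps)
          qed
          then have "\<phi> y = (1 - x) / M * (M * (y - c) - m) + x / M * (M * (y - d) - m) + (- 1 / M) * (M * (y - e) - m)"
            by (simp add: \<phi>_def B2(3))
          also have "\<dots> = 0" using M by (simp add: e field_simps)
          finally show ?thesis .
        qed
      qed
      from ort[OF this] have "integral {0..1} (\<lambda>y. h y * \<phi>2 y) = 0" by (simp add: d1 d2)
      also have "(\<lambda>y. h y * \<phi>2 y) = (\<lambda>y. (1 - x) * (h y * (M * B (M * (y - c)))) + x * (h y * (M * B (M * (y - d)))) + (-1) * (h y * (M * B (M * (y - e)))))"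
        by (simp add: \<phi>2_def algebra_simps)
      also have "integral {0..1} \<dots> = (1 - x) * ?I c n + x * ?I d n + (-1) * ?I e n"
      proof -
        have i: "(\<lambda>y. k * (h y * (M * B (M * (y - p))))) integrable_on {0..1}" for k p
          by (intro integrable_continuous_real continuous_intros h continuous_on_compose2[OF smooth_continuous[OF B(1), of UNIV]]) auto
        show ?thesis
          by (subst integral_add integral_mult_right, (intro integrable_add i)+)+ (simp add: M_def)
      qed
      finally show ?thesis .
    qed
    have "(\<lambda>n. (1 - x) * ?I c n + x * ?I d n + (-1) * ?I e n) \<longlonglongrightarrow> 0"
      using z by (intro tendsto_eventually) (auto simp: eventually_sequentially)
    from LIMSEQ_unique[OF L this] show ?thesis by simp
  qed
  \<comment> \<open>\<open>n + 3\<close> ensures \<open>\<delta> n < 1 - \<delta> n\<close>\<close>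
  define \<delta> where "\<delta> n = 1 / real (n + 3)" for n
  have \<delta>: "0 < \<delta> n" "\<delta> n < 1 - \<delta> n" "\<delta> n \<le> 1" for n by (auto simp: \<delta>_def field_simps)
  have \<delta>0: "\<delta> \<longlonglongrightarrow> 0" unfolding \<delta>_def[abs_def] by real_asymp
  have hl: "(\<lambda>n. h (p n)) \<longlonglongrightarrow> h q" if "p \<longlonglongrightarrow> q" "\<And>n. p n \<in> {0..1}" "q \<in> {0..1}" for p q
    using continuous_on_tendsto_compose[OF h that(1,3)] that(2) by auto
  have e01: "(1 - x) * \<delta> n + x * (1 - \<delta> n) \<in> {0..1}" for n
  proof -
    have "(1 - x) * \<delta> n + x * (1 - \<delta> n) \<le> (1 - x) * 1 + x * 1"
      using x \<delta>[of n] by (intro add_mono mult_left_mono) auto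
    then show ?thesis using x \<delta>[of n] by auto
  qed
  have "(\<lambda>n. h ((1 - x) * \<delta> n + x * (1 - \<delta> n))) \<longlonglongrightarrow> h x"
    using x by (intro hl e01) (auto intro!: tendsto_eq_intros \<delta>0)
  moreover have "(\<lambda>n. h ((1 - x) * \<delta> n + x * (1 - \<delta> n))) = (\<lambda>n. (1 - x) * h (\<delta> n) + x * h (1 - \<delta> n))"
    using \<delta> by (intro ext aff) (auto simp: less_diff_eq)
  moreover have "(\<lambda>n. (1 - x) * h (\<delta> n) + x * h (1 - \<delta> n)) \<longlonglongrightarrow> (1 - x) * h 0 + x * h 1"
    using \<delta> less_imp_le[OF \<delta>(1)] by (intro tendsto_add tendsto_mult tendsto_const hl) (auto intro!: tendsto_eq_intros \<delta>0)
  ultimately show ?thesis using LIMSEQ_unique by metis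
qed

text \<open>The fundamental theorem of calculus for weak derivatives. A smooth approximation of the indicator of
  \<open>{c..d}\<close> is a test function whose derivative consists of two narrow bumps at \<open>c\<close> and \<open>d\<close>; on the other side the
  limit is taken by dominated convergence.\<close>

lemma weak_deriv_increment:
  fixes v g :: "real \<Rightarrow> real"
  assumes ab: "a < b" and v: "continuous_on {a..b} v" and g: "integrable (lebesgue_on {a..b}) g"
    and w: "has_weak_deriv a b 1 v g" and cd: "a \<le> c" "c \<le> d" "d \<le> b"
  shows "v d - v c = integral {c..d} g"
proof -
  obtain B B1 B2 :: "real \<Rightarrow> real" and m where B: "smooth B" "\<And>x. (B1 has_real_derivative B x) (at x)"
    "\<And>x. B x \<ge> 0" "\<And>x. \<bar>x\<bar> \<ge> 1 \<Longrightarrow> B x = 0"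
    "\<And>x. x \<le> -1 \<Longrightarrow> B1 x = 0" "\<And>x. x \<ge> 1 \<Longrightarrow> B1 x = 1" and B1b: "\<And>x. 0 \<le> B1 x \<and> B1 x \<le> 1"
    using smooth_bump_exists by metis
  have sB1: "smooth B1" by (rule smooth_antiderivative(1)[OF B(2,1)])
  have gi: "g integrable_on {a..b}" using g by (simp add: integrable_on_lebesgue_on)
  \<comment> \<open>the pointwise limit of the rescaled steps \<open>B1\<close>; its value at \<open>0\<close> depends on \<open>B1\<close>\<close>
  define st where "st = (\<lambda>x::real. if x < 0 then 0 else if x > 0 then 1 else B1 0)"
  have B1l: "(\<lambda>n. B1 (real (Suc n) * x)) \<longlonglongrightarrow> st x" for x
  proof (cases "x = 0")
    case False
    then obtain N :: nat where N: "1 / real (Suc N) < \<bar>x\<bar>" using nat_approx_posE[of "\<bar>x\<bar>"] by auto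
    have "B1 (real (Suc n) * x) = (if x < 0 then 0 else 1)" if "n \<ge> N" for n
    proof -
      have "1 / real (Suc n) \<le> 1 / real (Suc N)" using that by (simp add: divide_simps)
      then have "1 / real (Suc n) < \<bar>x\<bar>" using N by linarith
      then have "1 < real (Suc n) * \<bar>x\<bar>" by (simp add: pos_divide_less_eq mult.commute)
      then show ?thesis using B(5,6) by (cases "x < 0") auto
    qed
    then have "\<forall>\<^sub>F n in sequentially. B1 (real (Suc n) * x) = (if x < 0 then 0 else 1)"
      by (rule eventually_sequentiallyI)
    then show ?thesis using False by (auto intro!: tendsto_eventually simp: st_def split: if_splits)
  qed (simp add: st_def)
  have inner: "v d - v c = integral {c..d} g" if cd: "a < c" "c < d" "d < b" for c d
  proof -
    obtain N :: nat where N: "1 / real (Suc N) < min (c - a) (b - d)"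
      using cd nat_approx_posE[of "min (c - a) (b - d)"] by auto
    define \<phi> where "\<phi> n y = 1 * B1 (real (Suc n) * (y - c)) + (-1) * B1 (real (Suc n) * (y - d))" for n y
    define \<phi>' where "\<phi>' n y = 1 * (real (Suc n) * B (real (Suc n) * (y - c))) + (-1) * (real (Suc n) * B (real (Suc n) * (y - d)))" for n y
    have s: "smooth (\<phi> n)" for n unfolding \<phi>_def[abs_def] by (intro smooth_add smooth_scaled sB1)
    have "(\<phi> n has_real_derivative \<phi>' n y) (at y)" for n y
      unfolding \<phi>_def[abs_def] \<phi>'_def by (intro DERIV_add DERIV_scaled B(2))
    then have d1: "deriv (\<phi> n) = \<phi>' n" for n using DERIV_imp_deriv by blast
    have t: "\<phi> n \<in> test_functions a b" if n: "n \<ge> N" for n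
    proof (rule test_functionsI[OF s, where a'="c - 1 / real (Suc n)" and b'="d + 1 / real (Suc n)"])
      have "1 / real (Suc n) \<le> 1 / real (Suc N)" using n by (simp add: divide_simps)
      then show "a < c - 1 / real (Suc n)" "d + 1 / real (Suc n) < b" using N by auto
      fix y assume y: "y \<notin> {c - 1 / real (Suc n)..d + 1 / real (Suc n)}"
      define M where "M = real (Suc n)"
      have M: "M > 0" by (simp add: M_def)
      show "\<phi> n y = 0"
      proof (cases "y < c - 1 / M")
        case True
        have "M * (y - p) \<le> -1" if "p \<in> {c,d}" for p
        proof -
          have "y - p \<le> - 1 / M" using True that cd by auto
          then show ?thesis using M by (simp add: field_simps)
        qed
        then show ?thesis by (simp add: \<phi>_def B(5) M_def)
      next
        case False
        then have y: "y > d + 1 / M" using y by (auto simp: M_def)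
        have "M * (y - p) \<ge> 1" if "p \<in> {c,d}" for p
        proof -
          have "y - p \<ge> 1 / M" using y that cd by auto
          then show ?thesis using M by (simp add: field_simps)
        qed
        then show ?thesis by (simp add: \<phi>_def B(6) M_def)
      qed
    qed
    let ?I = "\<lambda>p n. integral {a..b} (\<lambda>y. v y * (real (Suc n) * B (real (Suc n) * (y - p))))"
    have lim: "?I p \<longlonglongrightarrow> v p" if "p \<in> {c, d}" for p
      using that cd by (intro approximate_identity[OF smooth_continuous[OF B(1)] B(2-6) v]) auto
    have ci: "(\<lambda>y. v y * (real (Suc n) * B (real (Suc n) * (y - p)))) integrable_on {a..b}" for n p
      by (intro integrable_continuous_real continuous_intros v continuous_on_compose2[OF smooth_continuous[OF B(1), of UNIV]]) auto
    have "(LINT y|lebesgue_on {a..b}. v y * \<phi>' n y) = ?I c n - ?I d n" for n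
    proof -
      have "continuous_on {a..b} (\<lambda>y. v y * \<phi>' n y)"
        unfolding \<phi>'_def
        by (intro continuous_intros v continuous_on_compose2[OF smooth_continuous[OF B(1), of UNIV]]) auto
      then have "(LINT y|lebesgue_on {a..b}. v y * \<phi>' n y) = integral {a..b} (\<lambda>y. v y * \<phi>' n y)" by (rule LINT_continuous)
      also have "\<dots> = integral {a..b} (\<lambda>y. v y * (real (Suc n) * B (real (Suc n) * (y - c))) - v y * (real (Suc n) * B (real (Suc n) * (y - d))))"
        by (simp add: \<phi>'_def algebra_simps)
      also have "\<dots> = ?I c n - ?I d n" by (intro integral_diff ci)
      finally show ?thesis .
    qed
    then have l1: "(\<lambda>n. (LINT y|lebesgue_on {a..b}. v y * \<phi>' n y)) \<longlonglongrightarrow> v c - v d"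
      using tendsto_diff[OF lim[of c] lim[of d]] by simp
    have l2: "(\<lambda>n. (LINT y|lebesgue_on {a..b}. g y * \<phi> n y)) \<longlonglongrightarrow> (LINT y|lebesgue_on {a..b}. g y * (st (y - c) - st (y - d)))"
    and i2: "integrable (lebesgue_on {a..b}) (\<lambda>y. g y * (st (y - c) - st (y - d)))"
    proof -
      have gm: "g \<in> borel_measurable (lebesgue_on {a..b})" using g by auto
      have cm: "(\<lambda>y. st (y - p)) \<in> borel_measurable (lebesgue_on {a..b})" for p
      proof (rule borel_measurable_LIMSEQ_metric)
        show "(\<lambda>n. B1 (real (Suc n) * (y - p))) \<longlonglongrightarrow> st (y - p)" for y by (rule B1l)
        show "(\<lambda>y. B1 (real (Suc n) * (y - p))) \<in> borel_measurable (lebesgue_on {a..b})" for n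
          by (intro continuous_imp_measurable_on_sets_lebesgue continuous_on_compose2[OF smooth_continuous[OF sB1, of UNIV]] continuous_intros) auto
      qed
      have pm: "\<phi> n \<in> borel_measurable (lebesgue_on {a..b})" for n
        by (intro continuous_imp_measurable_on_sets_lebesgue smooth_continuous[OF s]) auto
      have m1: "(\<lambda>y. g y * (st (y - c) - st (y - d))) \<in> borel_measurable (lebesgue_on {a..b})"
        by (intro borel_measurable_times borel_measurable_diff gm cm)
      have m2: "(\<lambda>y. g y * \<phi> n y) \<in> borel_measurable (lebesgue_on {a..b})" for n
        by (intro borel_measurable_times gm pm)
      have bd: "AE y in lebesgue_on {a..b}. norm (g y * \<phi> n y) \<le> \<bar>g y\<bar>" for n
      proof (rule AE_I2)
        fix y
        have "\<bar>\<phi> n y\<bar> \<le> 1" using B1b[of "real (Suc n) * (y - c)"] B1b[of "real (Suc n) * (y - d)"] by (auto simp: \<phi>_def)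
        then show "norm (g y * \<phi> n y) \<le> \<bar>g y\<bar>" by (simp add: abs_mult mult_left_le)
      qed
      have pl: "AE y in lebesgue_on {a..b}. (\<lambda>n. g y * \<phi> n y) \<longlonglongrightarrow> g y * (st (y - c) - st (y - d))"
      proof (rule AE_I2)
        fix y
        show "(\<lambda>n. g y * \<phi> n y) \<longlonglongrightarrow> g y * (st (y - c) - st (y - d))"
          using tendsto_diff[OF B1l[of "y - c"] B1l[of "y - d"]]
          by (intro tendsto_mult tendsto_const) (simp add: \<phi>_def)
      qed
      show "(\<lambda>n. (LINT y|lebesgue_on {a..b}. g y * \<phi> n y)) \<longlonglongrightarrow> (LINT y|lebesgue_on {a..b}. g y * (st (y - c) - st (y - d)))"
        by (rule integral_dominated_convergence[OF m1 m2 integrable_abs[OF g] pl bd])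
      show "integrable (lebesgue_on {a..b}) (\<lambda>y. g y * (st (y - c) - st (y - d)))"
        by (rule integrable_dominated_convergence[OF m1 m2 integrable_abs[OF g] pl bd])
    qed
    have "(LINT y|lebesgue_on {a..b}. g y * (st (y - c) - st (y - d))) = integral {a..b} (\<lambda>y. g y * (st (y - c) - st (y - d)))"
      by (rule lebesgue_integral_eq_integral[OF i2]) simp
    also have "\<dots> = integral {a..b} (\<lambda>y. if y \<in> {c..d} then g y else 0)"
      by (rule integral_spike[of "{c,d}"]) (use cd in \<open>auto simp: st_def\<close>)
    also have "\<dots> = integral {c..d} g"
      using cd by (subst integral_restrict_Int) (auto simp: Int_absorb1 intro!: arg_cong2[where f=integral])
    finally have e: "(LINT y|lebesgue_on {a..b}. g y * (st (y - c) - st (y - d))) = integral {c..d} g" .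
    have "(LINT y|lebesgue_on {a..b}. v y * \<phi>' n y) = - (LINT y|lebesgue_on {a..b}. g y * \<phi> n y)" if "n \<ge> N" for n
      using bspec[OF w[unfolded has_weak_deriv_def] t[OF that]] by (simp add: d1[of n])
    then have "(\<lambda>n. (LINT y|lebesgue_on {a..b}. v y * \<phi>' n y)) \<longlonglongrightarrow> - integral {c..d} g \<longleftrightarrow>
       (\<lambda>n. - (LINT y|lebesgue_on {a..b}. g y * \<phi> n y)) \<longlonglongrightarrow> - integral {c..d} g"
      by (intro tendsto_cong) (auto simp: eventually_sequentially)
    then have "(\<lambda>n. (LINT y|lebesgue_on {a..b}. v y * \<phi>' n y)) \<longlonglongrightarrow> - integral {c..d} g"
      using tendsto_minus[OF l2] e by simp
    from LIMSEQ_unique[OF l1 this] show ?thesis by simp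
  qed
  define I where "I y = integral {a..y} g" for y
  have I: "I q - I p = integral {p..q} g" if "a \<le> p" "p \<le> q" "q \<le> b" for p q
    using Henstock_Kurzweil_Integration.integral_combine[of a p q g] that gi integrable_on_subinterval[OF gi, of a q] by (simp add: I_def)
  have Ic: "continuous_on {a..b} I" unfolding I_def by (rule indefinite_integral_continuous_1[OF gi])
  \<comment> \<open>The formula for inner points says that \<open>v - I\<close> is constant; continuity extends this to the end points.\<close>
  define p where "p = (a + b) / 2"
  have p: "a < p" "p < b" using ab by (auto simp: p_def)
  have const: "v x - I x = v p - I p" if x: "x \<in> {a..b}" for x
  proof (rule continuous_constant_on_closure[of "{a<..<b}" "\<lambda>x. v x - I x"])
    show "continuous_on (closure {a<..<b}) (\<lambda>x. v x - I x)" using ab v Ic by (auto intro!: continuous_intros)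
    show "v x - I x = v p - I p" if "x \<in> {a<..<b}" for x
      using that p inner[of p x] inner[of x p] I[of p x] I[of x p] by (cases x p rule: linorder_cases) auto
    show "x \<in> closure {a<..<b}" using x ab by simp
  qed
  show ?thesis using const[of c] const[of d] I[of c d] cd by auto
qed

section \<open>Averages over short time intervals\<close>

text \<open>Joint continuity on \<open>t \<ge> 0\<close>, \<open>0 \<le> y \<le> 1\<close>. All functions of time and space below
  are of this kind, and then integrals over time and over space exist, depend continuously on parameters and
  can be interchanged.\<close>

definition jc :: "(real \<Rightarrow> real \<Rightarrow> real) \<Rightarrow> bool" where
  "jc w \<longleftrightarrow> continuous_on ({0..} \<times> {0..1}) (\<lambda>p. w (fst p) (snd p))"

lemma jc_comp:
  assumes "jc w" "continuous_on S p" "continuous_on S q"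
    "\<And>x. x \<in> S \<Longrightarrow> 0 \<le> p x" "\<And>x. x \<in> S \<Longrightarrow> 0 \<le> q x \<and> q x \<le> 1"
  shows "continuous_on S (\<lambda>x. w (p x) (q x))"
proof -
  have "continuous_on S (\<lambda>x. (p x, q x))" by (intro continuous_on_Pair assms)
  moreover have "(\<lambda>x. (p x, q x)) ` S \<subseteq> {0..} \<times> {0..1}" using assms(4,5) by auto
  ultimately show ?thesis using continuous_on_compose2[OF assms(1)[unfolded jc_def]] by fastforce
qed

lemma jc_slice: "jc w \<Longrightarrow> 0 \<le> t \<Longrightarrow> continuous_on {0..1} (w t)"
  by (rule jc_comp[where p="\<lambda>_. t" and q="\<lambda>y. y"]) (auto intro!: continuous_intros)

lemma jc_time: "jc w \<Longrightarrow> 0 \<le> y \<Longrightarrow> y \<le> 1 \<Longrightarrow> continuous_on {0..} (\<lambda>t. w t y)"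
  by (rule jc_comp[where q="\<lambda>_. y" and p="\<lambda>y. y"]) (auto intro!: continuous_intros)

lemma jc_integrable: "jc w \<Longrightarrow> 0 \<le> t \<Longrightarrow> w t integrable_on {0..1}"
  by (intro integrable_continuous_real jc_slice)

lemma continuous_on_space_integral:
  fixes f :: "'a::topological_space \<Rightarrow> real \<Rightarrow> real"
  assumes "continuous_on (S \<times> {0..1}) (\<lambda>p. f (fst p) (snd p))"
  shows "continuous_on S (\<lambda>x. integral {0..1} (f x))"
  using integral_continuous_on_param[of S 0 1 f] assms by (simp add: case_prod_unfold)

lemma integral_swap_real:
  fixes f :: "real \<Rightarrow> real \<Rightarrow> real"
  assumes "continuous_on ({a..b} \<times> {c..d}) (\<lambda>p. f (fst p) (snd p))"
  shows "integral {a..b} (\<lambda>x. integral {c..d} (f x)) = integral {c..d} (\<lambda>y. integral {a..b} (\<lambda>x. f x y))"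
  using integral_swap_continuous[of a c b d f] assms by (simp add: case_prod_unfold cbox_Pair_eq)

lemma integral_unit_scale:
  fixes f :: "real \<Rightarrow> real"
  assumes h: "0 \<le> h" and f: "continuous_on {t..t+h} f"
  shows "integral {t..t+h} f = h * integral {0..1} (\<lambda>\<sigma>. f (t + h * \<sigma>))"
proof -
  have "((\<lambda>\<sigma>. h *\<^sub>R f (t + h * \<sigma>)) has_integral integral {t + h * 0..t + h * 1} f) {0..1}"
    by (rule has_integral_substitution[where c=t and d="t+h"])
       (use h f in \<open>auto intro!: derivative_eq_intros mult_left_le\<close>)
  from integral_unique[OF this] show ?thesis by simp
qed

text \<open>The average of \<open>w\<close> over the time interval \<open>{t..t+h}\<close>. Scaling to the unit interval gives
  the value \<open>w t y\<close> for \<open>h = 0\<close> and joint continuity in \<open>(h, t, y)\<close> up to \<open>h = 0\<close>.\<close>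

definition Av :: "real \<Rightarrow> (real \<Rightarrow> real \<Rightarrow> real) \<Rightarrow> real \<Rightarrow> real \<Rightarrow> real" where
  "Av h w t y = integral {0..1} (\<lambda>\<sigma>. w (t + h * \<sigma>) y)"

lemma continuous_on_Av:
  fixes h t y :: "'a::topological_space \<Rightarrow> real"
  assumes "jc w" "continuous_on S h" "continuous_on S t" "continuous_on S y"
    "\<And>x. x \<in> S \<Longrightarrow> 0 \<le> h x" "\<And>x. x \<in> S \<Longrightarrow> 0 \<le> t x" "\<And>x. x \<in> S \<Longrightarrow> 0 \<le> y x \<and> y x \<le> 1"
  shows "continuous_on S (\<lambda>x. Av (h x) w (t x) (y x))"
  unfolding Av_def
  by (intro continuous_on_space_integral jc_comp[OF assms(1)] continuous_intros
        continuous_on_compose2[OF assms(2) continuous_on_fst[OF continuous_on_id]]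
        continuous_on_compose2[OF assms(3) continuous_on_fst[OF continuous_on_id]]
        continuous_on_compose2[OF assms(4) continuous_on_fst[OF continuous_on_id]])
     (use assms(5-7) in auto)

lemma Av_0: "Av 0 w t y = w t y"
  by (simp add: Av_def)

lemma Av_eq:
  assumes "jc w" "0 \<le> h" "0 \<le> t" "0 \<le> y" "y \<le> 1"
  shows "h * Av h w t y = integral {t..t+h} (\<lambda>r. w r y)"
  unfolding Av_def
  by (rule integral_unit_scale[symmetric])
     (use assms in \<open>auto intro!: continuous_on_subset[OF jc_time[OF assms(1,4,5)]]\<close>)

lemma integral_has_real_derivative_atLeast:
  fixes f :: "real \<Rightarrow> real"
  assumes "continuous_on {0..} f" "0 \<le> x"
  shows "((\<lambda>x. integral {0..x} f) has_real_derivative f x) (at x within {0..})"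
proof -
  have "((\<lambda>x. integral {0..x} f) has_real_derivative f x) (at x within {0..x+1})"
    using assms by (intro integral_has_real_derivative continuous_on_subset[OF assms(1)]) auto
  moreover have "at x within {0..} = at x within {0..x+1}"
    by (rule at_within_nhd[of _ "{..<x+1}"]) auto
  ultimately show ?thesis by simp
qed

lemma DERIV_shift_within:
  fixes F :: "real \<Rightarrow> real"
  assumes "(F has_real_derivative d) (at (t + h) within {0..})" "0 \<le> h"
  shows "((\<lambda>t. F (t + h)) has_real_derivative d) (at t within {0..})"
proof -
  have "(F has_real_derivative d) (at (t + h) within (\<lambda>t. t + h) ` {0..})"
    by (rule has_field_derivative_subset[OF assms(1)]) (use assms(2) in auto)
  moreover have "((\<lambda>t. t + h) has_real_derivative 1) (at t within {0..})" by (auto intro!: derivative_eq_intros)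
  ultimately show ?thesis using DERIV_image_chain[of F d "\<lambda>t. t + h" t "{0..}" 1] by (simp add: o_def)
qed

lemma Av_has_time_derivative:
  assumes w: "jc w" and h: "0 < h" and t: "0 \<le> t" and y: "0 \<le> y" "y \<le> 1"
  shows "((\<lambda>t. Av h w t y) has_real_derivative (w (t + h) y - w t y) / h) (at t within {0..})"
proof -
  let ?J = "\<lambda>x. integral {0..x} (\<lambda>r. w r y)"
  have c: "continuous_on {0..} (\<lambda>r. w r y)" by (rule jc_time[OF w y])
  have "((\<lambda>t. (?J (t + h) - ?J t) / h) has_real_derivative (w (t + h) y - w t y) / h) (at t within {0..})"
    using h t by (intro DERIV_cdivide DERIV_diff DERIV_shift_within integral_has_real_derivative_atLeast c) auto
  then show ?thesis
  proof (rule has_field_derivative_transform_within[where d=1])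
    fix x :: real assume x: "x \<in> {0..}"
    have "?J x + integral {x..x+h} (\<lambda>r. w r y) = ?J (x + h)"
      using x h by (intro Henstock_Kurzweil_Integration.integral_combine integrable_continuous_real continuous_on_subset[OF c]) auto
    then show "(?J (x + h) - ?J x) / h = Av h w x y"
      using Av_eq[OF w less_imp_le[OF h] _ y, of x] x h by (simp add: field_simps)
  qed (use t in auto)
qed

section \<open>The energy inequality\<close>

lemma square_integral_le:
  fixes f :: "real \<Rightarrow> real"
  assumes f: "continuous_on {0..1} f"
  shows "(integral {0..1} f)\<^sup>2 \<le> integral {0..1} (\<lambda>y. (f y)\<^sup>2)"
proof -
  let ?m = "integral {0..1} f"
  have i: "f integrable_on {0..1}" "(\<lambda>y. (f y)\<^sup>2) integrable_on {0..1}"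
    by (intro integrable_continuous_real continuous_intros f)+
  have "0 \<le> integral {0..1} (\<lambda>y. (f y - ?m)\<^sup>2)"
    by (intro Henstock_Kurzweil_Integration.integral_nonneg integrable_continuous_real continuous_intros f) auto
  also have "\<dots> = integral {0..1} (\<lambda>y. (f y)\<^sup>2 + (- 2 * ?m) * f y + ?m\<^sup>2)"
    by (simp add: power2_diff algebra_simps)
  also have "\<dots> = integral {0..1} (\<lambda>y. (f y)\<^sup>2) + (- 2 * ?m) * ?m + ?m\<^sup>2"
    using has_integral_const_real[of "?m\<^sup>2" 0 1]
    by (intro integral_unique has_integral_add has_integral_mult_right integrable_integral i) simp
  finally show ?thesis by (simp add: power2_eq_square)
qed

lemma increment_le_integral_abs:
  fixes f f' :: "real \<Rightarrow> real"
  assumes d: "\<And>y. y \<in> {0..1} \<Longrightarrow> (f has_real_derivative f' y) (at y within {0..1})"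
    and c: "continuous_on {0..1} f'" and pq: "p \<in> {0..1}" "q \<in> {0..1}"
  shows "\<bar>f p - f q\<bar> \<le> integral {0..1} (\<lambda>y. \<bar>f' y\<bar>)"
proof -
  have "\<bar>f q - f p\<bar> \<le> integral {0..1} (\<lambda>y. \<bar>f' y\<bar>)" if pq: "0 \<le> p" "p \<le> q" "q \<le> 1" for p q
  proof -
    have "(f' has_integral (f q - f p)) {p..q}"
      using pq by (intro fundamental_theorem_of_calculus)
        (auto simp: has_real_derivative_iff_has_vector_derivative[symmetric] intro!: has_field_derivative_subset[OF d])
    then have "\<bar>f q - f p\<bar> = \<bar>integral {p..q} f'\<bar>" by (simp add: integral_unique)
    also have "\<dots> \<le> integral {p..q} (\<lambda>y. \<bar>f' y\<bar>)"
    proof -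
      have c': "continuous_on {p..q} f'" using pq by (intro continuous_on_subset[OF c]) auto
      have "norm (integral {p..q} f') \<le> integral {p..q} (\<lambda>y. \<bar>f' y\<bar>)"
        by (intro integral_norm_bound_integral integrable_continuous_real continuous_intros c') simp
      then show ?thesis by simp
    qed
    also have "\<dots> \<le> integral {0..1} (\<lambda>y. \<bar>f' y\<bar>)"
      using pq by (intro integral_subset_le integrable_continuous_real continuous_intros continuous_on_subset[OF c]) auto
    finally show ?thesis .
  qed
  from this[of p q] this[of q p] pq show ?thesis by (cases "p \<le> q") auto
qed

text \<open>In both cases \<open>f\<close> has a zero, so \<open>\<bar>f y\<bar>\<close> is at most the total variation of \<open>f\<close>.\<close>

lemma poincare:
  fixes f f' :: "real \<Rightarrow> real"
  assumes d: "\<And>y. y \<in> {0..1} \<Longrightarrow> (f has_real_derivative f' y) (at y within {0..1})"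
    and c: "continuous_on {0..1} f'" and z: "f 0 = 0 \<or> integral {0..1} f = 0" and y: "y \<in> {0..1}"
  shows "(f y)\<^sup>2 \<le> integral {0..1} (\<lambda>y. (f' y)\<^sup>2)"
proof -
  have fc: "continuous_on {0..1} f" using d by (meson DERIV_continuous_on)
  have "\<exists>p\<in>{0..1}. f p = 0"
  proof (rule ccontr)
    assume n: "\<not> (\<exists>p\<in>{0..1}. f p = 0)"
    then have i0: "integral {0..1} f = 0" using z by force
    have sgn: "f 0 > 0 \<and> f p > 0 \<or> f 0 < 0 \<and> f p < 0" if p: "p \<in> {0..1}" for p
    proof (rule ccontr)
      assume "\<not> ?thesis"
      then have "f 0 \<le> 0 \<and> 0 \<le> f p \<or> f p \<le> 0 \<and> 0 \<le> f 0"
        by linarith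
      then obtain q where "q \<in> {0..p}" "f q = 0"
        using IVT'[of f 0 0 p] IVT2'[of f p 0 0] continuous_on_subset[OF fc, of "{0..p}"] p by auto
      then show False using n p by auto
    qed
    have "integral {0..1} f \<noteq> 0"
    proof (cases "f 0 > 0")
      case True
      then have "f p \<ge> 0" if "p \<in> {0..1}" for p using sgn[OF that] by auto
      then show ?thesis using integral_eq_0_iff[OF fc] n by force
    next
      case False
      then have "- f p \<ge> 0" if "p \<in> {0..1}" for p using sgn[OF that] by auto
      then show ?thesis using integral_eq_0_iff[of 0 1 "\<lambda>y. - f y"] fc n by (force intro!: continuous_intros)
    qed
    then show False using i0 by simp
  qed
  then obtain p where p: "p \<in> {0..1}" "f p = 0" by blast
  have "\<bar>f y\<bar> \<le> integral {0..1} (\<lambda>y. \<bar>f' y\<bar>)" using increment_le_integral_abs[OF d c y p(1)] p(2) by simp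
  then have "(f y)\<^sup>2 \<le> (integral {0..1} (\<lambda>y. \<bar>f' y\<bar>))\<^sup>2" by (metis abs_ge_zero power2_abs power_mono)
  also have "\<dots> \<le> integral {0..1} (\<lambda>y. \<bar>f' y\<bar>\<^sup>2)" by (intro square_integral_le continuous_intros c)
  finally show ?thesis by simp
qed

lemma nonpos_at_0:
  fixes \<Phi> :: "real \<Rightarrow> real"
  assumes "continuous_on {0..} \<Phi>" "\<And>h. h > 0 \<Longrightarrow> \<Phi> h \<le> 0"
  shows "\<Phi> 0 \<le> 0"
proof -
  have "(\<Phi> \<longlongrightarrow> \<Phi> 0) (at 0 within {0..})" using assms(1) by (auto simp: continuous_on_def)
  then have "(\<Phi> \<longlongrightarrow> \<Phi> 0) (at_right 0)" by (rule tendsto_mono[rotated]) (auto intro: at_le)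
  then show ?thesis
    by (rule tendsto_upperbound) (auto simp: eventually_at_filter assms(2))
qed

lemma DERIV_half_squares:
  fixes A B :: "real \<Rightarrow> real"
  assumes "(A has_real_derivative A') (at x within S)" "(B has_real_derivative B') (at x within S)"
  shows "((\<lambda>x. (k * (A x)\<^sup>2 + l * (B x)\<^sup>2) / 2) has_real_derivative k * (A x * A') + l * (B x * B')) (at x within S)"
proof -
  have "((\<lambda>x. (k / 2) * (A x * A x) + (l / 2) * (B x * B x)) has_real_derivative
      (k / 2) * (A' * A x + A' * A x) + (l / 2) * (B' * B x + B' * B x)) (at x within S)"
    by (intro DERIV_add DERIV_cmult DERIV_mult assms)
  then show ?thesis by (simp add: power2_eq_square field_simps)
qed

text \<open>The system is \<open>\<rho> \<partial>\<^sub>t a = \<partial>\<^sub>y (\<eta> \<partial>\<^sub>y a + b)\<close>, \<open>\<lambda> \<partial>\<^sub>t b = G \<partial>\<^sub>y a - g\<close>, written without time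
  derivatives by means of a potential \<open>P\<close> with \<open>\<partial>\<^sub>y P = \<rho> a\<close> and \<open>\<partial>\<^sub>t P = \<eta> \<partial>\<^sub>y a + b\<close>. Multiplying the
  equations by \<open>G a\<close> and \<open>b\<close> makes the coupling terms cancel, and the dissipation \<open>G \<eta> (\<partial>\<^sub>y a)\<^sup>2\<close> controls
  \<open>G \<eta> a\<^sup>2\<close> by Poincare's inequality. The computation is legitimate for the averages over \<open>{t..t+h}\<close>,
  which solve the same system, are differentiable in time, and have the continuous space derivative \<open>Q\<close>
  below. Only the inequality survives the limit \<open>h \<rightarrow> 0\<close>, since \<open>\<partial>\<^sub>y a\<close> need not exist; it is
  enough. The boundary term vanishes if \<open>a\<close> or \<open>P\<close> vanishes at the end points.\<close>

lemma energy_inequality: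
  fixes \<rho> \<eta> lam G :: real and a b g P :: "real \<Rightarrow> real \<Rightarrow> real"
  assumes pos: "\<rho> > 0" "\<eta> > 0" "lam > 0" "G > 0"
    and a: "jc a" and b: "jc b" and g: "jc g" and P: "jc P"
    and Py: "\<And>t y. 0 \<le> t \<Longrightarrow> y \<in> {0..1} \<Longrightarrow> (P t has_real_derivative \<rho> * a t y) (at y within {0..1})"
    and ay: "\<And>s t y. 0 \<le> s \<Longrightarrow> s \<le> t \<Longrightarrow> y \<in> {0..1} \<Longrightarrow>
      ((\<lambda>y. integral {s..t} (\<lambda>r. a r y)) has_real_derivative
        (P t y - P s y - integral {s..t} (\<lambda>r. b r y)) / \<eta>) (at y within {0..1})"
    and bt: "\<And>s t y. 0 \<le> s \<Longrightarrow> s \<le> t \<Longrightarrow> y \<in> {0..1} \<Longrightarrow>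
      lam * (b t y - b s y) = G * ((P t y - P s y - integral {s..t} (\<lambda>r. b r y)) / \<eta>) - integral {s..t} (\<lambda>r. g r y)"
    and bdry: "(\<forall>t\<ge>0. a t 0 = 0 \<and> a t 1 = 0) \<or> (\<forall>t\<ge>0. P t 0 = 0 \<and> P t 1 = 0)"
    and zero: "(\<forall>t\<ge>0. a t 0 = 0) \<or> (\<forall>t\<ge>0. integral {0..1} (a t) = 0)"
    and st: "0 \<le> s" "s \<le> t"
  defines "E \<equiv> \<lambda>t. integral {0..1} (\<lambda>y. (G * \<rho> * (a t y)\<^sup>2 + lam * (b t y)\<^sup>2) / 2)"
  shows "E t - E s \<le> integral {s..t} (\<lambda>r. - (integral {0..1} (\<lambda>y. G * \<eta> * (a r y)\<^sup>2 + g r y * b r y)))"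
proof -
  define Eh where "Eh h t = integral {0..1} (\<lambda>y. (G * \<rho> * (Av h a t y)\<^sup>2 + lam * (Av h b t y)\<^sup>2) / 2)" for h t
  define Dh where "Dh h r = - (integral {0..1} (\<lambda>y. G * \<eta> * (Av h a r y)\<^sup>2 + Av h g r y * Av h b r y))" for h r
  have main: "Eh h t - Eh h s \<le> integral {s..t} (Dh h)" if h: "h > 0" for h
  proof -
    have h0: "h \<ge> 0" using h by simp
    define Q where "Q t y = (P (t + h) y - P t y - h * Av h b t y) / (\<eta> * h)" for t y
    have cQ: "continuous_on {0..1} (Q t)" if "t \<ge> 0" for t
      unfolding Q_def using pos h that
      by (intro continuous_intros jc_comp[OF P] continuous_on_Av[OF b]) auto
    have Qy: "(Av h a t has_real_derivative Q t y) (at y within {0..1})" if ty: "t \<ge> 0" "y \<in> {0..1}" for t y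
    proof -
      have "((\<lambda>y. integral {t..t+h} (\<lambda>r. a r y) / h) has_real_derivative
        ((P (t+h) y - P t y - integral {t..t+h} (\<lambda>r. b r y)) / \<eta>) / h) (at y within {0..1})"
        by (intro DERIV_cdivide ay) (use ty h in auto)
      also have "((P (t+h) y - P t y - integral {t..t+h} (\<lambda>r. b r y)) / \<eta>) / h = Q t y"
        using Av_eq[OF b h0, of t y] ty by (simp add: Q_def)
      finally show ?thesis
      proof (rule has_field_derivative_transform_within[where d=1])
        fix x :: real assume x: "x \<in> {0..1}"
        show "integral {t..t+h} (\<lambda>r. a r x) / h = Av h a t x"
          using Av_eq[OF a h0, of t x] ty x h by (simp add: field_simps)
      qed (use ty in auto)
    qed
    let ?a' = "\<lambda>t y. (a (t + h) y - a t y) / h" and ?b' = "\<lambda>t y. (b (t + h) y - b t y) / h"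
    let ?E' = "\<lambda>t. integral {0..1} (\<lambda>y. G * \<rho> * (Av h a t y * ?a' t y) + lam * (Av h b t y * ?b' t y))"
    have Ed: "(Eh h has_real_derivative ?E' t) (at t within {0..})" if t: "t \<ge> 0" for t
    proof -
      have "((\<lambda>t. integral (cbox 0 1) (\<lambda>y. (G * \<rho> * (Av h a t y)\<^sup>2 + lam * (Av h b t y)\<^sup>2) / 2)) has_real_derivative
        integral (cbox 0 1) (\<lambda>y. G * \<rho> * (Av h a t y * ?a' t y) + lam * (Av h b t y * ?b' t y))) (at t within {0..})"
      proof (rule leibniz_rule_field_derivative)
        fix x y :: real assume "x \<in> {0..}" "y \<in> cbox 0 1"
        then have xy: "0 \<le> x" "0 \<le> y" "y \<le> 1" by auto
        show "((\<lambda>x. (G * \<rho> * (Av h a x y)\<^sup>2 + lam * (Av h b x y)\<^sup>2) / 2) has_real_derivative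
          G * \<rho> * (Av h a x y * ?a' x y) + lam * (Av h b x y * ?b' x y)) (at x within {0..})"
          by (intro DERIV_half_squares Av_has_time_derivative[OF a h xy] Av_has_time_derivative[OF b h xy])
      next
        fix x :: real assume "x \<in> {0..}"
        then show "(\<lambda>y. (G * \<rho> * (Av h a x y)\<^sup>2 + lam * (Av h b x y)\<^sup>2) / 2) integrable_on cbox 0 1"
          using h0 unfolding cbox_interval
          by (intro integrable_continuous_real continuous_intros continuous_on_Av[OF a] continuous_on_Av[OF b]) auto
      next
        show "continuous_on ({0..} \<times> cbox 0 1) (\<lambda>(x, y). G * \<rho> * (Av h a x y * ?a' x y) + lam * (Av h b x y * ?b' x y))"
          using h unfolding case_prod_unfold
          by (intro continuous_intros continuous_on_Av[OF a] continuous_on_Av[OF b] jc_comp[OF a] jc_comp[OF b]) auto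
      qed (use t in auto)
      then show ?thesis by (simp add: Eh_def[abs_def])
    qed
    \<comment> \<open>the integrand \<open>?I\<close> is the space derivative of (average of \<open>a\<close>) times (difference quotient of \<open>P\<close>)\<close>
    have E'le: "?E' r \<le> Dh h r" if r: "r \<ge> 0" for r
    proof -
      let ?I = "\<lambda>y. Av h a r y * (\<rho> * ?a' r y) + Q r y * ((P (r + h) y - P r y) / h)"
      have "(?I has_integral (Av h a r 1 * ((P (r + h) 1 - P r 1) / h) - Av h a r 0 * ((P (r + h) 0 - P r 0) / h))) {0..1}"
      proof (rule fundamental_theorem_of_calculus)
        fix y :: real assume y: "y \<in> {0..1}"
        have "((\<lambda>y. Av h a r y * ((P (r + h) y - P r y) / h)) has_real_derivative
           Q r y * ((P (r + h) y - P r y) / h) + (\<rho> * a (r + h) y - \<rho> * a r y) / h * Av h a r y) (at y within {0..1})"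
          by (intro DERIV_mult Qy DERIV_cdivide DERIV_diff Py) (use r h y in auto)
        then show "((\<lambda>y. Av h a r y * ((P (r + h) y - P r y) / h)) has_vector_derivative ?I y) (at y within {0..1})"
          unfolding has_real_derivative_iff_has_vector_derivative by (simp add: algebra_simps diff_divide_distrib)
      qed simp
      moreover have "Av h a r 1 * ((P (r + h) 1 - P r 1) / h) - Av h a r 0 * ((P (r + h) 0 - P r 0) / h) = 0"
        using bdry
      proof
        assume z: "\<forall>t\<ge>0. a t 0 = 0 \<and> a t 1 = 0"
        have "Av h a r p = 0" if "p = 0 \<or> p = 1" for p
        proof -
          have "Av h a r p = integral {0..1} (\<lambda>\<sigma>::real. 0)" unfolding Av_def
            by (rule Henstock_Kurzweil_Integration.integral_cong) (use z r h that in auto)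
          then show ?thesis by simp
        qed
        then show ?thesis by simp
      qed (use r h in simp)
      ultimately have I0: "(?I has_integral 0) {0..1}" by (simp only:)
      have Q2: "integral {0..1} (\<lambda>y. (Av h a r y)\<^sup>2) \<le> integral {0..1} (\<lambda>y. (Q r y)\<^sup>2)"
      proof -
        have z: "Av h a r 0 = 0 \<or> integral {0..1} (Av h a r) = 0"
          using zero
        proof
          assume z: "\<forall>t\<ge>0. a t 0 = 0"
          have "Av h a r 0 = integral {0..1} (\<lambda>\<sigma>::real. 0)" unfolding Av_def
            by (rule Henstock_Kurzweil_Integration.integral_cong) (use z r h in auto)
          then show ?thesis by simp
        next
          assume z: "\<forall>t\<ge>0. integral {0..1} (a t) = 0"
          have "integral {0..1} (Av h a r) = integral {0..1} (\<lambda>y. integral {0..1} (\<lambda>\<sigma>. a (r + h * \<sigma>) y))"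
            by (simp add: Av_def[abs_def])
          also have "\<dots> = integral {0..1} (\<lambda>\<sigma>. integral {0..1} (\<lambda>y. a (r + h * \<sigma>) y))"
            by (rule integral_swap_real, rule jc_comp[OF a]) (use r h in \<open>auto intro!: continuous_intros\<close>)
          also have "\<dots> = integral {0..1} (\<lambda>\<sigma>::real. 0)"
            by (rule Henstock_Kurzweil_Integration.integral_cong) (use z r h in auto)
          finally show ?thesis by simp
        qed
        have "integral {0..1} (\<lambda>y. (Av h a r y)\<^sup>2) \<le> integral {0..1} (\<lambda>x::real. integral {0..1} (\<lambda>y. (Q r y)\<^sup>2))"
          by (intro integral_le integrable_continuous_real continuous_intros continuous_on_Av[OF a] poincare[OF Qy cQ z])
             (use r h in auto)
        then show ?thesis by simp
      qed
      have iQ: "(\<lambda>y. (Q r y)\<^sup>2) integrable_on {0..1}" "(\<lambda>y. Av h g r y * Av h b r y) integrable_on {0..1}"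
        "(\<lambda>y. (Av h a r y)\<^sup>2) integrable_on {0..1}"
        by (intro integrable_continuous_real continuous_intros cQ continuous_on_Av[OF a] continuous_on_Av[OF b] continuous_on_Av[OF g]; use r h in force)+
      have "?E' r = integral {0..1} (\<lambda>y. G * ?I y + ((- (G * \<eta>)) * (Q r y)\<^sup>2 + (- 1) * (Av h g r y * Av h b r y)))"
      proof (rule Henstock_Kurzweil_Integration.integral_cong)
        fix y :: real assume y: "y \<in> {0..1}"
        have e1: "lam * ?b' r y = G * Q r y - Av h g r y"
        proof -
          have "lam * (b (r + h) y - b r y) = G * ((P (r + h) y - P r y - h * Av h b r y) / \<eta>) - h * Av h g r y"
            using bt[of r "r + h" y] Av_eq[OF b h0, of r y] Av_eq[OF g h0, of r y] r h y by simp
          then have "lam * ?b' r y = (G * ((P (r + h) y - P r y - h * Av h b r y) / \<eta>) - h * Av h g r y) / h" by simp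
          also have "\<dots> = G * Q r y - Av h g r y" using h pos by (simp add: Q_def field_simps)
          finally show ?thesis .
        qed
        have e2: "(P (r + h) y - P r y) / h = \<eta> * Q r y + Av h b r y"
          using h pos by (simp add: Q_def field_simps)
        have "lam * (Av h b r y * ?b' r y) = Av h b r y * (G * Q r y - Av h g r y)" using e1 by (metis mult.left_commute)
        then show "G * \<rho> * (Av h a r y * ?a' r y) + lam * (Av h b r y * ?b' r y)
          = G * ?I y + ((- (G * \<eta>)) * (Q r y)\<^sup>2 + (- 1) * (Av h g r y * Av h b r y))"
          unfolding e2 by (simp add: algebra_simps power2_eq_square)
      qed
      also have "\<dots> = G * 0 + ((- (G * \<eta>)) * integral {0..1} (\<lambda>y. (Q r y)\<^sup>2) + (-1) * integral {0..1} (\<lambda>y. Av h g r y * Av h b r y))"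
        by (intro integral_unique has_integral_add has_integral_mult_right I0 integrable_integral iQ)
      also have "\<dots> \<le> G * 0 + ((- (G * \<eta>)) * integral {0..1} (\<lambda>y. (Av h a r y)\<^sup>2) + (-1) * integral {0..1} (\<lambda>y. Av h g r y * Av h b r y))"
        using Q2 pos by simp
      also have "\<dots> = Dh h r"
      proof -
        have "integral {0..1} (\<lambda>y. G * \<eta> * (Av h a r y)\<^sup>2 + Av h g r y * Av h b r y)
          = G * \<eta> * integral {0..1} (\<lambda>y. (Av h a r y)\<^sup>2) + integral {0..1} (\<lambda>y. Av h g r y * Av h b r y)"
          by (intro integral_unique has_integral_add has_integral_mult_right integrable_integral iQ)
        then show ?thesis by (simp add: Dh_def)
      qed
      finally show ?thesis .
    qed
    have "(?E' has_integral (Eh h t - Eh h s)) {s..t}"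
    proof (rule fundamental_theorem_of_calculus[OF st(2)])
      fix x assume x: "x \<in> {s..t}"
      then have "(Eh h has_real_derivative ?E' x) (at x within {s..t})"
        by (intro has_field_derivative_subset[OF Ed]) (use st in auto)
      then show "(Eh h has_vector_derivative ?E' x) (at x within {s..t})"
        by (simp only: has_real_derivative_iff_has_vector_derivative)
    qed
    moreover have "(Dh h has_integral integral {s..t} (Dh h)) {s..t}"
      unfolding Dh_def using st h
      by (intro integrable_integral integrable_continuous_real continuous_intros continuous_on_space_integral
          continuous_on_Av[OF a] continuous_on_Av[OF b] continuous_on_Av[OF g]) auto
    ultimately show ?thesis by (rule has_integral_le) (use E'le st in auto)
  qed
  \<comment> \<open>the inequality for \<open>h > 0\<close> extends to \<open>h = 0\<close> by continuity\<close>
  let ?\<Phi> = "\<lambda>h. Eh h t - Eh h s - integral {s..t} (Dh h)"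
  have "?\<Phi> 0 \<le> 0"
  proof (rule nonpos_at_0)
    have "continuous_on {0..} (\<lambda>h. Eh h r)" if "r \<ge> 0" for r
      unfolding Eh_def using that
      by (intro continuous_intros continuous_on_space_integral continuous_on_Av[OF a] continuous_on_Av[OF b]) auto
    moreover have "continuous_on {0..} (\<lambda>h. integral (cbox s t) (Dh h))"
      unfolding Dh_def case_prod_unfold using st
      by (intro integral_continuous_on_param[unfolded case_prod_unfold] continuous_intros continuous_on_space_integral continuous_on_Av[OF a] continuous_on_Av[OF b] continuous_on_Av[OF g]) auto
    ultimately show "continuous_on {0..} ?\<Phi>" using st by (auto intro!: continuous_intros)
  qed (use main in auto)
  then show ?thesis by (simp add: Eh_def Dh_def[abs_def] Av_0 E_def)
qed

section \<open>Means and primitives in space\<close>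

definition mean :: "(real \<Rightarrow> real) \<Rightarrow> real" where
  "mean f = integral {0..1} f"

definition prim :: "(real \<Rightarrow> real) \<Rightarrow> real \<Rightarrow> real" where
  "prim f y = integral {0..y} f"

text \<open>The primitive with mean zero; \<open>prim\<close> itself is the primitive that vanishes at \<open>0\<close>.\<close>

definition zprim :: "(real \<Rightarrow> real) \<Rightarrow> real \<Rightarrow> real" where
  "zprim f y = prim f y - mean (prim f)"

lemma prim_deriv:
  assumes "continuous_on {0..1} f" "y \<in> {0..1}"
  shows "(prim f has_real_derivative f y) (at y within {0..1})"
  unfolding prim_def[abs_def] by (rule integral_has_real_derivative) (use assms in auto)

lemma prim_cont: "continuous_on {0..1} f \<Longrightarrow> continuous_on {0..1} (prim f)"
  using prim_deriv by (meson DERIV_continuous_on)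

lemma prim_0 [simp]: "prim f 0 = 0" and prim_1: "prim f 1 = mean f"
  by (simp_all add: prim_def mean_def)

lemma mean_zprim: "continuous_on {0..1} f \<Longrightarrow> mean (zprim f) = 0"
  using integral_diff[of "prim f" "{0..1}" "\<lambda>_. mean (prim f)"] prim_cont[of f]
  by (auto simp: zprim_def[abs_def] mean_def integrable_continuous_real)

lemma jc_prim: assumes "jc w" shows "jc (\<lambda>t. prim (w t))"
proof -
  have "continuous_on ({0..} \<times> {0..1}) (\<lambda>p. snd p * integral {0..1} (\<lambda>\<sigma>. w (fst p) (snd p * \<sigma>)))"
    by (intro continuous_intros continuous_on_space_integral jc_comp[OF assms]) (auto intro: mult_le_one)
  then show ?thesis unfolding jc_def
  proof (rule continuous_on_eq)
    fix p :: "real \<times> real" assume p: "p \<in> {0..} \<times> {0..1}"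
    have "continuous_on {0..0+snd p} (w (fst p))"
      using p by (intro continuous_on_subset[OF jc_slice[OF assms]]) auto
    from integral_unit_scale[OF _ this] p
    show "snd p * integral {0..1} (\<lambda>\<sigma>. w (fst p) (snd p * \<sigma>)) = prim (w (fst p)) (snd p)"
      by (auto simp: prim_def)
  qed
qed

lemma continuous_on_mean: "jc w \<Longrightarrow> continuous_on {0..} (\<lambda>t. mean (w t))"
  unfolding mean_def by (intro continuous_on_space_integral) (simp add: jc_def)

lemma jc_const_y: "continuous_on {0..} f \<Longrightarrow> jc (\<lambda>t y. f t)"
  unfolding jc_def by (rule continuous_on_compose2[of "{0..}" f]) (auto intro!: continuous_intros)

lemma jc_mean: "jc w \<Longrightarrow> jc (\<lambda>t y. mean (w t))"
  by (intro jc_const_y continuous_on_mean)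

lemma jc_add: "jc a \<Longrightarrow> jc b \<Longrightarrow> jc (\<lambda>t y. a t y + b t y)"
  and jc_diff: "jc a \<Longrightarrow> jc b \<Longrightarrow> jc (\<lambda>t y. a t y - b t y)"
  and jc_mult: "jc a \<Longrightarrow> jc b \<Longrightarrow> jc (\<lambda>t y. a t y * b t y)"
  and jc_abs: "jc a \<Longrightarrow> jc (\<lambda>t y. \<bar>a t y\<bar>)"
  and jc_const: "jc (\<lambda>t y. k)"
  and jc_minus: "jc a \<Longrightarrow> jc (\<lambda>t y. - a t y)"
  and jc_power: "jc a \<Longrightarrow> jc (\<lambda>t y. a t y ^ n)"
  and jc_divide: "jc a \<Longrightarrow> jc (\<lambda>t y. a t y / k)"
  and jc_y: "jc (\<lambda>t y. y)"
  unfolding jc_def by (auto intro!: continuous_intros simp: divide_inverse)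

lemmas jc_intros = jc_add jc_diff jc_mult jc_abs jc_const jc_minus jc_power jc_divide jc_y jc_mean jc_prim

lemma jc_zprim: "jc w \<Longrightarrow> jc (\<lambda>t. zprim (w t))"
  unfolding zprim_def[abs_def] by (intro jc_intros)

lemma jc_time_integral_deriv:
  assumes "jc w" "0 \<le> t" "y \<in> {0..1}"
  shows "((\<lambda>t. integral {0..t} (\<lambda>r. w r y)) has_real_derivative w t y) (at t within {0..})"
  by (rule integral_has_real_derivative_atLeast[OF jc_time]) (use assms in auto)

lemma jc_time_integrable:
  assumes "jc w" "0 \<le> s" "y \<in> {0..1}"
  shows "(\<lambda>r. w r y) integrable_on {s..t}"
  by (intro integrable_continuous_real continuous_on_subset[OF jc_time[OF assms(1)]]) (use assms in auto)

lemma cont_time_integrable: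
  fixes f :: "real \<Rightarrow> real" shows "continuous_on {0..} f \<Longrightarrow> 0 \<le> s \<Longrightarrow> f integrable_on {s..t}"
  by (intro integrable_continuous_real) (auto elim: continuous_on_subset)

text \<open>Fubini's theorem.\<close>

lemma prim_time_integral:
  assumes w: "jc w" and st: "0 \<le> s" "y \<in> {0..1}"
  shows "prim (\<lambda>x. integral {s..t} (\<lambda>r. w r x)) y = integral {s..t} (\<lambda>r. prim (w r) y)"
  unfolding prim_def
  by (rule integral_swap_real, rule jc_comp[OF w]) (use st in \<open>auto intro!: continuous_intros\<close>)

lemma cont_time_integral:
  assumes w: "jc w" and st: "0 \<le> s" "s \<le> t"
  shows "continuous_on {0..1} (\<lambda>y. integral {s..t} (\<lambda>r. w r y))"
proof -
  have "continuous_on {0..1} (\<lambda>y. (t - s) * Av (t - s) w s y)"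
    using st by (intro continuous_intros continuous_on_Av[OF w]) auto
  then show ?thesis
    by (rule continuous_on_eq) (use Av_eq[OF w, of "t - s" s] st in auto)
qed

lemma increments_imp_DERIV:
  fixes F f :: "real \<Rightarrow> real"
  assumes "\<And>s t. 0 \<le> s \<Longrightarrow> s \<le> t \<Longrightarrow> F t - F s = integral {s..t} f" "continuous_on {0..} f" "0 \<le> t"
  shows "(F has_real_derivative f t) (at t within {0..})"
proof -
  have "((\<lambda>t. F 0 + integral {0..t} f) has_real_derivative 0 + f t) (at t within {0..})"
    by (intro DERIV_add DERIV_const integral_has_real_derivative_atLeast assms)
  then have "((\<lambda>t. F 0 + integral {0..t} f) has_real_derivative f t) (at t within {0..})" by simp
  then show ?thesis
  proof (rule has_field_derivative_transform_within[where d=1])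
    show "F 0 + integral {0..x} f = F x" if "x \<in> {0..}" for x using assms(1)[of 0 x] that by simp
  qed (use assms(3) in auto)
qed

lemma DERIV_imp_increments:
  fixes F f :: "real \<Rightarrow> real"
  assumes "\<And>t. 0 \<le> t \<Longrightarrow> (F has_real_derivative f t) (at t within {0..})" "0 \<le> s" "s \<le> t"
  shows "F t - F s = integral {s..t} f"
proof -
  have "(f has_integral (F t - F s)) {s..t}"
    using assms(2,3) by (intro fundamental_theorem_of_calculus)
      (auto simp: has_real_derivative_iff_has_vector_derivative[symmetric] intro!: has_field_derivative_subset[OF assms(1)])
  then show ?thesis by (simp add: integral_unique)
qed

text \<open>\<open>(w\<^sup>2)' = 2 w w'\<close> at every point, integrated over space and time.\<close>

lemma mean_square_increment:
  assumes w: "jc w" and k: "jc k"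
    and inc: "\<And>s t y. 0 \<le> s \<Longrightarrow> s \<le> t \<Longrightarrow> y \<in> {0..1} \<Longrightarrow> w t y - w s y = integral {s..t} (\<lambda>r. k r y)"
    and st: "0 \<le> s" "s \<le> t"
  shows "mean (\<lambda>y. (w t y)\<^sup>2) - mean (\<lambda>y. (w s y)\<^sup>2) = integral {s..t} (\<lambda>r. mean (\<lambda>y. 2 * (w r y * k r y)))"
proof (rule DERIV_imp_increments[OF _ st])
  fix t :: real assume t: "0 \<le> t"
  have "((\<lambda>t. integral (cbox 0 1) (\<lambda>y. (w t y)\<^sup>2)) has_real_derivative
      integral (cbox 0 1) (\<lambda>y. 2 * (w t y * k t y))) (at t within {0..})"
  proof (rule leibniz_rule_field_derivative)
    fix x y :: real assume "x \<in> {0..}" "y \<in> cbox 0 1"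
    then have "((\<lambda>t. w t y) has_real_derivative k x y) (at x within {0..})"
      using jc_time[OF k, of y] by (intro increments_imp_DERIV inc) auto
    from DERIV_mult[OF this this]
    show "((\<lambda>x. (w x y)\<^sup>2) has_real_derivative 2 * (w x y * k x y)) (at x within {0..})"
      by (simp add: power2_eq_square algebra_simps)
  next
    fix x :: real assume "x \<in> {0..}"
    then show "(\<lambda>y. (w x y)\<^sup>2) integrable_on cbox 0 1"
      using jc_integrable[OF jc_power[OF w]] by auto
  next
    show "continuous_on ({0..} \<times> cbox 0 1) (\<lambda>(x, y). 2 * (w x y * k x y))"
      using jc_mult[OF jc_const[of 2] jc_mult[OF w k]] by (simp add: jc_def case_prod_unfold)
  qed (use t in auto)
  then show "((\<lambda>t. mean (\<lambda>y. (w t y)\<^sup>2)) has_real_derivative mean (\<lambda>y. 2 * (w t y * k t y))) (at t within {0..})"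
    by (simp add: mean_def)
qed

lemma mean_mono:
  "continuous_on {0..1} f \<Longrightarrow> continuous_on {0..1} g \<Longrightarrow> (\<And>y. y \<in> {0..1} \<Longrightarrow> f y \<le> g y) \<Longrightarrow> mean f \<le> mean g"
  unfolding mean_def by (intro integral_le integrable_continuous_real) auto

lemma mean_lin:
  assumes "continuous_on {0..1} f" "continuous_on {0..1} g"
  shows "mean (\<lambda>y. a * f y + b * g y) = a * mean f + b * mean g"
  unfolding mean_def
  by (intro integral_unique has_integral_add has_integral_mult_right integrable_integral integrable_continuous_real assms)

lemma mean_const [simp]: "mean (\<lambda>y. k) = k"
  by (simp add: mean_def)

lemma mean_cong: "(\<And>y. y \<in> {0..1} \<Longrightarrow> f y = g y) \<Longrightarrow> mean f = mean g"
  unfolding mean_def by (rule Henstock_Kurzweil_Integration.integral_cong)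

lemma mean_square_centered:
  assumes "continuous_on {0..1} f"
  shows "mean (\<lambda>y. (f y - mean f)\<^sup>2) = mean (\<lambda>y. (f y)\<^sup>2) - (mean f)\<^sup>2"
proof -
  have "mean (\<lambda>y. (f y - mean f)\<^sup>2) = mean (\<lambda>y. 1 * (f y)\<^sup>2 + 1 * ((- 2 * mean f) * f y + (mean f)\<^sup>2 * 1))"
    by (rule mean_cong) (simp add: power2_diff algebra_simps)
  also have "\<dots> = 1 * mean (\<lambda>y. (f y)\<^sup>2) + 1 * ((- 2 * mean f) * mean f + (mean f)\<^sup>2 * mean (\<lambda>_. 1))"
    by (subst mean_lin mean_lin[OF assms] | intro continuous_intros assms)+ (rule refl)
  finally show ?thesis by (simp add: power2_eq_square)
qed

lemma mean_square_centered_le: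
  "continuous_on {0..1} f \<Longrightarrow> mean (\<lambda>y. (f y - mean f)\<^sup>2) \<le> mean (\<lambda>y. (f y)\<^sup>2)"
  by (simp add: mean_square_centered)

lemma prim_square_le:
  assumes f: "continuous_on {0..1} f" and y: "y \<in> {0..1}"
  shows "(prim f y)\<^sup>2 \<le> mean (\<lambda>y. (f y)\<^sup>2)"
proof -
  have "\<bar>prim f y - prim f 0\<bar> \<le> integral {0..1} (\<lambda>y. \<bar>f y\<bar>)"
    by (rule increment_le_integral_abs[OF prim_deriv[OF f] f]) (use y in auto)
  then have "(prim f y)\<^sup>2 \<le> (integral {0..1} (\<lambda>y. \<bar>f y\<bar>))\<^sup>2" by (metis abs_ge_zero diff_zero power2_abs power_mono prim_0)
  also have "\<dots> \<le> integral {0..1} (\<lambda>y. \<bar>f y\<bar>\<^sup>2)" by (intro square_integral_le continuous_intros f)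
  finally show ?thesis by (simp add: mean_def)
qed

section \<open>The viscoelastic system with a given force\<close>

text \<open>The equations \<open>\<rho> \<partial>\<^sub>t u = \<eta> \<partial>\<^sub>y\<^sub>y u + \<partial>\<^sub>y \<tau>\<close> and \<open>\<lambda> \<partial>\<^sub>t \<tau> = G \<partial>\<^sub>y u - g\<close> integrated over
  \<open>{s..t}\<close>, the former also integrated once in space. The quotient in \<open>flow_u\<close> is the time integral of
  \<open>\<partial>\<^sub>y u\<close>: time integration gains the regularity for a classical space derivative. The force \<open>g\<close> is a
  parameter, so that the locale applies to difference quotients of a solution, too.\<close>

locale linear_flow =
  fixes \<rho> \<eta> lam G :: real and u \<tau> g :: "real \<Rightarrow> real \<Rightarrow> real"
  assumes pos: "\<rho> > 0" "\<eta> > 0" "lam > 0" "G > 0"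
    and cont: "jc u" "jc \<tau>" "jc g"
    and u_bdry: "\<And>t. 0 \<le> t \<Longrightarrow> u t 0 = 0 \<and> u t 1 = 0"
    and flow_u: "\<And>s t y. 0 \<le> s \<Longrightarrow> s \<le> t \<Longrightarrow> y \<in> {0..1} \<Longrightarrow>
      ((\<lambda>y. integral {s..t} (\<lambda>r. u r y)) has_real_derivative
        (\<rho> * zprim (u t) y - \<rho> * zprim (u s) y - integral {s..t} (\<lambda>r. \<tau> r y - mean (\<tau> r))) / \<eta>) (at y within {0..1})"
    and flow_\<tau>: "\<And>s t y. 0 \<le> s \<Longrightarrow> s \<le> t \<Longrightarrow> y \<in> {0..1} \<Longrightarrow>
      lam * (\<tau> t y - \<tau> s y) =
        G * ((\<rho> * zprim (u t) y - \<rho> * zprim (u s) y - integral {s..t} (\<lambda>r. \<tau> r y - mean (\<tau> r))) / \<eta>)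
        - integral {s..t} (\<lambda>r. g r y)"
begin

text \<open>\<open>v\<close> is a potential with \<open>\<partial>\<^sub>y v = \<rho> u\<close> and \<open>\<partial>\<^sub>t v = \<eta> \<partial>\<^sub>y u + \<tau> - mean \<tau>\<close>. The multiple of
  \<open>v\<close> subtracted in \<open>w\<close> cancels \<open>\<partial>\<^sub>y u\<close> from the equation for \<open>\<tau> - mean \<tau>\<close>. \<open>D s t\<close> is the integral of
  \<open>\<partial>\<^sub>y u\<close> over \<open>{s..t}\<close>.\<close>

definition v :: "real \<Rightarrow> real \<Rightarrow> real" where "v t y = \<rho> * zprim (u t) y"
definition c :: real where "c = G / (lam * \<eta>)"
definition w :: "real \<Rightarrow> real \<Rightarrow> real" where "w t y = \<tau> t y - mean (\<tau> t) - c * v t y"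
definition D :: "real \<Rightarrow> real \<Rightarrow> real \<Rightarrow> real" where
  "D s t y = (v t y - v s y - integral {s..t} (\<lambda>r. \<tau> r y - mean (\<tau> r))) / \<eta>"

lemma c_pos: "c > 0" using pos by (simp add: c_def)

lemma jc_v: "jc v" unfolding v_def[abs_def] by (intro jc_intros jc_zprim cont)
lemma jc_w: "jc w" unfolding w_def[abs_def] by (intro jc_intros cont jc_v)

lemma v_deriv: "0 \<le> t \<Longrightarrow> y \<in> {0..1} \<Longrightarrow> (v t has_real_derivative \<rho> * u t y) (at y within {0..1})"
  unfolding v_def[abs_def] zprim_def
  by (rule DERIV_cong, rule DERIV_cmult, rule DERIV_diff[OF prim_deriv DERIV_const]) (auto intro: jc_slice cont)

lemma mean_v: "0 \<le> t \<Longrightarrow> mean (v t) = 0"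
  using mean_zprim[OF jc_slice[OF cont(1)], of t] by (simp add: mean_def v_def[abs_def])

lemma flow_u': "0 \<le> s \<Longrightarrow> s \<le> t \<Longrightarrow> y \<in> {0..1} \<Longrightarrow>
    ((\<lambda>y. integral {s..t} (\<lambda>r. u r y)) has_real_derivative D s t y) (at y within {0..1})"
  using flow_u unfolding D_def v_def by blast

lemma flow_\<tau>': "0 \<le> s \<Longrightarrow> s \<le> t \<Longrightarrow> y \<in> {0..1} \<Longrightarrow> lam * (\<tau> t y - \<tau> s y) = G * D s t y - integral {s..t} (\<lambda>r. g r y)"
  using flow_\<tau> unfolding D_def v_def by blast

text \<open>The basic energy. The potential of \<open>energy_inequality\<close> is \<open>v\<close> plus the time integral of
  \<open>mean \<tau>\<close>, because there the flux is \<open>\<eta> \<partial>\<^sub>y u + \<tau>\<close> with the mean included.\<close>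

lemma energy_u_\<tau>:
  assumes st: "0 \<le> s" "s \<le> t"
  shows "mean (\<lambda>y. (G * \<rho> * (u t y)\<^sup>2 + lam * (\<tau> t y)\<^sup>2) / 2) - mean (\<lambda>y. (G * \<rho> * (u s y)\<^sup>2 + lam * (\<tau> s y)\<^sup>2) / 2)
    \<le> integral {s..t} (\<lambda>r. - mean (\<lambda>y. G * \<eta> * (u r y)\<^sup>2 + g r y * \<tau> r y))"
proof -
  define m where "m = (\<lambda>t. integral {0..t} (\<lambda>r. mean (\<tau> r)))"
  define P where "P = (\<lambda>t y. v t y + m t)"
  have mc: "continuous_on {0..} m"
    unfolding m_def using integral_has_real_derivative_atLeast[OF continuous_on_mean[OF cont(2)]]
    by (meson DERIV_continuous_on atLeast_iff)
  have P: "P t y - P s y - integral {s..t} (\<lambda>r. \<tau> r y) = v t y - v s y - integral {s..t} (\<lambda>r. \<tau> r y - mean (\<tau> r))"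
    if "0 \<le> s" "s \<le> t" "y \<in> {0..1}" for s t y
  proof -
    have "m s + integral {s..t} (\<lambda>r. mean (\<tau> r)) = m t" unfolding m_def
      using that by (intro Henstock_Kurzweil_Integration.integral_combine cont_time_integrable continuous_on_mean cont) auto
    moreover have "integral {s..t} (\<lambda>r. \<tau> r y - mean (\<tau> r)) = integral {s..t} (\<lambda>r. \<tau> r y) - integral {s..t} (\<lambda>r. mean (\<tau> r))"
      using that by (intro Henstock_Kurzweil_Integration.integral_diff jc_time_integrable cont_time_integrable continuous_on_mean cont) auto
    ultimately show ?thesis by (simp add: P_def)
  qed
  show ?thesis unfolding mean_def
  proof (rule energy_inequality[OF pos cont(1,2,3), where P=P])
    show "jc P" unfolding P_def by (intro jc_intros jc_v jc_const_y mc)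
    show "(P t has_real_derivative \<rho> * u t y) (at y within {0..1})" if "0 \<le> t" "y \<in> {0..1}" for t y
      using DERIV_add[OF v_deriv[OF that] DERIV_const[of "m t"]] by (simp add: P_def)
    show "((\<lambda>y. integral {s..t} (\<lambda>r. u r y)) has_real_derivative
        (P t y - P s y - integral {s..t} (\<lambda>r. \<tau> r y)) / \<eta>) (at y within {0..1})"
      if "0 \<le> s" "s \<le> t" "y \<in> {0..1}" for s t y
      using flow_u'[OF that] P[OF that] by (simp add: D_def)
    show "lam * (\<tau> t y - \<tau> s y) = G * ((P t y - P s y - integral {s..t} (\<lambda>r. \<tau> r y)) / \<eta>) - integral {s..t} (\<lambda>r. g r y)"
      if "0 \<le> s" "s \<le> t" "y \<in> {0..1}" for s t y
      using flow_\<tau>'[OF that] P[OF that] by (simp add: D_def)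
  qed (use u_bdry st in auto)
qed

text \<open>The primitives of \<open>\<tau> - mean \<tau>\<close> and of \<open>g - mean g\<close> that vanish at both end points.\<close>

definition \<theta> :: "real \<Rightarrow> real \<Rightarrow> real" where "\<theta> t y = prim (\<tau> t) y - y * mean (\<tau> t)"
definition R :: "real \<Rightarrow> real \<Rightarrow> real" where "R t y = prim (g t) y - y * mean (g t)"

lemma jc_\<theta>: "jc \<theta>" unfolding \<theta>_def[abs_def] by (intro jc_intros cont)
lemma jc_R: "jc R" unfolding R_def[abs_def] by (intro jc_intros cont)

lemma prim_minus_mean:
  assumes "continuous_on {0..1} f" "y \<in> {0..1}"
  shows "prim (\<lambda>x. f x - mean f) y = prim f y - y * mean f"
proof -
  have "integral {0..y} (\<lambda>x. f x - mean f) = integral {0..y} f - integral {0..y} (\<lambda>x. mean f)"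
    using assms by (intro Henstock_Kurzweil_Integration.integral_diff integrable_continuous_real continuous_intros continuous_on_subset[OF assms(1)]) auto
  then show ?thesis using assms by (simp add: prim_def)
qed

lemma flow_v:
  assumes "0 \<le> s" "s \<le> t" "y \<in> {0..1}"
  shows "\<eta> * integral {s..t} (\<lambda>r. u r y) = prim (v t) y - prim (v s) y - integral {s..t} (\<lambda>r. \<theta> r y)"
proof -
  have cI: "continuous_on {0..1} (\<lambda>x. integral {s..t} (\<lambda>r. \<tau> r x - mean (\<tau> r)))"
    using assms by (intro cont_time_integral jc_intros cont)
  have cv: "continuous_on {0..1} (v r)" if "0 \<le> r" for r using jc_slice[OF jc_v that] .
  have cD: "continuous_on {0..1} (D s t)"
    unfolding D_def[abs_def] using assms pos by (intro continuous_intros cv cI) auto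
  have "(D s t has_integral (integral {s..t} (\<lambda>r. u r y) - integral {s..t} (\<lambda>r. u r 0))) {0..y}"
    by (rule fundamental_theorem_of_calculus)
      (use assms in \<open>auto simp: has_real_derivative_iff_has_vector_derivative[symmetric] intro!: has_field_derivative_subset[OF flow_u']\<close>)
  moreover have "integral {s..t} (\<lambda>r. u r 0) = integral {s..t} (\<lambda>r::real. 0)"
    by (rule Henstock_Kurzweil_Integration.integral_cong) (use u_bdry assms in auto)
  ultimately have "integral {s..t} (\<lambda>r. u r y) = prim (D s t) y" by (simp add: prim_def integral_unique)
  also have "prim (D s t) y = (prim (v t) y - prim (v s) y - prim (\<lambda>x. integral {s..t} (\<lambda>r. \<tau> r x - mean (\<tau> r))) y) / \<eta>"
  proof -
    have sub: "continuous_on {0..y} f" if "continuous_on {0..1} f" for f :: "real \<Rightarrow> real"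
      using assms by (intro continuous_on_subset[OF that]) auto
    show ?thesis unfolding prim_def D_def[abs_def]
      by (intro integral_unique has_integral_divide has_integral_diff integrable_integral integrable_continuous_real sub cv cI)
         (use assms in auto)
  qed
  also have "prim (\<lambda>x. integral {s..t} (\<lambda>r. \<tau> r x - mean (\<tau> r))) y = integral {s..t} (\<lambda>r. prim (\<lambda>x. \<tau> r x - mean (\<tau> r)) y)"
    using assms by (intro prim_time_integral jc_intros cont)
  also have "\<dots> = integral {s..t} (\<lambda>r. \<theta> r y)"
    by (rule Henstock_Kurzweil_Integration.integral_cong)
       (use assms in \<open>auto simp: \<theta>_def intro!: prim_minus_mean jc_slice cont\<close>)
  finally show ?thesis using pos by simp
qed

lemma prim_flow_\<tau>:
  assumes "0 \<le> s" "s \<le> t" "y \<in> {0..1}"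
  shows "lam * (prim (\<tau> t) y - prim (\<tau> s) y) = G * integral {s..t} (\<lambda>r. u r y) - integral {s..t} (\<lambda>r. prim (g r) y)"
proof -
  have sub: "continuous_on {0..y} f" if "continuous_on {0..1} f" for f :: "real \<Rightarrow> real"
    using assms by (intro continuous_on_subset[OF that]) auto
  have d: "(D s t has_integral (integral {s..t} (\<lambda>r. u r y) - integral {s..t} (\<lambda>r. u r 0))) {0..y}"
    by (rule fundamental_theorem_of_calculus)
      (use assms in \<open>auto simp: has_real_derivative_iff_has_vector_derivative[symmetric] intro!: has_field_derivative_subset[OF flow_u']\<close>)
  moreover have "integral {s..t} (\<lambda>r. u r 0) = integral {s..t} (\<lambda>r::real. 0)"
    by (rule Henstock_Kurzweil_Integration.integral_cong) (use u_bdry assms in auto)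
  ultimately have d: "(D s t has_integral (integral {s..t} (\<lambda>r. u r y))) {0..y}" by simp
  have "integral {0..y} (\<lambda>x. lam * (\<tau> t x - \<tau> s x)) = integral {0..y} (\<lambda>x. G * D s t x - integral {s..t} (\<lambda>r. g r x))"
    by (rule Henstock_Kurzweil_Integration.integral_cong) (use assms flow_\<tau>' in auto)
  also have "\<dots> = G * integral {s..t} (\<lambda>r. u r y) - prim (\<lambda>x. integral {s..t} (\<lambda>r. g r x)) y"
    unfolding prim_def
    by (intro integral_unique has_integral_diff has_integral_mult_right d integrable_integral integrable_continuous_real sub cont_time_integral cont assms)
  also have "integral {0..y} (\<lambda>x. lam * (\<tau> t x - \<tau> s x)) = lam * (prim (\<tau> t) y - prim (\<tau> s) y)"
    unfolding prim_def
    by (intro integral_unique has_integral_diff has_integral_mult_right integrable_integral integrable_continuous_real sub jc_slice cont)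
       (use assms in auto)
  also have "prim (\<lambda>x. integral {s..t} (\<lambda>r. g r x)) y = integral {s..t} (\<lambda>r. prim (g r) y)"
    using assms by (intro prim_time_integral cont)
  finally show ?thesis .
qed

lemma flow_mean_\<tau>:
  assumes "0 \<le> s" "s \<le> t"
  shows "lam * (mean (\<tau> t) - mean (\<tau> s)) = - integral {s..t} (\<lambda>r. mean (g r))"
proof -
  have "integral {s..t} (\<lambda>r. u r 1) = integral {s..t} (\<lambda>r::real. 0)"
    by (rule Henstock_Kurzweil_Integration.integral_cong) (use u_bdry assms in auto)
  then show ?thesis using prim_flow_\<tau>[OF assms, of 1] by (simp add: prim_1)
qed

lemma flow_\<theta>:
  assumes "0 \<le> s" "s \<le> t" "y \<in> {0..1}"
  shows "lam * (\<theta> t y - \<theta> s y) = G * integral {s..t} (\<lambda>r. u r y) - integral {s..t} (\<lambda>r. R r y)"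
proof -
  have "integral {s..t} (\<lambda>r. R r y) = integral {s..t} (\<lambda>r. prim (g r) y) - y * integral {s..t} (\<lambda>r. mean (g r))"
    unfolding R_def using assms
    by (intro integral_unique has_integral_diff has_integral_mult_right integrable_integral jc_time_integrable[OF jc_prim[OF cont(3)]] cont_time_integrable continuous_on_mean cont)
       auto
  moreover have "y * (lam * (mean (\<tau> t) - mean (\<tau> s))) = y * (- integral {s..t} (\<lambda>r. mean (g r)))"
    by (simp only: flow_mean_\<tau>[OF assms(1,2)])
  ultimately show ?thesis using prim_flow_\<tau>[OF assms]
    by (simp add: \<theta>_def algebra_simps)
qed

text \<open>The same energy for the primitives: \<open>v\<close> and \<open>\<rho> \<theta>\<close> solve the system with force \<open>\<rho> R\<close>, now with
  mean zero and vanishing potential in place of the boundary condition. It is the dissipation of \<open>v\<close>, and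
  not of \<open>u\<close>, that has to absorb the source \<open>v\<close> in the equation of \<open>w\<close>.\<close>

lemma energy_v_\<theta>:
  assumes st: "0 \<le> s" "s \<le> t"
  shows "mean (\<lambda>y. (G * \<rho> * (v t y)\<^sup>2 + lam * (\<rho> * \<theta> t y)\<^sup>2) / 2) - mean (\<lambda>y. (G * \<rho> * (v s y)\<^sup>2 + lam * (\<rho> * \<theta> s y)\<^sup>2) / 2)
    \<le> integral {s..t} (\<lambda>r. - mean (\<lambda>y. G * \<eta> * (v r y)\<^sup>2 + (\<rho> * R r y) * (\<rho> * \<theta> r y)))"
proof -
  have cv: "continuous_on {0..1} (v r)" if "0 \<le> r" for r using jc_slice[OF jc_v that] .
  have key: "(\<rho> * prim (v t) y - \<rho> * prim (v s) y - integral {s..t} (\<lambda>r. \<rho> * \<theta> r y)) / \<eta> = \<rho> * integral {s..t} (\<lambda>r. u r y)"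
    if "0 \<le> s" "s \<le> t" "y \<in> {0..1}" for s t y
  proof -
    have "\<rho> * prim (v t) y - \<rho> * prim (v s) y - integral {s..t} (\<lambda>r. \<rho> * \<theta> r y)
        = \<rho> * (prim (v t) y - prim (v s) y - integral {s..t} (\<lambda>r. \<theta> r y))"
      by (simp add: algebra_simps)
    also have "\<dots> = \<rho> * (\<eta> * integral {s..t} (\<lambda>r. u r y))" by (simp only: flow_v[OF that])
    finally show ?thesis using pos by simp
  qed
  show ?thesis unfolding mean_def
  proof (rule energy_inequality[OF pos, where P="\<lambda>t y. \<rho> * prim (v t) y" and a=v and b="\<lambda>t y. \<rho> * \<theta> t y" and g="\<lambda>t y. \<rho> * R t y"])
    show "jc v" "jc (\<lambda>t y. \<rho> * \<theta> t y)" "jc (\<lambda>t y. \<rho> * R t y)" "jc (\<lambda>t y. \<rho> * prim (v t) y)"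
      by (intro jc_intros jc_v jc_\<theta> jc_R)+
    show "((\<lambda>y. \<rho> * prim (v t) y) has_real_derivative \<rho> * v t y) (at y within {0..1})"
      if "0 \<le> t" "y \<in> {0..1}" for t y
      using that by (intro DERIV_cmult prim_deriv cv)
    show "((\<lambda>y. integral {s..t} (\<lambda>r. v r y)) has_real_derivative
        (\<rho> * prim (v t) y - \<rho> * prim (v s) y - integral {s..t} (\<lambda>r. \<rho> * \<theta> r y)) / \<eta>) (at y within {0..1})"
      if "0 \<le> s" "s \<le> t" "y \<in> {0..1}" for s t y
    proof -
      have "((\<lambda>y. integral (cbox s t) (\<lambda>r. v r y)) has_real_derivative integral (cbox s t) (\<lambda>r. \<rho> * u r y)) (at y within {0..1})"
      proof (rule leibniz_rule_field_derivative)
        fix x r :: real assume "x \<in> {0..1}" "r \<in> cbox s t"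
        then show "((\<lambda>x. v r x) has_real_derivative \<rho> * u r x) (at x within {0..1})"
          using that by (intro v_deriv) auto
      next
        fix x :: real assume "x \<in> {0..1}"
        then show "(\<lambda>r. v r x) integrable_on cbox s t"
          using jc_time_integrable[OF jc_v, of s x t] that by simp
      next
        show "continuous_on ({0..1} \<times> cbox s t) (\<lambda>(x, r). \<rho> * u r x)"
          unfolding case_prod_unfold using that by (intro continuous_intros jc_comp[OF cont(1)]) auto
      qed (use that in auto)
      then show ?thesis using key[OF that] by simp
    qed
    show "lam * (\<rho> * \<theta> t y - \<rho> * \<theta> s y) =
        G * ((\<rho> * prim (v t) y - \<rho> * prim (v s) y - integral {s..t} (\<lambda>r. \<rho> * \<theta> r y)) / \<eta>) - integral {s..t} (\<lambda>r. \<rho> * R r y)"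
      if "0 \<le> s" "s \<le> t" "y \<in> {0..1}" for s t y
    proof -
      have "lam * (\<rho> * \<theta> t y - \<rho> * \<theta> s y) = \<rho> * (lam * (\<theta> t y - \<theta> s y))" by (simp add: algebra_simps)
      also have "\<dots> = \<rho> * (G * integral {s..t} (\<lambda>r. u r y) - integral {s..t} (\<lambda>r. R r y))"
        by (simp only: flow_\<theta>[OF that])
      also have "\<dots> = G * (\<rho> * integral {s..t} (\<lambda>r. u r y)) - integral {s..t} (\<lambda>r. \<rho> * R r y)"
        by (simp add: algebra_simps)
      finally show ?thesis by (simp only: key[OF that])
    qed
    show "(\<forall>t\<ge>0. v t 0 = 0 \<and> v t 1 = 0) \<or> (\<forall>t\<ge>0. \<rho> * prim (v t) 0 = 0 \<and> \<rho> * prim (v t) 1 = 0)"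
      using mean_v by (simp add: prim_1)
    show "(\<forall>t\<ge>0. v t 0 = 0) \<or> (\<forall>t\<ge>0. integral {0..1} (v t) = 0)"
      using mean_v by (simp add: mean_def)
  qed (use st in auto)
qed

text \<open>This is a pointwise ordinary differential equation in time, with damping \<open>c\<close>.\<close>

lemma w_increment:
  assumes st: "0 \<le> s" "s \<le> t" "y \<in> {0..1}"
  shows "w t y - w s y = integral {s..t} (\<lambda>r. - c * w r y - c\<^sup>2 * v r y - (g r y - mean (g r)) / lam)"
proof -
  let ?T = "integral {s..t} (\<lambda>r. \<tau> r y - mean (\<tau> r))" and ?g = "integral {s..t} (\<lambda>r. g r y - mean (g r))"
  have iT: "(\<lambda>r. \<tau> r y - mean (\<tau> r)) integrable_on {s..t}" and ig: "(\<lambda>r. g r y - mean (g r)) integrable_on {s..t}"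
    by (rule jc_time_integrable; use st in \<open>auto intro!: jc_intros cont\<close>)+
  have "?g = integral {s..t} (\<lambda>r. g r y) - integral {s..t} (\<lambda>r. mean (g r))"
    using st by (intro Henstock_Kurzweil_Integration.integral_diff jc_time_integrable cont_time_integrable continuous_on_mean cont) auto
  then have e: "lam * (\<tau> t y - \<tau> s y) - lam * (mean (\<tau> t) - mean (\<tau> s)) = G * D s t y - ?g"
    using flow_\<tau>'[OF st] flow_mean_\<tau>[OF st(1,2)] by simp
  have "integral {s..t} (\<lambda>r. - c * w r y - c\<^sup>2 * v r y - (g r y - mean (g r)) / lam)
     = integral {s..t} (\<lambda>r. - c * (\<tau> r y - mean (\<tau> r)) - (g r y - mean (g r)) / lam)"
    by (rule Henstock_Kurzweil_Integration.integral_cong) (simp add: w_def algebra_simps power2_eq_square)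
  also have "\<dots> = - c * ?T - ?g / lam"
    by (intro integral_unique has_integral_diff has_integral_mult_right has_integral_divide integrable_integral iT ig)
  also have "\<dots> = w t y - w s y"
  proof -
    have GD: "G * D s t y = lam * (c * (v t y - v s y - ?T))"
      using pos by (simp add: D_def c_def)
    have "lam * (w t y - w s y) = (lam * (\<tau> t y - \<tau> s y) - lam * (mean (\<tau> t) - mean (\<tau> s))) - lam * c * (v t y - v s y)"
      by (simp add: w_def algebra_simps)
    also have "\<dots> = lam * (- c * ?T - ?g / lam)" unfolding e GD using pos by (simp add: algebra_simps)
    finally show ?thesis using pos by simp
  qed
  finally show ?thesis by simp
qed

end

section \<open>A Lyapunov functional for the fast variables\<close>

text \<open>Bookkeeping for the pointwise estimate in \<open>F_decay\<close>: with the products abstracted to variables the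
  step is linear.\<close>

lemma sum_bound_aux:
  fixes a b x x' y y' z q L H :: real
  assumes "a \<le> x - y + z" "b \<le> q" "L = - 2 * x + b" "H = a" "y' = - y" "x' = - x"
  shows "L + H \<le> x' + 1 * (y' + z) + q"
  using assms by simp

context linear_flow begin

text \<open>The constants are chosen backwards. Young's inequality for \<open>w w'\<close> leaves the term \<open>c\<^sup>3 v\<^sup>2\<close>, and
  \<open>A\<close> makes the dissipation of \<open>A\<close> times the energy twice as large. The cross term of \<open>R\<close> and \<open>\<theta>\<close> is split such
  that at most half of the remaining damping is lost. \<open>k3\<close> and \<open>K2\<close> compare \<open>F\<close> with \<open>X\<close>.\<close>

definition A where "A = 2 * c ^ 3 / (G * \<eta>)"
definition K1 where "K1 = 1 / (c * lam\<^sup>2) + 2 * A\<^sup>2 * \<rho> ^ 4 / c"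
definition K2 where "K2 = A * G * \<rho> / 2 + A * lam * \<rho>\<^sup>2 * (1 + c\<^sup>2) + 1 / 2"
definition k3 where "k3 = min (A * G * \<rho> / 2) (1 / 2)"
definition \<delta> where "\<delta> = min (3 * c ^ 3 / 4) (c / 4) / K2"
definition F where "F t = A * mean (\<lambda>y. (G * \<rho> * (v t y)\<^sup>2 + lam * (\<rho> * \<theta> t y)\<^sup>2) / 2) + mean (\<lambda>y. (w t y)\<^sup>2) / 2"
definition X where "X t = mean (\<lambda>y. (v t y)\<^sup>2) + mean (\<lambda>y. (w t y)\<^sup>2)"

lemma consts_pos: "A > 0" "K1 > 0" "K2 > 0" "k3 > 0" "\<delta> > 0"
proof -
  note p = pos c_pos
  show A: "A > 0" using p by (simp add: A_def)
  show "K1 > 0" unfolding K1_def using p A by (intro add_pos_nonneg) auto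
  show K2: "K2 > 0" unfolding K2_def using p A by (intro add_pos_pos add_nonneg_pos) (auto intro!: mult_nonneg_nonneg)
  show "k3 > 0" "\<delta> > 0" using p A K2 by (auto simp: k3_def \<delta>_def)
qed

text \<open>\<open>\<theta>\<close> is a primitive of \<open>\<tau> - mean \<tau> = w + c v\<close>.\<close>

lemma \<theta>_square_le:
  assumes "0 \<le> t" "y \<in> {0..1}"
  shows "(\<theta> t y)\<^sup>2 \<le> 2 * mean (\<lambda>y. (w t y)\<^sup>2) + 2 * c\<^sup>2 * mean (\<lambda>y. (v t y)\<^sup>2)"
proof -
  have cs: "continuous_on {0..1} (w t)" "continuous_on {0..1} (v t)" "continuous_on {0..1} (\<tau> t)"
    using jc_slice jc_w jc_v cont assms by auto
  have "\<theta> t y = prim (\<lambda>x. \<tau> t x - mean (\<tau> t)) y"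
    using prim_minus_mean[OF cs(3) assms(2)] by (simp add: \<theta>_def)
  then have "(\<theta> t y)\<^sup>2 \<le> mean (\<lambda>x. (\<tau> t x - mean (\<tau> t))\<^sup>2)"
    using prim_square_le[of "\<lambda>x. \<tau> t x - mean (\<tau> t)" y] assms cs by (simp add: continuous_intros)
  also have "\<dots> \<le> mean (\<lambda>y. 2 * (w t y)\<^sup>2 + (2 * c\<^sup>2) * (v t y)\<^sup>2)"
  proof (rule mean_mono)
    fix x
    have "2 * (w t x)\<^sup>2 + (2 * c\<^sup>2) * (v t x)\<^sup>2 - (\<tau> t x - mean (\<tau> t))\<^sup>2 = (w t x - c * v t x)\<^sup>2"
      by (simp add: w_def power2_eq_square algebra_simps)
    then show "(\<tau> t x - mean (\<tau> t))\<^sup>2 \<le> 2 * (w t x)\<^sup>2 + (2 * c\<^sup>2) * (v t x)\<^sup>2"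
      using zero_le_power2[of "w t x - c * v t x"] by linarith
  qed (intro continuous_intros cs)+
  also have "\<dots> = 2 * mean (\<lambda>y. (w t y)\<^sup>2) + 2 * c\<^sup>2 * mean (\<lambda>y. (v t y)\<^sup>2)"
    by (intro mean_lin continuous_intros cs)
  finally show ?thesis .
qed

lemma R_square_le:
  assumes "0 \<le> t" "y \<in> {0..1}"
  shows "(R t y)\<^sup>2 \<le> mean (\<lambda>y. (g t y)\<^sup>2)"
proof -
  have cg: "continuous_on {0..1} (g t)" using jc_slice cont assms by auto
  have "(R t y)\<^sup>2 = (prim (\<lambda>x. g t x - mean (g t)) y)\<^sup>2"
    using prim_minus_mean[OF cg assms(2)] by (simp add: R_def)
  also have "\<dots> \<le> mean (\<lambda>x. (g t x - mean (g t))\<^sup>2)"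
    by (intro prim_square_le continuous_intros cg assms)
  also have "\<dots> \<le> mean (\<lambda>y. (g t y)\<^sup>2)" by (rule mean_square_centered_le[OF cg])
  finally show ?thesis .
qed

lemma F_bounds:
  assumes t: "0 \<le> t"
  shows "k3 * X t \<le> F t" "F t \<le> K2 * X t"
proof -
  have cs: "continuous_on {0..1} (w t)" "continuous_on {0..1} (v t)" "continuous_on {0..1} (\<theta> t)"
    using jc_slice jc_w jc_v jc_\<theta> t by auto
  define V W \<Theta> where "V = mean (\<lambda>y. (v t y)\<^sup>2)" and "W = mean (\<lambda>y. (w t y)\<^sup>2)" and "\<Theta> = mean (\<lambda>y. (\<theta> t y)\<^sup>2)"
  have nn: "0 \<le> V" "0 \<le> W" "0 \<le> \<Theta>"
    unfolding V_def W_def \<Theta>_def mean_def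
    by (intro Henstock_Kurzweil_Integration.integral_nonneg integrable_continuous_real continuous_intros cs; simp)+
  have "mean (\<lambda>y. (G * \<rho> * (v t y)\<^sup>2 + lam * (\<rho> * \<theta> t y)\<^sup>2) / 2) = mean (\<lambda>y. (G * \<rho> / 2) * (v t y)\<^sup>2 + (lam * \<rho>\<^sup>2 / 2) * (\<theta> t y)\<^sup>2)"
    by (rule mean_cong) (simp add: power_mult_distrib add_divide_distrib)
  also have "\<dots> = (G * \<rho> / 2) * V + (lam * \<rho>\<^sup>2 / 2) * \<Theta>"
    unfolding V_def \<Theta>_def by (intro mean_lin continuous_intros cs)
  finally have F: "F t = A * ((G * \<rho> / 2) * V + (lam * \<rho>\<^sup>2 / 2) * \<Theta>) + W / 2"
    by (simp add: F_def W_def)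
  have Xe: "X t = V + W" by (simp add: X_def V_def W_def)
  have "k3 * X t = k3 * V + k3 * W" by (simp add: Xe algebra_simps)
  also have "\<dots> \<le> (A * G * \<rho> / 2) * V + (1/2) * W"
    using nn by (intro add_mono mult_right_mono) (auto simp: k3_def)
  also have "\<dots> \<le> F t" unfolding F using nn pos consts_pos(1) by (simp add: algebra_simps)
  finally show "k3 * X t \<le> F t" .
  have "\<Theta> \<le> mean (\<lambda>y. 2 * W + 2 * c\<^sup>2 * V)"
    unfolding \<Theta>_def by (rule mean_mono) (use \<theta>_square_le[OF t] in \<open>auto simp: V_def W_def intro!: continuous_intros cs\<close>)
  then have \<Theta>: "\<Theta> \<le> 2 * W + 2 * c\<^sup>2 * V" by simp
  have "F t \<le> A * ((G * \<rho> / 2) * V + (lam * \<rho>\<^sup>2 / 2) * (2 * W + 2 * c\<^sup>2 * V)) + W / 2"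
    unfolding F using nn pos consts_pos(1) \<Theta> by (intro add_mono mult_left_mono) auto
  also have "\<dots> = (A * G * \<rho> / 2 + A * lam * \<rho>\<^sup>2 * c\<^sup>2) * V + (A * lam * \<rho>\<^sup>2 + 1 / 2) * W"
    by (simp add: algebra_simps)
  also have "\<dots> \<le> K2 * V + K2 * W"
    using nn pos consts_pos(1) by (intro add_mono mult_right_mono) (auto simp: K2_def algebra_simps)
  finally show "F t \<le> K2 * X t" by (simp add: Xe algebra_simps)
qed

lemma F_cont: "continuous_on {0..} F"
proof -
  have "jc (\<lambda>t y. (G * \<rho> * (v t y)\<^sup>2 + lam * (\<rho> * \<theta> t y)\<^sup>2) / 2)" "jc (\<lambda>t y. (w t y)\<^sup>2)"
    by (intro jc_intros jc_v jc_\<theta> jc_w)+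
  then show ?thesis unfolding F_def[abs_def] by (intro continuous_intros continuous_on_mean) auto
qed

text \<open>The energy of \<open>(v, \<theta>)\<close> dissipates \<open>v\<close> but not \<open>\<theta>\<close>, and the equation of \<open>w\<close> damps \<open>w\<close> at the price
  of a source \<open>v\<close>. Together they damp both, and with them \<open>\<theta>\<close>, which \<open>v\<close> and \<open>w\<close> control.\<close>

lemma F_decay:
  assumes st: "0 \<le> s" "s \<le> t"
  shows "F t - F s \<le> integral {s..t} (\<lambda>r. K1 * mean (\<lambda>y. (g r y)\<^sup>2) - \<delta> * F r)"
proof -
  define k where "k r y = - c * w r y - c\<^sup>2 * v r y - (g r y - mean (g r)) / lam" for r y
  have jk: "jc k" unfolding k_def by (intro jc_intros jc_w jc_v cont)
  define f1 where "f1 r = - mean (\<lambda>y. G * \<eta> * (v r y)\<^sup>2 + (\<rho> * R r y) * (\<rho> * \<theta> r y))" for r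
  define f2 where "f2 r = mean (\<lambda>y. 2 * (w r y * k r y))" for r
  have i12: "f1 integrable_on {s..t}" "f2 integrable_on {s..t}"
    unfolding f1_def f2_def using st jk
    by (intro cont_time_integrable continuous_intros continuous_on_mean jc_intros jc_v jc_R jc_\<theta> jc_w; simp)+
  have cg: "continuous_on {0..} (\<lambda>r. mean (\<lambda>y. (g r y)\<^sup>2))" by (intro continuous_on_mean jc_intros cont)
  have W: "mean (\<lambda>y. (w t y)\<^sup>2) - mean (\<lambda>y. (w s y)\<^sup>2) = integral {s..t} f2"
    unfolding f2_def by (rule mean_square_increment[OF jc_w jk _ st]) (simp add: k_def w_increment)
  have E: "mean (\<lambda>y. (G * \<rho> * (v t y)\<^sup>2 + lam * (\<rho> * \<theta> t y)\<^sup>2) / 2) - mean (\<lambda>y. (G * \<rho> * (v s y)\<^sup>2 + lam * (\<rho> * \<theta> s y)\<^sup>2) / 2)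
    \<le> integral {s..t} f1"
    unfolding f1_def by (rule energy_v_\<theta>[OF st])
  have "F t - F s \<le> A * integral {s..t} f1 + integral {s..t} f2 / 2"
    using mult_left_mono[OF E less_imp_le[OF consts_pos(1)]] W unfolding F_def right_diff_distrib by linarith
  also have "\<dots> = integral {s..t} (\<lambda>r. A * f1 r + f2 r / 2)"
    by (rule integral_unique[symmetric]) (intro has_integral_add has_integral_mult_right has_integral_divide integrable_integral i12)
  also have "\<dots> \<le> integral {s..t} (\<lambda>r. K1 * mean (\<lambda>y. (g r y)\<^sup>2) - \<delta> * F r)"
  proof (rule integral_le)
    show "(\<lambda>r. A * f1 r + f2 r / 2) integrable_on {s..t}"
      by (intro integrable_add integrable_on_mult_right integrable_on_divide i12)
    show "(\<lambda>r. K1 * mean (\<lambda>y. (g r y)\<^sup>2) - \<delta> * F r) integrable_on {s..t}"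
      using st by (intro cont_time_integrable continuous_intros cg F_cont)
    fix r assume "r \<in> {s..t}"
    then have r: "0 \<le> r" using st by auto
    have cs: "continuous_on {0..1} (w r)" "continuous_on {0..1} (v r)" "continuous_on {0..1} (\<theta> r)"
        "continuous_on {0..1} (R r)" "continuous_on {0..1} (g r)" "continuous_on {0..1} (k r)"
      using jc_slice jc_w jc_v jc_\<theta> jc_R cont jk r by auto
    define V W \<gamma> where "V = mean (\<lambda>y. (v r y)\<^sup>2)" and "W = mean (\<lambda>y. (w r y)\<^sup>2)" and "\<gamma> = mean (\<lambda>y. (g r y)\<^sup>2)"
    have nn: "0 \<le> V" "0 \<le> W" "0 \<le> \<gamma>"
      unfolding V_def W_def \<gamma>_def mean_def
      by (intro Henstock_Kurzweil_Integration.integral_nonneg integrable_continuous_real continuous_intros cs; simp)+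
    have "A * f1 r + f2 r / 2 = mean (\<lambda>y. (- A) * (G * \<eta> * (v r y)\<^sup>2 + (\<rho> * R r y) * (\<rho> * \<theta> r y)) + (1/2) * (2 * (w r y * k r y)))"
      unfolding f1_def f2_def by (subst mean_lin) (auto intro!: continuous_intros cs)
    also have "\<dots> \<le> mean (\<lambda>y. (- (c ^ 3)) * (v r y)\<^sup>2 + 1 * ((- c / 2) * (w r y)\<^sup>2 + (1 / (c * lam\<^sup>2)) * (g r y - mean (g r))\<^sup>2)
        + (c / 8 * (2 * W + 2 * c\<^sup>2 * V) + 2 * A\<^sup>2 * \<rho> ^ 4 / c * \<gamma>))"
    proof (rule mean_mono)
      fix y :: real assume y: "y \<in> {0..1}"
      have AG: "A * (G * \<eta>) = 2 * c ^ 3" using pos by (simp add: A_def)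
      have w: "w r y * k r y \<le> c ^ 3 * (v r y)\<^sup>2 - c / 2 * (w r y)\<^sup>2 + (1 / (c * lam\<^sup>2)) * (g r y - mean (g r))\<^sup>2"
      proof -
        define q where "q = g r y - mean (g r)"
        \<comment> \<open>Young's inequality twice: completion to two squares\<close>
        have "c ^ 3 * (v r y)\<^sup>2 - c / 2 * (w r y)\<^sup>2 + (1 / (c * lam\<^sup>2)) * q\<^sup>2 - w r y * k r y
          = (c / 4) * (w r y + 2 * c * v r y)\<^sup>2 + (c / 4) * (w r y + 2 * q / (c * lam))\<^sup>2"
          unfolding k_def q_def[symmetric] using pos c_pos by (simp add: field_simps power2_eq_square power3_eq_cube)
        then show ?thesis unfolding q_def
          using c_pos zero_le_power2[of "w r y + 2 * c * v r y"] zero_le_power2[of "w r y + 2 * (g r y - mean (g r)) / (c * lam)"]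
          by (smt (verit) mult_nonneg_nonneg divide_nonneg_pos)
      qed
      have th: "- A * ((\<rho> * R r y) * (\<rho> * \<theta> r y)) \<le> c / 8 * (2 * W + 2 * c\<^sup>2 * V) + 2 * A\<^sup>2 * \<rho> ^ 4 / c * \<gamma>"
      proof -
        have "c / 8 * (\<theta> r y)\<^sup>2 + 2 * A\<^sup>2 * \<rho> ^ 4 / c * (R r y)\<^sup>2 + A * ((\<rho> * R r y) * (\<rho> * \<theta> r y))
          = (c / 8) * (\<theta> r y + 4 * A * \<rho>\<^sup>2 / c * R r y)\<^sup>2"
          using c_pos by (simp add: field_simps power2_eq_square power4_eq_xxxx)
        also have "\<dots> \<ge> 0" using c_pos by simp
        finally have "- A * ((\<rho> * R r y) * (\<rho> * \<theta> r y)) \<le> c / 8 * (\<theta> r y)\<^sup>2 + 2 * A\<^sup>2 * \<rho> ^ 4 / c * (R r y)\<^sup>2" by simp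
        also have "\<dots> \<le> c / 8 * (2 * W + 2 * c\<^sup>2 * V) + 2 * A\<^sup>2 * \<rho> ^ 4 / c * \<gamma>"
          using \<theta>_square_le[OF r y] R_square_le[OF r y] c_pos pos
          by (intro add_mono mult_left_mono) (auto simp: V_def W_def \<gamma>_def)
        finally show ?thesis .
      qed
      have l: "(- A) * (G * \<eta> * (v r y)\<^sup>2 + (\<rho> * R r y) * (\<rho> * \<theta> r y))
          = - 2 * (c ^ 3 * (v r y)\<^sup>2) + - A * ((\<rho> * R r y) * (\<rho> * \<theta> r y))"
      proof -
        have "(- A) * (G * \<eta> * (v r y)\<^sup>2 + (\<rho> * R r y) * (\<rho> * \<theta> r y)) = - (A * (G * \<eta>)) * (v r y)\<^sup>2 + - A * ((\<rho> * R r y) * (\<rho> * \<theta> r y))"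
          by (simp only: distrib_left mult_minus_left mult.assoc)
        then show ?thesis unfolding AG by (simp only: mult_minus_left mult.assoc)
      qed
      have "(1/2) * (2 * (w r y * k r y)) = w r y * k r y" by simp
      moreover have "(- c / 2) * (w r y)\<^sup>2 = - (c / 2 * (w r y)\<^sup>2)" by simp
      moreover have "(- (c ^ 3)) * (v r y)\<^sup>2 = - (c ^ 3 * (v r y)\<^sup>2)" by simp
      ultimately show "(- A) * (G * \<eta> * (v r y)\<^sup>2 + (\<rho> * R r y) * (\<rho> * \<theta> r y)) + (1/2) * (2 * (w r y * k r y))
        \<le> (- (c ^ 3)) * (v r y)\<^sup>2 + 1 * ((- c / 2) * (w r y)\<^sup>2 + (1 / (c * lam\<^sup>2)) * (g r y - mean (g r))\<^sup>2)
        + (c / 8 * (2 * W + 2 * c\<^sup>2 * V) + 2 * A\<^sup>2 * \<rho> ^ 4 / c * \<gamma>)"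
        by (rule sum_bound_aux[OF w th l])
    qed (intro continuous_intros cs)+
    also have "\<dots> = ((- (c ^ 3)) * V + 1 * ((- c / 2) * W + (1 / (c * lam\<^sup>2)) * mean (\<lambda>y. (g r y - mean (g r))\<^sup>2)))
        + (c / 8 * (2 * W + 2 * c\<^sup>2 * V) + 2 * A\<^sup>2 * \<rho> ^ 4 / c * \<gamma>)"
    proof -
      let ?k = "c / 8 * (2 * W + 2 * c\<^sup>2 * V) + 2 * A\<^sup>2 * \<rho> ^ 4 / c * \<gamma>"
      let ?h = "\<lambda>y. (- c / 2) * (w r y)\<^sup>2 + (1 / (c * lam\<^sup>2)) * (g r y - mean (g r))\<^sup>2"
      have ch: "continuous_on {0..1} ?h" by (intro continuous_intros cs)
      have "mean (\<lambda>y. 1 * ((- (c ^ 3)) * (v r y)\<^sup>2 + 1 * ?h y) + ?k * 1) = 1 * mean (\<lambda>y. (- (c ^ 3)) * (v r y)\<^sup>2 + 1 * ?h y) + ?k * mean (\<lambda>_. 1)"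
        by (intro mean_lin continuous_intros cs)
      also have "mean (\<lambda>y. (- (c ^ 3)) * (v r y)\<^sup>2 + 1 * ?h y) = (- (c ^ 3)) * V + 1 * mean ?h"
        unfolding V_def by (intro mean_lin continuous_intros cs)
      also have "mean ?h = (- c / 2) * W + (1 / (c * lam\<^sup>2)) * mean (\<lambda>y. (g r y - mean (g r))\<^sup>2)"
        unfolding W_def by (intro mean_lin continuous_intros cs)
      finally show ?thesis by simp
    qed
    also have "\<dots> \<le> ((- (c ^ 3)) * V + 1 * ((- c / 2) * W + (1 / (c * lam\<^sup>2)) * \<gamma>))
        + (c / 8 * (2 * W + 2 * c\<^sup>2 * V) + 2 * A\<^sup>2 * \<rho> ^ 4 / c * \<gamma>)"
      using mean_square_centered_le[OF cs(5)] c_pos pos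
      by (intro add_mono mult_left_mono order_refl) (auto simp: \<gamma>_def)
    also have "\<dots> = K1 * \<gamma> - ((3 * c ^ 3 / 4) * V + (c / 4) * W)"
      by (simp add: K1_def algebra_simps power2_eq_square power3_eq_cube)
    also have "\<dots> \<le> K1 * \<gamma> - \<delta> * F r"
    proof -
      have "\<delta> * F r \<le> \<delta> * (K2 * X r)" using F_bounds(2)[OF r] consts_pos by (intro mult_left_mono) auto
      also have "\<dots> = min (3 * c ^ 3 / 4) (c / 4) * V + min (3 * c ^ 3 / 4) (c / 4) * W"
        using consts_pos by (simp add: \<delta>_def X_def V_def W_def algebra_simps)
      also have "\<dots> \<le> (3 * c ^ 3 / 4) * V + (c / 4) * W"
        using nn by (intro add_mono mult_right_mono) auto
      finally show ?thesis by simp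
    qed
    finally show "A * f1 r + f2 r / 2 \<le> K1 * mean (\<lambda>y. (g r y)\<^sup>2) - \<delta> * F r" by (simp add: \<gamma>_def)
  qed
  finally show ?thesis .
qed

end

section \<open>Comparison for integral inequalities\<close>

text \<open>\<open>y' \<le> \<phi> - a y\<close> in integrated form and a differentiable supersolution \<open>Y\<close>. Beyond the last
  time \<open>b'\<close> before \<open>t\<close> at which they agree \<open>y\<close> would exceed \<open>Y\<close>, and since \<open>a \<ge> 0\<close> it would grow no faster.\<close>

lemma comparison:
  fixes y Y Y' a \<phi> :: "real \<Rightarrow> real"
  assumes cy: "continuous_on {b..} y" and ca: "continuous_on {b..} a" and cf: "continuous_on {b..} \<phi>"
    and a0: "\<And>t. b \<le> t \<Longrightarrow> 0 \<le> a t"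
    and sub: "\<And>s t. b \<le> s \<Longrightarrow> s \<le> t \<Longrightarrow> y t - y s \<le> integral {s..t} (\<lambda>r. \<phi> r - a r * y r)"
    and dY: "\<And>t. b \<le> t \<Longrightarrow> (Y has_real_derivative Y' t) (at t within {b..})"
    and super: "\<And>t. b \<le> t \<Longrightarrow> \<phi> t - a t * Y t \<le> Y' t"
    and init: "y b \<le> Y b" and t: "b \<le> t"
  shows "y t \<le> Y t"
proof (rule ccontr)
  assume n: "\<not> y t \<le> Y t"
  have cY: "continuous_on {b..} Y" using dY by (meson DERIV_continuous_on atLeast_iff)
  let ?D = "\<lambda>r. y r - Y r"
  have cD: "continuous_on S ?D" if "S \<subseteq> {b..}" for S
    using that by (intro continuous_intros continuous_on_subset[OF cy] continuous_on_subset[OF cY])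
  let ?Z = "{r \<in> {b..t}. ?D r = 0}"
  have "compact ?Z"
  proof -
    have "closed ?Z" using continuous_closed_preimage_constant[OF cD[of "{b..t}"], of 0] by auto
    then show ?thesis using compact_Int_closed[of "{b..t}" ?Z] by (simp add: Int_absorb1 subset_iff) 
  qed
  moreover have "?Z \<noteq> {}"
  proof -
    have "\<exists>r. b \<le> r \<and> r \<le> t \<and> ?D r = 0"
      using n init t by (intro IVT' cD) auto
    then show ?thesis by auto
  qed
  ultimately obtain b' where b': "b' \<in> ?Z" "\<And>r. r \<in> ?Z \<Longrightarrow> r \<le> b'"
    using compact_attains_sup[of ?Z] by blast
  have st: "b \<le> b'" "b' \<le> t" "y b' = Y b'" using b' by auto
  have pos: "?D r \<ge> 0" if r: "b' \<le> r" "r \<le> t" for r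
  proof (rule ccontr)
    assume "\<not> ?D r \<ge> 0"
    then have "\<exists>q. r \<le> q \<and> q \<le> t \<and> ?D q = 0"
      using n r st by (intro IVT' cD) auto
    then obtain q where q: "r \<le> q" "q \<le> t" "?D q = 0" by blast
    then have "q \<le> b'" using r st by (intro b'(2)) auto
    then have "q = r" using q r by simp
    then show False using q \<open>\<not> ?D r \<ge> 0\<close> by simp
  qed
  have iY: "(Y' has_integral (Y t - Y b')) {b'..t}"
  proof (rule fundamental_theorem_of_calculus[OF st(2)])
    fix x assume x: "x \<in> {b'..t}"
    then have "(Y has_real_derivative Y' x) (at x within {b'..t})"
      by (intro has_field_derivative_subset[OF dY]) (use st in auto)
    then show "(Y has_vector_derivative Y' x) (at x within {b'..t})"
      by (simp only: has_real_derivative_iff_has_vector_derivative)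
  qed
  have iy: "((\<lambda>r. \<phi> r - a r * y r) has_integral integral {b'..t} (\<lambda>r. \<phi> r - a r * y r)) {b'..t}"
    using st by (intro integrable_integral integrable_continuous_real continuous_intros
       continuous_on_subset[OF cy] continuous_on_subset[OF ca] continuous_on_subset[OF cf]) auto
  have "integral {b'..t} (\<lambda>r. \<phi> r - a r * y r) \<le> Y t - Y b'"
  proof (rule has_integral_le[OF iy iY])
    fix r assume r: "r \<in> {b'..t}"
    have "a r * Y r \<le> a r * y r" using pos[of r] a0[of r] r st by (intro mult_left_mono) auto
    then show "\<phi> r - a r * y r \<le> Y' r" using super[of r] r st by auto
  qed
  then show False using sub[OF st(1,2)] st(3) n by auto
qed

text \<open>From time \<open>T\<close> on, the power \<open>(1 + t)\<close> to the \<open>- q\<close> decays at a relative rate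
  of at most \<open>\<delta> / 2\<close>, so the multiple \<open>K\<close> of it is a supersolution.\<close>

lemma exponential_decay_powr:
  fixes F \<gamma> :: "real \<Rightarrow> real"
  assumes cF: "continuous_on {T..} F"
    and sub: "\<And>s t. T \<le> s \<Longrightarrow> s \<le> t \<Longrightarrow> F t - F s \<le> integral {s..t} (\<lambda>r. C * (1 + r) powr (- q) - \<delta> * F r)"
    and T: "0 \<le> T" "2 * q \<le> \<delta> * (1 + T)" and \<delta>: "0 < \<delta>" and q: "0 \<le> q" and K: "2 * C \<le> \<delta> * K" "0 \<le> K"
    and init: "F T \<le> K * (1 + T) powr (- q)" and t: "T \<le> t"
  shows "F t \<le> K * (1 + t) powr (- q)"
proof (rule comparison[where \<phi>="\<lambda>r. C * (1 + r) powr (- q)" and a="\<lambda>_. \<delta>" and y=F and b=T])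
  show "continuous_on {T..} (\<lambda>r. C * (1 + r) powr - q)"
    using T by (intro continuous_intros continuous_on_powr) auto
  show "((\<lambda>t. K * (1 + t) powr - q) has_real_derivative K * (- q * (1 + t) powr (- q - 1))) (at t within {T..})"
    if "T \<le> t" for t
    using that T by (auto intro!: derivative_eq_intros simp: powr_diff field_simps)
  show "C * (1 + t) powr - q - \<delta> * (K * (1 + t) powr - q) \<le> K * (- q * (1 + t) powr (- q - 1))" if t: "T \<le> t" for t
  proof -
    have p: "(1 + t) powr (- q - 1) = (1 + t) powr - q / (1 + t)" using t T by (simp add: powr_diff)
    have "2 * q \<le> \<delta> * (1 + t)" using T t \<delta> by (smt (verit) mult_left_mono)
    then have "q / (1 + t) \<le> \<delta> / 2" using t T by (simp add: field_simps)
    then have "K * (q / (1 + t)) \<le> K * (\<delta> / 2)" using K by (intro mult_left_mono)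
    also have "K * (\<delta> / 2) \<le> \<delta> * K - C" using K by (simp add: mult.commute)
    finally have "C - \<delta> * K \<le> - (K * (q / (1 + t)))" by linarith
    then have "(C - \<delta> * K) * (1 + t) powr - q \<le> - (K * (q / (1 + t))) * (1 + t) powr - q"
      by (intro mult_right_mono) auto
    then show ?thesis unfolding p by (simp add: algebra_simps)
  qed
qed (use assms in \<open>auto intro!: continuous_intros\<close>)

text \<open>The right-hand side solves \<open>Y' = - k / (1 + t) Y\<close> with the same value at \<open>T\<close>.\<close>

lemma algebraic_decay:
  fixes H :: "real \<Rightarrow> real"
  assumes cH: "continuous_on {T..} H" and T: "0 \<le> T" and k: "0 \<le> k"
    and sub: "\<And>s t. T \<le> s \<Longrightarrow> s \<le> t \<Longrightarrow> H t - H s \<le> integral {s..t} (\<lambda>r. - (k / (1 + r) * H r))" and t: "T \<le> t"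
  shows "H t \<le> H T * (1 + T) powr k * (1 + t) powr (- k)"
proof (rule comparison[where b=T and y=H and a="\<lambda>r. k / (1 + r)" and \<phi>="\<lambda>_. 0"
      and Y'="\<lambda>t. H T * (1 + T) powr k * (- k * (1 + t) powr (- k - 1))"])
  show "continuous_on {T..} (\<lambda>r. k / (1 + r))" using T by (intro continuous_intros) auto
  show "((\<lambda>t. H T * (1 + T) powr k * (1 + t) powr - k) has_real_derivative
      H T * (1 + T) powr k * (- k * (1 + t) powr (- k - 1))) (at t within {T..})" if "T \<le> t" for t
    using that T by (auto intro!: derivative_eq_intros simp: powr_diff field_simps)
  show "0 - k / (1 + t) * (H T * (1 + T) powr k * (1 + t) powr - k) \<le> H T * (1 + T) powr k * (- k * (1 + t) powr (- k - 1))"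
    if "T \<le> t" for t
    using that T by (simp add: powr_diff field_simps)
  show "H T \<le> H T * (1 + T) powr k * (1 + T) powr - k"
    using T by (simp add: mult.assoc powr_add[symmetric])
  show "H t - H s \<le> integral {s..t} (\<lambda>r. 0 - k / (1 + r) * H r)" if "T \<le> s" "s \<le> t" for s t
    using sub[OF that] by simp
qed (use T k t cH in \<open>auto intro!: continuous_intros\<close>)

section \<open>The coupled system\<close>

locale aging_flow = linear_flow \<rho> \<eta> lam G u \<tau> "\<lambda>t y. f t y * \<tau> t y"
  for \<rho> \<eta> lam G :: real and u \<tau> f :: "real \<Rightarrow> real \<Rightarrow> real" +
  fixes \<xi> \<nu> :: real
  assumes pos': "\<xi> > 0" "\<nu> > 0" and jc_f: "jc f"
    and flow_f: "\<And>s t y. 0 \<le> s \<Longrightarrow> s \<le> t \<Longrightarrow> y \<in> {0..1} \<Longrightarrow>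
      f t y - f s y = integral {s..t} (\<lambda>r. (- 1 + \<xi> * \<bar>\<tau> r y\<bar>) * (f r y)\<^sup>2 - \<nu> * (f r y) ^ 3)"
    and f0_nonneg: "\<And>y. y \<in> {0..1} \<Longrightarrow> 0 \<le> f 0 y"
    and f0_nonzero: "\<exists>y\<in>{0..1}. f 0 y \<noteq> 0"
begin

text \<open>This is the time derivative of \<open>1 / f\<close>.\<close>

definition rate :: "real \<Rightarrow> real \<Rightarrow> real" where
  "rate t y = 1 - \<xi> * \<bar>\<tau> t y\<bar> + \<nu> * f t y"

lemma jc_rate: "jc rate" unfolding rate_def[abs_def] by (intro jc_intros cont jc_f)

lemma f_deriv:
  assumes "0 \<le> t" "y \<in> {0..1}"
  shows "((\<lambda>t. f t y) has_real_derivative - rate t y * (f t y)\<^sup>2) (at t within {0..})"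
proof (rule increments_imp_DERIV)
  show "continuous_on {0..} (\<lambda>t. - rate t y * (f t y)\<^sup>2)"
    using jc_time[OF jc_mult[OF jc_minus[OF jc_rate] jc_power[OF jc_f]], of y] assms by auto
  show "f t y - f s y = integral {s..t} (\<lambda>t. - rate t y * (f t y)\<^sup>2)" if "0 \<le> s" "s \<le> t" for s t
    unfolding flow_f[OF that assms(2)]
    by (rule Henstock_Kurzweil_Integration.integral_cong) (simp add: rate_def power2_eq_square power3_eq_cube algebra_simps)
qed (use assms in auto)

text \<open>With the coefficient \<open>rate f\<close> regarded as given, \<open>f' = - (rate f) f\<close> is linear. This gives the sign and
  the support of \<open>f\<close> before one can divide by it.\<close>

lemma f_exp:
  assumes "0 \<le> t" "y \<in> {0..1}"
  shows "f t y = f 0 y * exp (- integral {0..t} (\<lambda>r. rate r y * f r y))"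
proof -
  let ?I = "\<lambda>t. integral {0..t} (\<lambda>r. rate r y * f r y)"
  have dI: "(?I has_real_derivative rate t y * f t y) (at t within {0..})" if "0 \<le> t" for t
    using jc_time_integral_deriv[OF jc_mult[OF jc_rate jc_f] that assms(2)] .
  have "\<exists>c. \<forall>t\<in>{0..}. f t y * exp (?I t) = c"
  proof (rule has_field_derivative_zero_constant)
    fix t :: real assume "t \<in> {0..}"
    then have t: "0 \<le> t" by simp
    have "((\<lambda>t. f t y * exp (?I t)) has_real_derivative
       (- rate t y * (f t y)\<^sup>2) * exp (?I t) + (exp (?I t) * (rate t y * f t y)) * f t y) (at t within {0..})"
      by (intro DERIV_mult f_deriv t assms DERIV_chain2[OF DERIV_exp dI])
    then show "((\<lambda>t. f t y * exp (?I t)) has_real_derivative 0) (at t within {0..})"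
      by (simp add: power2_eq_square algebra_simps)
  qed simp
  then obtain k where k: "\<And>t. 0 \<le> t \<Longrightarrow> f t y * exp (?I t) = k" by auto
  have "f t y * exp (?I t) = f 0 y" using k[of 0] k[OF assms(1)] by simp
  then have "f t y * (exp (?I t) * exp (- ?I t)) = f 0 y * exp (- ?I t)" by (simp only: mult.assoc[symmetric])
  then show ?thesis by (simp add: exp_add[symmetric])
qed

lemma f_nonneg: "0 \<le> t \<Longrightarrow> y \<in> {0..1} \<Longrightarrow> 0 \<le> f t y"
  by (subst f_exp) (auto intro!: mult_nonneg_nonneg f0_nonneg)

lemma f_pos_iff: "0 \<le> t \<Longrightarrow> y \<in> {0..1} \<Longrightarrow> 0 < f t y \<longleftrightarrow> 0 < f 0 y"
  by (subst f_exp) (auto simp: zero_less_mult_iff)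

lemma inverse_f_increment:
  assumes y: "y \<in> {0..1}" "0 < f 0 y" and st: "0 \<le> s" "s \<le> t"
  shows "1 / f t y - 1 / f s y = integral {s..t} (\<lambda>r. rate r y)"
proof (rule DERIV_imp_increments[OF _ st])
  fix t :: real assume t: "0 \<le> t"
  have p: "f t y > 0" using f_pos_iff t y by blast
  have "((\<lambda>t. inverse (f t y)) has_real_derivative - (inverse (f t y) * (- rate t y * (f t y)\<^sup>2) * inverse (f t y))) (at t within {0..})"
    by (intro DERIV_inverse' f_deriv t y) (use p in auto)
  also have "- (inverse (f t y) * (- rate t y * (f t y)\<^sup>2) * inverse (f t y)) = rate t y"
    using p by (simp add: field_simps power2_eq_square)
  finally show "((\<lambda>t. 1 / f t y) has_real_derivative rate t y) (at t within {0..})"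
    by (simp only: divide_inverse mult_1)
qed

lemma inverse_f_bounds:
  assumes y: "y \<in> {0..1}" "0 < f 0 y" and T: "0 \<le> T" "T \<le> t"
    and ab: "\<And>r. T \<le> r \<Longrightarrow> a \<le> rate r y \<and> rate r y \<le> b"
  shows "1 / f T y + a * (t - T) \<le> 1 / f t y" "1 / f t y \<le> 1 / f T y + b * (t - T)"
proof -
  have i: "((\<lambda>r. rate r y) has_integral (1 / f t y - 1 / f T y)) {T..t}"
    using inverse_f_increment[OF y T] integrable_integral[OF jc_time_integrable[OF jc_rate T(1) y(1), of t]] by simp
  have k: "((\<lambda>r. k) has_integral k * (t - T)) {T..t}" for k :: real
    using has_integral_const_real[of k T t] T by (simp add: mult.commute)
  show "1 / f T y + a * (t - T) \<le> 1 / f t y" using has_integral_le[OF k i] ab by fastforce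
  show "1 / f t y \<le> 1 / f T y + b * (t - T)" using has_integral_le[OF i k] ab by fastforce
qed

text \<open>\<open>E\<close> is the energy of \<open>(u, \<tau>)\<close>, and \<open>dev\<close> the squared distance of \<open>\<tau>\<close> to the constants.\<close>

definition E where "E t = mean (\<lambda>y. (G * \<rho> * (u t y)\<^sup>2 + lam * (\<tau> t y)\<^sup>2) / 2)"
definition dev where "dev t = mean (\<lambda>y. (\<tau> t y - mean (\<tau> t))\<^sup>2)"

lemma slices: assumes "0 \<le> t"
  shows "continuous_on {0..1} (u t)" "continuous_on {0..1} (\<tau> t)" "continuous_on {0..1} (f t)"
    "continuous_on {0..1} (v t)" "continuous_on {0..1} (w t)"
  using jc_slice cont jc_f jc_v jc_w assms by auto

lemma mean_nonneg: "continuous_on {0..1} h \<Longrightarrow> (\<And>y. y \<in> {0..1} \<Longrightarrow> 0 \<le> h y) \<Longrightarrow> 0 \<le> mean h"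
  using mean_mono[of "\<lambda>_. 0" h] by simp

lemma E_eq: "0 \<le> t \<Longrightarrow> E t = (G * \<rho> / 2) * mean (\<lambda>y. (u t y)\<^sup>2) + (lam / 2) * mean (\<lambda>y. (\<tau> t y)\<^sup>2)"
proof -
  assume t: "0 \<le> t"
  have "E t = mean (\<lambda>y. (G * \<rho> / 2) * (u t y)\<^sup>2 + (lam / 2) * (\<tau> t y)\<^sup>2)"
    unfolding E_def by (rule mean_cong) (simp add: add_divide_distrib)
  also have "\<dots> = (G * \<rho> / 2) * mean (\<lambda>y. (u t y)\<^sup>2) + (lam / 2) * mean (\<lambda>y. (\<tau> t y)\<^sup>2)"
    by (intro mean_lin continuous_intros slices t)
  finally show ?thesis .
qed

lemma E_bounds:
  assumes t: "0 \<le> t"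
  shows "0 \<le> E t" "(mean (\<tau> t))\<^sup>2 \<le> 2 / lam * E t" "y \<in> {0..1} \<Longrightarrow> (v t y)\<^sup>2 \<le> 2 * \<rho> / G * E t"
    "mean (\<lambda>y. (\<tau> t y)\<^sup>2) = (mean (\<tau> t))\<^sup>2 + dev t" "0 \<le> dev t" "dev t \<le> 2 * (1 + c\<^sup>2) * X t"
proof -
  have nn: "0 \<le> mean (\<lambda>y. (u t y)\<^sup>2)" "0 \<le> mean (\<lambda>y. (\<tau> t y)\<^sup>2)"
    by (intro mean_nonneg continuous_intros slices t; simp)+
  show "0 \<le> E t" using nn pos by (simp add: E_eq[OF t])
  show d: "mean (\<lambda>y. (\<tau> t y)\<^sup>2) = (mean (\<tau> t))\<^sup>2 + dev t"
    using mean_square_centered[OF slices(2)[OF t]] by (simp add: dev_def)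
  show d0: "0 \<le> dev t" unfolding dev_def by (intro mean_nonneg continuous_intros slices t) simp
  have "lam / 2 * (mean (\<tau> t))\<^sup>2 \<le> lam / 2 * mean (\<lambda>y. (\<tau> t y)\<^sup>2)" using d d0 pos by (intro mult_left_mono) auto
  also have "\<dots> \<le> E t" using nn pos by (simp add: E_eq[OF t])
  finally show "(mean (\<tau> t))\<^sup>2 \<le> 2 / lam * E t" using pos by (simp add: field_simps)
  show "(v t y)\<^sup>2 \<le> 2 * \<rho> / G * E t" if y: "y \<in> {0..1}"
  proof -
    have "(v t y)\<^sup>2 \<le> integral {0..1} (\<lambda>y. (\<rho> * u t y)\<^sup>2)"
      by (rule poincare[OF v_deriv[OF t]]) (use y mean_v[OF t] in \<open>auto simp: mean_def intro!: continuous_intros slices t\<close>)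
    also have "\<dots> = \<rho>\<^sup>2 * mean (\<lambda>y. (u t y)\<^sup>2)" by (simp add: mean_def power_mult_distrib)
    also have "\<dots> = 2 * \<rho> / G * (G * \<rho> / 2 * mean (\<lambda>y. (u t y)\<^sup>2))" using pos by (simp add: power2_eq_square)
    also have "\<dots> \<le> 2 * \<rho> / G * E t" using nn pos by (intro mult_left_mono) (auto simp: E_eq[OF t])
    finally show ?thesis .
  qed
  have "dev t \<le> mean (\<lambda>y. (2 * (1 + c\<^sup>2)) * (v t y)\<^sup>2 + (2 * (1 + c\<^sup>2)) * (w t y)\<^sup>2)"
    unfolding dev_def
  proof (rule mean_mono)
    fix y
    have "(2 * (1 + c\<^sup>2)) * (v t y)\<^sup>2 + (2 * (1 + c\<^sup>2)) * (w t y)\<^sup>2 - (\<tau> t y - mean (\<tau> t))\<^sup>2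
      = (w t y - c * v t y)\<^sup>2 + 2 * (v t y)\<^sup>2 + 2 * (c * w t y)\<^sup>2"
      by (simp add: w_def power2_eq_square algebra_simps)
    also have "\<dots> \<ge> 0" by simp
    finally show "(\<tau> t y - mean (\<tau> t))\<^sup>2 \<le> (2 * (1 + c\<^sup>2)) * (v t y)\<^sup>2 + (2 * (1 + c\<^sup>2)) * (w t y)\<^sup>2" by simp
  qed (intro continuous_intros slices t)+
  also have "\<dots> = 2 * (1 + c\<^sup>2) * X t"
  proof -
    have "mean (\<lambda>y. (2 * (1 + c\<^sup>2)) * (v t y)\<^sup>2 + (2 * (1 + c\<^sup>2)) * (w t y)\<^sup>2)
        = (2 * (1 + c\<^sup>2)) * mean (\<lambda>y. (v t y)\<^sup>2) + (2 * (1 + c\<^sup>2)) * mean (\<lambda>y. (w t y)\<^sup>2)"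
      by (intro mean_lin continuous_intros slices t)
    then show ?thesis by (simp only: X_def distrib_left)
  qed
  finally show "dev t \<le> 2 * (1 + c\<^sup>2) * X t" .
qed

lemma E_cont: "continuous_on {0..} E"
  unfolding E_def[abs_def] by (intro continuous_on_mean jc_intros cont)

lemma E_decay:
  assumes "0 \<le> s" "s \<le> t"
  shows "E t - E s \<le> integral {s..t} (\<lambda>r. - mean (\<lambda>y. G * \<eta> * (u r y)\<^sup>2 + f r y * \<tau> r y * \<tau> r y))"
  using energy_u_\<tau>[OF assms] by (simp add: E_def)

lemma E_antimono:
  assumes "0 \<le> s" "s \<le> t" shows "E t \<le> E s"
proof -
  have "integral {s..t} (\<lambda>r. - mean (\<lambda>y. G * \<eta> * (u r y)\<^sup>2 + f r y * \<tau> r y * \<tau> r y)) \<le> integral {s..t} (\<lambda>r::real. 0)"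
  proof (rule integral_le)
    show "(\<lambda>r. - mean (\<lambda>y. G * \<eta> * (u r y)\<^sup>2 + f r y * \<tau> r y * \<tau> r y)) integrable_on {s..t}"
      using assms by (intro cont_time_integrable continuous_on_minus continuous_on_mean jc_intros cont jc_f)
    show "(\<lambda>r::real. 0::real) integrable_on {s..t}" by (rule integrable_0)
    fix r assume "r \<in> {s..t}"
    then have r: "0 \<le> r" using assms by auto
    have "0 \<le> G * \<eta> * (u r y)\<^sup>2 + f r y * \<tau> r y * \<tau> r y" if "y \<in> {0..1}" for y
      using f_nonneg[OF r that] pos by (simp add: mult.assoc)
    then have "0 \<le> mean (\<lambda>y. G * \<eta> * (u r y)\<^sup>2 + f r y * \<tau> r y * \<tau> r y)"
      by (intro mean_nonneg continuous_intros slices r) auto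
    then show "- mean (\<lambda>y. G * \<eta> * (u r y)\<^sup>2 + f r y * \<tau> r y * \<tau> r y) \<le> 0" by simp
  qed
  then show ?thesis using E_decay[OF assms] by simp
qed

text \<open>For \<open>\<tau> - c v\<close>, in contrast to \<open>w\<close>, the force \<open>- f \<tau> / \<lambda>\<close> is part of the damping, which
  it can only increase.\<close>

lemma z_increment:
  assumes st: "0 \<le> s" "s \<le> t" "y \<in> {0..1}"
  shows "(\<tau> t y - c * v t y) - (\<tau> s y - c * v s y)
    = integral {s..t} (\<lambda>r. (c * mean (\<tau> r) - (c + f r y / lam) * (c * v r y)) - (c + f r y / lam) * (\<tau> r y - c * v r y))"
proof -
  have iT: "(\<lambda>r. \<tau> r y - mean (\<tau> r)) integrable_on {s..t}" and ig: "(\<lambda>r. f r y * \<tau> r y) integrable_on {s..t}"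
    using jc_time_integrable[OF jc_diff[OF cont(2) jc_mean[OF cont(2)]] st(1,3)]
      jc_time_integrable[OF cont(3) st(1,3)] by auto
  have "integral {s..t} (\<lambda>r. (c * mean (\<tau> r) - (c + f r y / lam) * (c * v r y)) - (c + f r y / lam) * (\<tau> r y - c * v r y))
    = integral {s..t} (\<lambda>r. (- c) * (\<tau> r y - mean (\<tau> r)) - (f r y * \<tau> r y) / lam)"
    by (rule Henstock_Kurzweil_Integration.integral_cong) (simp add: algebra_simps)
  also have "\<dots> = (- c) * integral {s..t} (\<lambda>r. \<tau> r y - mean (\<tau> r)) - integral {s..t} (\<lambda>r. f r y * \<tau> r y) / lam"
    by (intro integral_unique has_integral_diff has_integral_mult_right has_integral_divide integrable_integral iT ig)
  also have "\<dots> = (\<tau> t y - c * v t y) - (\<tau> s y - c * v s y)"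
  proof -
    have GD: "G * D s t y = lam * (c * (v t y - v s y - integral {s..t} (\<lambda>r. \<tau> r y - mean (\<tau> r))))"
      using pos by (simp add: D_def c_def)
    have "lam * (\<tau> t y - \<tau> s y) = lam * (c * (v t y - v s y - integral {s..t} (\<lambda>r. \<tau> r y - mean (\<tau> r))) - integral {s..t} (\<lambda>r. f r y * \<tau> r y) / lam)"
      unfolding flow_\<tau>'[OF st] GD using pos by (simp add: algebra_simps)
    then have "\<tau> t y - \<tau> s y = c * (v t y - v s y - integral {s..t} (\<lambda>r. \<tau> r y - mean (\<tau> r))) - integral {s..t} (\<lambda>r. f r y * \<tau> r y) / lam"
      using pos by simp
    then show ?thesis by (simp add: algebra_simps)
  qed
  finally show ?thesis by simp
qed

text \<open>Pointwise control of the stress by averaged quantities: \<open>\<tau> - c v\<close> is damped at rate at least \<open>c\<close>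
  towards values of order \<open>m\<close>, so a bound on energy level becomes a uniform one up to an exponentially small
  term.\<close>

lemma \<tau>_sup:
  assumes T: "0 \<le> T" "T \<le> t" and y: "y \<in> {0..1}" and m0: "0 \<le> m" and M0: "0 \<le> M"
    and m: "\<And>t. T \<le> t \<Longrightarrow> \<bar>mean (\<tau> t)\<bar> \<le> m \<and> c * \<bar>v t y\<bar> \<le> m"
    and M: "\<bar>\<tau> T y\<bar> \<le> m + M"
  shows "\<bar>\<tau> t y\<bar> \<le> 3 * m + M * exp (- c * (t - T))"
proof -
  \<comment> \<open>The sign \<open>k\<close> treats the upper and the lower bound at once.\<close>
  have main: "k * (\<tau> t y - c * v t y) \<le> 2 * m + M * exp (- c * (t - T))" if k: "k = 1 \<or> k = -1" for k :: real
  proof (rule comparison[where b=T and y="\<lambda>t. k * (\<tau> t y - c * v t y)" and a="\<lambda>r. c + f r y / lam"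
        and \<phi>="\<lambda>r. k * (c * mean (\<tau> r) - (c + f r y / lam) * (c * v r y))"
        and Y' = "\<lambda>t. - c * (M * exp (- c * (t - T)))"])
    have jz: "jc (\<lambda>t y. k * (\<tau> t y - c * v t y))" by (intro jc_intros cont jc_v)
    show "continuous_on {T..} (\<lambda>t. k * (\<tau> t y - c * v t y))"
      using continuous_on_subset[OF jc_time[OF jz, of y]] T y by auto
    have ja: "jc (\<lambda>t y. c + f t y / lam)" by (intro jc_intros jc_f)
    show "continuous_on {T..} (\<lambda>r. c + f r y / lam)"
      using continuous_on_subset[OF jc_time[OF ja, of y]] T y by auto
    have jp: "jc (\<lambda>r y. k * (c * mean (\<tau> r) - (c + f r y / lam) * (c * v r y)))" by (intro jc_intros jc_f cont jc_v)
    show "continuous_on {T..} (\<lambda>r. k * (c * mean (\<tau> r) - (c + f r y / lam) * (c * v r y)))"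
      using continuous_on_subset[OF jc_time[OF jp, of y]] T y by auto
    show "0 \<le> c + f t y / lam" if "T \<le> t" for t using f_nonneg[of t y] that T y c_pos pos by auto
    show "k * (\<tau> t y - c * v t y) - k * (\<tau> s y - c * v s y)
       \<le> integral {s..t} (\<lambda>r. k * (c * mean (\<tau> r) - (c + f r y / lam) * (c * v r y)) - (c + f r y / lam) * (k * (\<tau> r y - c * v r y)))"
      if "T \<le> s" "s \<le> t" for s t
    proof -
      have "k * ((\<tau> t y - c * v t y) - (\<tau> s y - c * v s y)) = integral {s..t} (\<lambda>r. k * ((c * mean (\<tau> r) - (c + f r y / lam) * (c * v r y)) - (c + f r y / lam) * (\<tau> r y - c * v r y)))"
        using z_increment[of s t y] that T y by (simp only: integral_mult_right)
      moreover have "k * (c * mean (\<tau> r) - (c + f r y / lam) * (c * v r y)) - (c + f r y / lam) * (k * (\<tau> r y - c * v r y))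
          = k * ((c * mean (\<tau> r) - (c + f r y / lam) * (c * v r y)) - (c + f r y / lam) * (\<tau> r y - c * v r y))" for r
        by (simp only: right_diff_distrib[of k] mult.left_commute[of k])
      ultimately show ?thesis by (simp only: right_diff_distrib[symmetric] order_refl)
    qed
    show "((\<lambda>t. 2 * m + M * exp (- c * (t - T))) has_real_derivative - c * (M * exp (- c * (t - T)))) (at t within {T..})"
      if "T \<le> t" for t by (auto intro!: derivative_eq_intros)
    show "k * (c * mean (\<tau> t) - (c + f t y / lam) * (c * v t y)) - (c + f t y / lam) * (2 * m + M * exp (- c * (t - T)))
        \<le> - c * (M * exp (- c * (t - T)))" if t: "T \<le> t" for t
    proof -
      define a where "a = c + f t y / lam"
      define e where "e = M * exp (- c * (t - T))"
      have a: "c \<le> a" "0 \<le> a" unfolding a_def using f_nonneg[of t y] t T y c_pos pos by auto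
      have "k * (c * mean (\<tau> t)) \<le> c * m"
      proof -
        have "k * mean (\<tau> t) \<le> m" using m[OF t] k by auto
        then show ?thesis using mult_left_mono[of "k * mean (\<tau> t)" m c] c_pos by (simp add: mult.left_commute)
      qed
      moreover have "- k * (a * (c * v t y)) \<le> a * m"
      proof -
        have "- k * (c * v t y) \<le> \<bar>c * v t y\<bar>" using k by auto
        also have "\<dots> = c * \<bar>v t y\<bar>" using c_pos by (simp add: abs_mult)
        finally have "- k * (c * v t y) \<le> m" using m[OF t] by linarith
        then show ?thesis using mult_left_mono[of "- k * (c * v t y)" m a] a by (simp add: mult.left_commute)
      qed
      moreover have "c * m \<le> a * m" "c * e \<le> a * e"
        unfolding e_def using a m0 M0 by (intro mult_right_mono; simp)+
      ultimately show ?thesis unfolding a_def[symmetric] e_def[symmetric] by (simp add: algebra_simps)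
    qed
    show "k * (\<tau> T y - c * v T y) \<le> 2 * m + M * exp (- c * (T - T))"
    proof -
      have "k * (\<tau> T y - c * v T y) \<le> \<bar>\<tau> T y\<bar> + \<bar>c * v T y\<bar>" using k by auto
      also have "\<bar>c * v T y\<bar> \<le> m" using m[of T] c_pos by (simp add: abs_mult)
      finally show ?thesis using M by simp
    qed
  qed (use T in auto)
  have "\<bar>c * v t y\<bar> \<le> m" using m[OF T(2)] c_pos by (simp add: abs_mult)
  then show ?thesis using main[of 1] main[of "-1"] by (simp add: abs_le_iff)
qed

end

section \<open>Uniform decay of the stress\<close>

lemma bounded_on_unit:
  fixes h :: "real \<Rightarrow> real" assumes "continuous_on {0..1} h"
  obtains M where "M \<ge> 0" "\<And>y. y \<in> {0..1} \<Longrightarrow> \<bar>h y\<bar> \<le> M"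
proof -
  have "bounded (h ` {0..1})" by (intro compact_imp_bounded compact_continuous_image assms) auto
  then obtain M where "\<And>y. y \<in> {0..1} \<Longrightarrow> \<bar>h y\<bar> \<le> M" unfolding bounded_iff by force
  then show ?thesis using that[of M] by (meson abs_ge_zero atLeastAtMost_iff order_refl order_trans zero_le_one)
qed

context aging_flow begin

lemma m_bound:
  assumes t: "0 \<le> t" and E: "E t \<le> e" and y: "y \<in> {0..1}"
  shows "\<bar>mean (\<tau> t)\<bar> \<le> sqrt (2 / lam * e) + c * sqrt (2 * \<rho> / G * e)"
    "c * \<bar>v t y\<bar> \<le> sqrt (2 / lam * e) + c * sqrt (2 * \<rho> / G * e)"
proof -
  have e: "0 \<le> e" using E E_bounds(1)[OF t] by linarith
  have nn: "0 \<le> sqrt (2 / lam * e)" "0 \<le> c * sqrt (2 * \<rho> / G * e)" using e pos c_pos by auto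
  have "(mean (\<tau> t))\<^sup>2 \<le> 2 / lam * e" using E_bounds(2)[OF t] E pos by (meson divide_nonneg_pos mult_left_mono order_trans zero_le_numeral)
  then have "\<bar>mean (\<tau> t)\<bar> \<le> sqrt (2 / lam * e)" using real_le_rsqrt real_sqrt_abs real_sqrt_le_mono by metis
  then show "\<bar>mean (\<tau> t)\<bar> \<le> sqrt (2 / lam * e) + c * sqrt (2 * \<rho> / G * e)" using nn by linarith
  have "0 \<le> 2 * \<rho> / G" using pos by simp
  then have "(v t y)\<^sup>2 \<le> 2 * \<rho> / G * e" using E_bounds(3)[OF t y] E mult_left_mono order_trans by blast
  then have "\<bar>v t y\<bar> \<le> sqrt (2 * \<rho> / G * e)" using real_sqrt_abs real_sqrt_le_mono by metis
  then have "c * \<bar>v t y\<bar> \<le> c * sqrt (2 * \<rho> / G * e)" using c_pos by simp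
  then show "c * \<bar>v t y\<bar> \<le> sqrt (2 / lam * e) + c * sqrt (2 * \<rho> / G * e)" using nn by linarith
qed

lemma \<tau>_bounded: obtains M where "0 \<le> M" "\<And>t y. 0 \<le> t \<Longrightarrow> y \<in> {0..1} \<Longrightarrow> \<bar>\<tau> t y\<bar> \<le> M"
proof -
  define m where "m = sqrt (2 / lam * E 0) + c * sqrt (2 * \<rho> / G * E 0)"
  have m0: "0 \<le> m" unfolding m_def using E_bounds(1)[of 0] pos c_pos by auto
  obtain M where M: "0 \<le> M" "\<And>y. y \<in> {0..1} \<Longrightarrow> \<bar>\<tau> 0 y\<bar> \<le> M"
    using bounded_on_unit[OF slices(2)[of 0]] by auto
  have "\<bar>\<tau> t y\<bar> \<le> 3 * m + M" if t: "0 \<le> t" "y \<in> {0..1}" for t y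
  proof -
    have "\<bar>\<tau> t y\<bar> \<le> 3 * m + M * exp (- c * (t - 0))"
    proof (rule \<tau>_sup[OF order_refl t m0 M(1)])
      show "\<bar>mean (\<tau> t)\<bar> \<le> m \<and> c * \<bar>v t y\<bar> \<le> m" if "0 \<le> t" for t
        unfolding m_def using m_bound[OF that E_antimono[of 0 t] \<open>y \<in> {0..1}\<close>] that by auto
      show "\<bar>\<tau> 0 y\<bar> \<le> m + M" using M(2)[OF t(2)] m0 by linarith
    qed
    also have "M * exp (- c * (t - 0)) \<le> M * 1"
      using M(1) c_pos t by (intro mult_left_mono) auto
    finally show ?thesis by simp
  qed
  moreover have "0 \<le> 3 * m + M" using m0 M by simp
  ultimately show ?thesis using that by blast
qed

text \<open>For \<open>f > \<xi> M / \<nu>\<close> the cubic term of the equation dominates.\<close>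

lemma f_bounded: obtains M where "0 < M" "\<And>t y. 0 \<le> t \<Longrightarrow> y \<in> {0..1} \<Longrightarrow> f t y \<le> M"
proof -
  obtain M where M: "0 \<le> M" "\<And>t y. 0 \<le> t \<Longrightarrow> y \<in> {0..1} \<Longrightarrow> \<bar>\<tau> t y\<bar> \<le> M" using \<tau>_bounded by blast
  obtain M0 where M0: "0 \<le> M0" "\<And>y. y \<in> {0..1} \<Longrightarrow> \<bar>f 0 y\<bar> \<le> M0"
    using bounded_on_unit[OF slices(3)[of 0]] by auto
  define B where "B = M0 + \<xi> * M / \<nu> + 1"
  have Bp: "B > 0" using M0 M pos' by (auto simp: B_def add_nonneg_pos)
  have B1: "\<xi> * M \<le> \<nu> * B" using M0 M pos' by (simp add: B_def field_simps)
  have "f t y \<le> B" if t: "0 \<le> t" and y: "y \<in> {0..1}" for t y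
  proof (rule comparison[where b=0 and y="\<lambda>t. f t y" and a="\<lambda>r. \<nu> * (f r y)\<^sup>2" and \<phi>="\<lambda>r. \<xi> * M * (f r y)\<^sup>2" and Y'="\<lambda>_. 0"])
    have cf: "continuous_on {0..} (\<lambda>t. f t y)" using jc_time[OF jc_f] y by auto
    show "continuous_on {0..} (\<lambda>t. f t y)" "continuous_on {0..} (\<lambda>r. \<nu> * (f r y)\<^sup>2)" "continuous_on {0..} (\<lambda>r. \<xi> * M * (f r y)\<^sup>2)"
      by (intro continuous_intros cf)+
    show "f t y - f s y \<le> integral {s..t} (\<lambda>r. \<xi> * M * (f r y)\<^sup>2 - \<nu> * (f r y)\<^sup>2 * f r y)" if "0 \<le> s" "s \<le> t" for s t
    proof -
      have ct: "continuous_on {0..} (\<lambda>r. \<tau> r y)" using jc_time[OF cont(2)] y by auto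
      show ?thesis unfolding flow_f[OF that y]
      proof (rule integral_le)
        show "(\<lambda>r. (- 1 + \<xi> * \<bar>\<tau> r y\<bar>) * (f r y)\<^sup>2 - \<nu> * f r y ^ 3) integrable_on {s..t}"
          "(\<lambda>r. \<xi> * M * (f r y)\<^sup>2 - \<nu> * (f r y)\<^sup>2 * f r y) integrable_on {s..t}"
          using that by (intro cont_time_integrable continuous_intros cf ct; simp)+
        fix r assume "r \<in> {s..t}"
        then have "\<xi> * \<bar>\<tau> r y\<bar> \<le> \<xi> * M" using M(2)[of r y] that y pos' by auto
        then have "(- 1 + \<xi> * \<bar>\<tau> r y\<bar>) * (f r y)\<^sup>2 \<le> \<xi> * M * (f r y)\<^sup>2" by (intro mult_right_mono) auto
        then show "(- 1 + \<xi> * \<bar>\<tau> r y\<bar>) * (f r y)\<^sup>2 - \<nu> * f r y ^ 3 \<le> \<xi> * M * (f r y)\<^sup>2 - \<nu> * (f r y)\<^sup>2 * f r y"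
          by (simp add: power2_eq_square power3_eq_cube mult.assoc)
      qed
    qed
    show "\<xi> * M * (f t y)\<^sup>2 - \<nu> * (f t y)\<^sup>2 * B \<le> 0" for t
      using mult_right_mono[OF B1, of "(f t y)\<^sup>2"] by (simp add: mult.assoc mult.commute mult.left_commute)
    show "f 0 y \<le> B" using M0(2)[OF y] M M0(1) pos' by (simp add: B_def add_increasing2)
  qed (use t pos' in auto)
  then show ?thesis using that Bp by blast
qed

text \<open>The derivative of \<open>1 / f\<close> is at most \<open>L\<close>, so \<open>1 / f\<close> grows at most linearly, uniformly in \<open>y\<close> after
  multiplication by \<open>f 0 y\<close>.\<close>

lemma f_lower: obtains \<kappa> where "0 < \<kappa>" "\<And>t y. 0 \<le> t \<Longrightarrow> y \<in> {0..1} \<Longrightarrow> \<kappa> * f 0 y \<le> (1 + t) * f t y"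
proof -
  obtain M where M: "0 < M" "\<And>t y. 0 \<le> t \<Longrightarrow> y \<in> {0..1} \<Longrightarrow> f t y \<le> M" using f_bounded by blast
  obtain M' where M': "\<And>t y. 0 \<le> t \<Longrightarrow> y \<in> {0..1} \<Longrightarrow> \<bar>\<tau> t y\<bar> \<le> M'" using \<tau>_bounded by blast
  define L where "L = 1 + \<nu> * M"
  have L: "L > 0" using M pos' by (simp add: L_def add_pos_pos)
  have "1 / (1 + L * M) * f 0 y \<le> (1 + t) * f t y" if t: "0 \<le> t" and y: "y \<in> {0..1}" for t y
  proof (cases "f 0 y > 0")
    case True
    have p: "f t y > 0" using f_pos_iff t y True by blast
    have "1 / f t y \<le> 1 / f 0 y + L * (t - 0)"
    proof (rule inverse_f_bounds(2)[OF y True order_refl t, where a="1 - \<xi> * M'"])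
      fix r :: real assume r: "0 \<le> r"
      have "\<xi> * \<bar>\<tau> r y\<bar> \<le> \<xi> * M'" using M'[OF r y] pos' by simp
      moreover have "0 \<le> \<nu> * f r y" "\<nu> * f r y \<le> \<nu> * M" "0 \<le> \<xi> * \<bar>\<tau> r y\<bar>"
        using pos' f_nonneg[OF r y] M(2)[OF r y] by auto
      ultimately show "1 - \<xi> * M' \<le> rate r y \<and> rate r y \<le> L"
        unfolding rate_def L_def by linarith
    qed
    also have "\<dots> = (1 + L * f 0 y * t) / f 0 y" using True by (simp add: field_simps)
    also have "\<dots> \<le> ((1 + L * M) * (1 + t)) / f 0 y"
    proof (rule divide_right_mono)
      have "L * f 0 y * t \<le> L * M * t" using L M(2)[OF order_refl y] t by (intro mult_right_mono mult_left_mono) auto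
      moreover have "0 \<le> L * M" using L M by simp
      ultimately show "1 + L * f 0 y * t \<le> (1 + L * M) * (1 + t)" using t by (simp add: algebra_simps)
    qed (use True in simp)
    finally have q: "1 / f t y \<le> ((1 + L * M) * (1 + t)) / f 0 y" .
    have LM: "1 + L * M > 0" using L M by (simp add: add_pos_pos)
    have "f 0 y * (1 / f t y) \<le> (1 + L * M) * (1 + t)"
      using mult_left_mono[OF q, of "f 0 y"] True by simp
    then have "f 0 y \<le> (1 + L * M) * (1 + t) * f t y" using p by (simp add: field_simps)
    then show ?thesis using LM by (simp add: field_simps)
  next
    case False
    then have "f 0 y = 0" using f0_nonneg[OF y] by simp
    then show ?thesis using f_nonneg[OF t y] t by simp
  qed
  moreover have "0 < 1 / (1 + L * M)" using L M by (simp add: add_pos_pos)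
  ultimately show ?thesis using that by blast
qed

lemma mean_f0_pos: "0 < mean (f 0)"
proof -
  have "mean (f 0) \<noteq> 0"
    using integral_eq_0_iff[OF slices(3)[of 0]] f0_nonneg f0_nonzero by (auto simp: mean_def)
  moreover have "0 \<le> mean (f 0)" by (rule mean_nonneg) (use slices(3)[of 0] f0_nonneg in auto)
  ultimately show ?thesis by linarith
qed

lemma X_nonneg: "0 \<le> t \<Longrightarrow> 0 \<le> X t"
  unfolding X_def by (intro add_nonneg_nonneg mean_nonneg continuous_intros slices) auto

lemma F_nonneg: "0 \<le> t \<Longrightarrow> 0 \<le> F t"
  using F_bounds(1)[of t] X_nonneg[of t] consts_pos mult_nonneg_nonneg[of k3 "X t"] by linarith

text \<open>The constant of \<open>dev_le\<close>.\<close>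

definition dF :: real where "dF = 2 * (1 + c\<^sup>2) / k3"

lemma dF_pos: "0 < dF"
proof -
  have "0 < 1 + c\<^sup>2" by (simp add: add_pos_nonneg)
  then show ?thesis using consts_pos by (simp add: dF_def)
qed

lemma dev_le: "0 \<le> t \<Longrightarrow> dev t \<le> dF * F t"
proof -
  assume t: "0 \<le> t"
  have "X t \<le> F t / k3" using F_bounds(1)[OF t] consts_pos by (simp add: field_simps)
  then have "2 * (1 + c\<^sup>2) * X t \<le> 2 * (1 + c\<^sup>2) * (F t / k3)" by (intro mult_left_mono) auto
  then show ?thesis using E_bounds(6)[OF t] by (simp add: dF_def)
qed

text \<open>The energy \<open>E\<close> dissipates \<open>\<parallel>u\<parallel>\<^sup>2\<close> and the mean \<open>Z\<close> of \<open>f \<tau>\<^sup>2\<close>. The latter sees the mean of \<open>\<tau>\<close> with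
  a weight of order \<open>1 / (1 + t)\<close>, by \<open>f_lower\<close>, up to \<open>dev\<close>, which is damped in \<open>F\<close>; and the source of \<open>F\<close>
  is bounded by \<open>Z\<close>, since \<open>f\<close> is bounded. So \<open>H = E + \<kappa> F\<close> satisfies \<open>H' \<le> - k / (1 + t) H\<close>. The exponent \<open>k\<close>
  obtained in this way is far from optimal, but it yields convergence to zero.\<close>

lemma E_algebraic_decay: obtains C k where "0 < k" "\<And>t. 0 \<le> t \<Longrightarrow> E t \<le> C * (1 + t) powr (- k)"
proof -
  obtain M where M: "0 < M" "\<And>t y. 0 \<le> t \<Longrightarrow> y \<in> {0..1} \<Longrightarrow> f t y \<le> M" using f_bounded by blast
  obtain \<kappa>0 where \<kappa>0: "0 < \<kappa>0" "\<And>t y. 0 \<le> t \<Longrightarrow> y \<in> {0..1} \<Longrightarrow> \<kappa>0 * f 0 y \<le> (1 + t) * f t y" using f_lower by blast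
  define B where "B = mean (f 0)"
  have B: "B > 0" using mean_f0_pos by (simp add: B_def)
  \<comment> \<open>half of the dissipation \<open>Z\<close> pays for the source of \<open>\<kappa> F\<close>\<close>
  define \<kappa> where "\<kappa> = 1 / (2 * K1 * M)"
  have \<kappa>: "\<kappa> > 0" using M consts_pos by (simp add: \<kappa>_def)
  define a1 where "a1 = lam / 2 * (2 / (B * \<kappa>0))"
  define a2 where "a2 = lam / 2 * ((2 * M / B + 1) * dF) + \<kappa>"
  have a: "a1 > 0" "a2 > 0" unfolding a1_def a2_def
    by (intro add_pos_pos mult_pos_pos divide_pos_pos pos B \<kappa>0(1) M(1) \<kappa> dF_pos zero_less_numeral zero_less_one)+
  define k where "k = min (2 * \<eta> / \<rho>) (min (1 / (2 * a1)) (\<kappa> * \<delta> / a2))"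
  have k: "k > 0" using pos a \<kappa> consts_pos by (auto simp: k_def)
  define H where "H t = E t + \<kappa> * F t" for t
  have key: "k * H r \<le> (1 + r) * (G * \<eta> * mean (\<lambda>y. (u r y)\<^sup>2) + mean (\<lambda>y. f r y * (\<tau> r y)\<^sup>2) / 2 + \<kappa> * \<delta> * F r)"
    if r: "0 \<le> r" for r
  proof -
    define U Z where "U = mean (\<lambda>y. (u r y)\<^sup>2)" and "Z = mean (\<lambda>y. f r y * (\<tau> r y)\<^sup>2)"
    have nn: "0 \<le> U" "0 \<le> Z" "0 \<le> F r"
      unfolding U_def Z_def using f_nonneg[OF r] F_nonneg[OF r] by (auto intro!: mean_nonneg continuous_intros slices r)
    \<comment> \<open>the mean of \<open>\<tau>\<close> is seen through the support of \<open>f 0\<close>\<close>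
    have "B * (mean (\<tau> r))\<^sup>2 = mean (\<lambda>y. f 0 y * (mean (\<tau> r))\<^sup>2)"
      unfolding B_def mean_def by simp
    also have "\<dots> \<le> mean (\<lambda>y. (2 * ((1 + r) / \<kappa>0)) * (f r y * (\<tau> r y)\<^sup>2) + (2 * M) * (\<tau> r y - mean (\<tau> r))\<^sup>2)"
    proof (rule mean_mono)
      fix y :: real assume y: "y \<in> {0..1}"
      have "(mean (\<tau> r))\<^sup>2 \<le> 2 * (\<tau> r y)\<^sup>2 + 2 * (\<tau> r y - mean (\<tau> r))\<^sup>2"
        using zero_le_power2[of "2 * \<tau> r y - mean (\<tau> r)"] by (simp add: power2_eq_square algebra_simps)
      then have "f 0 y * (mean (\<tau> r))\<^sup>2 \<le> f 0 y * (2 * (\<tau> r y)\<^sup>2 + 2 * (\<tau> r y - mean (\<tau> r))\<^sup>2)"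
        using f0_nonneg[OF y] by (intro mult_left_mono)
      also have "\<dots> = 2 * (f 0 y * (\<tau> r y)\<^sup>2) + 2 * (f 0 y * (\<tau> r y - mean (\<tau> r))\<^sup>2)" by (simp add: algebra_simps)
      also have "\<dots> \<le> 2 * (((1 + r) / \<kappa>0 * f r y) * (\<tau> r y)\<^sup>2) + 2 * (M * (\<tau> r y - mean (\<tau> r))\<^sup>2)"
      proof (intro add_mono mult_left_mono mult_right_mono)
        show "f 0 y \<le> (1 + r) / \<kappa>0 * f r y" using \<kappa>0(2)[OF r y] \<kappa>0(1) by (simp add: field_simps)
        show "f 0 y \<le> M" using M(2)[OF order_refl y] .
      qed auto
      finally show "f 0 y * (mean (\<tau> r))\<^sup>2 \<le> (2 * ((1 + r) / \<kappa>0)) * (f r y * (\<tau> r y)\<^sup>2) + (2 * M) * (\<tau> r y - mean (\<tau> r))\<^sup>2"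
        by (simp only: mult.assoc)
    qed (use \<kappa>0(1) in \<open>auto intro!: continuous_intros slices r\<close>)
    also have "\<dots> = (2 * ((1 + r) / \<kappa>0)) * Z + (2 * M) * dev r"
      unfolding Z_def dev_def by (intro mean_lin continuous_intros slices r)
    finally have m: "(mean (\<tau> r))\<^sup>2 \<le> (2 / (B * \<kappa>0)) * ((1 + r) * Z) + (2 * M / B) * dev r"
      using B \<kappa>0 by (simp add: field_simps)
    have "mean (\<lambda>y. (\<tau> r y)\<^sup>2) \<le> (2 / (B * \<kappa>0)) * ((1 + r) * Z) + (2 * M / B + 1) * dev r"
      using m E_bounds(4)[OF r] by (simp add: algebra_simps)
    also have "\<dots> \<le> (2 / (B * \<kappa>0)) * ((1 + r) * Z) + (2 * M / B + 1) * (dF * F r)"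
      by (intro add_left_mono mult_left_mono dev_le r) (use M(1) B in auto)
    finally have t2: "mean (\<lambda>y. (\<tau> r y)\<^sup>2) \<le> (2 / (B * \<kappa>0)) * ((1 + r) * Z) + (2 * M / B + 1) * (dF * F r)" .
    have "H r = (G * \<rho> / 2) * U + (lam / 2) * mean (\<lambda>y. (\<tau> r y)\<^sup>2) + \<kappa> * F r"
      by (simp add: H_def E_eq[OF r] U_def)
    also have "\<dots> \<le> (G * \<rho> / 2) * U + (lam / 2) * ((2 / (B * \<kappa>0)) * ((1 + r) * Z) + (2 * M / B + 1) * (dF * F r)) + \<kappa> * F r"
      by (intro add_right_mono add_left_mono mult_left_mono t2) (use pos in auto)
    also have "\<dots> = (G * \<rho> / 2) * U + a1 * ((1 + r) * Z) + a2 * F r"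
      by (simp add: a1_def a2_def distrib_left distrib_right mult.assoc)
    also have "\<dots> \<le> (G * \<rho> / 2) * ((1 + r) * U) + a1 * ((1 + r) * Z) + a2 * ((1 + r) * F r)"
      using nn r a pos by (intro add_mono mult_left_mono order_refl) (auto simp: algebra_simps)
    finally have Hle: "H r \<le> (G * \<rho> / 2) * ((1 + r) * U) + a1 * ((1 + r) * Z) + a2 * ((1 + r) * F r)" .
    have "k * H r \<le> k * ((G * \<rho> / 2) * ((1 + r) * U) + a1 * ((1 + r) * Z) + a2 * ((1 + r) * F r))"
      using Hle k by (intro mult_left_mono) auto
    also have "\<dots> = (k * (G * \<rho> / 2)) * ((1 + r) * U) + (k * a1) * ((1 + r) * Z) + (k * a2) * ((1 + r) * F r)"
      by (simp only: distrib_left mult.assoc)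
    also have "\<dots> \<le> (G * \<eta>) * ((1 + r) * U) + (1/2) * ((1 + r) * Z) + (\<kappa> * \<delta>) * ((1 + r) * F r)"
    proof (intro add_mono mult_right_mono)
      have "k \<le> 2 * \<eta> / \<rho>" by (simp add: k_def)
      then have "k * (G * \<rho> / 2) \<le> (2 * \<eta> / \<rho>) * (G * \<rho> / 2)" using pos by (intro mult_right_mono) auto
      then show "k * (G * \<rho> / 2) \<le> G * \<eta>" using pos by simp
      have "k \<le> 1 / (2 * a1)" by (simp add: k_def)
      then have "k * a1 \<le> 1 / (2 * a1) * a1" using a by (intro mult_right_mono) auto
      then show "k * a1 \<le> 1 / 2" using a by simp
      have "k \<le> \<kappa> * \<delta> / a2" by (simp add: k_def)
      then have "k * a2 \<le> \<kappa> * \<delta> / a2 * a2" using a by (intro mult_right_mono) auto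
      then show "k * a2 \<le> \<kappa> * \<delta>" using a by simp
    qed (use nn r in auto)
    also have "\<dots> = (1 + r) * (G * \<eta> * U + Z / 2 + \<kappa> * \<delta> * F r)" by (simp add: algebra_simps)
    finally show ?thesis by (simp add: U_def Z_def)
  qed
  have H0: "0 \<le> H 0" using E_bounds(1)[of 0] F_nonneg[of 0] \<kappa> by (simp add: H_def)
  have cH: "continuous_on {0..} H" unfolding H_def by (intro continuous_intros E_cont F_cont)
  have main: "H t \<le> H 0 * (1 + t) powr (- k)" if t: "0 \<le> t" for t
  proof -
    have "H t - H s \<le> integral {s..t} (\<lambda>r. - (k / (1 + r) * H r))" if st: "0 \<le> s" "s \<le> t" for s t
    proof -
      let ?e = "\<lambda>r. - mean (\<lambda>y. G * \<eta> * (u r y)\<^sup>2 + f r y * \<tau> r y * \<tau> r y)"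
      let ?F = "\<lambda>r. K1 * mean (\<lambda>y. (f r y * \<tau> r y)\<^sup>2) - \<delta> * F r"
      have i: "?e integrable_on {s..t}" "?F integrable_on {s..t}"
        using st by (intro cont_time_integrable continuous_on_minus continuous_on_diff continuous_on_mult continuous_on_const F_cont continuous_on_mean jc_intros cont jc_f; simp)+
      have "H t - H s = (E t - E s) + \<kappa> * (F t - F s)" by (simp add: H_def algebra_simps)
      also have "\<dots> \<le> integral {s..t} ?e + \<kappa> * integral {s..t} ?F"
        using E_decay[OF st] F_decay[OF st] \<kappa> by (intro add_mono mult_left_mono) auto
      also have "\<dots> = integral {s..t} (\<lambda>r. ?e r + \<kappa> * ?F r)"
        by (rule integral_unique[symmetric]) (intro has_integral_add has_integral_mult_right integrable_integral i)
      also have "\<dots> \<le> integral {s..t} (\<lambda>r. - (k / (1 + r) * H r))"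
      proof (rule integral_le)
        show "(\<lambda>r. ?e r + \<kappa> * ?F r) integrable_on {s..t}" by (intro integrable_add integrable_on_mult_right i)
        show "(\<lambda>r. - (k / (1 + r) * H r)) integrable_on {s..t}"
          using st by (intro cont_time_integrable continuous_intros cH) auto
        fix r assume "r \<in> {s..t}"
        then have r: "0 \<le> r" using st by auto
        let ?U = "mean (\<lambda>y. (u r y)\<^sup>2)" and ?Z = "mean (\<lambda>y. f r y * (\<tau> r y)\<^sup>2)"
        have "mean (\<lambda>y. G * \<eta> * (u r y)\<^sup>2 + f r y * \<tau> r y * \<tau> r y) = mean (\<lambda>y. (G * \<eta>) * (u r y)\<^sup>2 + 1 * (f r y * (\<tau> r y)\<^sup>2))"
          by (rule mean_cong) (simp add: power2_eq_square)
        also have "\<dots> = (G * \<eta>) * ?U + 1 * ?Z" by (intro mean_lin continuous_intros slices r)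
        finally have e: "?e r = - (G * \<eta> * ?U + ?Z)" by simp
        have "mean (\<lambda>y. (f r y * \<tau> r y)\<^sup>2) \<le> mean (\<lambda>y. M * (f r y * (\<tau> r y)\<^sup>2) + 0 * 0)"
        proof (rule mean_mono)
          fix y :: real assume y: "y \<in> {0..1}"
          have "(f r y * \<tau> r y)\<^sup>2 = f r y * (f r y * (\<tau> r y)\<^sup>2)" by (simp add: power2_eq_square algebra_simps)
          also have "\<dots> \<le> M * (f r y * (\<tau> r y)\<^sup>2)" using M(2)[OF r y] f_nonneg[OF r y] by (intro mult_right_mono) auto
          finally show "(f r y * \<tau> r y)\<^sup>2 \<le> M * (f r y * (\<tau> r y)\<^sup>2) + 0 * 0" by simp
        qed (intro continuous_intros slices r)+
        also have "\<dots> = M * ?Z + 0 * mean (\<lambda>_. 0)" by (intro mean_lin continuous_intros slices r)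
        finally have "\<kappa> * ?F r \<le> \<kappa> * (K1 * (M * ?Z) - \<delta> * F r)"
          using \<kappa> consts_pos by (intro mult_left_mono diff_mono order_refl) auto
        also have "\<dots> = ?Z / 2 - \<kappa> * \<delta> * F r"
        proof -
          have "\<kappa> * (K1 * M) = 1 / 2" using consts_pos M by (simp add: \<kappa>_def)
          then have "\<kappa> * (K1 * M) * ?Z = ?Z / 2" by simp
          then show ?thesis by (simp add: right_diff_distrib mult.assoc)
        qed
        finally have "?e r + \<kappa> * ?F r \<le> - (G * \<eta> * ?U + ?Z / 2 + \<kappa> * \<delta> * F r)" using e by simp
        also have "\<dots> \<le> - (k * H r / (1 + r))"
        proof -
          have "k * H r / (1 + r) \<le> G * \<eta> * ?U + ?Z / 2 + \<kappa> * \<delta> * F r"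
            using key[OF r] r by (simp add: pos_divide_le_eq mult.commute)
          then show ?thesis by (simp only: neg_le_iff_le)
        qed
        finally show "?e r + \<kappa> * ?F r \<le> - (k / (1 + r) * H r)" by simp
      qed
      finally show ?thesis .
    qed
    from algebraic_decay[OF cH order_refl less_imp_le[OF k] this t] show ?thesis by simp
  qed
  have "E t \<le> H 0 * (1 + t) powr (- k)" if t: "0 \<le> t" for t
  proof -
    have "0 \<le> \<kappa> * F t" using F_nonneg[OF t] \<kappa> by simp
    then show ?thesis using main[OF t] unfolding H_def[of t] by linarith
  qed
  then show ?thesis using that k by blast
qed

section \<open>Asymptotics of the fluidity\<close>

lemma f_zero: "0 \<le> t \<Longrightarrow> y \<in> {0..1} \<Longrightarrow> \<not> 0 < f 0 y \<Longrightarrow> f t y = 0"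
  using f_pos_iff[of t y] f_nonneg[of t y] by linarith

lemma E_small: assumes "0 < e" obtains T where "0 \<le> T" "\<And>t. T \<le> t \<Longrightarrow> E t \<le> e"
proof -
  obtain C k where k: "0 < k" "\<And>t. 0 \<le> t \<Longrightarrow> E t \<le> C * (1 + t) powr (- k)" using E_algebraic_decay by blast
  have "((\<lambda>t. C * (1 + t) powr (- k)) \<longlongrightarrow> 0) at_top" using k(1) by real_asymp
  then have "\<forall>\<^sub>F t in at_top. C * (1 + t) powr (- k) < e" using assms order_tendstoD(2) by blast
  then obtain T where T: "\<And>t. T \<le> t \<Longrightarrow> C * (1 + t) powr (- k) < e" by (auto simp: eventually_at_top_linorder)
  show ?thesis
  proof (rule that[of "max 0 T"])
    fix t assume "max 0 T \<le> t"
    then show "E t \<le> e" using T[of t] k(2)[of t] by auto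
  qed simp
qed

text \<open>Restart \<open>\<tau>_sup\<close> at a late time, when the energy is small.\<close>

lemma \<tau>_small: assumes "0 < e" obtains T where "0 \<le> T" "\<And>t y. T \<le> t \<Longrightarrow> y \<in> {0..1} \<Longrightarrow> \<bar>\<tau> t y\<bar> \<le> e"
proof -
  obtain M where M: "0 \<le> M" "\<And>t y. 0 \<le> t \<Longrightarrow> y \<in> {0..1} \<Longrightarrow> \<bar>\<tau> t y\<bar> \<le> M" using \<tau>_bounded by blast
  define m where "m x = sqrt (2 / lam * x) + c * sqrt (2 * \<rho> / G * x)" for x
  have "continuous_on {0..} m" unfolding m_def by (intro continuous_intros)
  then have "(m \<longlongrightarrow> m 0) (at 0 within {0..})" by (simp add: continuous_on_def)
  then have "(m \<longlongrightarrow> 0) (at_right 0)"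
    by (rule tendsto_mono[rotated, THEN tendsto_eq_rhs]) (auto intro: at_le simp: m_def)
  then have "\<forall>\<^sub>F x in at_right 0. m x < e / 6" using assms by (intro order_tendstoD(2)) auto
  then obtain b where b: "b > 0" "\<And>x. 0 < x \<Longrightarrow> x < b \<Longrightarrow> m x < e / 6"
    using eventually_at_right[of 0 1 "\<lambda>x. m x < e / 6"] by auto
  define x where "x = b / 2"
  have x: "0 < x" "m x < e / 6" using b by (auto simp: x_def)
  obtain T1 where T1: "0 \<le> T1" "\<And>t. T1 \<le> t \<Longrightarrow> E t \<le> x" using E_small[OF x(1)] by blast
  have mx: "0 \<le> m x" unfolding m_def using x pos c_pos by auto
  have "((\<lambda>t. M * exp (- c * (t - T1))) \<longlongrightarrow> 0) at_top" using c_pos by real_asymp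
  then have "\<forall>\<^sub>F t in at_top. M * exp (- c * (t - T1)) < e / 2" using assms by (intro order_tendstoD(2)) auto
  then obtain T2 where T2: "\<And>t. T2 \<le> t \<Longrightarrow> M * exp (- c * (t - T1)) < e / 2" by (auto simp: eventually_at_top_linorder)
  show ?thesis
  proof (rule that[of "max T1 T2"])
    fix t y :: real assume t: "max T1 T2 \<le> t" and y: "y \<in> {0..1}"
    have "\<bar>\<tau> t y\<bar> \<le> 3 * m x + M * exp (- c * (t - T1))"
    proof (rule \<tau>_sup[OF T1(1) _ y mx M(1)])
      show "\<bar>mean (\<tau> t)\<bar> \<le> m x \<and> c * \<bar>v t y\<bar> \<le> m x" if "T1 \<le> t" for t
        unfolding m_def using m_bound[OF _ T1(2)[OF that] y] that T1(1) by auto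
      show "\<bar>\<tau> T1 y\<bar> \<le> m x + M" using M(2)[OF T1(1) y] mx by linarith
    qed (use t in auto)
    then show "\<bar>\<tau> t y\<bar> \<le> e" using T2[of t] x t by auto
  qed (use T1 in auto)
qed

text \<open>Once \<open>\<tau>\<close> is small, \<open>1 / f\<close> grows at rate at least \<open>1 / 2\<close>; so \<open>f\<close> becomes uniformly small, even
  where it was large, and the rate tends to \<open>1\<close>.\<close>

lemma rate_close:
  assumes "0 < a"
  obtains T where "0 \<le> T" "\<And>t y. T \<le> t \<Longrightarrow> y \<in> {0..1} \<Longrightarrow> 1 - a \<le> rate t y \<and> rate t y \<le> 1 + a"
proof -
  define e where "e = min a 1 / (2 * \<xi>)"
  have e: "0 < e" "\<xi> * e \<le> 1 / 2" "\<xi> * e \<le> a / 2" using assms pos' by (auto simp: e_def)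
  obtain T1 where T1: "0 \<le> T1" "\<And>t y. T1 \<le> t \<Longrightarrow> y \<in> {0..1} \<Longrightarrow> \<bar>\<tau> t y\<bar> \<le> e" using \<tau>_small[OF e(1)] by blast
  have x: "0 \<le> \<xi> * \<bar>\<tau> t y\<bar> \<and> \<xi> * \<bar>\<tau> t y\<bar> \<le> \<xi> * e" if "T1 \<le> t" "y \<in> {0..1}" for t y
    using T1(2)[OF that] pos' by auto
  obtain M where M: "0 < M" "\<And>t y. 0 \<le> t \<Longrightarrow> y \<in> {0..1} \<Longrightarrow> f t y \<le> M" using f_bounded by blast
  define T where "T = T1 + 4 * \<nu> / a"
  have T: "T1 < T" "0 \<le> T" using T1(1) assms pos' by (auto simp: T_def)
  show ?thesis
  proof (rule that[OF T(2)])
    fix t y :: real assume t: "T \<le> t" and y: "y \<in> {0..1}"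
    have t0: "0 \<le> t" "T1 \<le> t" using t T by auto
    have "\<nu> * f t y \<le> a / 2"
    proof (cases "0 < f 0 y")
      case True
      have p: "0 < f t y" "0 < f T1 y" using f_pos_iff True y t0 T1(1) by blast+
      have "1 / f T1 y + (1/2) * (t - T1) \<le> 1 / f t y"
      proof (rule inverse_f_bounds(1)[OF y True T1(1) t0(2), where b="1 + \<nu> * M"])
        fix r assume r: "T1 \<le> r"
        have "0 \<le> \<nu> * f r y" "\<nu> * f r y \<le> \<nu> * M" using f_nonneg[of r y] M(2)[of r y] r T1(1) y pos' by auto
        then show "1 / 2 \<le> rate r y \<and> rate r y \<le> 1 + \<nu> * M" using x[OF r y] e unfolding rate_def by linarith
      qed
      moreover have "0 < 1 / f T1 y" using p by simp
      ultimately have "(t - T1) / 2 < 1 / f t y" by linarith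
      moreover have "2 * \<nu> / a \<le> (t - T1) / 2" using t by (simp add: T_def)
      ultimately have "2 * \<nu> / a < 1 / f t y" by linarith
      then have "f t y * (2 * \<nu> / a) < f t y * (1 / f t y)" using p by (intro mult_strict_left_mono)
      then have "f t y * (2 * \<nu> / a) < 1" using p by simp
      then show ?thesis using assms by (simp add: field_simps)
    next
      case False
      then have "f t y = 0" using f_zero[OF t0(1) y] by simp
      then show ?thesis using assms by simp
    qed
    moreover have "0 \<le> \<nu> * f t y" using f_nonneg[OF t0(1) y] pos' by simp
    ultimately show "1 - a \<le> rate t y \<and> rate t y \<le> 1 + a" using x[OF t0(2) y] e unfolding rate_def by linarith
  qed
qed

lemma f_recip_bounds:
  assumes T: "0 \<le> T" "T \<le> t" and y: "y \<in> {0..1}" and a: "0 < a" "a < 1"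
    and r: "\<And>t. T \<le> t \<Longrightarrow> 1 - a \<le> rate t y \<and> rate t y \<le> 1 + a"
  shows "recip_bound (f T y) ((1 + a) * (t - T)) \<le> f t y" "f t y \<le> recip_bound (f T y) ((1 - a) * (t - T))"
proof -
  have t: "0 \<le> t" using T by simp
  have "recip_bound (f T y) ((1 + a) * (t - T)) \<le> f t y \<and> f t y \<le> recip_bound (f T y) ((1 - a) * (t - T))"
  proof (cases "0 < f 0 y")
    case True
    have p: "0 < f t y" "0 < f T y" using f_pos_iff True y T t by blast+
    have p': "0 < 1 / f t y" "0 < 1 / f T y" using p by auto
    have l: "1 / f T y + (1 - a) * (t - T) \<le> 1 / f t y" and u: "1 / f t y \<le> 1 / f T y + (1 + a) * (t - T)"
      using inverse_f_bounds[OF y True T, where a="1 - a" and b="1 + a"] r by auto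
    have l0: "0 < 1 / f T y + (1 - a) * (t - T)" using p' a T by (intro add_pos_nonneg mult_nonneg_nonneg) auto
    have "f t y = 1 / (1 / f t y)" by simp
    then show ?thesis using le_imp_inverse_le[OF u p'(1)] le_imp_inverse_le[OF l l0] p
      by (simp add: recip_bound_def inverse_eq_divide)
  next
    case False
    then have "f t y = 0" "f T y = 0" using f_zero[OF t y] f_zero[OF T(1) y] by simp_all
    then show ?thesis by (simp add: recip_bound_def)
  qed
  then show "recip_bound (f T y) ((1 + a) * (t - T)) \<le> f t y" "f t y \<le> recip_bound (f T y) ((1 - a) * (t - T))" by auto
qed

definition \<beta> where "\<beta> = measure lebesgue {y\<in>{0..1}. f 0 y > 0}"

text \<open>Uniform in \<open>y\<close>, as the bound on \<open>1 / f\<close> does not use its value at time \<open>T\<close>. From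
  \<open>2 T + 1\<close> on, \<open>(t - T) / 2\<close> is at least \<open>(1 + t) / 4\<close>.\<close>

lemma f_upper_rate:
  assumes T: "0 \<le> T" "2 * T + 1 \<le> t" and y: "y \<in> {0..1}" and a: "a \<le> 1 / 2"
    and r: "\<And>t. T \<le> t \<Longrightarrow> 1 - a \<le> rate t y \<and> rate t y \<le> 1 + a"
  shows "f t y \<le> 4 / (1 + t)"
proof (cases "0 < f 0 y")
  case True
  have t: "0 \<le> t" "T \<le> t" using T by auto
  have p: "0 < f t y" "0 < f T y" using f_pos_iff True y T t by blast+
  have "1 / f T y + (1 - a) * (t - T) \<le> 1 / f t y"
    using inverse_f_bounds(1)[OF y True T(1) t(2), where a="1 - a" and b="1 + a"] r by auto
  moreover have "0 < 1 / f T y" using p by simp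
  moreover have "(1/2) * (t - T) \<le> (1 - a) * (t - T)" using a t by (intro mult_right_mono) auto
  moreover have "(1 + t) / 4 \<le> (1/2) * (t - T)" using T by simp
  ultimately have "(1 + t) / 4 \<le> 1 / f t y" by linarith
  then have "f t y * ((1 + t) / 4) \<le> f t y * (1 / f t y)" using p by (intro mult_left_mono) auto
  then have "f t y * ((1 + t) / 4) \<le> 1" using p by simp
  then show ?thesis using t by (simp add: field_simps)
next
  case False
  then have "f t y = 0" using f_zero[of t y] y T by simp
  then show ?thesis using T by simp
qed

lemma positive_set_measurable: "{y\<in>{0..1}. f 0 y > 0} \<in> lmeasurable"
proof -
  have "{y \<in> space (lebesgue_on {0..1}). 0 < f 0 y} \<in> sets (lebesgue_on {0..1})"
    using continuous_imp_measurable_on_sets_lebesgue[OF slices(3)[of 0]] by (intro borel_measurable_less) auto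
  then have "{y\<in>{0..1}. f 0 y > 0} \<in> sets lebesgue"
    using sets_restrict_space_iff[of "{0..1}" lebesgue "{y\<in>{0..1}. f 0 y > 0}"] by simp
  moreover have "bounded {y\<in>{0..1}. f 0 y > 0}" by (rule bounded_subset[of "{0..1}"]) auto
  ultimately show ?thesis using bounded_set_imp_lmeasurable by blast
qed

lemma \<beta>_pos: "0 < \<beta>"
proof (rule ccontr)
  assume "\<not> 0 < \<beta>"
  then have "measure lebesgue {y\<in>{0..1}. f 0 y > 0} = 0" unfolding \<beta>_def using measure_nonneg[of lebesgue] by (simp add: order.antisym not_less)
  then have n: "negligible {y\<in>{0..1}. f 0 y > 0}"
    using positive_set_measurable negligible_iff_measure by blast
  have "mean (f 0) = integral {0..1} (\<lambda>y::real. 0::real)" unfolding mean_def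
    by (rule integral_spike[OF n]) (use f0_nonneg in force)
  then show False using mean_f0_pos by simp
qed

text \<open>At a point where \<open>f\<close> is positive, \<open>f\<close> is eventually at least \<open>1 / ((1 + 2 a) (1 + t))\<close>, but not
  uniformly near the zeros of \<open>f\<close>. The sets \<open>Q n\<close> on which \<open>f T\<close> is bounded below exhaust the support up to a
  small part of the measure \<open>\<beta>\<close>, and on each of them the bound is uniform.\<close>

lemma mean_f_lower:
  assumes T: "0 \<le> T" and a: "0 < a" "a < 1" and r: "\<And>t y. T \<le> t \<Longrightarrow> y \<in> {0..1} \<Longrightarrow> 1 - a \<le> rate t y \<and> rate t y \<le> 1 + a"
  obtains T' where "T \<le> T'" "\<And>t. T' \<le> t \<Longrightarrow> \<beta> * (1 - 3 * a) / (1 + t) \<le> mean (f t)"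
proof -
  define Q where "Q n = {y\<in>{0..1}. f T y \<ge> 1 / real (Suc n)}" for n
  have Qc: "compact (Q n)" for n
  proof -
    have "Q n = {0..1} \<inter> f T -` {1 / real (Suc n)..}" by (auto simp: Q_def)
    moreover have "closed ({0..1} \<inter> f T -` {1 / real (Suc n)..})"
      by (intro continuous_closed_preimage slices T) auto
    moreover have "bounded (Q n)" by (rule bounded_subset[of "{0..1}"]) (auto simp: Q_def)
    ultimately show ?thesis by (simp add: compact_eq_bounded_closed)
  qed
  have Qm: "Q n \<in> lmeasurable" for n using Qc lmeasurable_compact by blast
  have U: "(\<Union>n. Q n) = {y\<in>{0..1}. f 0 y > 0}"
  proof (intro equalityI subsetI)
    fix y assume "y \<in> (\<Union>n. Q n)"
    then obtain n where y: "y \<in> {0..1}" "f T y \<ge> 1 / real (Suc n)" by (auto simp: Q_def)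
    then have "f T y > 0" by (meson divide_pos_pos less_le_trans of_nat_0_less_iff zero_less_Suc zero_less_one)
    then show "y \<in> {y\<in>{0..1}. f 0 y > 0}" using f_pos_iff[OF T y(1)] y by auto
  next
    fix y assume "y \<in> {y\<in>{0..1}. f 0 y > 0}"
    then have y: "y \<in> {0..1}" "0 < f T y" using f_pos_iff[OF T, of y] by auto
    then obtain n where "1 / real (Suc n) < f T y" using nat_approx_posE by metis
    then show "y \<in> (\<Union>n. Q n)" using y by (auto simp: Q_def intro!: exI[of _ n])
  qed
  have inc: "incseq Q"
  proof (rule incseq_SucI)
    fix n
    have "1 / real (Suc (Suc n)) \<le> 1 / real (Suc n)" by (simp add: divide_simps)
    then show "Q n \<le> Q (Suc n)" by (auto simp: Q_def)
  qed
  have "(\<lambda>n. measure lebesgue (Q n)) \<longlonglongrightarrow> measure lebesgue (\<Union>n. Q n)"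
  proof (rule Lim_measure_incseq[OF _ inc])
    show "range Q \<subseteq> sets lebesgue" using Qm by (auto dest: fmeasurableD)
    show "emeasure lebesgue (\<Union>n. Q n) \<noteq> \<infinity>"
      unfolding U using fmeasurableD2[OF positive_set_measurable] by simp
  qed
  then have "(\<lambda>n. measure lebesgue (Q n)) \<longlonglongrightarrow> \<beta>" by (simp add: U \<beta>_def)
  moreover have "\<beta> * (1 - a) < \<beta>" using \<beta>_pos a by simp
  ultimately have "\<forall>\<^sub>F n in sequentially. \<beta> * (1 - a) < measure lebesgue (Q n)" by (rule order_tendstoD(1))
  then obtain n where n: "\<beta> * (1 - a) < measure lebesgue (Q n)" by (auto simp: eventually_sequentially)
  define T' where "T' = T + real (Suc n) / a"
  have T': "T \<le> T'" using a by (simp add: T'_def)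
  show ?thesis
  proof (rule that[OF T'])
    fix t assume t: "T' \<le> t"
    have t0: "0 \<le> t" "T \<le> t" using t T' T by auto
    let ?k = "1 / ((1 + 2 * a) * (1 + t))"
    have k0: "0 \<le> ?k" using a t0 by simp
    have low: "?k \<le> f t y" if y: "y \<in> Q n" for y
    proof -
      have y1: "y \<in> {0..1}" and fy: "1 / real (Suc n) \<le> f T y" using y by (auto simp: Q_def)
      then have p: "0 < f T y" by (meson divide_pos_pos less_le_trans of_nat_0_less_iff zero_less_Suc zero_less_one)
      then have f0: "0 < f 0 y" using f_pos_iff[OF T y1] by simp
      have pt: "0 < f t y" using f_pos_iff[OF t0(1) y1] f0 by simp
      have "1 / f t y \<le> 1 / f T y + (1 + a) * (t - T)"
        using inverse_f_bounds(2)[OF y1 f0 T t0(2), where a="1 - a" and b="1 + a"] r[OF _ y1] by auto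
      also have "1 / f T y \<le> real (Suc n)" using fy p by (simp add: field_simps)
      also have "real (Suc n) \<le> a * (1 + t)"
      proof -
        have "real (Suc n) / a \<le> 1 + t" using t T by (simp add: T'_def)
        then show ?thesis using a by (simp add: field_simps)
      qed
      also have "a * (1 + t) + (1 + a) * (t - T) \<le> (1 + 2 * a) * (1 + t)"
        using a T t0 by (simp add: algebra_simps)
      finally have "1 / f t y \<le> (1 + 2 * a) * (1 + t)" by simp
      then have "f t y * (1 / f t y) \<le> f t y * ((1 + 2 * a) * (1 + t))" using pt by (intro mult_left_mono) auto
      then have "1 \<le> f t y * ((1 + 2 * a) * (1 + t))" using pt by simp
      then show ?thesis using a t0 by (simp add: divide_le_eq)
    qed
    have Qsub: "Q n \<subseteq> {0..1}" by (auto simp: Q_def)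
    have i1: "((\<lambda>y. 1::real) has_integral measure lebesgue (Q n)) (Q n)"
      using integrable_integral[OF lmeasurable_iff_integrable_on[THEN iffD1, OF Qm[of n]]] lmeasure_integral[OF Qm[of n]] by simp
    have "((\<lambda>y. ?k * 1) has_integral ?k * measure lebesgue (Q n)) (Q n)"
      by (rule has_integral_mult_right[OF i1])
    then have "((\<lambda>y. if y \<in> Q n then ?k * 1 else 0) has_integral ?k * measure lebesgue (Q n)) {0..1}"
      using has_integral_restrict[OF Qsub, of "\<lambda>y. ?k * 1" "?k * measure lebesgue (Q n)"] by simp
    moreover have "(f t has_integral mean (f t)) {0..1}"
      unfolding mean_def by (intro integrable_integral integrable_continuous_real slices t0)
    ultimately have l: "?k * measure lebesgue (Q n) \<le> mean (f t)"
      by (rule has_integral_le) (use low f_nonneg[OF t0(1)] in auto)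
    have "(1 - 3 * a) * (1 + 2 * a) \<le> 1 - a" by (simp add: algebra_simps)
    then have "(1 - 3 * a) \<le> (1 - a) / (1 + 2 * a)" using a by (simp add: pos_le_divide_eq)
    then have "\<beta> * (1 - 3 * a) / (1 + t) \<le> \<beta> * ((1 - a) / (1 + 2 * a)) / (1 + t)"
      using \<beta>_pos t0 by (intro divide_right_mono mult_left_mono) auto
    also have "\<dots> = ?k * (\<beta> * (1 - a))" using a t0 by (simp add: field_simps)
    also have "\<dots> \<le> ?k * measure lebesgue (Q n)" using n k0 by (intro mult_left_mono) auto
    finally show "\<beta> * (1 - 3 * a) / (1 + t) \<le> mean (f t)" using l by linarith
  qed
qed

end

context aging_flow begin

section \<open>Rates for the mean and the deviation of the stress\<close>

lemma force_square_le:
  assumes t: "0 \<le> t" and f: "\<And>y. y \<in> {0..1} \<Longrightarrow> f t y \<le> \<phi>" and \<phi>: "0 \<le> \<phi>"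
  shows "mean (\<lambda>y. (f t y * \<tau> t y)\<^sup>2) \<le> \<phi>\<^sup>2 * ((mean (\<tau> t))\<^sup>2 + dF * F t)"
proof -
  have "mean (\<lambda>y. (f t y * \<tau> t y)\<^sup>2) \<le> mean (\<lambda>y. \<phi>\<^sup>2 * (\<tau> t y)\<^sup>2 + 0 * 0)"
  proof (rule mean_mono)
    fix y :: real assume y: "y \<in> {0..1}"
    have "(f t y)\<^sup>2 \<le> \<phi>\<^sup>2" using f[OF y] f_nonneg[OF t y] by (intro power_mono)
    then show "(f t y * \<tau> t y)\<^sup>2 \<le> \<phi>\<^sup>2 * (\<tau> t y)\<^sup>2 + 0 * 0" by (simp add: power_mult_distrib mult_right_mono)
  qed (intro continuous_intros slices t)+
  also have "\<dots> = \<phi>\<^sup>2 * mean (\<lambda>y. (\<tau> t y)\<^sup>2) + 0 * mean (\<lambda>_. 0)" by (intro mean_lin continuous_intros slices t)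
  also have "\<dots> \<le> \<phi>\<^sup>2 * ((mean (\<tau> t))\<^sup>2 + dF * F t)"
    using E_bounds(4)[OF t] dev_le[OF t] by (auto intro!: mult_left_mono)
  finally show ?thesis .
qed

lemma mean_\<tau>_square_increment:
  assumes st: "0 \<le> s" "s \<le> t"
  shows "(mean (\<tau> t))\<^sup>2 - (mean (\<tau> s))\<^sup>2 = integral {s..t} (\<lambda>r. - (2 / lam) * (mean (\<tau> r) * mean (\<lambda>y. f r y * \<tau> r y)))"
proof (rule DERIV_imp_increments[OF _ st])
  fix t :: real assume t: "0 \<le> t"
  have "((\<lambda>t. mean (\<tau> t)) has_real_derivative - mean (\<lambda>y. f t y * \<tau> t y) / lam) (at t within {0..})"
  proof (rule increments_imp_DERIV)
    show "continuous_on {0..} (\<lambda>t. - mean (\<lambda>y. f t y * \<tau> t y) / lam)"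
      using pos by (intro continuous_intros continuous_on_mean cont) auto
    show "mean (\<tau> t) - mean (\<tau> s) = integral {s..t} (\<lambda>t. - mean (\<lambda>y. f t y * \<tau> t y) / lam)" if "0 \<le> s" "s \<le> t" for s t
    proof -
      have "integral {s..t} (\<lambda>t. - mean (\<lambda>y. f t y * \<tau> t y) / lam) = - integral {s..t} (\<lambda>t. mean (\<lambda>y. f t y * \<tau> t y)) / lam"
        using that by (intro integral_unique has_integral_divide has_integral_neg integrable_integral cont_time_integrable continuous_on_mean cont)
      also have "\<dots> = (lam * (mean (\<tau> t) - mean (\<tau> s))) / lam" by (simp only: flow_mean_\<tau>[OF that])
      finally show ?thesis using pos by simp
    qed
  qed (rule t)
  from DERIV_mult[OF this this]
  show "((\<lambda>t. (mean (\<tau> t))\<^sup>2) has_real_derivative - (2 / lam) * (mean (\<tau> t) * mean (\<lambda>y. f t y * \<tau> t y))) (at t within {0..})"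
    by (rule DERIV_cong[THEN has_field_derivative_transform_within[where d=1]])
       (use t in \<open>auto simp: power2_eq_square\<close>)
qed

text \<open>\<open>mean (f \<tau>)\<close> is \<open>mean f mean \<tau>\<close> up to \<open>mean (f (\<tau> - mean \<tau>))\<close>. By Young's inequality the error costs a
  fraction of the damping of \<open>F\<close> and a term \<open>\<phi>\<^sup>2 (mean \<tau>)\<^sup>2\<close>; for \<open>\<phi>\<close> of order \<open>1 / t\<close> this is of higher order.\<close>

lemma mean_production_le:
  assumes t: "0 \<le> t" and f: "\<And>y. y \<in> {0..1} \<Longrightarrow> f t y \<le> \<phi>" and \<phi>: "0 \<le> \<phi>"
  shows "- (2 / lam) * (mean (\<tau> t) * mean (\<lambda>y. f t y * \<tau> t y))
    \<le> - (2 / lam) * mean (f t) * (mean (\<tau> t))\<^sup>2 + 4 * dF / (\<delta> * lam\<^sup>2) * \<phi>\<^sup>2 * (mean (\<tau> t))\<^sup>2 + \<delta> / 4 * F t"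
proof -
  define m where "m = mean (\<tau> t)"
  define \<epsilon> where "\<epsilon> = \<delta> / (4 * dF)"
  have \<epsilon>: "\<epsilon> > 0" using consts_pos dF_pos by (simp add: \<epsilon>_def)
  have "- (2 / lam) * (m * mean (\<lambda>y. f t y * \<tau> t y)) = (- (2 / lam) * m) * mean (\<lambda>y. f t y * \<tau> t y) + 0 * mean (\<lambda>_. 0)" by simp
  also have "\<dots> = mean (\<lambda>y. (- (2 / lam) * m) * (f t y * \<tau> t y) + 0 * 0)"
    by (rule mean_lin[symmetric]; intro continuous_intros slices t)
  also have "\<dots> \<le> mean (\<lambda>y. (- (2 / lam) * m\<^sup>2) * f t y + 1 * (\<epsilon> * (\<tau> t y - m)\<^sup>2 + (1 / (\<epsilon> * lam\<^sup>2) * \<phi>\<^sup>2 * m\<^sup>2) * 1))"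
  proof (rule mean_mono)
    fix y :: real assume y: "y \<in> {0..1}"
    define d where "d = \<tau> t y - m"
    have f2: "(f t y)\<^sup>2 \<le> \<phi>\<^sup>2" using f[OF y] f_nonneg[OF t y] by (intro power_mono)
    have "\<epsilon> * d\<^sup>2 + 1 / (\<epsilon> * lam\<^sup>2) * (f t y)\<^sup>2 * m\<^sup>2 + (2 / lam) * m * (f t y * d) = \<epsilon> * (d + f t y * m / (\<epsilon> * lam))\<^sup>2"
      using \<epsilon> pos by (simp add: field_simps power2_eq_square)
    also have "\<dots> \<ge> 0" using \<epsilon> by simp
    finally have "- ((2 / lam) * m * (f t y * d)) \<le> \<epsilon> * d\<^sup>2 + 1 / (\<epsilon> * lam\<^sup>2) * (f t y)\<^sup>2 * m\<^sup>2" by linarith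
    also have "1 / (\<epsilon> * lam\<^sup>2) * (f t y)\<^sup>2 * m\<^sup>2 \<le> 1 / (\<epsilon> * lam\<^sup>2) * \<phi>\<^sup>2 * m\<^sup>2"
      using f2 \<epsilon> by (intro mult_right_mono mult_left_mono) auto
    finally have k: "- ((2 / lam) * m * (f t y * d)) \<le> \<epsilon> * d\<^sup>2 + 1 / (\<epsilon> * lam\<^sup>2) * \<phi>\<^sup>2 * m\<^sup>2" by simp
    have "(- (2 / lam) * m) * (f t y * \<tau> t y) = (- (2 / lam) * m\<^sup>2) * f t y + - ((2 / lam) * m * (f t y * d))"
      by (simp add: d_def algebra_simps power2_eq_square)
    then show "(- (2 / lam) * m) * (f t y * \<tau> t y) + 0 * 0
       \<le> (- (2 / lam) * m\<^sup>2) * f t y + 1 * (\<epsilon> * (\<tau> t y - m)\<^sup>2 + (1 / (\<epsilon> * lam\<^sup>2) * \<phi>\<^sup>2 * m\<^sup>2) * 1)"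
      using k unfolding d_def by simp
  qed (intro continuous_intros slices t)+
  also have "\<dots> = (- (2 / lam) * m\<^sup>2) * mean (f t) + 1 * mean (\<lambda>y. \<epsilon> * (\<tau> t y - m)\<^sup>2 + (1 / (\<epsilon> * lam\<^sup>2) * \<phi>\<^sup>2 * m\<^sup>2) * 1)"
    by (intro mean_lin continuous_intros slices t)
  also have "mean (\<lambda>y. \<epsilon> * (\<tau> t y - m)\<^sup>2 + (1 / (\<epsilon> * lam\<^sup>2) * \<phi>\<^sup>2 * m\<^sup>2) * 1) = \<epsilon> * dev t + (1 / (\<epsilon> * lam\<^sup>2) * \<phi>\<^sup>2 * m\<^sup>2) * mean (\<lambda>_. 1)"
    unfolding dev_def m_def[symmetric] by (intro mean_lin continuous_intros slices t)
  also have "\<epsilon> * dev t \<le> \<epsilon> * (dF * F t)" using dev_le[OF t] \<epsilon> by (intro mult_left_mono) auto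
  also have "\<epsilon> * (dF * F t) = \<delta> / 4 * F t" using dF_pos by (simp add: \<epsilon>_def)
  finally show ?thesis using dF_pos consts_pos by (simp add: m_def \<epsilon>_def field_simps)
qed

definition N where "N t = (mean (\<tau> t))\<^sup>2 + F t"

lemma N_nonneg: "0 \<le> t \<Longrightarrow> 0 \<le> N t"
  using F_nonneg by (simp add: N_def)

lemma N_cont: "continuous_on {0..} N"
  unfolding N_def[abs_def] by (intro continuous_intros continuous_on_mean cont F_cont)

text \<open>In \<open>N' \<le> - q / (1 + t) N\<close> the exponent is dictated by the mean of \<open>f\<close>, since \<open>F\<close> decays much faster on
  its own and all coupling terms are of order \<open>1 / t\<^sup>2\<close>. The gap \<open>g\<close> between \<open>2 b / \<lambda>\<close> and \<open>q\<close> absorbs these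
  from the time \<open>T'\<close> on.\<close>

lemma N_decay:
  assumes T: "0 \<le> T" and f: "\<And>t y. T \<le> t \<Longrightarrow> y \<in> {0..1} \<Longrightarrow> f t y \<le> 4 / (1 + t)"
    and m: "\<And>t. T \<le> t \<Longrightarrow> b / (1 + t) \<le> mean (f t)" and q: "0 \<le> q" "q < 2 / lam * b"
  obtains T' C where "T \<le> T'" "\<And>t. T' \<le> t \<Longrightarrow> N t \<le> C * (1 + t) powr (- q)"
proof -
  define g where "g = 2 / lam * b - q"
  have g: "0 < g" using q by (simp add: g_def)
  define C2 where "C2 = 4 * dF / (\<delta> * lam\<^sup>2) + K1"
  have C2: "0 < C2" unfolding C2_def using dF_pos consts_pos pos by (intro add_pos_pos divide_pos_pos mult_pos_pos) auto
  \<comment> \<open>the last two summands make \<open>4\<close> and \<open>5\<close> below hold, respectively\<close>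
  define T' where "T' = T + 16 * C2 / g + (16 * K1 * dF + q) * (4 / (3 * \<delta>))"
  have "0 \<le> 16 * C2 / g" "0 \<le> (16 * K1 * dF + q) * (4 / (3 * \<delta>))" using C2 g dF_pos consts_pos q by auto
  then have T': "T \<le> T'" "0 \<le> T'" "16 * C2 / g \<le> T'" "(16 * K1 * dF + q) * (4 / (3 * \<delta>)) \<le> T'"
    using T unfolding T'_def by linarith+
  show ?thesis
  proof (rule that[OF T'(1)])
    fix t assume t: "T' \<le> t"
    show "N t \<le> (N T' * (1 + T') powr q) * (1 + t) powr (- q)"
    proof (rule algebraic_decay[OF _ T'(2) q(1) _ t])
      show "continuous_on {T'..} N" by (rule continuous_on_subset[OF N_cont]) (use T' in auto)
      fix s t assume st: "T' \<le> s" "s \<le> t"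
      then have st0: "0 \<le> s" "s \<le> t" using T' by auto
      let ?x = "\<lambda>r. - (2 / lam) * (mean (\<tau> r) * mean (\<lambda>y. f r y * \<tau> r y))"
      let ?F = "\<lambda>r. K1 * mean (\<lambda>y. (f r y * \<tau> r y)\<^sup>2) - \<delta> * F r"
      have i: "?x integrable_on {s..t}" "?F integrable_on {s..t}"
        using st0 by (intro cont_time_integrable continuous_on_diff continuous_on_mult continuous_on_const F_cont continuous_on_mean jc_power cont; simp)+
      have "N t - N s = ((mean (\<tau> t))\<^sup>2 - (mean (\<tau> s))\<^sup>2) + (F t - F s)" by (simp add: N_def)
      also have "\<dots> \<le> integral {s..t} ?x + integral {s..t} ?F"
        using mean_\<tau>_square_increment[OF st0] F_decay[OF st0] by linarith
      also have "\<dots> = integral {s..t} (\<lambda>r. ?x r + ?F r)"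
        by (rule integral_unique[symmetric]) (intro has_integral_add integrable_integral i)
      also have "\<dots> \<le> integral {s..t} (\<lambda>r. - (q / (1 + r) * N r))"
      proof (rule integral_le)
        show "(\<lambda>r. ?x r + ?F r) integrable_on {s..t}" by (intro integrable_add i)
        show "(\<lambda>r. - (q / (1 + r) * N r)) integrable_on {s..t}"
          using st0 by (intro cont_time_integrable continuous_intros N_cont) auto
        fix r assume "r \<in> {s..t}"
        then have r: "0 \<le> r" "T \<le> r" "T' \<le> r" using st T' by auto
        define x where "x = (mean (\<tau> r))\<^sup>2"
        define e where "e = 1 / (1 + r)"
        have e: "0 < e" "e \<le> 1" using r by (auto simp: e_def)
        have \<phi>: "4 / (1 + r) = 4 * e" by (simp add: e_def)
        have nn: "0 \<le> x" "0 \<le> F r" using F_nonneg[OF r(1)] by (auto simp: x_def)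
        have fr: "f r y \<le> 4 * e" if "y \<in> {0..1}" for y using f[OF r(2) that] \<phi> by simp
        have p4: "0 \<le> 4 * e" using e by simp
        have 1: "?x r \<le> - (2 / lam) * mean (f r) * x + 4 * dF / (\<delta> * lam\<^sup>2) * (4 * e)\<^sup>2 * x + \<delta> / 4 * F r"
          unfolding x_def by (rule mean_production_le[OF r(1) fr p4])
        have 2: "K1 * mean (\<lambda>y. (f r y * \<tau> r y)\<^sup>2) \<le> K1 * ((4 * e)\<^sup>2 * (x + dF * F r))"
          unfolding x_def using force_square_le[OF r(1) fr p4] consts_pos by (intro mult_left_mono) auto
        have 3: "(2 / lam) * b * e * x \<le> (2 / lam) * mean (f r) * x"
        proof -
          have "b * e \<le> mean (f r)" using m[OF r(2)] by (simp add: e_def)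
          then have "(2 / lam) * (b * e) * x \<le> (2 / lam) * mean (f r) * x"
            using pos nn by (intro mult_right_mono mult_left_mono) auto
          then show ?thesis by (simp add: mult.assoc)
        qed
        have 4: "16 * C2 * e * (e * x) \<le> g * (e * x)"
        proof (rule mult_right_mono)
          have "16 * C2 / g \<le> 1 + r" using T'(3) r by linarith
          then have "16 * C2 \<le> g * (1 + r)" using g by (simp add: field_simps)
          then show "16 * C2 * e \<le> g" using r by (simp add: e_def divide_le_eq)
        qed (use e nn in auto)
        have 5: "(16 * K1 * dF * e\<^sup>2 + q * e) * F r \<le> (3 / 4 * \<delta>) * F r"
        proof (rule mult_right_mono)
          have "(16 * K1 * dF + q) * (4 / (3 * \<delta>)) \<le> 1 + r" using T'(4) r by linarith
          then have k: "(16 * K1 * dF + q) \<le> 3 / 4 * \<delta> * (1 + r)" using consts_pos by (simp add: field_simps)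
          have "16 * K1 * dF * e\<^sup>2 \<le> 16 * K1 * dF * e"
            using e consts_pos dF_pos by (intro mult_left_mono) (auto simp: power2_eq_square mult_left_le)
          then have "16 * K1 * dF * e\<^sup>2 + q * e \<le> (16 * K1 * dF + q) * e" by (simp add: algebra_simps)
          also have "\<dots> \<le> 3 / 4 * \<delta> * (1 + r) * e" using k e by (intro mult_right_mono) auto
          also have "\<dots> = 3 / 4 * \<delta>"
          proof -
            have "(1 + r) * e = 1" using r by (simp add: e_def)
            then show ?thesis by (simp only: mult.assoc mult_1_right)
          qed
          finally show "16 * K1 * dF * e\<^sup>2 + q * e \<le> 3 / 4 * \<delta>" .
        qed (use nn in auto)
        have "?x r + ?F r \<le> - ((2 / lam) * mean (f r) * x) + 4 * dF / (\<delta> * lam\<^sup>2) * (4 * e)\<^sup>2 * x + \<delta> / 4 * F r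
            + (K1 * ((4 * e)\<^sup>2 * (x + dF * F r)) - \<delta> * F r)"
          using 1 2 by (simp only: mult_minus_left)
        also have "\<dots> = - ((2 / lam) * mean (f r) * x) + 16 * C2 * e * (e * x) + 16 * K1 * dF * e\<^sup>2 * F r - 3 / 4 * \<delta> * F r"
          by (simp add: C2_def power2_eq_square algebra_simps)
        also have "\<dots> \<le> - ((2 / lam) * b * e * x) + g * (e * x) - q * e * F r"
          using 3 4 5 by (simp add: distrib_right)
        also have "\<dots> = - (q * e * (x + F r))" by (simp add: g_def algebra_simps)
        also have "\<dots> = - (q / (1 + r) * N r)" by (simp add: N_def x_def e_def)
        finally show "?x r + ?F r \<le> - (q / (1 + r) * N r)" .
      qed
      finally show "N t - N s \<le> integral {s..t} (\<lambda>r. - (q / (1 + r) * N r))" .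
    qed
  qed
qed

text \<open>Now the force is known to be of order \<open>1 / t\<close> times the square root of \<open>N\<close>, and exponential damping
  lets \<open>F\<close> follow its square.\<close>

lemma F_rate:
  assumes T: "0 \<le> T" and f: "\<And>t y. T \<le> t \<Longrightarrow> y \<in> {0..1} \<Longrightarrow> f t y \<le> 4 / (1 + t)"
    and q: "0 \<le> q" and N: "\<And>t. T \<le> t \<Longrightarrow> N t \<le> C * (1 + t) powr (- q)"
  obtains T' K where "T \<le> T'" "\<And>t. T' \<le> t \<Longrightarrow> F t \<le> K * (1 + t) powr (- (2 + q))"
proof -
  define T' where "T' = T + 32 * K1 * dF / \<delta> + 4 * (2 + q) / \<delta>"
  have "0 \<le> 32 * K1 * dF / \<delta>" "0 \<le> 4 * (2 + q) / \<delta>" using dF_pos consts_pos q by auto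
  then have T': "T \<le> T'" "0 \<le> T'" "32 * K1 * dF / \<delta> \<le> T'" "4 * (2 + q) / \<delta> \<le> T'"
    using T unfolding T'_def by linarith+
  have C: "0 \<le> C"
  proof -
    have "0 \<le> C * (1 + T) powr (- q)" using N[of T] N_nonneg[OF T] by simp
    moreover have "0 < (1 + T) powr (- q)" using T by simp
    ultimately show ?thesis by (simp add: zero_le_mult_iff)
  qed
  define C1 where "C1 = 16 * K1 * C"
  have C1: "0 \<le> C1" using C consts_pos by (simp add: C1_def)
  define K where "K = 4 * C1 / \<delta> + F T' * (1 + T') powr (2 + q)"
  have FT: "0 \<le> F T'" using F_nonneg T' by simp
  show ?thesis
  proof (rule that[OF T'(1)])
    fix t assume t: "T' \<le> t"
    show "F t \<le> K * (1 + t) powr (- (2 + q))"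
    proof (rule exponential_decay_powr[where C=C1 and \<delta>="\<delta> / 2" and T=T'])
      show "continuous_on {T'..} F" by (rule continuous_on_subset[OF F_cont]) (use T' in auto)
      show "2 * (2 + q) \<le> \<delta> / 2 * (1 + T')"
      proof -
        have "4 * (2 + q) / \<delta> \<le> 1 + T'" using T'(4) by linarith
        then show ?thesis using consts_pos by (simp add: field_simps)
      qed
      show "2 * C1 \<le> \<delta> / 2 * K" "0 \<le> K"
        using consts_pos C1 FT by (auto simp: K_def field_simps intro!: add_nonneg_nonneg mult_nonneg_nonneg)
      show "F T' \<le> K * (1 + T') powr - (2 + q)"
      proof -
        have "F T' = F T' * (1 + T') powr (2 + q) * (1 + T') powr - (2 + q)"
          using T' by (simp add: mult.assoc powr_add[symmetric])
        also have "\<dots> \<le> K * (1 + T') powr - (2 + q)"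
          using C1 consts_pos by (intro mult_right_mono) (auto simp: K_def)
        finally show ?thesis .
      qed
      fix s t assume st: "T' \<le> s" "s \<le> t"
      then have st0: "0 \<le> s" "s \<le> t" using T' by auto
      have "F t - F s \<le> integral {s..t} (\<lambda>r. K1 * mean (\<lambda>y. (f r y * \<tau> r y)\<^sup>2) - \<delta> * F r)"
        by (rule F_decay[OF st0])
      also have "\<dots> \<le> integral {s..t} (\<lambda>r. C1 * (1 + r) powr - (2 + q) - \<delta> / 2 * F r)"
      proof (rule integral_le)
        show "(\<lambda>r. K1 * mean (\<lambda>y. (f r y * \<tau> r y)\<^sup>2) - \<delta> * F r) integrable_on {s..t}"
          using st0 by (intro cont_time_integrable continuous_on_diff continuous_on_mult continuous_on_const F_cont continuous_on_mean jc_power cont)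
        show "(\<lambda>r. C1 * (1 + r) powr - (2 + q) - \<delta> / 2 * F r) integrable_on {s..t}"
          using st0 by (intro cont_time_integrable continuous_intros F_cont continuous_on_powr) auto
        fix r assume "r \<in> {s..t}"
        then have r: "0 \<le> r" "T \<le> r" "T' \<le> r" using st T' by auto
        define e where "e = 1 / (1 + r)"
        have e: "0 < e" "e \<le> 1" using r by (auto simp: e_def)
        have fr: "f r y \<le> 4 * e" if "y \<in> {0..1}" for y using f[OF r(2) that] by (simp add: e_def)
        have p4: "0 \<le> 4 * e" using e by simp
        have nn: "0 \<le> F r" using F_nonneg[OF r(1)] .
        have xN: "(mean (\<tau> r))\<^sup>2 \<le> C * (1 + r) powr (- q)" using N[OF r(2)] nn by (simp add: N_def)
        have "K1 * mean (\<lambda>y. (f r y * \<tau> r y)\<^sup>2) \<le> K1 * ((4 * e)\<^sup>2 * ((mean (\<tau> r))\<^sup>2 + dF * F r))"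
          using force_square_le[OF r(1) fr p4] consts_pos by (intro mult_left_mono) auto
        also have "\<dots> \<le> K1 * ((4 * e)\<^sup>2 * (C * (1 + r) powr (- q) + dF * F r))"
          using xN consts_pos by (intro mult_left_mono add_right_mono) auto
        also have "\<dots> = C1 * (e\<^sup>2 * (1 + r) powr (- q)) + 16 * K1 * dF * e\<^sup>2 * F r"
          by (simp add: C1_def power2_eq_square algebra_simps)
        also have "e\<^sup>2 * (1 + r) powr (- q) = (1 + r) powr - (2 + q)"
        proof -
          have "(1 + r) powr - (2 + q) = (1 + r) powr (- q) * (1 + r) powr (- 2)"
            by (simp add: powr_add[symmetric] algebra_simps)
          also have "(1 + r) powr (- 2) = e\<^sup>2"
            using r by (simp add: e_def powr_minus powr_numeral power_one_over inverse_eq_divide)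
          finally show ?thesis by simp
        qed
        also have "16 * K1 * dF * e\<^sup>2 * F r \<le> \<delta> / 2 * F r"
        proof (rule mult_right_mono[OF _ nn])
          have "32 * K1 * dF / \<delta> \<le> 1 + r" using T'(3) r by linarith
          then have k: "16 * K1 * dF \<le> \<delta> / 2 * (1 + r)" using consts_pos by (simp add: field_simps)
          have "16 * K1 * dF * e\<^sup>2 \<le> 16 * K1 * dF * e"
            using e consts_pos dF_pos by (intro mult_left_mono) (auto simp: power2_eq_square mult_left_le)
          also have "\<dots> \<le> \<delta> / 2 * (1 + r) * e" using k e by (intro mult_right_mono) auto
          also have "\<dots> = \<delta> / 2"
          proof -
            have "(1 + r) * e = 1" using r by (simp add: e_def)
            then show ?thesis by (simp only: mult.assoc mult_1_right)
          qed
          finally show "16 * K1 * dF * e\<^sup>2 \<le> \<delta> / 2" .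
        qed
        finally show "K1 * mean (\<lambda>y. (f r y * \<tau> r y)\<^sup>2) - \<delta> * F r \<le> C1 * (1 + r) powr - (2 + q) - \<delta> / 2 * F r" by simp
      qed
      finally show "F t - F s \<le> integral {s..t} (\<lambda>r. C1 * (1 + r) powr - (2 + q) - \<delta> / 2 * F r)" .
    qed (use T' consts_pos q t in auto)
  qed
qed

text \<open>The choice \<open>a = \<alpha> / 4\<close> turns the loss factor \<open>1 - 3 a\<close> of \<open>mean_f_lower\<close> into a gap to \<open>1 - \<alpha>\<close>.\<close>

lemma decay_rates:
  assumes \<alpha>: "0 < \<alpha>" "\<alpha> < 1"
  defines "q \<equiv> 2 * (\<beta> / lam * (1 - \<alpha>))"
  obtains T C where "0 \<le> T" "0 \<le> C"
    "\<And>t y. T \<le> t \<Longrightarrow> y \<in> {0..1} \<Longrightarrow> 1 - \<alpha> \<le> rate t y \<and> rate t y \<le> 1 + \<alpha>"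
    "\<And>t y. T \<le> t \<Longrightarrow> y \<in> {0..1} \<Longrightarrow> f t y \<le> 4 / (1 + t)"
    "\<And>t. T \<le> t \<Longrightarrow> N t \<le> C * (1 + t) powr (- q)"
    "\<And>t. T \<le> t \<Longrightarrow> F t \<le> C * (1 + t) powr (- (2 + q))"
proof -
  define a where "a = \<alpha> / 4"
  have a: "0 < a" "a < 1" "a \<le> 1 / 2" using \<alpha> by (auto simp: a_def)
  have q0: "0 \<le> q" using \<beta>_pos pos \<alpha> by (simp add: q_def)
  obtain T1 where T1: "0 \<le> T1" "\<And>t y. T1 \<le> t \<Longrightarrow> y \<in> {0..1} \<Longrightarrow> 1 - a \<le> rate t y \<and> rate t y \<le> 1 + a"
    using rate_close[OF a(1)] by blast
  obtain T2 where T2: "T1 \<le> T2" "\<And>t. T2 \<le> t \<Longrightarrow> \<beta> * (1 - 3 * a) / (1 + t) \<le> mean (f t)"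
    using mean_f_lower[OF T1(1) a(1,2) T1(2)] by blast
  define T3 where "T3 = 2 * T2 + 1"
  have T3: "0 \<le> T3" "T1 \<le> T3" "T2 \<le> T3" "2 * T1 + 1 \<le> T3" using T1(1) T2(1) by (auto simp: T3_def)
  have f4: "f t y \<le> 4 / (1 + t)" if "T3 \<le> t" "y \<in> {0..1}" for t y
    using that T3 by (intro f_upper_rate[OF T1(1) _ that(2) a(3) T1(2)]) auto
  have q1: "q < 2 / lam * (\<beta> * (1 - 3 * a))"
  proof -
    have "\<beta> / lam * (1 - \<alpha>) < \<beta> / lam * (1 - 3 * a)"
      using \<beta>_pos pos \<alpha> by (intro mult_strict_left_mono) (auto simp: a_def)
    then have "q < 2 * (\<beta> / lam * (1 - 3 * a))" by (simp add: q_def)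
    also have "\<dots> = 2 / lam * (\<beta> * (1 - 3 * a))" by simp
    finally show ?thesis .
  qed
  have m3: "\<beta> * (1 - 3 * a) / (1 + t) \<le> mean (f t)" if "T3 \<le> t" for t using T2(2)[of t] T3 that by auto
  obtain T4 C where T4: "T3 \<le> T4" "\<And>t. T4 \<le> t \<Longrightarrow> N t \<le> C * (1 + t) powr (- q)"
    using N_decay[OF T3(1) f4 m3 q0 q1] by blast
  have T40: "0 \<le> T4" using T4 T3 by simp
  have f44: "f t y \<le> 4 / (1 + t)" if "T4 \<le> t" "y \<in> {0..1}" for t y using f4[of t y] that T4(1) by auto
  obtain T5 K where T5: "T4 \<le> T5" "\<And>t. T5 \<le> t \<Longrightarrow> F t \<le> K * (1 + t) powr (- (2 + q))"
    using F_rate[OF T40 f44 q0 T4(2)] by blast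
  show ?thesis
  proof (rule that[of T5 "max 0 (max C K)"])
    show "1 - \<alpha> \<le> rate t y \<and> rate t y \<le> 1 + \<alpha>" if "T5 \<le> t" "y \<in> {0..1}" for t y
      using T1(2)[of t y] that T3 T4 T5 \<alpha> by (auto simp: a_def)
    show "f t y \<le> 4 / (1 + t)" if "T5 \<le> t" "y \<in> {0..1}" for t y using f44[of t y] that T5(1) by auto
    show "N t \<le> max 0 (max C K) * (1 + t) powr - q" if "T5 \<le> t" for t
    proof -
      have "N t \<le> C * (1 + t) powr - q" using T4(2)[of t] that T5(1) by auto
      also have "\<dots> \<le> max 0 (max C K) * (1 + t) powr - q" by (intro mult_right_mono) auto
      finally show ?thesis .
    qed
    show "F t \<le> max 0 (max C K) * (1 + t) powr - (2 + q)" if "T5 \<le> t" for t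
    proof -
      have "F t \<le> K * (1 + t) powr - (2 + q)" using T5(2)[of t] that by auto
      also have "\<dots> \<le> max 0 (max C K) * (1 + t) powr - (2 + q)" by (intro mult_right_mono) auto
      finally show ?thesis .
    qed
  qed (use T5 T40 in auto)
qed

end

section \<open>Difference quotients in time\<close>

definition dq :: "real \<Rightarrow> (real \<Rightarrow> real \<Rightarrow> real) \<Rightarrow> real \<Rightarrow> real \<Rightarrow> real" where
  "dq h w t y = (w (t + h) y - w t y) / h"

lemma jc_shift:
  assumes "jc w" "0 \<le> h" shows "jc (\<lambda>t y. w (t + h) y)"
  unfolding jc_def by (rule jc_comp[OF assms(1)]) (use assms(2) in \<open>auto intro!: continuous_intros\<close>)

lemma jc_dq: "jc w \<Longrightarrow> 0 \<le> h \<Longrightarrow> jc (dq h w)"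
  unfolding dq_def[abs_def] by (intro jc_intros jc_shift)

lemma mean_dq:
  assumes "jc w" "0 \<le> h" "0 \<le> t" shows "mean (dq h w t) = (mean (w (t + h)) - mean (w t)) / h"
  unfolding mean_def dq_def[abs_def] using assms
  by (intro integral_unique has_integral_divide has_integral_diff integrable_integral jc_integrable) auto

lemma prim_dq:
  assumes "jc w" "0 \<le> h" "0 \<le> t" "y \<in> {0..1}" shows "prim (dq h w t) y = (prim (w (t + h)) y - prim (w t) y) / h"
proof -
  have "w r integrable_on {0..y}" if "0 \<le> r" for r
    using assms that by (intro integrable_continuous_real continuous_on_subset[OF jc_slice[OF assms(1)]]) auto
  then show ?thesis unfolding prim_def dq_def[abs_def] using assms
    by (intro integral_unique has_integral_divide has_integral_diff integrable_integral) auto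
qed

lemma zprim_dq:
  assumes "jc w" "0 \<le> h" "0 \<le> t" "y \<in> {0..1}" shows "zprim (dq h w t) y = (zprim (w (t + h)) y - zprim (w t) y) / h"
proof -
  have "mean (prim (dq h w t)) = mean (dq h (\<lambda>t. prim (w t)) t)"
    using assms by (intro mean_cong) (simp add: prim_dq dq_def)
  then show ?thesis using assms by (simp add: zprim_def prim_dq mean_dq jc_prim diff_divide_distrib)
qed

lemma integral_shift_time:
  fixes f :: "real \<Rightarrow> real"
  assumes "continuous_on {0..} f" "0 \<le> s" "s \<le> t" "0 \<le> h"
  shows "integral {s..t} (\<lambda>r. f (r + h)) = integral {s+h..t+h} f"
proof -
  have "((\<lambda>r. 1 *\<^sub>R f (r + h)) has_integral integral {s + h..t + h} f) {s..t}"
    by (rule has_integral_substitution[where c="s+h" and d="t+h"])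
       (use assms in \<open>auto intro!: derivative_eq_intros continuous_on_subset[OF assms(1)]\<close>)
  then show ?thesis by (simp add: integral_unique)
qed

lemma integral_dq:
  assumes w: "jc w" "0 \<le> h" "0 \<le> s" "s \<le> t" "y \<in> {0..1}"
  shows "integral {s..t} (\<lambda>r. dq h w r y) = (integral {s+h..t+h} (\<lambda>r. w r y) - integral {s..t} (\<lambda>r. w r y)) / h"
proof -
  have "integral {s..t} (\<lambda>r. dq h w r y) = (integral {s..t} (\<lambda>r. w (r + h) y) - integral {s..t} (\<lambda>r. w r y)) / h"
    unfolding dq_def using w
    by (intro integral_unique has_integral_divide has_integral_diff integrable_integral
        jc_time_integrable[OF jc_shift[OF w(1,2)]] jc_time_integrable[OF w(1)]) auto
  also have "integral {s..t} (\<lambda>r. w (r + h) y) = integral {s+h..t+h} (\<lambda>r. w r y)"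
    using integral_shift_time[OF jc_time[OF w(1)]] w by auto
  finally show ?thesis .
qed

context linear_flow begin

lemma v_dq: "0 \<le> h \<Longrightarrow> 0 \<le> t \<Longrightarrow> y \<in> {0..1} \<Longrightarrow> \<rho> * zprim (dq h u t) y = dq h v t y"
  using zprim_dq[OF cont(1)] by (simp add: v_def dq_def right_diff_distrib)

text \<open>The system is linear and autonomous.\<close>

lemma dq_flow:
  assumes h: "0 < h"
  shows "linear_flow \<rho> \<eta> lam G (dq h u) (dq h \<tau>) (dq h g)"
proof
  have h0: "0 \<le> h" using h by simp
  show "jc (dq h u)" "jc (dq h \<tau>)" "jc (dq h g)" by (intro jc_dq cont h0)+
  show "dq h u t 0 = 0 \<and> dq h u t 1 = 0" if "0 \<le> t" for t
    using u_bdry[of t] u_bdry[of "t + h"] that h by (simp add: dq_def)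
  have key: "(\<rho> * zprim (dq h u t) y - \<rho> * zprim (dq h u s) y - integral {s..t} (\<lambda>r. dq h \<tau> r y - mean (dq h \<tau> r))) / \<eta>
      = (D (s + h) (t + h) y - D s t y) / h" if st: "0 \<le> s" "s \<le> t" "y \<in> {0..1}" for s t y
  proof -
    have j: "jc (\<lambda>r y. \<tau> r y - mean (\<tau> r))" by (intro jc_intros cont)
    have "integral {s..t} (\<lambda>r. dq h \<tau> r y - mean (dq h \<tau> r)) = integral {s..t} (\<lambda>r. dq h (\<lambda>r y. \<tau> r y - mean (\<tau> r)) r y)"
      by (rule Henstock_Kurzweil_Integration.integral_cong)
         (use st h in \<open>auto simp: mean_dq[OF cont(2) h0] dq_def diff_divide_distrib\<close>)
    also have "\<dots> = (integral {s+h..t+h} (\<lambda>r. \<tau> r y - mean (\<tau> r)) - integral {s..t} (\<lambda>r. \<tau> r y - mean (\<tau> r))) / h"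
      by (rule integral_dq[OF j h0 st])
    finally show ?thesis using v_dq[OF h0, of t y] v_dq[OF h0, of s y] st
      by (simp add: D_def dq_def diff_divide_distrib mult.commute[of \<eta> h])
  qed
  show "((\<lambda>y. integral {s..t} (\<lambda>r. dq h u r y)) has_real_derivative
        (\<rho> * zprim (dq h u t) y - \<rho> * zprim (dq h u s) y - integral {s..t} (\<lambda>r. dq h \<tau> r y - mean (dq h \<tau> r))) / \<eta>)
        (at y within {0..1})" if st: "0 \<le> s" "s \<le> t" "y \<in> {0..1}" for s t y
  proof -
    have "((\<lambda>y. (integral {s+h..t+h} (\<lambda>r. u r y) - integral {s..t} (\<lambda>r. u r y)) / h) has_real_derivative
        (D (s + h) (t + h) y - D s t y) / h) (at y within {0..1})"
      using st h by (intro DERIV_cdivide DERIV_diff flow_u') auto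
    then show ?thesis unfolding key[OF st]
    proof (rule has_field_derivative_transform_within[where d=1])
      fix x :: real assume "x \<in> {0..1}"
      then show "(integral {s+h..t+h} (\<lambda>r. u r x) - integral {s..t} (\<lambda>r. u r x)) / h = integral {s..t} (\<lambda>r. dq h u r x)"
        by (rule integral_dq[OF cont(1) h0 st(1,2), symmetric])
    qed (use st in auto)
  qed
  show "lam * (dq h \<tau> t y - dq h \<tau> s y) =
        G * ((\<rho> * zprim (dq h u t) y - \<rho> * zprim (dq h u s) y - integral {s..t} (\<lambda>r. dq h \<tau> r y - mean (dq h \<tau> r))) / \<eta>)
        - integral {s..t} (\<lambda>r. dq h g r y)" if st: "0 \<le> s" "s \<le> t" "y \<in> {0..1}" for s t y
  proof -
    have "lam * (dq h \<tau> t y - dq h \<tau> s y) = (lam * (\<tau> (t + h) y - \<tau> (s + h) y) - lam * (\<tau> t y - \<tau> s y)) / h"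
      by (simp add: dq_def diff_divide_distrib right_diff_distrib)
    also have "\<dots> = (G * D (s+h) (t+h) y - integral {s+h..t+h} (\<lambda>r. g r y) - (G * D s t y - integral {s..t} (\<lambda>r. g r y))) / h"
      using flow_\<tau>'[OF st] flow_\<tau>'[of "s + h" "t + h" y] st h by simp
    also have "\<dots> = G * ((D (s+h) (t+h) y - D s t y) / h) - (integral {s+h..t+h} (\<lambda>r. g r y) - integral {s..t} (\<lambda>r. g r y)) / h"
      by (simp add: diff_divide_distrib right_diff_distrib)
    finally show ?thesis unfolding key[OF st] integral_dq[OF cont(3) h0 st] .
  qed
qed (use pos in auto)

end

lemma integral_bounded_by:
  fixes p :: "real \<Rightarrow> real"
  assumes "p integrable_on {s..t}" "s \<le> t" "\<And>r. r \<in> {s..t} \<Longrightarrow> \<bar>p r\<bar> \<le> B"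
  shows "\<bar>integral {s..t} p\<bar> \<le> (t - s) * B"
proof -
  have k: "((\<lambda>r. k) has_integral k * (t - s)) {s..t}" for k :: real
    using has_integral_const_real[of k s t] assms(2) by (simp add: mult.commute)
  have "integral {s..t} p \<le> B * (t - s)"
    using has_integral_le[OF integrable_integral[OF assms(1)] k[of B]] assms(3) by (simp add: abs_le_iff)
  moreover have "- B * (t - s) \<le> integral {s..t} p"
    using has_integral_le[OF k[of "- B"] integrable_integral[OF assms(1)]] assms(3) by (simp add: abs_le_iff minus_le_iff)
  ultimately show ?thesis by (simp add: abs_le_iff mult.commute)
qed

context aging_flow begin

text \<open>Product rule: the quotient of \<open>f\<close> is of order \<open>f\<^sup>2\<close>, that of \<open>\<tau>\<close> has mean of the order of \<open>f \<tau>\<close>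
  by the equation of the mean stress, and the deviation of the latter from its mean is left for the damping to
  absorb. All bounds are uniform in \<open>h\<close>.\<close>

lemma dq_force_le:
  assumes T: "0 \<le> T" and C: "0 \<le> C" and q: "0 \<le> q"
    and r: "\<And>t y. T \<le> t \<Longrightarrow> y \<in> {0..1} \<Longrightarrow> 0 \<le> rate t y \<and> rate t y \<le> 2"
    and f: "\<And>t y. T \<le> t \<Longrightarrow> y \<in> {0..1} \<Longrightarrow> f t y \<le> 4 / (1 + t)"
    and N: "\<And>t. T \<le> t \<Longrightarrow> N t \<le> C * (1 + t) powr (- q)"
    and h: "0 < h" and t: "T \<le> t"
  defines "e \<equiv> 1 / (1 + t)" and "P \<equiv> (1 + dF) * C * (1 + t) powr (- q)"
  shows "mean (\<lambda>y. (dq h (\<lambda>t y. f t y * \<tau> t y) t y)\<^sup>2)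
    \<le> (3072 + 768 / lam\<^sup>2) * (e ^ 4 * P) + 48 * e\<^sup>2 * mean (\<lambda>y. (dq h \<tau> t y - mean (dq h \<tau> t))\<^sup>2)"
proof -
  have t0: "0 \<le> t" using t T by simp
  have h0: "0 \<le> h" using h by simp
  have e: "0 < e" using t0 by (simp add: e_def)
  have P0: "0 \<le> P" using C dF_pos by (simp add: P_def)
  have N2: "(mean (\<tau> r))\<^sup>2 + dF * F r \<le> P" if tr: "t \<le> r" for r
  proof -
    have r0: "0 \<le> r" "T \<le> r" using tr t0 t by auto
    have "(mean (\<tau> r))\<^sup>2 + dF * F r \<le> (1 + dF) * N r"
    proof -
      have "0 \<le> dF * (mean (\<tau> r))\<^sup>2" "0 \<le> F r" using dF_pos F_nonneg[OF r0(1)] by auto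
      then show ?thesis by (simp add: N_def algebra_simps)
    qed
    also have "\<dots> \<le> (1 + dF) * (C * (1 + r) powr (- q))" using N[OF r0(2)] dF_pos by (intro mult_left_mono) auto
    also have "\<dots> \<le> (1 + dF) * (C * (1 + t) powr (- q))"
      using dF_pos C t0 tr q by (intro mult_left_mono powr_mono2') auto
    finally show ?thesis by (simp add: P_def mult.assoc)
  qed
  have fe: "f r y \<le> 4 * e" if "t \<le> r" "y \<in> {0..1}" for r y
  proof -
    have "f r y \<le> 4 / (1 + r)" using f[of r y] that t by auto
    also have "\<dots> \<le> 4 / (1 + t)" using that t0 by (intro divide_left_mono) auto
    finally show ?thesis by (simp add: e_def)
  qed
  have \<tau>2: "mean (\<lambda>y. (\<tau> r y)\<^sup>2) \<le> P" if "t \<le> r" for r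
    using E_bounds(4)[of r] dev_le[of r] N2[OF that] that t0 by auto
  have df: "(dq h f t y)\<^sup>2 \<le> 1024 * e ^ 4" if y: "y \<in> {0..1}" for y
  proof -
    have j: "jc (\<lambda>r y. - rate r y * (f r y)\<^sup>2)" by (intro jc_intros jc_rate jc_f)
    have "f (t + h) y - f t y = integral {t..t+h} (\<lambda>r. - rate r y * (f r y)\<^sup>2)"
      by (rule DERIV_imp_increments[OF f_deriv]) (use y t0 h in auto)
    also have "\<bar>\<dots>\<bar> \<le> (t + h - t) * (32 * e\<^sup>2)"
    proof (rule integral_bounded_by)
      show "(\<lambda>r. - rate r y * (f r y)\<^sup>2) integrable_on {t..t+h}" by (rule jc_time_integrable[OF j t0 y])
      fix s assume s: "s \<in> {t..t+h}"
      have "(f s y)\<^sup>2 \<le> (4 * e)\<^sup>2" using fe[of s y] f_nonneg[of s y] s y t0 by (intro power_mono) auto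
      moreover have "\<bar>rate s y\<bar> \<le> 2" using r[of s y] s y t by auto
      ultimately have "\<bar>rate s y\<bar> * (f s y)\<^sup>2 \<le> 2 * (4 * e)\<^sup>2" by (intro mult_mono) auto
      then show "\<bar>- rate s y * (f s y)\<^sup>2\<bar> \<le> 32 * e\<^sup>2" by (simp add: abs_mult power2_eq_square)
    qed (use h in simp)
    finally have "\<bar>dq h f t y\<bar> \<le> 32 * e\<^sup>2" using h by (simp add: dq_def abs_divide pos_divide_le_eq mult.commute)
    then have "\<bar>dq h f t y\<bar>\<^sup>2 \<le> (32 * e\<^sup>2)\<^sup>2" by (intro power_mono) auto
    then show ?thesis by (simp add: power_mult_distrib power_mult[symmetric])
  qed
  \<comment> \<open>the mean is controlled directly, by \<open>\<lambda> (mean \<tau>)' = - mean (f \<tau>)\<close>\<close>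
  define m where "m = mean (dq h \<tau> t)"
  have m: "m\<^sup>2 \<le> 16 * e\<^sup>2 * P / lam\<^sup>2"
  proof -
    define S where "S = sqrt (16 * e\<^sup>2 * P)"
    have S2: "S\<^sup>2 = 16 * e\<^sup>2 * P" unfolding S_def using P0 by (simp)
    have "\<bar>integral {t..t+h} (\<lambda>r. mean (\<lambda>y. f r y * \<tau> r y))\<bar> \<le> (t + h - t) * S"
    proof (rule integral_bounded_by)
      show "(\<lambda>r. mean (\<lambda>y. f r y * \<tau> r y)) integrable_on {t..t+h}"
        by (intro cont_time_integrable continuous_on_mean cont t0)
      fix s assume s: "s \<in> {t..t+h}"
      then have s0: "0 \<le> s" "t \<le> s" using t0 by auto
      have "(mean (\<lambda>y. f s y * \<tau> s y))\<^sup>2 \<le> mean (\<lambda>y. (f s y * \<tau> s y)\<^sup>2)"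
        unfolding mean_def by (intro square_integral_le continuous_intros slices s0)
      also have "\<dots> \<le> (4 * e)\<^sup>2 * ((mean (\<tau> s))\<^sup>2 + dF * F s)"
        by (rule force_square_le[OF s0(1)]) (use fe[OF s0(2)] e in auto)
      also have "\<dots> \<le> (4 * e)\<^sup>2 * P" using N2[OF s0(2)] by (intro mult_left_mono) auto
      finally have "(mean (\<lambda>y. f s y * \<tau> s y))\<^sup>2 \<le> 16 * e\<^sup>2 * P" by (simp add: power_mult_distrib)
      then show "\<bar>mean (\<lambda>y. f s y * \<tau> s y)\<bar> \<le> S" unfolding S_def using real_sqrt_le_mono real_sqrt_abs by metis
    qed (use h in simp)
    moreover have "lam * (h * m) = - integral {t..t+h} (\<lambda>r. mean (\<lambda>y. f r y * \<tau> r y))"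
      using flow_mean_\<tau>[of t "t + h"] mean_dq[OF cont(2) h0 t0] t0 h by (simp add: m_def)
    ultimately have "\<bar>lam * (h * m)\<bar> \<le> h * S" by simp
    then have "h * \<bar>lam * m\<bar> \<le> h * S" using h by (simp add: abs_mult mult.left_commute)
    then have "\<bar>lam * m\<bar> \<le> S" using h by simp
    then have "\<bar>lam * m\<bar>\<^sup>2 \<le> S\<^sup>2" by (intro power_mono) auto
    then show ?thesis using S2 pos by (simp add: power_mult_distrib field_simps)
  qed
  have cs: "continuous_on {0..1} (dq h (\<lambda>t y. f t y * \<tau> t y) t)" "continuous_on {0..1} (dq h \<tau> t)" "continuous_on {0..1} (\<tau> (t + h))"
    using jc_slice[OF jc_dq[OF cont(3) h0] t0] jc_slice[OF jc_dq[OF cont(2) h0] t0] slices(2)[of "t + h"] t0 h0 by auto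
  have "mean (\<lambda>y. (dq h (\<lambda>t y. f t y * \<tau> t y) t y)\<^sup>2)
    \<le> mean (\<lambda>y. (3 * (1024 * e ^ 4)) * (\<tau> (t + h) y)\<^sup>2 + 1 * ((48 * e\<^sup>2 * m\<^sup>2) * 1 + (48 * e\<^sup>2) * (dq h \<tau> t y - m)\<^sup>2))"
  proof (rule mean_mono)
    fix y :: real assume y: "y \<in> {0..1}"
    define d where "d = dq h \<tau> t y - m"
    have f2: "(f t y)\<^sup>2 \<le> (4 * e)\<^sup>2" using fe[of t y] f_nonneg[of t y] y t0 by (intro power_mono) auto
    have "dq h (\<lambda>t y. f t y * \<tau> t y) t y = dq h f t y * \<tau> (t + h) y + f t y * dq h \<tau> t y"
      by (simp add: dq_def diff_divide_distrib algebra_simps)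
    also have "\<dots> = dq h f t y * \<tau> (t + h) y + f t y * m + f t y * d" by (simp add: d_def algebra_simps)
    also have "(\<dots>)\<^sup>2 \<le> 3 * ((dq h f t y * \<tau> (t + h) y)\<^sup>2 + (f t y * m)\<^sup>2 + (f t y * d)\<^sup>2)"
    proof -
      have "(a + b + c)\<^sup>2 \<le> 3 * (a\<^sup>2 + b\<^sup>2 + c\<^sup>2)" for a b c :: real
        using zero_le_power2[of "a - b"] zero_le_power2[of "a - c"] zero_le_power2[of "b - c"]
        by (simp add: power2_eq_square algebra_simps)
      then show ?thesis .
    qed
    also have "\<dots> \<le> 3 * ((1024 * e ^ 4) * (\<tau> (t + h) y)\<^sup>2 + (4 * e)\<^sup>2 * m\<^sup>2 + (4 * e)\<^sup>2 * d\<^sup>2)"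
      unfolding power_mult_distrib[of "dq h f t y"] power_mult_distrib[of "f t y"]
      using df[OF y] f2 by (intro mult_left_mono add_mono mult_right_mono) auto
    finally show "(dq h (\<lambda>t y. f t y * \<tau> t y) t y)\<^sup>2 \<le> (3 * (1024 * e ^ 4)) * (\<tau> (t + h) y)\<^sup>2 + 1 * ((48 * e\<^sup>2 * m\<^sup>2) * 1 + (48 * e\<^sup>2) * (dq h \<tau> t y - m)\<^sup>2)"
      by (simp add: d_def power_mult_distrib algebra_simps)
  qed (intro continuous_intros cs)+
  also have "\<dots> = (3 * (1024 * e ^ 4)) * mean (\<lambda>y. (\<tau> (t + h) y)\<^sup>2) + 1 * mean (\<lambda>y. (48 * e\<^sup>2 * m\<^sup>2) * 1 + (48 * e\<^sup>2) * (dq h \<tau> t y - m)\<^sup>2)"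
    by (intro mean_lin continuous_intros cs)
  also have "mean (\<lambda>y. (48 * e\<^sup>2 * m\<^sup>2) * 1 + (48 * e\<^sup>2) * (dq h \<tau> t y - m)\<^sup>2) = (48 * e\<^sup>2 * m\<^sup>2) * mean (\<lambda>_. 1) + (48 * e\<^sup>2) * mean (\<lambda>y. (dq h \<tau> t y - m)\<^sup>2)"
    by (intro mean_lin continuous_intros cs)
  also have "(3 * (1024 * e ^ 4)) * mean (\<lambda>y. (\<tau> (t + h) y)\<^sup>2) + 1 * ((48 * e\<^sup>2 * m\<^sup>2) * mean (\<lambda>_. 1) + (48 * e\<^sup>2) * mean (\<lambda>y. (dq h \<tau> t y - m)\<^sup>2))
     \<le> (3 * (1024 * e ^ 4)) * P + 1 * ((48 * e\<^sup>2 * (16 * e\<^sup>2 * P / lam\<^sup>2)) * mean (\<lambda>_. 1) + (48 * e\<^sup>2) * mean (\<lambda>y. (dq h \<tau> t y - m)\<^sup>2))"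
    using \<tau>2[of "t + h"] m h by (intro add_mono mult_left_mono mult_right_mono order_refl) auto
  also have "\<dots> = (3072 + 768 / lam\<^sup>2) * (e ^ 4 * P) + 48 * e\<^sup>2 * mean (\<lambda>y. (dq h \<tau> t y - mean (dq h \<tau> t))\<^sup>2)"
    by (simp add: m_def power4_eq_xxxx power2_eq_square algebra_simps)
  finally show ?thesis .
qed

text \<open>\<open>F_decay\<close> for the difference quotients, whose functional is \<open>I.F\<close>. The starting time \<open>T1\<close> does not
  depend on \<open>h\<close>. The assumption asks for bounded quotients of \<open>v\<close> at time \<open>T1\<close>; those of \<open>w\<close> are bounded by the
  equation of \<open>w\<close>.\<close>

lemma dq_rate:
  assumes T: "0 \<le> T" and C: "0 \<le> C" and q: "0 \<le> q"
    and r: "\<And>t y. T \<le> t \<Longrightarrow> y \<in> {0..1} \<Longrightarrow> 0 \<le> rate t y \<and> rate t y \<le> 2"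
    and f: "\<And>t y. T \<le> t \<Longrightarrow> y \<in> {0..1} \<Longrightarrow> f t y \<le> 4 / (1 + t)"
    and N: "\<And>t. T \<le> t \<Longrightarrow> N t \<le> C * (1 + t) powr (- q)"
  obtains T1 where "T \<le> T1"
    "\<And>h0 B. 0 < h0 \<Longrightarrow> (\<And>h. 0 < h \<Longrightarrow> h \<le> h0 \<Longrightarrow> mean (\<lambda>y. (dq h v T1 y)\<^sup>2) \<le> B) \<Longrightarrow>
      \<exists>K h1. 0 < h1 \<and> h1 \<le> h0 \<and> (\<forall>h t. 0 < h \<longrightarrow> h \<le> h1 \<longrightarrow> T1 \<le> t \<longrightarrow> mean (\<lambda>y. (dq h v t y)\<^sup>2) \<le> K * (1 + t) powr (- (4 + q)))"
proof -
  define T1 where "T1 = T + 96 * K1 * dF / \<delta> + 4 * (4 + q) / \<delta>"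
  have "0 \<le> 96 * K1 * dF / \<delta>" "0 \<le> 4 * (4 + q) / \<delta>" using dF_pos consts_pos q by auto
  then have T1: "T \<le> T1" "0 \<le> T1" "96 * K1 * dF / \<delta> \<le> T1" "4 * (4 + q) / \<delta> \<le> T1"
    using T unfolding T1_def by linarith+
  show ?thesis
  proof (rule that[OF T1(1)])
    fix h0 B :: real assume h0: "0 < h0" and B: "\<And>h. 0 < h \<Longrightarrow> h \<le> h0 \<Longrightarrow> mean (\<lambda>y. (dq h v T1 y)\<^sup>2) \<le> B"
    define h1 where "h1 = min h0 1"
    have h1: "0 < h1" "h1 \<le> h0" "h1 \<le> 1" using h0 by (auto simp: h1_def)
    define k where "k r y = - c * w r y - c\<^sup>2 * v r y - (f r y * \<tau> r y - mean (\<lambda>y. f r y * \<tau> r y)) / lam" for r y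
    have jk: "jc k" unfolding k_def by (intro jc_diff jc_mult jc_divide jc_mean jc_const jc_w jc_v cont)
    obtain M where M: "\<And>r y. r \<in> {T1..T1+1} \<Longrightarrow> y \<in> {0..1} \<Longrightarrow> \<bar>k r y\<bar> \<le> M"
    proof -
      have "continuous_on ({T1..T1+1} \<times> {0..1}) (\<lambda>p. k (fst p) (snd p))"
        using jk[unfolded jc_def] by (rule continuous_on_subset) (use T1 in auto)
      then have "bounded ((\<lambda>p. k (fst p) (snd p)) ` ({T1..T1+1} \<times> {0..1}))"
        by (intro compact_imp_bounded compact_continuous_image compact_Times) auto
      then obtain M where "\<And>p. p \<in> {T1..T1+1} \<times> {0..1} \<Longrightarrow> \<bar>k (fst p) (snd p)\<bar> \<le> M" unfolding bounded_iff by force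
      then show ?thesis using that[of M] by fastforce
    qed
    define C1 where "C1 = K1 * (3072 + 768 / lam\<^sup>2) * ((1 + dF) * C)"
    have C1: "0 \<le> C1" using C dF_pos consts_pos by (simp add: C1_def)
    define F1 where "F1 = K2 * (max 0 B + M\<^sup>2)"
    have F1: "0 \<le> F1" using consts_pos by (simp add: F1_def)
    define K where "K = 4 * C1 / \<delta> + F1 * (1 + T1) powr (4 + q)"
    have K0: "0 \<le> K" using C1 F1 consts_pos by (simp add: K_def)
    have main: "mean (\<lambda>y. (dq h v t y)\<^sup>2) \<le> K / k3 * (1 + t) powr (- (4 + q))" if h: "0 < h" "h \<le> h1" and t: "T1 \<le> t" for h t
    proof -
      have hn: "0 \<le> h" using h by simp
      interpret I: linear_flow \<rho> \<eta> lam G "dq h u" "dq h \<tau>" "dq h (\<lambda>t y. f t y * \<tau> t y)"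
        by (rule dq_flow[OF h(1)])
      have Iv: "I.v t y = dq h v t y" if "0 \<le> t" "y \<in> {0..1}" for t y
        using v_dq[OF hn that] by (simp add: I.v_def)
      have Iw: "I.w t y = dq h w t y" if "0 \<le> t" "y \<in> {0..1}" for t y
        using Iv[OF that] mean_dq[OF cont(2) hn that(1)] unfolding I.w_def w_def by (simp add: dq_def diff_divide_distrib right_diff_distrib)
      have "I.F t \<le> K * (1 + t) powr - (4 + q)"
      proof (rule exponential_decay_powr[where C=C1 and \<delta>="\<delta> / 2" and T=T1])
        show "continuous_on {T1..} I.F" by (rule continuous_on_subset[OF I.F_cont]) (use T1 in auto)
        show "2 * (4 + q) \<le> \<delta> / 2 * (1 + T1)"
        proof -
          have "4 * (4 + q) / \<delta> \<le> 1 + T1" using T1(4) by linarith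
          then show ?thesis using consts_pos by (simp add: field_simps)
        qed
        show "2 * C1 \<le> \<delta> / 2 * K"
          using consts_pos F1 by (auto simp: K_def field_simps intro!: add_nonneg_nonneg mult_nonneg_nonneg)
        show "I.F T1 \<le> K * (1 + T1) powr - (4 + q)"
        proof -
          have "mean (\<lambda>y. (I.v T1 y)\<^sup>2) = mean (\<lambda>y. (dq h v T1 y)\<^sup>2)" by (rule mean_cong) (simp add: Iv T1)
          then have a: "mean (\<lambda>y. (I.v T1 y)\<^sup>2) \<le> max 0 B" using B[OF h(1)] h h1 by simp
          have "mean (\<lambda>y. (I.w T1 y)\<^sup>2) \<le> mean (\<lambda>y. M\<^sup>2)"
          proof (rule mean_mono)
            show "continuous_on {0..1} (\<lambda>y. (I.w T1 y)\<^sup>2)" using jc_slice[OF I.jc_w T1(2)] by (intro continuous_intros)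
            fix y :: real assume y: "y \<in> {0..1}"
            have "w (T1 + h) y - w T1 y = integral {T1..T1+h} (\<lambda>r. k r y)"
              using w_increment[of T1 "T1 + h" y] T1 h y by (simp add: k_def)
            also have "\<bar>\<dots>\<bar> \<le> (T1 + h - T1) * M"
              by (rule integral_bounded_by) (use jc_time_integrable[OF jk T1(2) y] h h1 M y in auto)
            finally have "\<bar>I.w T1 y\<bar> \<le> M"
              using h Iw[OF T1(2) y] by (simp add: dq_def abs_divide pos_divide_le_eq mult.commute)
            then have "\<bar>I.w T1 y\<bar>\<^sup>2 \<le> M\<^sup>2" by (intro power_mono) auto
            then show "(I.w T1 y)\<^sup>2 \<le> M\<^sup>2" by simp
          qed simp
          then have "I.X T1 \<le> max 0 B + M\<^sup>2" using a by (simp add: I.X_def)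
          then have "K2 * I.X T1 \<le> F1" unfolding F1_def using consts_pos by (intro mult_left_mono) auto
          then have "I.F T1 \<le> F1" using I.F_bounds(2)[OF T1(2)] by linarith
          also have "F1 = F1 * (1 + T1) powr (4 + q) * (1 + T1) powr - (4 + q)"
            using T1 by (simp add: mult.assoc powr_add[symmetric])
          also have "\<dots> \<le> K * (1 + T1) powr - (4 + q)"
            using C1 consts_pos by (intro mult_right_mono) (auto simp: K_def)
          finally show ?thesis .
        qed
        fix s t assume st: "T1 \<le> s" "s \<le> t"
        then have st0: "0 \<le> s" "s \<le> t" using T1 by auto
        have "I.F t - I.F s \<le> integral {s..t} (\<lambda>r. K1 * mean (\<lambda>y. (dq h (\<lambda>t y. f t y * \<tau> t y) r y)\<^sup>2) - \<delta> * I.F r)"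
          by (rule I.F_decay[OF st0])
        also have "\<dots> \<le> integral {s..t} (\<lambda>r. C1 * (1 + r) powr - (4 + q) - \<delta> / 2 * I.F r)"
        proof (rule integral_le)
          show "(\<lambda>r. K1 * mean (\<lambda>y. (dq h (\<lambda>t y. f t y * \<tau> t y) r y)\<^sup>2) - \<delta> * I.F r) integrable_on {s..t}"
            using st0 by (intro cont_time_integrable continuous_on_diff continuous_on_mult continuous_on_const I.F_cont continuous_on_mean jc_power I.cont)
          show "(\<lambda>r. C1 * (1 + r) powr - (4 + q) - \<delta> / 2 * I.F r) integrable_on {s..t}"
            using st0 by (intro cont_time_integrable continuous_intros I.F_cont continuous_on_powr) auto
          fix r assume "r \<in> {s..t}"
          then have rr: "0 \<le> r" "T \<le> r" "T1 \<le> r" using st T1 by auto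
          define e where "e = 1 / (1 + r)"
          have e: "0 < e" "e \<le> 1" using rr by (auto simp: e_def)
          have F0: "0 \<le> I.F r"
          proof -
            have "0 \<le> I.X r" unfolding I.X_def
              using jc_slice[OF I.jc_w rr(1)] jc_slice[OF I.jc_v rr(1)] by (intro add_nonneg_nonneg mean_nonneg continuous_intros) auto
            then have "0 \<le> k3 * I.X r" using consts_pos by simp
            then show ?thesis using I.F_bounds(1)[OF rr(1)] by linarith
          qed
          have X: "I.X r \<le> I.F r / k3" using I.F_bounds(1)[OF rr(1)] consts_pos by (simp add: field_simps)
          have dev: "mean (\<lambda>y. (dq h \<tau> r y - mean (dq h \<tau> r))\<^sup>2) \<le> dF * I.F r"
          proof -
            have ci: "continuous_on {0..1} (I.w r)" "continuous_on {0..1} (I.v r)" "continuous_on {0..1} (dq h \<tau> r)"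
              using jc_slice[OF I.jc_w rr(1)] jc_slice[OF I.jc_v rr(1)] jc_slice[OF I.cont(2) rr(1)] by auto
            have "mean (\<lambda>y. (dq h \<tau> r y - mean (dq h \<tau> r))\<^sup>2) \<le> mean (\<lambda>y. (2 * (1 + c\<^sup>2)) * (I.v r y)\<^sup>2 + (2 * (1 + c\<^sup>2)) * (I.w r y)\<^sup>2)"
            proof (rule mean_mono)
              fix y
              have "(2 * (1 + c\<^sup>2)) * (I.v r y)\<^sup>2 + (2 * (1 + c\<^sup>2)) * (I.w r y)\<^sup>2 - (dq h \<tau> r y - mean (dq h \<tau> r))\<^sup>2
                = (I.w r y - c * I.v r y)\<^sup>2 + 2 * (I.v r y)\<^sup>2 + 2 * (c * I.w r y)\<^sup>2"
                by (simp add: I.w_def power2_eq_square algebra_simps)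
              also have "\<dots> \<ge> 0" by simp
              finally show "(dq h \<tau> r y - mean (dq h \<tau> r))\<^sup>2 \<le> (2 * (1 + c\<^sup>2)) * (I.v r y)\<^sup>2 + (2 * (1 + c\<^sup>2)) * (I.w r y)\<^sup>2" by simp
            qed (intro continuous_intros ci)+
            also have "\<dots> = (2 * (1 + c\<^sup>2)) * mean (\<lambda>y. (I.v r y)\<^sup>2) + (2 * (1 + c\<^sup>2)) * mean (\<lambda>y. (I.w r y)\<^sup>2)"
              by (intro mean_lin continuous_intros ci)
            also have "\<dots> = (2 * (1 + c\<^sup>2)) * I.X r" by (simp only: I.X_def distrib_left)
            also have "\<dots> \<le> (2 * (1 + c\<^sup>2)) * (I.F r / k3)" using X by (intro mult_left_mono) auto
            finally show ?thesis by (simp add: dF_def)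
          qed
          have "K1 * mean (\<lambda>y. (dq h (\<lambda>t y. f t y * \<tau> t y) r y)\<^sup>2)
             \<le> K1 * ((3072 + 768 / lam\<^sup>2) * (e ^ 4 * ((1 + dF) * C * (1 + r) powr (- q))) + 48 * e\<^sup>2 * mean (\<lambda>y. (dq h \<tau> r y - mean (dq h \<tau> r))\<^sup>2))"
            unfolding e_def using consts_pos by (intro mult_left_mono dq_force_le[OF T C q r f N h(1) rr(2)]) auto
          also have "\<dots> \<le> K1 * ((3072 + 768 / lam\<^sup>2) * (e ^ 4 * ((1 + dF) * C * (1 + r) powr (- q))) + 48 * e\<^sup>2 * (dF * I.F r))"
            using dev consts_pos by (intro mult_left_mono add_left_mono) auto
          also have "\<dots> = C1 * (e ^ 4 * (1 + r) powr (- q)) + 48 * K1 * dF * e\<^sup>2 * I.F r"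
            by (simp add: C1_def algebra_simps add_divide_distrib)
          also have "e ^ 4 * (1 + r) powr (- q) = (1 + r) powr - (4 + q)"
          proof -
            have "(1 + r) powr - (4 + q) = (1 + r) powr (- q) * (1 + r) powr (- 4)"
              by (simp add: powr_add[symmetric] algebra_simps)
            also have "(1 + r) powr (- 4) = e ^ 4"
              using rr by (simp add: e_def powr_minus powr_numeral power_one_over inverse_eq_divide)
            finally show ?thesis by simp
          qed
          also have "48 * K1 * dF * e\<^sup>2 * I.F r \<le> \<delta> / 2 * I.F r"
          proof (rule mult_right_mono[OF _ F0])
            have "96 * K1 * dF / \<delta> \<le> 1 + r" using T1(3) rr by linarith
            then have k: "48 * K1 * dF \<le> \<delta> / 2 * (1 + r)" using consts_pos by (simp add: field_simps)
            have "48 * K1 * dF * e\<^sup>2 \<le> 48 * K1 * dF * e"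
              using e consts_pos dF_pos by (intro mult_left_mono) (auto simp: power2_eq_square mult_left_le)
            also have "\<dots> \<le> \<delta> / 2 * (1 + r) * e" using k e by (intro mult_right_mono) auto
            also have "\<dots> = \<delta> / 2"
            proof -
              have "(1 + r) * e = 1" using rr by (simp add: e_def)
              then show ?thesis by (simp only: mult.assoc mult_1_right)
            qed
            finally show "48 * K1 * dF * e\<^sup>2 \<le> \<delta> / 2" .
          qed
          finally show "K1 * mean (\<lambda>y. (dq h (\<lambda>t y. f t y * \<tau> t y) r y)\<^sup>2) - \<delta> * I.F r \<le> C1 * (1 + r) powr - (4 + q) - \<delta> / 2 * I.F r" by simp
        qed
        finally show "I.F t - I.F s \<le> integral {s..t} (\<lambda>r. C1 * (1 + r) powr - (4 + q) - \<delta> / 2 * I.F r)" .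
      qed (use T1 consts_pos q t K0 in auto)
      moreover have "k3 * mean (\<lambda>y. (dq h v t y)\<^sup>2) \<le> I.F t"
      proof -
        have t0: "0 \<le> t" using t T1 by simp
        have "mean (\<lambda>y. (I.v t y)\<^sup>2) = mean (\<lambda>y. (dq h v t y)\<^sup>2)" by (rule mean_cong) (simp add: Iv t0)
        moreover have "0 \<le> mean (\<lambda>y. (I.w t y)\<^sup>2)" using jc_slice[OF I.jc_w t0] by (intro mean_nonneg continuous_intros) auto
        ultimately have "mean (\<lambda>y. (dq h v t y)\<^sup>2) \<le> I.X t" by (simp add: I.X_def)
        then have "k3 * mean (\<lambda>y. (dq h v t y)\<^sup>2) \<le> k3 * I.X t" using consts_pos by (intro mult_left_mono) auto
        then show ?thesis using I.F_bounds(1)[OF t0] by linarith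
      qed
      ultimately have "k3 * mean (\<lambda>y. (dq h v t y)\<^sup>2) \<le> K * (1 + t) powr - (4 + q)" by linarith
      then show ?thesis using consts_pos by (simp add: field_simps)
    qed
    show "\<exists>K h1. 0 < h1 \<and> h1 \<le> h0 \<and> (\<forall>h t. 0 < h \<longrightarrow> h \<le> h1 \<longrightarrow> T1 \<le> t \<longrightarrow> mean (\<lambda>y. (dq h v t y)\<^sup>2) \<le> K * (1 + t) powr (- (4 + q)))"
      using main h1 by blast
  qed
qed

end

section \<open>Lebesgue space on the unit interval\<close>

lemma Omega_finite: "finite_measure Omega"
  by (rule finite_measure_lebesgue_on) simp

lemma LINT_mean:
  assumes "continuous_on {0..1} f"
  shows "integrable Omega f" "(LINT y|Omega. f y) = mean f"
  using LINT_continuous[OF assms] by (simp_all add: mean_def)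

lemma continuous_L2: "continuous_on {0..1} f \<Longrightarrow> f \<in> L2"
  unfolding L2_def by (auto intro!: LINT_mean continuous_intros continuous_imp_measurable_on_sets_lebesgue)

lemma L2_norm_continuous: "continuous_on {0..1} f \<Longrightarrow> L2_norm f = sqrt (mean (\<lambda>y. (f y)\<^sup>2))"
  unfolding L2_norm_def by (subst LINT_mean) (auto intro!: continuous_intros)

lemma L2_norm_nonneg: "0 \<le> L2_norm v"
  by (simp add: L2_norm_def)

lemma L2_norm_square: "(L2_norm v)\<^sup>2 = (LINT y|Omega. (v y)\<^sup>2)"
  by (simp add: L2_norm_def)

lemma L2_mult_integrable:
  assumes "v \<in> L2" "w \<in> L2" shows "integrable Omega (\<lambda>y. v y * w y)"
proof (rule Bochner_Integration.integrable_bound[where f="\<lambda>y. (v y)\<^sup>2 + (w y)\<^sup>2"])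
  show "AE y in Omega. norm (v y * w y) \<le> norm ((v y)\<^sup>2 + (w y)\<^sup>2)"
  proof (rule AE_I2)
    fix y
    have "2 * (\<bar>v y\<bar> * \<bar>w y\<bar>) \<le> \<bar>v y\<bar>\<^sup>2 + \<bar>w y\<bar>\<^sup>2"
      using sum_squares_bound[of "\<bar>v y\<bar>" "\<bar>w y\<bar>"] by (simp add: mult.assoc)
    moreover have "0 \<le> \<bar>v y\<bar> * \<bar>w y\<bar>" by simp
    ultimately have "\<bar>v y\<bar> * \<bar>w y\<bar> \<le> \<bar>v y\<bar>\<^sup>2 + \<bar>w y\<bar>\<^sup>2" by linarith
    then show "norm (v y * w y) \<le> norm ((v y)\<^sup>2 + (w y)\<^sup>2)" by (simp add: abs_mult)
  qed
qed (use assms in \<open>auto simp: L2_def\<close>)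

lemma L2_integrable: "v \<in> L2 \<Longrightarrow> integrable Omega v"
  using L2_mult_integrable[of v "\<lambda>_. 1"] continuous_L2[of "\<lambda>_. 1"] by simp

lemma L2_add: assumes "v \<in> L2" "w \<in> L2" shows "(\<lambda>y. v y + w y) \<in> L2"
proof -
  have "integrable Omega (\<lambda>y. (v y)\<^sup>2 + 2 * (v y * w y) + (w y)\<^sup>2)"
    using assms L2_mult_integrable[OF assms] by (auto simp: L2_def)
  moreover have "(\<lambda>y. (v y + w y)\<^sup>2) = (\<lambda>y. (v y)\<^sup>2 + 2 * (v y * w y) + (w y)\<^sup>2)"
    by (auto simp: power2_sum)
  ultimately show ?thesis using assms by (auto simp: L2_def)
qed

lemma L2_cmult: "v \<in> L2 \<Longrightarrow> (\<lambda>y. k * v y) \<in> L2"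
  by (auto simp: L2_def power_mult_distrib)

lemma L2_diff: "v \<in> L2 \<Longrightarrow> w \<in> L2 \<Longrightarrow> (\<lambda>y. v y - w y) \<in> L2"
  using L2_add[of v "\<lambda>y. - 1 * w y"] L2_cmult[of w "- 1"] by simp

lemma L2_norm_cmult: "L2_norm (\<lambda>y. k * v y) = \<bar>k\<bar> * L2_norm v"
  by (simp add: L2_norm_def power_mult_distrib real_sqrt_mult)

lemma L2_Cauchy_Schwarz:
  assumes v: "v \<in> L2" and w: "w \<in> L2"
  shows "\<bar>LINT y|Omega. v y * w y\<bar> \<le> L2_norm v * L2_norm w"
proof -
  define A B C where "A = (LINT y|Omega. (v y)\<^sup>2)" and "B = (LINT y|Omega. v y * w y)" and "C = (LINT y|Omega. (w y)\<^sup>2)"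
  have iv: "integrable Omega (\<lambda>y. (v y)\<^sup>2)" and iw: "integrable Omega (\<lambda>y. (w y)\<^sup>2)" using v w by (auto simp: L2_def)
  have ivw: "integrable Omega (\<lambda>y. v y * w y)" by (rule L2_mult_integrable[OF v w])
  have q: "0 \<le> A - 2 * x * B + x\<^sup>2 * C" for x
  proof -
    have "0 \<le> (LINT y|Omega. (v y - x * w y)\<^sup>2)" by (rule integral_nonneg_AE) simp
    also have "(\<lambda>y. (v y - x * w y)\<^sup>2) = (\<lambda>y. (v y)\<^sup>2 - (2 * x) * (v y * w y) + x\<^sup>2 * (w y)\<^sup>2)"
      by (auto simp: power2_diff power_mult_distrib)
    also have "(LINT y|Omega. (v y)\<^sup>2 - (2 * x) * (v y * w y) + x\<^sup>2 * (w y)\<^sup>2) = A - 2 * x * B + x\<^sup>2 * C"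
      using iv iw ivw by (simp add: A_def B_def C_def)
    finally show ?thesis .
  qed
  have C0: "0 \<le> C" unfolding C_def by (rule integral_nonneg_AE) simp
  have "B\<^sup>2 \<le> A * C"
  proof (cases "C = 0")
    case True
    have "B = 0"
    proof (rule ccontr)
      assume "B \<noteq> 0"
      then show False using q[of "(A + 1) / (2 * B)"] True by (simp add: field_simps)
    qed
    then show ?thesis using True by simp
  next
    case False
    then have "0 < C" using C0 by simp
    then show ?thesis using q[of "B / C"] by (simp add: field_simps power2_eq_square)
  qed
  then have "sqrt (B\<^sup>2) \<le> sqrt (A * C)" by (rule real_sqrt_le_mono)
  then show ?thesis by (simp add: real_sqrt_mult L2_norm_def A_def B_def C_def)
qed

lemma L2_norm_triangle:
  assumes v: "v \<in> L2" and w: "w \<in> L2"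
  shows "L2_norm (\<lambda>y. v y + w y) \<le> L2_norm v + L2_norm w"
proof (rule power2_le_imp_le)
  have "(L2_norm (\<lambda>y. v y + w y))\<^sup>2 = (LINT y|Omega. (v y)\<^sup>2 + 2 * (v y * w y) + (w y)\<^sup>2)"
    by (simp add: L2_norm_square power2_sum algebra_simps)
  also have "\<dots> = (L2_norm v)\<^sup>2 + 2 * (LINT y|Omega. v y * w y) + (L2_norm w)\<^sup>2"
    using v w L2_mult_integrable[OF v w] by (simp add: L2_norm_square L2_def)
  also have "\<dots> \<le> (L2_norm v)\<^sup>2 + 2 * (L2_norm v * L2_norm w) + (L2_norm w)\<^sup>2"
    using L2_Cauchy_Schwarz[OF v w] by simp
  also have "\<dots> = (L2_norm v + L2_norm w)\<^sup>2" by (simp add: power2_sum)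
  finally show "(L2_norm (\<lambda>y. v y + w y))\<^sup>2 \<le> (L2_norm v + L2_norm w)\<^sup>2" .
qed (simp add: L2_norm_nonneg)

lemma L2_HK:
  assumes v: "v \<in> L2" and ab: "0 \<le> a" "a \<le> b" "b \<le> 1"
  shows "v integrable_on {a..b}" "(integral {a..b} v)\<^sup>2 \<le> (b - a) * integral {a..b} (\<lambda>y. (v y)\<^sup>2)"
    "(\<lambda>y. (v y)\<^sup>2) integrable_on {a..b}"
proof -
  have i: "v integrable_on {0..1}" "(\<lambda>y. (v y)\<^sup>2) integrable_on {0..1}"
    using L2_integrable[OF v] v by (auto simp: L2_def integrable_on_lebesgue_on)
  show 1: "v integrable_on {a..b}" and 2: "(\<lambda>y. (v y)\<^sup>2) integrable_on {a..b}"
    using ab i by (auto intro: integrable_on_subinterval)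
  define B A where "B = integral {a..b} v" and "A = integral {a..b} (\<lambda>y. (v y)\<^sup>2)"
  have q: "0 \<le> A - 2 * x * B + x\<^sup>2 * (b - a)" for x
  proof -
    have h: "((\<lambda>y. (v y)\<^sup>2 - (2 * x) * v y + x\<^sup>2) has_integral (A - (2 * x) * B + x\<^sup>2 * (b - a))) {a..b}"
      unfolding A_def B_def using has_integral_const_real[of "x\<^sup>2" a b] ab
      by (intro has_integral_add has_integral_diff has_integral_mult_right integrable_integral 1 2) (simp add: mult.commute)
    have "0 \<le> A - (2 * x) * B + x\<^sup>2 * (b - a)"
    proof (rule has_integral_nonneg[OF h])
      fix y
      have "(v y)\<^sup>2 - (2 * x) * v y + x\<^sup>2 = (v y - x)\<^sup>2" by (simp add: power2_diff)
      then show "0 \<le> (v y)\<^sup>2 - (2 * x) * v y + x\<^sup>2" by simp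
    qed
    then show ?thesis by simp
  qed
  have "B\<^sup>2 \<le> (b - a) * A"
  proof (cases "a = b")
    case True then show ?thesis by (simp add: B_def)
  next
    case False
    define L where "L = b - a"
    have L: "0 < L" using False ab by (simp add: L_def)
    then show ?thesis using q[of "B / L"] unfolding L_def[symmetric] by (simp add: field_simps power2_eq_square)
  qed
  then show "(integral {a..b} v)\<^sup>2 \<le> (b - a) * integral {a..b} (\<lambda>y. (v y)\<^sup>2)" by (simp add: A_def B_def)
qed

lemma L2_norm_square_HK: "v \<in> L2 \<Longrightarrow> (L2_norm v)\<^sup>2 = integral {0..1} (\<lambda>y. (v y)\<^sup>2)"
  unfolding L2_norm_square by (rule lebesgue_integral_eq_integral) (auto simp: L2_def)

lemma L2_integral_le:
  assumes v: "v \<in> L2" and ab: "0 \<le> a" "a \<le> b" "b \<le> 1"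
  shows "\<bar>integral {a..b} v\<bar> \<le> L2_norm v"
proof (rule power2_le_imp_le[OF _ L2_norm_nonneg])
  have "\<bar>integral {a..b} v\<bar>\<^sup>2 \<le> (b - a) * integral {a..b} (\<lambda>y. (v y)\<^sup>2)" using L2_HK(2)[OF assms] by simp
  also have "\<dots> \<le> 1 * integral {a..b} (\<lambda>y. (v y)\<^sup>2)"
    using ab by (intro mult_right_mono Henstock_Kurzweil_Integration.integral_nonneg L2_HK[OF assms]) auto
  also have "\<dots> \<le> integral {0..1} (\<lambda>y. (v y)\<^sup>2)"
    using ab L2_HK(3)[OF v, of 0 1] L2_HK(3)[OF assms] by (simp add: integral_subset_le)
  finally show "\<bar>integral {a..b} v\<bar>\<^sup>2 \<le> (L2_norm v)\<^sup>2" by (simp add: L2_norm_square_HK[OF v])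
qed

lemma sum_integral_partition:
  fixes s :: "real \<Rightarrow> real"
  assumes "s integrable_on {0..1}" "m \<le> Suc n"
  shows "(\<Sum>i<m. integral {real i / real (Suc n)..real (Suc i) / real (Suc n)} s) = integral {0..real m / real (Suc n)} s"
  using assms(2)
proof (induction m)
  case (Suc m)
  have "real (Suc m) / real (Suc n) \<le> 1" using Suc.prems by (simp add: divide_simps)
  moreover have "real m / real (Suc n) \<le> real (Suc m) / real (Suc n)" by (simp add: divide_simps)
  ultimately have "integral {0..real m / real (Suc n)} s + integral {real m / real (Suc n)..real (Suc m) / real (Suc n)} s = integral {0..real (Suc m) / real (Suc n)} s"
    by (intro Henstock_Kurzweil_Integration.integral_combine integrable_on_subinterval[OF assms(1)]) auto
  then show ?case using Suc by simp
qed simp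

lemma partition_subset: "i < Suc n \<Longrightarrow> 0 \<le> real i / real (Suc n) \<and> real i / real (Suc n) \<le> real (Suc i) / real (Suc n) \<and> real (Suc i) / real (Suc n) \<le> 1"
  by (simp add: divide_simps)

lemma partition_length: "real (Suc i) / real (Suc n) - real i / real (Suc n) = 1 / real (Suc n)"
  by (simp add: diff_divide_distrib[symmetric])

text \<open>The squared norm of the orthogonal projection of \<open>s\<close> to the step functions on \<open>n + 1\<close> intervals of
  equal length. It sees \<open>s\<close> only through integrals over intervals, that is through increments of a primitive.
  So it can be computed for weak derivatives, and it is continuous in parameters where the norm need not be.\<close>

definition Qn :: "nat \<Rightarrow> (real \<Rightarrow> real) \<Rightarrow> real" where
  "Qn n s = real (Suc n) * (\<Sum>i<Suc n. (integral {real i / real (Suc n)..real (Suc i) / real (Suc n)} s)\<^sup>2)"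

lemma Qn_le:
  assumes "s \<in> L2" shows "Qn n s \<le> (L2_norm s)\<^sup>2"
proof -
  have "Qn n s \<le> real (Suc n) * (\<Sum>i<Suc n. 1 / real (Suc n) * integral {real i / real (Suc n)..real (Suc i) / real (Suc n)} (\<lambda>y. (s y)\<^sup>2))"
    unfolding Qn_def
  proof (intro mult_left_mono sum_mono)
    fix i assume "i \<in> {..<Suc n}"
    then have "0 \<le> real i / real (Suc n) \<and> real i / real (Suc n) \<le> real (Suc i) / real (Suc n) \<and> real (Suc i) / real (Suc n) \<le> 1"
      by (intro partition_subset) simp
    then show "(integral {real i / real (Suc n)..real (Suc i) / real (Suc n)} s)\<^sup>2 \<le> 1 / real (Suc n) * integral {real i / real (Suc n)..real (Suc i) / real (Suc n)} (\<lambda>y. (s y)\<^sup>2)"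
      using L2_HK(2)[OF assms, of "real i / real (Suc n)" "real (Suc i) / real (Suc n)"] unfolding partition_length by blast
  qed simp
  also have "\<dots> = (\<Sum>i<Suc n. integral {real i / real (Suc n)..real (Suc i) / real (Suc n)} (\<lambda>y. (s y)\<^sup>2))"
    unfolding sum_distrib_left[symmetric] by simp
  also have "\<dots> = integral {0..real (Suc n) / real (Suc n)} (\<lambda>y. (s y)\<^sup>2)"
    by (rule sum_integral_partition) (use L2_HK(3)[OF assms, of 0 1] in auto)
  also have "\<dots> = (L2_norm s)\<^sup>2" by (simp add: L2_norm_square_HK[OF assms])
  finally show ?thesis .
qed

text \<open>Uniform continuity of \<open>\<psi>\<close>.\<close>

lemma step_function_limit:
  fixes \<psi> s :: "real \<Rightarrow> real"
  assumes \<psi>: "continuous_on {0..1} \<psi>" and s: "s \<in> L2"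
  shows "(\<lambda>n. \<Sum>i<Suc n. \<psi> (real i / real (Suc n)) * integral {real i / real (Suc n)..real (Suc i) / real (Suc n)} s)
    \<longlonglongrightarrow> integral {0..1} (\<lambda>y. \<psi> y * s y)"
proof (rule LIMSEQ_I)
  fix e :: real assume e: "e > 0"
  have s_abs: "(\<lambda>y. \<bar>s y\<bar>) integrable_on {0..1}"
    using integrable_abs[OF L2_integrable[OF s]] by (simp add: integrable_on_lebesgue_on)
  have ps: "(\<lambda>y. \<psi> y * s y) integrable_on {0..1}"
    using L2_mult_integrable[OF continuous_L2[OF \<psi>] s] by (simp add: integrable_on_lebesgue_on)
  define S where "S = integral {0..1} (\<lambda>y. \<bar>s y\<bar>)"
  have S: "0 \<le> S" unfolding S_def by (rule Henstock_Kurzweil_Integration.integral_nonneg[OF s_abs]) simp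
  define e' where "e' = e / (S + 1)"
  have e': "e' > 0" "e' * S < e"
  proof -
    show "e' > 0" using e S by (simp add: e'_def)
    then have "e' * S < e' * (S + 1)" by simp
    also have "\<dots> = e" using S by (simp add: e'_def)
    finally show "e' * S < e" .
  qed
  have "uniformly_continuous_on {0..1} \<psi>" by (rule compact_uniformly_continuous[OF \<psi>]) simp
  then obtain d where d: "d > 0" "\<And>x y. x \<in> {0..1} \<Longrightarrow> y \<in> {0..1} \<Longrightarrow> dist y x < d \<Longrightarrow> dist (\<psi> y) (\<psi> x) < e'"
    using e' unfolding uniformly_continuous_on_def by metis
  obtain N :: nat where N: "1 / real (Suc N) < d" using nat_approx_posE[OF d(1)] by blast
  have "norm ((\<Sum>i<Suc n. \<psi> (real i / real (Suc n)) * integral {real i / real (Suc n)..real (Suc i) / real (Suc n)} s) - integral {0..1} (\<lambda>y. \<psi> y * s y)) < e"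
    if n: "n \<ge> N" for n
  proof -
    let ?a = "\<lambda>i. real i / real (Suc n)" and ?b = "\<lambda>i. real (Suc i) / real (Suc n)"
    have nd: "1 / real (Suc n) < d"
    proof -
      have "1 / real (Suc n) \<le> 1 / real (Suc N)" using n by (simp add: divide_simps)
      then show ?thesis using N by linarith
    qed
    have "integral {0..1} (\<lambda>y. \<psi> y * s y) = (\<Sum>i<Suc n. integral {?a i..?b i} (\<lambda>y. \<psi> y * s y))"
      using sum_integral_partition[OF ps, of "Suc n" n] by simp
    then have "norm ((\<Sum>i<Suc n. \<psi> (?a i) * integral {?a i..?b i} s) - integral {0..1} (\<lambda>y. \<psi> y * s y))
       = norm (\<Sum>i<Suc n. \<psi> (?a i) * integral {?a i..?b i} s - integral {?a i..?b i} (\<lambda>y. \<psi> y * s y))"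
      by (simp only: sum_subtractf)
    also have "\<dots> \<le> (\<Sum>i<Suc n. e' * integral {?a i..?b i} (\<lambda>y. \<bar>s y\<bar>))"
    proof (rule order_trans[OF norm_sum], rule sum_mono)
      fix i assume "i \<in> {..<Suc n}"
      then have p: "0 \<le> ?a i \<and> ?a i \<le> ?b i \<and> ?b i \<le> 1" by (intro partition_subset) simp
      have sub: "{?a i..?b i} \<subseteq> {0..1}" using p by auto
      have i1: "s integrable_on {?a i..?b i}" "(\<lambda>y. \<psi> y * s y) integrable_on {?a i..?b i}" "(\<lambda>y. \<bar>s y\<bar>) integrable_on {?a i..?b i}"
        using L2_HK(1)[OF s] p integrable_on_subinterval[OF ps sub] integrable_on_subinterval[OF s_abs sub] by auto
      have "\<psi> (?a i) * integral {?a i..?b i} s - integral {?a i..?b i} (\<lambda>y. \<psi> y * s y) = integral {?a i..?b i} (\<lambda>y. \<psi> (?a i) * s y - \<psi> y * s y)"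
        by (rule integral_unique[symmetric]) (intro has_integral_diff has_integral_mult_right integrable_integral i1)
      also have "norm \<dots> \<le> integral {?a i..?b i} (\<lambda>y. e' * \<bar>s y\<bar>)"
      proof (rule integral_norm_bound_integral)
        show "(\<lambda>y. \<psi> (?a i) * s y - \<psi> y * s y) integrable_on {?a i..?b i}" "(\<lambda>y. e' * \<bar>s y\<bar>) integrable_on {?a i..?b i}"
          by (intro integrable_diff integrable_on_mult_right i1)+
        fix y assume y: "y \<in> {?a i..?b i}"
        have "\<bar>?a i - y\<bar> \<le> ?b i - ?a i" using y by auto
        then have "dist (?a i) y < d" using nd unfolding dist_real_def partition_length by linarith
        moreover have "0 \<le> y" "y \<le> 1" using y p order_trans by (meson atLeastAtMost_iff)+
        ultimately have "dist (\<psi> (?a i)) (\<psi> y) < e'" using p by (intro d(2)) auto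
        then have "\<bar>\<psi> (?a i) - \<psi> y\<bar> * \<bar>s y\<bar> \<le> e' * \<bar>s y\<bar>" by (intro mult_right_mono) (auto simp: dist_real_def)
        then show "norm (\<psi> (?a i) * s y - \<psi> y * s y) \<le> e' * \<bar>s y\<bar>" by (simp add: abs_mult[symmetric] left_diff_distrib)
      qed
      finally show "norm (\<psi> (?a i) * integral {?a i..?b i} s - integral {?a i..?b i} (\<lambda>y. \<psi> y * s y)) \<le> e' * integral {?a i..?b i} (\<lambda>y. \<bar>s y\<bar>)"
        by simp
    qed
    also have "\<dots> = e' * S"
      using sum_integral_partition[OF s_abs, of "Suc n" n] by (simp add: sum_distrib_left[symmetric] S_def)
    finally show ?thesis using e' by linarith
  qed
  then show "\<exists>no. \<forall>n\<ge>no. norm ((\<Sum>i<Suc n. \<psi> (real i / real (Suc n)) * integral {real i / real (Suc n)..real (Suc i) / real (Suc n)} s) - integral {0..1} (\<lambda>y. \<psi> y * s y)) < e"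
    by blast
qed

text \<open>The Cauchy-Schwarz inequality for the sums, then \<open>n \<rightarrow> \<infinity>\<close>.\<close>

lemma Qn_bound_dual:
  assumes s: "s \<in> L2" and K: "0 \<le> K" "\<And>n. Qn n s \<le> K\<^sup>2" and \<psi>: "continuous_on {0..1} \<psi>"
  shows "\<bar>LINT y|Omega. \<psi> y * s y\<bar> \<le> K * L2_norm \<psi>"
proof -
  let ?a = "\<lambda>n i. real i / real (Suc n)" and ?b = "\<lambda>n i. real (Suc i) / real (Suc n)"
  let ?L = "\<lambda>n. \<Sum>i<Suc n. \<psi> (?a n i) * integral {?a n i..?b n i} s"
  let ?P = "\<lambda>n. \<Sum>i<Suc n. (\<psi> (?a n i))\<^sup>2 * integral {?a n i..?b n i} (\<lambda>y. 1)"
  have one: "(\<lambda>y. 1) \<in> L2" by (intro continuous_L2 continuous_intros)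
  have l1: "?L \<longlonglongrightarrow> integral {0..1} (\<lambda>y. \<psi> y * s y)" by (rule step_function_limit[OF \<psi> s])
  have l2: "?P \<longlonglongrightarrow> integral {0..1} (\<lambda>y. (\<psi> y)\<^sup>2 * 1)" by (rule step_function_limit[OF _ one]) (intro continuous_intros \<psi>)
  have "(?L n)\<^sup>2 \<le> K\<^sup>2 * ?P n" for n
  proof -
    have "(?L n)\<^sup>2 \<le> (\<Sum>i<Suc n. (\<psi> (?a n i))\<^sup>2) * (\<Sum>i<Suc n. (integral {?a n i..?b n i} s)\<^sup>2)"
      by (rule Cauchy_Schwarz_ineq_sum)
    also have "\<dots> = ?P n * Qn n s"
    proof -
      have "integral {?a n i..?b n i} (\<lambda>y. 1) = 1 / real (Suc n)" for i
        using partition_length[of i n] by (simp add: divide_right_mono)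
      then have "?P n = (\<Sum>i<Suc n. (\<psi> (?a n i))\<^sup>2) * (1 / real (Suc n))" by (simp only: sum_distrib_right)
      then show ?thesis by (simp add: Qn_def)
    qed
    also have "\<dots> \<le> ?P n * K\<^sup>2"
      by (intro mult_left_mono K sum_nonneg mult_nonneg_nonneg Henstock_Kurzweil_Integration.integral_nonneg) auto
    finally show ?thesis by (simp add: mult.commute)
  qed
  then have "(integral {0..1} (\<lambda>y. \<psi> y * s y))\<^sup>2 \<le> K\<^sup>2 * integral {0..1} (\<lambda>y. (\<psi> y)\<^sup>2 * 1)"
    by (intro LIMSEQ_le[OF tendsto_power[OF l1] tendsto_mult[OF tendsto_const l2]]) auto
  also have "integral {0..1} (\<lambda>y. (\<psi> y)\<^sup>2 * 1) = (L2_norm \<psi>)\<^sup>2"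
    using L2_norm_square_HK[OF continuous_L2[OF \<psi>]] by simp
  finally have "\<bar>integral {0..1} (\<lambda>y. \<psi> y * s y)\<bar>\<^sup>2 \<le> (K * L2_norm \<psi>)\<^sup>2" by (simp add: power_mult_distrib)
  then have "\<bar>integral {0..1} (\<lambda>y. \<psi> y * s y)\<bar> \<le> K * L2_norm \<psi>"
    using power2_le_imp_le K L2_norm_nonneg by (meson mult_nonneg_nonneg)
  moreover have "(LINT y|Omega. \<psi> y * s y) = integral {0..1} (\<lambda>y. \<psi> y * s y)"
    by (rule lebesgue_integral_eq_integral[OF L2_mult_integrable[OF continuous_L2[OF \<psi>] s]]) simp
  ultimately show ?thesis by simp
qed

text \<open>One would like to test with \<open>s\<close> itself. The truncation of \<open>s\<close> at level \<open>M\<close> is an almost everywhere limit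
  of bounded continuous functions, so the hypothesis extends to it, and \<open>M \<rightarrow> \<infinity>\<close>.\<close>

lemma L2_norm_le_if_dual:
  assumes s: "s \<in> L2" and K: "0 \<le> K"
    and dual: "\<And>\<psi>. continuous_on {0..1} \<psi> \<Longrightarrow> \<bar>LINT y|Omega. \<psi> y * s y\<bar> \<le> K * L2_norm \<psi>"
  shows "L2_norm s \<le> K"
proof -
  interpret finite_measure Omega by (rule Omega_finite)
  have sm: "s \<in> borel_measurable Omega" and s2: "integrable Omega (\<lambda>y. (s y)\<^sup>2)" using s by (auto simp: L2_def)
  have "s measurable_on {0..1}" using sm by (simp add: measurable_on_iff_borel_measurable)
  then obtain Z g where Z: "negligible Z" and g: "\<And>n. continuous_on UNIV (g n)"
    and lim: "\<And>x. x \<notin> Z \<Longrightarrow> (\<lambda>n. g n x) \<longlonglongrightarrow> (if x \<in> {0..1} then s x else 0)"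
    unfolding measurable_on_def by blast
  have AEZ: "AE x in Omega. x \<notin> Z"
    using Z by (auto simp: AE_restrict_space_iff negligible_iff_null_sets intro!: AE_I'[of Z])
  define cl where "cl M x = max (- M) (min M x)" for M x :: real
  have clc: "continuous_on UNIV (cl M)" for M unfolding cl_def by (intro continuous_intros)
  have clb: "\<bar>cl M x\<bar> \<le> M" if "0 \<le> M" for M x using that by (auto simp: cl_def)
  have clm: "(\<lambda>y. cl M (s y)) \<in> borel_measurable Omega" for M
    using sm unfolding cl_def by measurable
  have key: "(LINT y|Omega. (cl M (s y))\<^sup>2) \<le> K\<^sup>2" if M: "0 \<le> M" for M
  proof -
    define \<psi> where "\<psi> n y = cl M (g n y)" for n y
    have \<psi>c: "continuous_on {0..1} (\<psi> n)" for n
      unfolding \<psi>_def by (intro continuous_on_compose2[OF clc] continuous_on_subset[OF g]) auto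
    have \<psi>m: "\<psi> n \<in> borel_measurable Omega" for n by (intro continuous_imp_measurable_on_sets_lebesgue \<psi>c) simp
    have "AE y in Omega. y \<in> {0..1}" using AE_space[of Omega] by simp
    with AEZ have pl: "AE y in Omega. (\<lambda>n. \<psi> n y) \<longlonglongrightarrow> cl M (s y)"
    proof eventually_elim
      case (elim y)
      then have "(\<lambda>n. g n y) \<longlonglongrightarrow> s y" using lim[of y] by auto
      then show ?case unfolding \<psi>_def by (intro continuous_on_tendsto_compose[OF clc]) auto
    qed
    have c1: "(\<lambda>n. LINT y|Omega. \<psi> n y * s y) \<longlonglongrightarrow> (LINT y|Omega. cl M (s y) * s y)"
    proof (rule integral_dominated_convergence)
      show "integrable Omega (\<lambda>y. M * \<bar>s y\<bar>)" using L2_integrable[OF s] by auto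
      show "AE y in Omega. (\<lambda>n. \<psi> n y * s y) \<longlonglongrightarrow> cl M (s y) * s y"
        using pl by eventually_elim (intro tendsto_mult tendsto_const)
      show "AE y in Omega. norm (\<psi> n y * s y) \<le> M * \<bar>s y\<bar>" for n
        unfolding \<psi>_def using clb[OF M] by (intro AE_I2) (auto simp: abs_mult intro!: mult_right_mono)
    qed (intro borel_measurable_times clm sm \<psi>m)+
    have c2: "(\<lambda>n. LINT y|Omega. (\<psi> n y)\<^sup>2) \<longlonglongrightarrow> (LINT y|Omega. (cl M (s y))\<^sup>2)"
    proof (rule integral_dominated_convergence)
      show "integrable Omega (\<lambda>y. M\<^sup>2)" by simp
      show "AE y in Omega. (\<lambda>n. (\<psi> n y)\<^sup>2) \<longlonglongrightarrow> (cl M (s y))\<^sup>2"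
        using pl by eventually_elim (intro tendsto_power)
      show "AE y in Omega. norm ((\<psi> n y)\<^sup>2) \<le> M\<^sup>2" for n
      proof (rule AE_I2)
        fix y
        have "\<bar>\<psi> n y\<bar>\<^sup>2 \<le> M\<^sup>2" unfolding \<psi>_def using clb[OF M] by (intro power_mono) auto
        then show "norm ((\<psi> n y)\<^sup>2) \<le> M\<^sup>2" by simp
      qed
    qed (intro borel_measurable_power clm \<psi>m)+
    let ?J = "LINT y|Omega. (cl M (s y))\<^sup>2"
    have J0: "0 \<le> ?J" by (rule integral_nonneg_AE) simp
    have "(LINT y|Omega. cl M (s y) * s y) \<le> K * sqrt ?J"
    proof (rule LIMSEQ_le[OF c1])
      show "(\<lambda>n. K * sqrt (LINT y|Omega. (\<psi> n y)\<^sup>2)) \<longlonglongrightarrow> K * sqrt ?J"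
        by (intro tendsto_mult tendsto_const tendsto_real_sqrt c2)
      show "\<exists>N. \<forall>n\<ge>N. (LINT y|Omega. \<psi> n y * s y) \<le> K * sqrt (LINT y|Omega. (\<psi> n y)\<^sup>2)"
        using dual[OF \<psi>c] unfolding L2_norm_def by (auto intro: order_trans[OF abs_ge_self])
    qed
    moreover have "?J \<le> (LINT y|Omega. cl M (s y) * s y)"
    proof (rule integral_mono_AE)
      show "integrable Omega (\<lambda>y. (cl M (s y))\<^sup>2)"
        by (rule Bochner_Integration.integrable_bound[where f="\<lambda>y. M\<^sup>2"])
           (use clm M clb[OF M] in \<open>auto intro!: borel_measurable_power AE_I2 simp: abs_le_square_iff[symmetric]\<close>)
      show "integrable Omega (\<lambda>y. cl M (s y) * s y)"
      proof (rule Bochner_Integration.integrable_bound[where f="\<lambda>y. M * \<bar>s y\<bar>"])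
        show "AE y in Omega. norm (cl M (s y) * s y) \<le> norm (M * \<bar>s y\<bar>)"
          using clb[OF M] M by (intro AE_I2) (auto simp: abs_mult intro!: mult_right_mono)
      qed (use L2_integrable[OF s] clm sm in auto)
      show "AE y in Omega. (cl M (s y))\<^sup>2 \<le> cl M (s y) * s y"
      proof (rule AE_I2)
        fix y
        have "0 \<le> cl M (s y) * (s y - cl M (s y))"
          using M unfolding cl_def by (auto simp: max_def min_def mult_le_0_iff)
        then show "(cl M (s y))\<^sup>2 \<le> cl M (s y) * s y" by (simp add: power2_eq_square algebra_simps)
      qed
    qed
    ultimately have h: "sqrt ?J * sqrt ?J \<le> K * sqrt ?J" using J0 by simp
    have "sqrt ?J \<le> K"
    proof (cases "sqrt ?J = 0")
      case False
      then have "0 < sqrt ?J" using J0 real_sqrt_ge_zero[OF J0] by linarith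
      then show ?thesis using h by (simp only: mult_le_cancel_right_pos)
    qed (use K in simp)
    then have "(sqrt ?J)\<^sup>2 \<le> K\<^sup>2" using J0 by (intro power_mono) auto
    then show ?thesis using J0 by simp
  qed
  have "(\<lambda>n. LINT y|Omega. (cl (real n) (s y))\<^sup>2) \<longlonglongrightarrow> (LINT y|Omega. (s y)\<^sup>2)"
  proof (rule integral_dominated_convergence)
    show "AE y in Omega. (\<lambda>n. (cl (real n) (s y))\<^sup>2) \<longlonglongrightarrow> (s y)\<^sup>2"
    proof (rule AE_I2)
      fix y
      obtain N :: nat where N: "\<bar>s y\<bar> \<le> real N" using real_arch_simple by blast
      have "\<forall>\<^sub>F n in sequentially. (cl (real n) (s y))\<^sup>2 = (s y)\<^sup>2"
      proof (rule eventually_sequentiallyI[of N])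
        fix n assume "N \<le> n"
        then have "\<bar>s y\<bar> \<le> real n" using N by linarith
        then show "(cl (real n) (s y))\<^sup>2 = (s y)\<^sup>2" by (auto simp: cl_def max_def min_def abs_le_iff)
      qed
      then show "(\<lambda>n. (cl (real n) (s y))\<^sup>2) \<longlonglongrightarrow> (s y)\<^sup>2" by (rule tendsto_eventually)
    qed
    show "AE y in Omega. norm ((cl (real n) (s y))\<^sup>2) \<le> (s y)\<^sup>2" for n
    proof (rule AE_I2)
      fix y
      have "\<bar>cl (real n) (s y)\<bar> \<le> \<bar>s y\<bar>" by (auto simp: cl_def max_def min_def)
      then show "norm ((cl (real n) (s y))\<^sup>2) \<le> (s y)\<^sup>2" by (simp add: abs_le_square_iff)
    qed
  qed (use clm sm s2 in auto)
  then have "(LINT y|Omega. (s y)\<^sup>2) \<le> K\<^sup>2"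
    by (rule LIMSEQ_le_const2) (use key in auto)
  then show ?thesis unfolding L2_norm_def using K real_le_lsqrt by blast
qed

lemma L2_norm_le_if_Qn:
  assumes "s \<in> L2" "0 \<le> K" "\<And>n. Qn n s \<le> K\<^sup>2" shows "L2_norm s \<le> K"
  by (rule L2_norm_le_if_dual[OF assms(1,2) Qn_bound_dual[OF assms]])

section \<open>From the Sobolev formulation to increments\<close>

lemma test_function_smooth: "\<phi> \<in> test_functions a b \<Longrightarrow> smooth \<phi>"
  by (simp add: test_functions_def smooth_def)

lemma smooth_funpow: "smooth \<phi> \<Longrightarrow> smooth ((deriv ^^ k) \<phi>)"
  by (induction k) (auto intro: smooth_deriv)

lemma test_function_continuous: "\<phi> \<in> test_functions a b \<Longrightarrow> continuous_on S ((deriv ^^ k) \<phi>)"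
  by (intro smooth_continuous smooth_funpow test_function_smooth)

lemma test_function_zero: "\<phi> \<in> test_functions a b \<Longrightarrow> x \<notin> {a<..<b} \<Longrightarrow> \<phi> x = 0"
  unfolding test_functions_def using closure_subset[of "{x. \<phi> x \<noteq> 0}"] by blast

lemma test_function_deriv:
  assumes "\<phi> \<in> test_functions a b" shows "deriv \<phi> \<in> test_functions a b"
proof -
  have s: "smooth (deriv \<phi>)" by (intro smooth_deriv test_function_smooth[OF assms])
  have "{x. deriv \<phi> x \<noteq> 0} \<subseteq> closure {x. \<phi> x \<noteq> 0}"
  proof
    fix x assume x: "x \<in> {x. deriv \<phi> x \<noteq> 0}"
    show "x \<in> closure {x. \<phi> x \<noteq> 0}"
    proof (rule ccontr)
      assume n: "x \<notin> closure {x. \<phi> x \<noteq> 0}"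
      have "((\<lambda>_. 0) has_real_derivative 0) (at x)" by simp
      then have "(\<phi> has_real_derivative 0) (at x)"
        by (rule DERIV_cong_ev[THEN iffD1, rotated -1])
           (use n closure_subset[of "{x. \<phi> x \<noteq> 0}"] in \<open>auto simp: eventually_nhds intro!: exI[of _ "- closure {x. \<phi> x \<noteq> 0}"]\<close>)
      then show False using x DERIV_imp_deriv by auto
    qed
  qed
  then have "closure {x. deriv \<phi> x \<noteq> 0} \<subseteq> {a<..<b}"
    using assms closure_minimal[OF _ closed_closure] unfolding test_functions_def by blast
  then show ?thesis using s by (auto simp: test_functions_def smooth_def)
qed

lemma test_function_by_parts:
  assumes \<phi>: "\<phi> \<in> test_functions 0 1" and F: "\<And>y. y \<in> {0..1} \<Longrightarrow> (F has_real_derivative F' y) (at y within {0..1})"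
    and c: "continuous_on {0..1} F'"
  shows "mean (\<lambda>y. F' y * \<phi> y) = - mean (\<lambda>y. F y * deriv \<phi> y)"
proof -
  have cF: "continuous_on {0..1} F" using F by (meson DERIV_continuous_on)
  have c0: "continuous_on {0..1} \<phi>" and c1: "continuous_on {0..1} (deriv \<phi>)"
    using test_function_continuous[OF \<phi>, of _ 0] test_function_continuous[OF \<phi>, of _ 1] by auto
  have "((\<lambda>y. F' y * \<phi> y + deriv \<phi> y * F y) has_integral (F 1 * \<phi> 1 - F 0 * \<phi> 0)) {0..1}"
  proof (rule fundamental_theorem_of_calculus)
    fix y :: real assume "y \<in> {0..1}"
    then have "((\<lambda>y. F y * \<phi> y) has_real_derivative F' y * \<phi> y + deriv \<phi> y * F y) (at y within {0..1})"
      by (intro DERIV_mult F has_field_derivative_at_within[OF smooth_DERIV] test_function_smooth[OF \<phi>])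
    then show "((\<lambda>y. F y * \<phi> y) has_vector_derivative F' y * \<phi> y + deriv \<phi> y * F y) (at y within {0..1})"
      by (simp only: has_real_derivative_iff_has_vector_derivative)
  qed simp
  then have "mean (\<lambda>y. 1 * (F' y * \<phi> y) + 1 * (F y * deriv \<phi> y)) = 0"
    using test_function_zero[OF \<phi>, of 0] test_function_zero[OF \<phi>, of 1] by (simp add: mean_def integral_unique mult.commute)
  also have "mean (\<lambda>y. 1 * (F' y * \<phi> y) + 1 * (F y * deriv \<phi> y)) = 1 * mean (\<lambda>y. F' y * \<phi> y) + 1 * mean (\<lambda>y. F y * deriv \<phi> y)"
    by (intro mean_lin continuous_intros c cF c0 c1)
  finally show ?thesis by simp
qed

lemma weak_D_props:
  assumes "v \<in> sobolev k" "j \<le> k"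
  shows "weak_D j v \<in> L2" "has_weak_deriv 0 1 j v (weak_D j v)"
proof -
  have "\<exists>g. g \<in> L2 \<and> has_weak_deriv 0 1 j v g" using assms by (auto simp: sobolev_def)
  from someI_ex[OF this] show "weak_D j v \<in> L2" "has_weak_deriv 0 1 j v (weak_D j v)"
    by (auto simp: weak_D_def)
qed

lemma sobolev_norm_ge:
  "j \<le> k \<Longrightarrow> L2_norm (weak_D j v) \<le> sobolev_norm k v"
  unfolding sobolev_norm_def
  by (rule real_le_rsqrt) (auto intro!: member_le_sum[of j "{..k}" "\<lambda>j. (L2_norm (weak_D j v))\<^sup>2"])

lemma sobolev_norm_1_le: "sobolev_norm 1 v \<le> L2_norm (weak_D 0 v) + L2_norm (weak_D 1 v)"
  unfolding sobolev_norm_def by (simp add: sqrt_sum_squares_le_sum L2_norm_nonneg)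

lemma weak_deriv_L2_increment:
  assumes "continuous_on {0..1} v" "g \<in> L2" "has_weak_deriv 0 1 1 v g" "0 \<le> a" "a \<le> b" "b \<le> 1"
  shows "v b - v a = integral {a..b} g"
  by (rule weak_deriv_increment[OF _ assms(1) L2_integrable[OF assms(2)] assms(3-6)]) simp

text \<open>A weak derivative of order zero is a function with the same integrals against test functions. Apply
  \<open>weak_deriv_increment\<close> to the zero function, which has the weak derivative \<open>v - g\<close>.\<close>

lemma weak_deriv_0_integral:
  assumes v: "v \<in> L2" and g: "g \<in> L2" and w: "has_weak_deriv 0 1 0 v g" and ab: "0 \<le> a" "a \<le> b" "b \<le> 1"
  shows "integral {a..b} v = integral {a..b} g"
proof -
  have "has_weak_deriv 0 1 1 (\<lambda>_. 0) (\<lambda>y. v y - g y)"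
    unfolding has_weak_deriv_def
  proof
    fix \<phi> assume \<phi>: "\<phi> \<in> test_functions 0 1"
    have L: "\<phi> \<in> L2" using test_function_continuous[OF \<phi>, of _ 0] by (intro continuous_L2) simp
    have "(LINT x|Omega. (v x - g x) * \<phi> x) = (LINT x|Omega. v x * \<phi> x) - (LINT x|Omega. g x * \<phi> x)"
      using L2_mult_integrable[OF v L] L2_mult_integrable[OF g L] by (simp add: left_diff_distrib)
    also have "\<dots> = 0" using w \<phi> by (simp add: has_weak_deriv_def)
    finally show "(LINT x|Omega. 0 * (deriv ^^ 1) \<phi> x) = (- 1) ^ 1 * (LINT x|Omega. (v x - g x) * \<phi> x)" by simp
  qed
  from weak_deriv_L2_increment[OF _ L2_diff[OF v g] this ab]
  have "integral {a..b} (\<lambda>y. v y - g y) = 0" by simp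
  also have "integral {a..b} (\<lambda>y. v y - g y) = integral {a..b} v - integral {a..b} g"
    by (intro Henstock_Kurzweil_Integration.integral_diff L2_HK v g ab)
  finally show ?thesis by simp
qed

lemma has_weak_deriv_diff:
  assumes v: "v \<in> L2" "v' \<in> L2" and g: "g \<in> L2" "g' \<in> L2" and w: "has_weak_deriv 0 1 j v g" "has_weak_deriv 0 1 j v' g'"
  shows "has_weak_deriv 0 1 j (\<lambda>y. v y - v' y) (\<lambda>y. g y - g' y)"
  unfolding has_weak_deriv_def
proof
  fix \<phi> assume \<phi>: "\<phi> \<in> test_functions 0 1"
  have L: "\<phi> \<in> L2" "(deriv ^^ j) \<phi> \<in> L2"
    using test_function_continuous[OF \<phi>, of _ 0] test_function_continuous[OF \<phi>] by (auto intro!: continuous_L2)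
  show "(LINT x|Omega. (v x - v' x) * (deriv ^^ j) \<phi> x) = (- 1) ^ j * (LINT x|Omega. (g x - g' x) * \<phi> x)"
    using w \<phi> L2_mult_integrable[OF v(1) L(2)] L2_mult_integrable[OF v(2) L(2)] L2_mult_integrable[OF g(1) L(1)] L2_mult_integrable[OF g(2) L(1)]
    unfolding has_weak_deriv_def by (simp add: left_diff_distrib right_diff_distrib)
qed

lemma H1_props: assumes "v \<in> H1" shows "v \<in> sobolev 1" "v \<in> L2" "continuous_on {0..1} v"
  using assms by (auto simp: H1_def sobolev_def)

lemma H1_diff:
  assumes "v \<in> H1" "v' \<in> H1" shows "(\<lambda>y. v y - v' y) \<in> H1"
proof -
  have "\<exists>g\<in>L2. has_weak_deriv 0 1 j (\<lambda>y. v y - v' y) g" if "j \<le> 1" for j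
    using has_weak_deriv_diff[OF H1_props(2)[OF assms(1)] H1_props(2)[OF assms(2)]
        weak_D_props(1)[OF H1_props(1)[OF assms(1)] that] weak_D_props(1)[OF H1_props(1)[OF assms(2)] that]
        weak_D_props(2)[OF H1_props(1)[OF assms(1)] that] weak_D_props(2)[OF H1_props(1)[OF assms(2)] that]]
      L2_diff[OF weak_D_props(1)[OF H1_props(1)[OF assms(1)] that] weak_D_props(1)[OF H1_props(1)[OF assms(2)] that]] by blast
  then show ?thesis using H1_props[OF assms(1)] H1_props[OF assms(2)]
    by (auto simp: H1_def sobolev_def intro!: L2_diff continuous_intros)
qed

text \<open>The Sobolev embedding: the mean is bounded by the norm of \<open>v\<close> and the distance of \<open>v\<close> to its mean by the
  norm of the derivative. The first term is expressed by \<open>weak_D 0 v\<close>, which agrees with \<open>v\<close> in integrals.\<close>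

lemma H1_sup_le:
  assumes v: "v \<in> H1" and y: "y \<in> {0..1}"
  shows "\<bar>v y\<bar> \<le> 2 * sobolev_norm 1 v"
proof -
  note p = H1_props[OF v]
  note w0 = weak_D_props[OF p(1), of 0, simplified] and w1 = weak_D_props[OF p(1) order_refl]
  let ?n0 = "L2_norm (weak_D 0 v)" and ?n1 = "L2_norm (weak_D 1 v)"
  have inc: "\<bar>v y - v x\<bar> \<le> ?n1" if x: "x \<in> {0..1}" for x
  proof -
    have "\<bar>v b - v a\<bar> \<le> ?n1" if "0 \<le> a" "a \<le> b" "b \<le> 1" for a b
      using weak_deriv_L2_increment[OF p(3) w1 that] L2_integral_le[OF w1(1) that] by simp
    from this[of x y] this[of y x] show ?thesis using x y by (cases "x \<le> y") auto
  qed
  have "\<bar>integral {0..1} v\<bar> \<le> ?n0"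
    using weak_deriv_0_integral[OF p(2) w0, of 0 1] L2_integral_le[OF w0(1), of 0 1] by simp
  then have m: "\<bar>mean v\<bar> \<le> ?n0" by (simp add: mean_def)
  have "v y - mean v = mean (\<lambda>x. v y - v x)"
    using mean_lin[of "\<lambda>_. 1" v "v y" "- 1"] p(3) by simp
  moreover have "mean (\<lambda>x. v y - v x) \<le> mean (\<lambda>x. ?n1)" "mean (\<lambda>x. - ?n1) \<le> mean (\<lambda>x. v y - v x)"
    by (rule mean_mono; use inc p(3) in \<open>force intro!: continuous_intros simp: abs_le_iff\<close>)+
  ultimately have "\<bar>v y - mean v\<bar> \<le> ?n1" by simp
  then have "\<bar>v y\<bar> \<le> ?n0 + ?n1" using m by linarith
  then show ?thesis using sobolev_norm_ge[of 0 1 v] sobolev_norm_ge[of 1 1 v] by simp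
qed

lemma C_time_H1_jc:
  assumes "\<And>T. 0 < T \<Longrightarrow> w \<in> C_time T H1 (sobolev_norm 1)"
  shows "jc w"
  unfolding jc_def continuous_on_def
proof safe
  fix t y :: real assume t: "0 \<le> t" and y: "y \<in> {0..1}"
  have H: "w s \<in> H1" if "0 \<le> s" for s
    using assms[of "s + 1"] that by (auto simp: C_time_def)
  have "((\<lambda>s. sobolev_norm 1 (\<lambda>y. w s y - w t y)) \<longlongrightarrow> 0) (at t within {0..t+1})"
    using assms[of "t + 1"] t by (auto simp: C_time_def)
  moreover have "at t within {0..t+1} = at t within {0..}"
    by (rule at_within_nhd[of _ "{..<t+1}"]) auto
  ultimately have N: "((\<lambda>s. sobolev_norm 1 (\<lambda>y. w s y - w t y)) \<longlongrightarrow> 0) (at t within {0..})" by simp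
  have N0: "w t \<in> H1" "continuous_on {0..1} (w t)" using H[OF t] H1_props by auto
  show "((\<lambda>p. w (fst p) (snd p)) \<longlongrightarrow> w (fst (t, y)) (snd (t, y))) (at (t, y) within {0..} \<times> {0..1})"
  proof (rule tendstoI)
    fix e :: real assume e: "0 < e"
    have "\<forall>\<^sub>F s in at t within {0..}. sobolev_norm 1 (\<lambda>y. w s y - w t y) < e / 4"
      using order_tendstoD(2)[OF N, of "e / 4"] e by simp
    then obtain d1 where d1: "d1 > 0" "\<And>s. 0 \<le> s \<Longrightarrow> s \<noteq> t \<Longrightarrow> dist s t < d1 \<Longrightarrow> sobolev_norm 1 (\<lambda>y. w s y - w t y) < e / 4"
      unfolding eventually_at by auto
    obtain d2 where d2: "d2 > 0" "\<And>x. x \<in> {0..1} \<Longrightarrow> dist x y < d2 \<Longrightarrow> dist (w t x) (w t y) < e / 2"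
      using N0(2) y e unfolding continuous_on_iff by (metis half_gt_zero)
    show "\<forall>\<^sub>F p in at (t, y) within {0..} \<times> {0..1}. dist (w (fst p) (snd p)) (w (fst (t, y)) (snd (t, y))) < e"
      unfolding eventually_at
    proof (intro exI[of _ "min d1 d2"] conjI ballI impI)
      fix p :: "real \<times> real" assume p: "p \<in> {0..} \<times> {0..1}" "p \<noteq> (t, y) \<and> dist p (t, y) < min d1 d2"
      obtain s x where sx: "p = (s, x)" by (cases p)
      have s: "0 \<le> s" "x \<in> {0..1}" using p sx by auto
      have ds: "dist s t < d1" "dist x y < d2"
        using p(2) sx dist_fst_le[of p "(t, y)"] dist_snd_le[of p "(t, y)"] by auto
      have "\<bar>w s x - w t x\<bar> \<le> e / 2"
      proof (cases "s = t")
        case False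
        have "\<bar>w s x - w t x\<bar> \<le> 2 * sobolev_norm 1 (\<lambda>y. w s y - w t y)"
          by (rule H1_sup_le[OF H1_diff[OF H[OF s(1)] N0(1)] s(2)])
        then show ?thesis using d1(2)[OF s(1) False ds(1)] by simp
      qed (use e in simp)
      moreover have "\<bar>w t x - w t y\<bar> < e / 2" using d2(2)[OF s(2) ds(2)] by (simp add: dist_real_def)
      ultimately have "\<bar>w s x - w t y\<bar> < e" by linarith
      then show "dist (w (fst p) (snd p)) (w (fst (t, y)) (snd (t, y))) < e" by (simp add: sx dist_real_def)
    qed (use d1 d2 in simp)
  qed
qed

lemma borel_measurable_lebesgue_on_AE:
  fixes f g :: "real \<Rightarrow> real"
  assumes f: "f \<in> borel_measurable (lebesgue_on {a..b})" and AE: "AE x in lebesgue_on {a..b}. f x = g x"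
  shows "g \<in> borel_measurable (lebesgue_on {a..b})"
proof -
  have f': "(\<lambda>x. if x \<in> {a..b} then f x else 0) \<in> borel_measurable lebesgue"
    by (rule borel_measurable_if_I[OF f]) simp
  have "AE x in lebesgue. (if x \<in> {a..b} then f x else 0) = (if x \<in> {a..b} then g x else 0)"
    using AE by (simp add: AE_restrict_space_iff)
  from borel_measurable_if_D[OF borel_measurable_AE[OF f' this]] show ?thesis .
qed

lemma weak_time_deriv_increment:
  fixes A A' R :: "real \<Rightarrow> real"
  assumes T: "0 < T" and A: "continuous_on {0..T} A" and R: "continuous_on {0..T} R"
    and AE: "AE t in lebesgue_on {0..T}. A' t = R t" and w: "has_weak_deriv 0 T 1 A A'"
    and st: "0 \<le> s" "s \<le> t" "t \<le> T"
  shows "A t - A s = integral {s..t} R"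
proof -
  have Rm: "R \<in> borel_measurable (lebesgue_on {0..T})" by (intro continuous_imp_measurable_on_sets_lebesgue R) simp
  have Am: "A' \<in> borel_measurable (lebesgue_on {0..T})"
    by (rule borel_measurable_lebesgue_on_AE[OF Rm]) (use AE in \<open>auto elim: eventually_mono\<close>)
  have "has_weak_deriv 0 T 1 A R"
    unfolding has_weak_deriv_def
  proof
    fix \<phi> assume \<phi>: "\<phi> \<in> test_functions 0 T"
    have m: "\<phi> \<in> borel_measurable (lebesgue_on {0..T})"
      using test_function_continuous[OF \<phi>, of _ 0] by (intro continuous_imp_measurable_on_sets_lebesgue) auto
    have "(LINT x|lebesgue_on {0..T}. A' x * \<phi> x) = (LINT x|lebesgue_on {0..T}. R x * \<phi> x)"
      by (rule integral_cong_AE) (use Rm Am m AE in \<open>auto elim: eventually_mono intro!: borel_measurable_times\<close>)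
    then show "(LINT x|lebesgue_on {0..T}. A x * (deriv ^^ 1) \<phi> x) = (- 1) ^ 1 * (LINT x|lebesgue_on {0..T}. R x * \<phi> x)"
      using w \<phi> by (simp add: has_weak_deriv_def)
  qed
  from weak_deriv_increment[OF T A LINT_continuous(1)[OF R] this st] show ?thesis .
qed

lemma L2_time_AE: "w \<in> L2_time T X N \<Longrightarrow> AE t in lebesgue_on {0..T}. w t \<in> X"
  by (simp add: L2_time_def)

lemma C_time_AE: "w \<in> C_time T X N \<Longrightarrow> AE t in lebesgue_on {0..T}. w t \<in> X"
  by (rule AE_I2) (simp add: C_time_def)

lemma L2_inner_AE_cong:
  assumes "v \<in> L2" "w \<in> L2" "\<phi> \<in> L2" "AE y in Omega. v y = w y"
  shows "L2_inner v \<phi> = L2_inner w \<phi>"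
  unfolding L2_inner_def
  by (rule integral_cong_AE) (use assms in \<open>auto simp: L2_def elim: eventually_mono intro!: borel_measurable_times\<close>)

lemma L2_inner_lin:
  assumes "v \<in> L2" "w \<in> L2" "\<phi> \<in> L2"
  shows "L2_inner (\<lambda>y. a * v y + b * w y) \<phi> = a * L2_inner v \<phi> + b * L2_inner w \<phi>"
  using L2_mult_integrable[OF assms(1,3)] L2_mult_integrable[OF assms(2,3)]
  by (simp add: L2_inner_def distrib_right mult.assoc)

lemma L2_inner_mean:
  "continuous_on {0..1} v \<Longrightarrow> continuous_on {0..1} \<phi> \<Longrightarrow> L2_inner v \<phi> = mean (\<lambda>y. v y * \<phi> y)"
  unfolding L2_inner_def by (intro LINT_mean continuous_intros)

lemma jc_times_y: "jc w \<Longrightarrow> continuous_on {0..1} \<phi> \<Longrightarrow> jc (\<lambda>t y. w t y * \<phi> y)"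
proof (rule jc_mult)
  assume "continuous_on {0..1} \<phi>"
  then show "jc (\<lambda>t. \<phi>)" unfolding jc_def
    by (rule continuous_on_compose2) (auto intro!: continuous_intros)
qed

text \<open>Pairing an evolution equation \<open>\<partial>\<^sub>t w = w'\<close> with a test function in space yields a weak derivative of a real
  function in time, which is turned into increments.\<close>

lemma tested_increment:
  assumes w: "jc w" and \<phi>: "\<phi> \<in> test_functions 0 1" and R: "continuous_on {0..} R"
    and d: "\<And>T. 0 < T \<Longrightarrow> has_weak_time_deriv T w w'"
    and AE: "\<And>T. 0 < T \<Longrightarrow> AE t in lebesgue_on {0..T}. L2_inner (w' t) \<phi> = R t"
    and st: "0 \<le> s" "s \<le> t"
  shows "mean (\<lambda>y. w t y * \<phi> y) - mean (\<lambda>y. w s y * \<phi> y) = integral {s..t} R"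
proof -
  have \<phi>c: "continuous_on {0..1} \<phi>" using test_function_continuous[OF \<phi>, of _ 0] by simp
  have e: "L2_inner (w r) \<phi> = mean (\<lambda>y. w r y * \<phi> y)" if "0 \<le> r" for r
    by (rule L2_inner_mean[OF jc_slice[OF w that] \<phi>c])
  have cA: "continuous_on {0..t+1} (\<lambda>r. L2_inner (w r) \<phi>)"
  proof (rule continuous_on_eq)
    show "continuous_on {0..t+1} (\<lambda>r. mean (\<lambda>y. w r y * \<phi> y))"
      using continuous_on_mean[OF jc_times_y[OF w \<phi>c]] by (rule continuous_on_subset) auto
  qed (use e in auto)
  have "has_weak_deriv 0 (t+1) 1 (\<lambda>r. L2_inner (w r) \<phi>) (\<lambda>r. L2_inner (w' r) \<phi>)"
    using d[of "t + 1"] st continuous_L2[OF \<phi>c] by (auto simp: has_weak_time_deriv_def)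
  from weak_time_deriv_increment[OF _ cA continuous_on_subset[OF R] AE this, of s t]
  show ?thesis using st e by auto
qed

lemma mean_time_integral:
  assumes "jc w" "0 \<le> s"
  shows "mean (\<lambda>y. integral {s..t} (\<lambda>r. w r y)) = integral {s..t} (\<lambda>r. mean (w r))"
  using prim_time_integral[OF assms, of 1 t] by (simp add: prim_1)

lemma mean_time_integral_mult:
  assumes w: "jc w" and s: "0 \<le> s" and \<phi>: "continuous_on {0..1} \<phi>"
  shows "mean (\<lambda>y. integral {s..t} (\<lambda>r. w r y) * \<phi> y) = integral {s..t} (\<lambda>r. mean (\<lambda>y. w r y * \<phi> y))"
proof -
  have "mean (\<lambda>y. integral {s..t} (\<lambda>r. w r y) * \<phi> y) = mean (\<lambda>y. integral {s..t} (\<lambda>r. w r y * \<phi> y))" by simp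
  also have "\<dots> = integral {s..t} (\<lambda>r. mean (\<lambda>y. w r y * \<phi> y))" by (rule mean_time_integral[OF jc_times_y[OF w \<phi>] s])
  finally show ?thesis .
qed

lemma orthogonal_test_functions_0:
  assumes "continuous_on {0..1} h" "\<And>\<phi>. \<phi> \<in> test_functions 0 1 \<Longrightarrow> mean (\<lambda>y. h y * \<phi> y) = 0" "y \<in> {0..1}"
  shows "h y = 0"
  by (rule continuous_orthogonal_test_functions[OF _ assms(1) _ assms(3)]) (use assms(2) in \<open>auto simp: mean_def\<close>)

text \<open>All three equations are tested in space and integrated in time; then the test functions are removed, which
  is possible because the time integrals are continuous in space. For the momentum equation with time
  integral \<open>U\<close> of \<open>u\<close> the result is that \<open>\<eta> U\<close> plus a primitive of continuous functions has weak second
  derivative zero, hence is affine. The boundary values determine this affine function, so \<open>U\<close> is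
  continuously differentiable. The stress equation then holds with this derivative of \<open>U\<close>.\<close>

theorem global_solution_imp_aging_flow:
  assumes pos: "\<rho> > 0" "\<eta> > 0" "lam > 0" "G > 0" "\<xi> > 0" "\<nu> > 0"
    and f0: "\<forall>y\<in>{0..1}. f0 y \<ge> 0" "\<exists>y\<in>{0..1}. f0 y \<noteq> 0"
    and sol: "global_solution \<rho> \<eta> lam G \<xi> \<nu> u0 \<tau>0 f0 u \<tau> f"
  shows "aging_flow \<rho> \<eta> lam G u \<tau> f \<xi> \<nu>"
proof -
  obtain ut \<tau>t ft where S: "\<And>T. 0 < T \<Longrightarrow>
        u \<in> C_time T H1 (sobolev_norm 1) \<inter> L2_time T (sobolev 2) (sobolev_norm 2) \<and>
        \<tau> \<in> C_time T H1 (sobolev_norm 1) \<and> f \<in> C_time T H1 (sobolev_norm 1) \<and>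
        has_weak_time_deriv T u ut \<and> ut \<in> L2_time T L2 L2_norm \<and>
        has_weak_time_deriv T \<tau> \<tau>t \<and> \<tau>t \<in> C_time T L2 L2_norm \<and>
        has_weak_time_deriv T f ft \<and> ft \<in> C_time T L2 L2_norm \<and>
        (AE t in lebesgue_on {0..T}.
          (AE y in Omega. \<rho> * ut t y = \<eta> * weak_D 2 (u t) y + weak_D 1 (\<tau> t) y) \<and>
          (AE y in Omega. lam * \<tau>t t y = G * weak_D 1 (u t) y - f t y * \<tau> t y) \<and>
          (AE y in Omega. ft t y = (- 1 + \<xi> * \<bar>\<tau> t y\<bar>) * (f t y)\<^sup>2 - \<nu> * (f t y) ^ 3))"
    and init: "\<forall>y\<in>{0..1}. u 0 y = u0 y \<and> \<tau> 0 y = \<tau>0 y \<and> f 0 y = f0 y"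
    and bdry: "\<forall>t\<ge>0. u t 0 = 0 \<and> u t 1 = 0"
    using sol unfolding global_solution_def by blast
  have ju: "jc u" and j\<tau>: "jc \<tau>" and jf: "jc f" using S by (auto intro!: C_time_H1_jc)
  define F where "F r y = (- 1 + \<xi> * \<bar>\<tau> r y\<bar>) * (f r y)\<^sup>2 - \<nu> * (f r y) ^ 3" for r y
  have jF: "jc F" unfolding F_def by (intro jc_intros j\<tau> jf)
  have jg: "jc (\<lambda>t y. f t y * \<tau> t y)" by (intro jc_intros j\<tau> jf)
  have H1u: "AE t in lebesgue_on {0..T}. u t \<in> H1 \<and> \<tau> t \<in> H1 \<and> 0 \<le> t" if "0 < T" for T
    using S[OF that] by (intro AE_I2) (auto simp: C_time_def)

  have eq_f: "mean (\<lambda>y. f t y * \<phi> y) - mean (\<lambda>y. f s y * \<phi> y) = integral {s..t} (\<lambda>r. mean (\<lambda>y. F r y * \<phi> y))"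
    if \<phi>: "\<phi> \<in> test_functions 0 1" and st: "0 \<le> s" "s \<le> t" for \<phi> s t
  proof (rule tested_increment[OF jf \<phi> _ _ _ st])
    have \<phi>c: "continuous_on {0..1} \<phi>" using test_function_continuous[OF \<phi>, of _ 0] by simp
    show "continuous_on {0..} (\<lambda>r. mean (\<lambda>y. F r y * \<phi> y))" by (intro continuous_on_mean jc_times_y jF \<phi>c)
    show "has_weak_time_deriv T f ft" if "0 < T" for T using S[OF that] by blast
    show "AE t in lebesgue_on {0..T}. L2_inner (ft t) \<phi> = mean (\<lambda>y. F t y * \<phi> y)" if T: "0 < T" for T
    proof -
      have "AE t in lebesgue_on {0..T}. ft t \<in> L2" using S[OF T] C_time_AE by blast
      moreover have "AE t in lebesgue_on {0..T}. AE y in Omega. ft t y = F t y"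
        using S[OF T] unfolding F_def by (auto elim: eventually_mono)
      ultimately show ?thesis using H1u[OF T]
      proof eventually_elim
        case (elim t)
        have c: "continuous_on {0..1} (F t)" using jc_slice[OF jF] elim by auto
        have "L2_inner (ft t) \<phi> = L2_inner (F t) \<phi>"
          by (rule L2_inner_AE_cong) (use elim continuous_L2[OF c] continuous_L2[OF \<phi>c] in auto)
        then show ?case by (simp add: L2_inner_mean[OF c \<phi>c])
      qed
    qed
  qed

  have eq_\<tau>: "mean (\<lambda>y. \<tau> t y * \<phi> y) - mean (\<lambda>y. \<tau> s y * \<phi> y)
      = integral {s..t} (\<lambda>r. (- (G / lam)) * mean (\<lambda>y. u r y * deriv \<phi> y) + (- (1 / lam)) * mean (\<lambda>y. (f r y * \<tau> r y) * \<phi> y))"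
    if \<phi>: "\<phi> \<in> test_functions 0 1" and st: "0 \<le> s" "s \<le> t" for \<phi> s t
  proof (rule tested_increment[OF j\<tau> \<phi> _ _ _ st])
    have \<phi>c: "continuous_on {0..1} \<phi>" using test_function_continuous[OF \<phi>, of _ 0] by simp
    have \<phi>1: "continuous_on {0..1} (deriv \<phi>)" using test_function_continuous[OF \<phi>, of _ 1] by simp
    show "continuous_on {0..} (\<lambda>r. (- (G / lam)) * mean (\<lambda>y. u r y * deriv \<phi> y) + (- (1 / lam)) * mean (\<lambda>y. (f r y * \<tau> r y) * \<phi> y))"
      by (intro continuous_intros continuous_on_mean jc_times_y jg ju \<phi>c \<phi>1)
    show "has_weak_time_deriv T \<tau> \<tau>t" if "0 < T" for T using S[OF that] by blast
    show "AE t in lebesgue_on {0..T}. L2_inner (\<tau>t t) \<phi> = (- (G / lam)) * mean (\<lambda>y. u t y * deriv \<phi> y) + (- (1 / lam)) * mean (\<lambda>y. (f t y * \<tau> t y) * \<phi> y)"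
      if T: "0 < T" for T
    proof -
      have "AE t in lebesgue_on {0..T}. \<tau>t t \<in> L2" using S[OF T] C_time_AE by blast
      moreover have "AE t in lebesgue_on {0..T}. AE y in Omega. lam * \<tau>t t y = G * weak_D 1 (u t) y - f t y * \<tau> t y"
        using S[OF T] by (auto elim: eventually_mono)
      ultimately show ?thesis using H1u[OF T]
      proof eventually_elim
        case (elim t)
        have cg: "continuous_on {0..1} (\<lambda>y. f t y * \<tau> t y)" and cu: "continuous_on {0..1} (u t)"
          using jc_slice[OF jg] jc_slice[OF ju] elim by auto
        note D = weak_D_props[OF H1_props(1), of "u t" 1]
        have gL: "(\<lambda>y. f t y * \<tau> t y) \<in> L2" by (rule continuous_L2[OF cg])
        have \<phi>L: "\<phi> \<in> L2" by (rule continuous_L2[OF \<phi>c])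
        have "L2_inner (\<tau>t t) \<phi> = L2_inner (\<lambda>y. (G / lam) * weak_D 1 (u t) y + (- (1 / lam)) * (f t y * \<tau> t y)) \<phi>"
        proof (rule L2_inner_AE_cong)
          show "(\<lambda>y. (G / lam) * weak_D 1 (u t) y + (- (1 / lam)) * (f t y * \<tau> t y)) \<in> L2"
            using D elim gL by (intro L2_add L2_cmult) auto
          show "AE y in Omega. \<tau>t t y = (G / lam) * weak_D 1 (u t) y + (- (1 / lam)) * (f t y * \<tau> t y)"
            using elim(2) by eventually_elim (use pos in \<open>simp add: field_simps\<close>)
        qed (use elim \<phi>L in auto)
        also have "\<dots> = (G / lam) * L2_inner (weak_D 1 (u t)) \<phi> + (- (1 / lam)) * L2_inner (\<lambda>y. f t y * \<tau> t y) \<phi>"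
          using D elim gL \<phi>L by (intro L2_inner_lin) auto
        also have "L2_inner (weak_D 1 (u t)) \<phi> = - mean (\<lambda>y. u t y * deriv \<phi> y)"
        proof -
          have "(LINT x|Omega. u t x * deriv \<phi> x) = - (LINT x|Omega. weak_D 1 (u t) x * \<phi> x)"
            using D(2) elim \<phi> unfolding has_weak_deriv_def by auto
          moreover have "(LINT x|Omega. u t x * deriv \<phi> x) = mean (\<lambda>y. u t y * deriv \<phi> y)"
            by (intro LINT_mean continuous_intros cu \<phi>1)
          ultimately show ?thesis by (simp add: L2_inner_def)
        qed
        finally show ?case by (simp add: L2_inner_mean[OF cg \<phi>c])
      qed
    qed
  qed

  have eq_u: "mean (\<lambda>y. u t y * \<phi> y) - mean (\<lambda>y. u s y * \<phi> y)
      = integral {s..t} (\<lambda>r. (\<eta> / \<rho>) * mean (\<lambda>y. u r y * deriv (deriv \<phi>) y) + (- (1 / \<rho>)) * mean (\<lambda>y. \<tau> r y * deriv \<phi> y))"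
    if \<phi>: "\<phi> \<in> test_functions 0 1" and st: "0 \<le> s" "s \<le> t" for \<phi> s t
  proof (rule tested_increment[OF ju \<phi> _ _ _ st])
    have \<phi>c: "continuous_on {0..1} \<phi>" using test_function_continuous[OF \<phi>, of _ 0] by simp
    have \<phi>1: "continuous_on {0..1} (deriv \<phi>)" using test_function_continuous[OF \<phi>, of _ 1] by simp
    have \<phi>2: "continuous_on {0..1} (deriv (deriv \<phi>))" using test_function_continuous[OF \<phi>, of _ 2] by (simp add: numeral_2_eq_2)
    show "continuous_on {0..} (\<lambda>r. (\<eta> / \<rho>) * mean (\<lambda>y. u r y * deriv (deriv \<phi>) y) + (- (1 / \<rho>)) * mean (\<lambda>y. \<tau> r y * deriv \<phi> y))"
      by (intro continuous_on_add continuous_on_mult continuous_on_const continuous_on_mean jc_times_y j\<tau> ju \<phi>2 \<phi>1)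
    show "has_weak_time_deriv T u ut" if "0 < T" for T using S[OF that] by blast
    show "AE t in lebesgue_on {0..T}. L2_inner (ut t) \<phi> = (\<eta> / \<rho>) * mean (\<lambda>y. u t y * deriv (deriv \<phi>) y) + (- (1 / \<rho>)) * mean (\<lambda>y. \<tau> t y * deriv \<phi> y)"
      if T: "0 < T" for T
    proof -
      have "AE t in lebesgue_on {0..T}. ut t \<in> L2" using S[OF T] L2_time_AE by blast
      moreover have "AE t in lebesgue_on {0..T}. u t \<in> sobolev 2" using S[OF T] L2_time_AE by blast
      moreover have "AE t in lebesgue_on {0..T}. AE y in Omega. \<rho> * ut t y = \<eta> * weak_D 2 (u t) y + weak_D 1 (\<tau> t) y"
        using S[OF T] by (auto elim: eventually_mono)
      ultimately show ?thesis using H1u[OF T]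
      proof eventually_elim
        case (elim t)
        have c\<tau>: "continuous_on {0..1} (\<tau> t)" and cu: "continuous_on {0..1} (u t)"
          using jc_slice[OF j\<tau>] jc_slice[OF ju] elim by auto
        note D = weak_D_props[OF H1_props(1), of "\<tau> t" 1]
        note D2 = weak_D_props[OF elim(2), of 2]
        have \<phi>L: "\<phi> \<in> L2" by (rule continuous_L2[OF \<phi>c])
        have "L2_inner (ut t) \<phi> = L2_inner (\<lambda>y. (\<eta> / \<rho>) * weak_D 2 (u t) y + (1 / \<rho>) * weak_D 1 (\<tau> t) y) \<phi>"
        proof (rule L2_inner_AE_cong)
          show "(\<lambda>y. (\<eta> / \<rho>) * weak_D 2 (u t) y + (1 / \<rho>) * weak_D 1 (\<tau> t) y) \<in> L2"
            using D D2 elim by (intro L2_add L2_cmult) auto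
          show "AE y in Omega. ut t y = (\<eta> / \<rho>) * weak_D 2 (u t) y + (1 / \<rho>) * weak_D 1 (\<tau> t) y"
            using elim(3) by eventually_elim (use pos in \<open>simp add: field_simps\<close>)
        qed (use elim \<phi>L in auto)
        also have "\<dots> = (\<eta> / \<rho>) * L2_inner (weak_D 2 (u t)) \<phi> + (1 / \<rho>) * L2_inner (weak_D 1 (\<tau> t)) \<phi>"
          using D D2 elim \<phi>L by (intro L2_inner_lin) auto
        also have "L2_inner (weak_D 1 (\<tau> t)) \<phi> = - mean (\<lambda>y. \<tau> t y * deriv \<phi> y)"
        proof -
          have "(LINT x|Omega. \<tau> t x * deriv \<phi> x) = - (LINT x|Omega. weak_D 1 (\<tau> t) x * \<phi> x)"
            using D(2) elim \<phi> unfolding has_weak_deriv_def by auto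
          moreover have "(LINT x|Omega. \<tau> t x * deriv \<phi> x) = mean (\<lambda>y. \<tau> t y * deriv \<phi> y)"
            by (intro LINT_mean continuous_intros c\<tau> \<phi>1)
          ultimately show ?thesis by (simp add: L2_inner_def)
        qed
        also have "L2_inner (weak_D 2 (u t)) \<phi> = mean (\<lambda>y. u t y * deriv (deriv \<phi>) y)"
        proof -
          have "(LINT x|Omega. u t x * deriv (deriv \<phi>) x) = (LINT x|Omega. weak_D 2 (u t) x * \<phi> x)"
            using D2(2) \<phi> unfolding has_weak_deriv_def by (auto simp: numeral_2_eq_2)
          moreover have "(LINT x|Omega. u t x * deriv (deriv \<phi>) x) = mean (\<lambda>y. u t y * deriv (deriv \<phi>) y)"
            by (intro LINT_mean continuous_intros cu \<phi>2)
          ultimately show ?thesis by (simp add: L2_inner_def)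
        qed
        finally show ?case by simp
      qed
    qed
  qed

  have flow_u: "((\<lambda>y. integral {s..t} (\<lambda>r. u r y)) has_real_derivative
        (\<rho> * zprim (u t) y - \<rho> * zprim (u s) y - integral {s..t} (\<lambda>r. \<tau> r y - mean (\<tau> r))) / \<eta>) (at y within {0..1})"
    if st: "0 \<le> s" "s \<le> t" and y: "y \<in> {0..1}" for s t y
  proof -
    have t0: "0 \<le> t" using st by simp
    define U where "U y = integral {s..t} (\<lambda>r. u r y)" for y
    define Tt where "Tt y = integral {s..t} (\<lambda>r. \<tau> r y)" for y
    define W where "W y = \<rho> * zprim (u t) y - \<rho> * zprim (u s) y" for y
    have cU: "continuous_on {0..1} U" and cT: "continuous_on {0..1} Tt"
      unfolding U_def Tt_def by (intro cont_time_integral ju j\<tau> st)+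
    have cus: "continuous_on {0..1} (u s)" "continuous_on {0..1} (u t)" using jc_slice[OF ju] st t0 by auto
    have W': "(W has_real_derivative \<rho> * u t y - \<rho> * u s y) (at y within {0..1})" if "y \<in> {0..1}" for y
    proof -
      have z: "(zprim g has_real_derivative g y) (at y within {0..1})" if "continuous_on {0..1} g" for g
        using DERIV_diff[OF prim_deriv[OF that \<open>y \<in> {0..1}\<close>] DERIV_const[of "mean (prim g)"]] by (simp add: zprim_def[abs_def])
      show ?thesis unfolding W_def[abs_def] by (intro DERIV_diff DERIV_cmult z cus)
    qed
    have cW: "continuous_on {0..1} W" by (rule DERIV_continuous_on[OF W'])
    define P where "P y = Tt y - W y" for y
    have cP: "continuous_on {0..1} P" unfolding P_def by (intro continuous_intros cT cW)
    define h where "h y = \<eta> * U y + prim P y" for y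
    have ch: "continuous_on {0..1} h" unfolding h_def by (intro continuous_intros cU prim_cont[OF cP])
    have aff: "h y = (1 - y) * h 0 + y * h 1" if y: "y \<in> {0..1}" for y
    proof (rule weak_second_deriv_zero_imp_affine[OF ch _ y])
      fix \<phi> assume \<phi>: "\<phi> \<in> test_functions 0 1"
      have \<phi>c: "continuous_on {0..1} \<phi>" using test_function_continuous[OF \<phi>, of _ 0] by simp
      have \<phi>1: "continuous_on {0..1} (deriv \<phi>)" using test_function_continuous[OF \<phi>, of _ 1] by simp
      have \<phi>2: "continuous_on {0..1} (deriv (deriv \<phi>))" using test_function_continuous[OF \<phi>, of _ 2] by (simp add: numeral_2_eq_2)
      have a: "mean (\<lambda>y. U y * deriv (deriv \<phi>) y) = integral {s..t} (\<lambda>r. mean (\<lambda>y. u r y * deriv (deriv \<phi>) y))"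
        unfolding U_def by (rule mean_time_integral_mult[OF ju st(1) \<phi>2])
      have b: "mean (\<lambda>y. Tt y * deriv \<phi> y) = integral {s..t} (\<lambda>r. mean (\<lambda>y. \<tau> r y * deriv \<phi> y))"
        unfolding Tt_def by (rule mean_time_integral_mult[OF j\<tau> st(1) \<phi>1])
      have "integral {s..t} (\<lambda>r. (\<eta> / \<rho>) * mean (\<lambda>y. u r y * deriv (deriv \<phi>) y) + (- (1 / \<rho>)) * mean (\<lambda>y. \<tau> r y * deriv \<phi> y))
        = (\<eta> / \<rho>) * mean (\<lambda>y. U y * deriv (deriv \<phi>) y) + (- (1 / \<rho>)) * mean (\<lambda>y. Tt y * deriv \<phi> y)"
        unfolding a b
        by (intro integral_unique has_integral_add has_integral_mult_right integrable_integral cont_time_integrable continuous_on_mean jc_times_y ju j\<tau> \<phi>1 \<phi>2 st)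
      then have e: "mean (\<lambda>y. u t y * \<phi> y) - mean (\<lambda>y. u s y * \<phi> y) = (\<eta> / \<rho>) * mean (\<lambda>y. U y * deriv (deriv \<phi>) y) + (- (1 / \<rho>)) * mean (\<lambda>y. Tt y * deriv \<phi> y)"
        using eq_u[OF \<phi> st] by simp
      have "mean (\<lambda>y. (\<rho> * u t y - \<rho> * u s y) * \<phi> y) = - mean (\<lambda>y. W y * deriv \<phi> y)"
        by (rule test_function_by_parts[OF \<phi> W']) (auto intro!: continuous_intros cus)
      also have "mean (\<lambda>y. (\<rho> * u t y - \<rho> * u s y) * \<phi> y) = mean (\<lambda>y. \<rho> * (u t y * \<phi> y) + (- \<rho>) * (u s y * \<phi> y))"
        by (rule mean_cong) (simp add: algebra_simps)
      also have "\<dots> = \<rho> * mean (\<lambda>y. u t y * \<phi> y) + (- \<rho>) * mean (\<lambda>y. u s y * \<phi> y)"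
        by (intro mean_lin continuous_intros cus \<phi>c)
      finally have w: "\<rho> * (mean (\<lambda>y. u t y * \<phi> y) - mean (\<lambda>y. u s y * \<phi> y)) = - mean (\<lambda>y. W y * deriv \<phi> y)"
        by (simp add: right_diff_distrib)
      have p: "mean (\<lambda>y. P y * deriv \<phi> y) = - mean (\<lambda>y. prim P y * deriv (deriv \<phi>) y)"
        by (rule test_function_by_parts[OF test_function_deriv[OF \<phi>] prim_deriv[OF cP] cP])
      have "mean (\<lambda>y. P y * deriv \<phi> y) = mean (\<lambda>y. 1 * (Tt y * deriv \<phi> y) + (- 1) * (W y * deriv \<phi> y))"
        by (rule mean_cong) (simp add: P_def algebra_simps)
      also have "\<dots> = 1 * mean (\<lambda>y. Tt y * deriv \<phi> y) + (- 1) * mean (\<lambda>y. W y * deriv \<phi> y)"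
        by (intro mean_lin continuous_intros cT cW \<phi>1)
      finally have p2: "mean (\<lambda>y. P y * deriv \<phi> y) = mean (\<lambda>y. Tt y * deriv \<phi> y) - mean (\<lambda>y. W y * deriv \<phi> y)" by simp
      have "mean (\<lambda>y. h y * deriv (deriv \<phi>) y) = mean (\<lambda>y. \<eta> * (U y * deriv (deriv \<phi>) y) + 1 * (prim P y * deriv (deriv \<phi>) y))"
        by (rule mean_cong) (simp add: h_def algebra_simps)
      also have "\<dots> = \<eta> * mean (\<lambda>y. U y * deriv (deriv \<phi>) y) + 1 * mean (\<lambda>y. prim P y * deriv (deriv \<phi>) y)"
        by (intro mean_lin continuous_intros cU prim_cont[OF cP] \<phi>2)
      also have "\<dots> = 0"
      proof -
        have "\<rho> * ((\<eta> / \<rho>) * mean (\<lambda>y. U y * deriv (deriv \<phi>) y) + (- (1 / \<rho>)) * mean (\<lambda>y. Tt y * deriv \<phi> y)) = - mean (\<lambda>y. W y * deriv \<phi> y)"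
          using w by (simp only: e)
        then have "\<eta> * mean (\<lambda>y. U y * deriv (deriv \<phi>) y) - mean (\<lambda>y. Tt y * deriv \<phi> y) = - mean (\<lambda>y. W y * deriv \<phi> y)"
          using pos by (simp add: right_diff_distrib distrib_left)
        then show ?thesis using p p2 by simp
      qed
      finally show "integral {0..1} (\<lambda>y. h y * deriv (deriv \<phi>) y) = 0" by (simp add: mean_def)
    qed
    have U01: "U 0 = 0" "U 1 = 0"
    proof -
      have "U p = integral {s..t} (\<lambda>r::real. 0)" if "p = 0 \<or> p = 1" for p
        unfolding U_def by (rule Henstock_Kurzweil_Integration.integral_cong) (use that bdry st in auto)
      then show "U 0 = 0" "U 1 = 0" by auto
    qed
    have mW: "mean W = 0"
    proof -
      have zc: "continuous_on {0..1} (zprim g)" if "continuous_on {0..1} g" for g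
        unfolding zprim_def[abs_def] by (intro continuous_intros prim_cont[OF that])
      have "mean W = mean (\<lambda>y. \<rho> * zprim (u t) y + (- \<rho>) * zprim (u s) y)" by (rule mean_cong) (simp add: W_def)
      also have "\<dots> = \<rho> * mean (zprim (u t)) + (- \<rho>) * mean (zprim (u s))" by (intro mean_lin zc cus)
      finally show ?thesis using mean_zprim cus by simp
    qed
    have mP: "prim P 1 = mean Tt"
      unfolding prim_1 P_def[abs_def] using mean_lin[OF cT cW, of 1 "- 1"] mW by simp
    have "((\<lambda>x. (x * mean Tt - prim P x) / \<eta>) has_real_derivative (mean Tt - P y) / \<eta>) (at y within {0..1})"
      by (rule derivative_eq_intros prim_deriv[OF cP y] refl)+ (use pos in auto)
    then have d: "(U has_real_derivative (mean Tt - P y) / \<eta>) (at y within {0..1})"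
    proof (rule has_field_derivative_transform_within[where d=1])
      fix x :: real assume x: "x \<in> {0..1}"
      have "\<eta> * U x + prim P x = x * mean Tt" using aff[OF x] U01 mP by (simp add: h_def)
      then show "(x * mean Tt - prim P x) / \<eta> = U x" using pos by (simp add: field_simps)
    qed (use y in auto)
    have "integral {s..t} (\<lambda>r. \<tau> r y - mean (\<tau> r)) = Tt y - mean Tt"
    proof -
      have "integral {s..t} (\<lambda>r. \<tau> r y - mean (\<tau> r)) = integral {s..t} (\<lambda>r. \<tau> r y) - integral {s..t} (\<lambda>r. mean (\<tau> r))"
        using st y by (intro Henstock_Kurzweil_Integration.integral_diff jc_time_integrable[OF j\<tau>] cont_time_integrable continuous_on_mean j\<tau>) auto
      also have "integral {s..t} (\<lambda>r. mean (\<tau> r)) = mean Tt"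
        unfolding Tt_def by (rule mean_time_integral[OF j\<tau> st(1), symmetric])
      finally show ?thesis by (simp add: Tt_def)
    qed
    then have e: "mean Tt - P y = \<rho> * zprim (u t) y - \<rho> * zprim (u s) y - integral {s..t} (\<lambda>r. \<tau> r y - mean (\<tau> r))"
      by (simp add: P_def W_def)
    show ?thesis using d unfolding U_def[abs_def] e .
  qed

  have flow_\<tau>: "lam * (\<tau> t y - \<tau> s y) =
        G * ((\<rho> * zprim (u t) y - \<rho> * zprim (u s) y - integral {s..t} (\<lambda>r. \<tau> r y - mean (\<tau> r))) / \<eta>)
        - integral {s..t} (\<lambda>r. f r y * \<tau> r y)"
    if st: "0 \<le> s" "s \<le> t" and y: "y \<in> {0..1}" for s t y
  proof -
    have t0: "0 \<le> t" using st by simp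
    define U where "U y = integral {s..t} (\<lambda>r. u r y)" for y
    define I where "I y = integral {s..t} (\<lambda>r. f r y * \<tau> r y)" for y
    define Dd where "Dd y = (\<rho> * zprim (u t) y - \<rho> * zprim (u s) y - integral {s..t} (\<lambda>r. \<tau> r y - mean (\<tau> r))) / \<eta>" for y
    have cU: "continuous_on {0..1} U" and cI: "continuous_on {0..1} I"
      unfolding U_def I_def by (intro cont_time_integral ju jg st)+
    have cus: "continuous_on {0..1} (\<tau> s)" "continuous_on {0..1} (\<tau> t)" using jc_slice[OF j\<tau>] st t0 by auto
    have cD: "continuous_on {0..1} Dd"
    proof -
      have z: "continuous_on {0..1} (zprim (u r))" if "0 \<le> r" for r
        unfolding zprim_def[abs_def] by (intro continuous_intros prim_cont jc_slice[OF ju that])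
      have "continuous_on {0..1} (\<lambda>y. integral {s..t} (\<lambda>r. \<tau> r y - mean (\<tau> r)))"
        by (intro cont_time_integral jc_intros j\<tau> st)
      then show ?thesis unfolding Dd_def using pos st t0 by (intro continuous_intros z) auto
    qed
    have "lam * (\<tau> t y - \<tau> s y) - G * Dd y + I y = 0"
    proof (rule orthogonal_test_functions_0[OF _ _ y, where h="\<lambda>y. lam * (\<tau> t y - \<tau> s y) - G * Dd y + I y"])
      show "continuous_on {0..1} (\<lambda>y. lam * (\<tau> t y - \<tau> s y) - G * Dd y + I y)" by (intro continuous_intros cus cD cI)
      fix \<phi> assume \<phi>: "\<phi> \<in> test_functions 0 1"
      have \<phi>c: "continuous_on {0..1} \<phi>" using test_function_continuous[OF \<phi>, of _ 0] by simp
      have \<phi>1: "continuous_on {0..1} (deriv \<phi>)" using test_function_continuous[OF \<phi>, of _ 1] by simp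
      have a: "mean (\<lambda>y. U y * deriv \<phi> y) = integral {s..t} (\<lambda>r. mean (\<lambda>y. u r y * deriv \<phi> y))"
        unfolding U_def by (rule mean_time_integral_mult[OF ju st(1) \<phi>1])
      have b: "mean (\<lambda>y. I y * \<phi> y) = integral {s..t} (\<lambda>r. mean (\<lambda>y. (f r y * \<tau> r y) * \<phi> y))"
        unfolding I_def by (rule mean_time_integral_mult[OF jg st(1) \<phi>c])
      have "integral {s..t} (\<lambda>r. (- (G / lam)) * mean (\<lambda>y. u r y * deriv \<phi> y) + (- (1 / lam)) * mean (\<lambda>y. (f r y * \<tau> r y) * \<phi> y))
        = (- (G / lam)) * mean (\<lambda>y. U y * deriv \<phi> y) + (- (1 / lam)) * mean (\<lambda>y. I y * \<phi> y)"
        unfolding a b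
        by (intro integral_unique has_integral_add has_integral_mult_right integrable_integral cont_time_integrable continuous_on_mean jc_times_y ju jg \<phi>1 \<phi>c st)
      then have e: "mean (\<lambda>y. \<tau> t y * \<phi> y) - mean (\<lambda>y. \<tau> s y * \<phi> y) = (- (G / lam)) * mean (\<lambda>y. U y * deriv \<phi> y) + (- (1 / lam)) * mean (\<lambda>y. I y * \<phi> y)"
        using eq_\<tau>[OF \<phi> st] by simp
      have d: "mean (\<lambda>y. Dd y * \<phi> y) = - mean (\<lambda>y. U y * deriv \<phi> y)"
        by (rule test_function_by_parts[OF \<phi> _ cD]) (use flow_u[OF st] in \<open>simp add: U_def[abs_def] Dd_def\<close>)
      have "mean (\<lambda>y. (lam * (\<tau> t y - \<tau> s y) - G * Dd y + I y) * \<phi> y)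
        = mean (\<lambda>y. 1 * (lam * (\<tau> t y * \<phi> y) + (- lam) * (\<tau> s y * \<phi> y)) + 1 * ((- G) * (Dd y * \<phi> y) + 1 * (I y * \<phi> y)))"
        by (rule mean_cong) (simp add: algebra_simps)
      also have "\<dots> = 1 * mean (\<lambda>y. lam * (\<tau> t y * \<phi> y) + (- lam) * (\<tau> s y * \<phi> y)) + 1 * mean (\<lambda>y. (- G) * (Dd y * \<phi> y) + 1 * (I y * \<phi> y))"
        by (intro mean_lin continuous_intros cus cD cI \<phi>c)
      also have "mean (\<lambda>y. lam * (\<tau> t y * \<phi> y) + (- lam) * (\<tau> s y * \<phi> y)) = lam * mean (\<lambda>y. \<tau> t y * \<phi> y) + (- lam) * mean (\<lambda>y. \<tau> s y * \<phi> y)"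
        by (intro mean_lin continuous_intros cus \<phi>c)
      also have "mean (\<lambda>y. (- G) * (Dd y * \<phi> y) + 1 * (I y * \<phi> y)) = (- G) * mean (\<lambda>y. Dd y * \<phi> y) + 1 * mean (\<lambda>y. I y * \<phi> y)"
        by (intro mean_lin continuous_intros cD cI \<phi>c)
      also have "1 * (lam * mean (\<lambda>y. \<tau> t y * \<phi> y) + (- lam) * mean (\<lambda>y. \<tau> s y * \<phi> y)) + 1 * ((- G) * mean (\<lambda>y. Dd y * \<phi> y) + 1 * mean (\<lambda>y. I y * \<phi> y))
         = lam * (mean (\<lambda>y. \<tau> t y * \<phi> y) - mean (\<lambda>y. \<tau> s y * \<phi> y)) + G * mean (\<lambda>y. U y * deriv \<phi> y) + mean (\<lambda>y. I y * \<phi> y)"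
        by (simp add: d right_diff_distrib)
      also have "\<dots> = 0" unfolding e using pos by (simp add: right_diff_distrib)
      finally show "mean (\<lambda>y. (lam * (\<tau> t y - \<tau> s y) - G * Dd y + I y) * \<phi> y) = 0" .
    qed
    then show ?thesis by (simp add: Dd_def I_def)
  qed

  have flow_f: "f t y - f s y = integral {s..t} (\<lambda>r. F r y)" if st: "0 \<le> s" "s \<le> t" and y: "y \<in> {0..1}" for s t y
  proof -
    have t0: "0 \<le> t" using st by simp
    define I where "I y = integral {s..t} (\<lambda>r. F r y)" for y
    have cI: "continuous_on {0..1} I" unfolding I_def by (intro cont_time_integral jF st)
    have cus: "continuous_on {0..1} (f s)" "continuous_on {0..1} (f t)" using jc_slice[OF jf] st t0 by auto
    have "f t y - f s y - I y = 0"
    proof (rule orthogonal_test_functions_0[OF _ _ y, where h="\<lambda>y. f t y - f s y - I y"])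
      show "continuous_on {0..1} (\<lambda>y. f t y - f s y - I y)" by (intro continuous_intros cus cI)
      fix \<phi> assume \<phi>: "\<phi> \<in> test_functions 0 1"
      have \<phi>c: "continuous_on {0..1} \<phi>" using test_function_continuous[OF \<phi>, of _ 0] by simp
      have b: "mean (\<lambda>y. I y * \<phi> y) = integral {s..t} (\<lambda>r. mean (\<lambda>y. F r y * \<phi> y))"
        unfolding I_def by (rule mean_time_integral_mult[OF jF st(1) \<phi>c])
      have "mean (\<lambda>y. (f t y - f s y - I y) * \<phi> y) = mean (\<lambda>y. 1 * (1 * (f t y * \<phi> y) + (- 1) * (f s y * \<phi> y)) + (- 1) * (I y * \<phi> y))"
        by (rule mean_cong) (simp add: algebra_simps)
      also have "\<dots> = 1 * mean (\<lambda>y. 1 * (f t y * \<phi> y) + (- 1) * (f s y * \<phi> y)) + (- 1) * mean (\<lambda>y. I y * \<phi> y)"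
        by (intro mean_lin continuous_intros cus cI \<phi>c)
      also have "mean (\<lambda>y. 1 * (f t y * \<phi> y) + (- 1) * (f s y * \<phi> y)) = 1 * mean (\<lambda>y. f t y * \<phi> y) + (- 1) * mean (\<lambda>y. f s y * \<phi> y)"
        by (intro mean_lin continuous_intros cus \<phi>c)
      finally show "mean (\<lambda>y. (f t y - f s y - I y) * \<phi> y) = 0" using eq_f[OF \<phi> st] b by simp
    qed
    then show ?thesis by (simp add: I_def)
  qed

  show ?thesis
  proof
    show "\<exists>y\<in>{0..1}. f 0 y \<noteq> 0" using f0(2) init by auto
    show "0 \<le> f 0 y" if "y \<in> {0..1}" for y using f0(1) init that by auto
  qed (use pos ju j\<tau> jf jg bdry flow_u flow_\<tau> flow_f in \<open>auto simp: F_def\<close>)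
qed

section \<open>The flux as a limit of difference quotients\<close>

lemma C_time_H1_limit:
  assumes "\<And>T. 0 < T \<Longrightarrow> w \<in> C_time T H1 (sobolev_norm 1)" "0 \<le> t"
  shows "w t \<in> H1" "((\<lambda>s. sobolev_norm 1 (\<lambda>y. w s y - w t y)) \<longlongrightarrow> 0) (at t within {0..})"
proof -
  show "w t \<in> H1" using assms(1)[of "t + 1"] assms(2) by (auto simp: C_time_def)
  have "((\<lambda>s. sobolev_norm 1 (\<lambda>y. w s y - w t y)) \<longlongrightarrow> 0) (at t within {0..t+1})"
    using assms(1)[of "t + 1"] assms(2) by (auto simp: C_time_def)
  moreover have "at t within {0..t+1} = at t within {0..}"
    by (rule at_within_nhd[of _ "{..<t+1}"]) auto
  ultimately show "((\<lambda>s. sobolev_norm 1 (\<lambda>y. w s y - w t y)) \<longlongrightarrow> 0) (at t within {0..})" by simp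
qed

text \<open>The continuity of \<open>u\<close> in time with values in \<open>H\<^sup>1\<close> serves to bound the difference quotients of \<open>v\<close> near
  one time.\<close>

locale regular_aging_flow = aging_flow +
  assumes u_H1: "\<And>t. 0 \<le> t \<Longrightarrow> u t \<in> H1"
    and u_cont_H1: "\<And>t. 0 \<le> t \<Longrightarrow> ((\<lambda>s. sobolev_norm 1 (\<lambda>y. u s y - u t y)) \<longlongrightarrow> 0) (at t within {0..})"
begin

text \<open>\<open>flux\<close> is the time derivative of \<open>v\<close>, and \<open>flux_on r a b\<close> is its integral over \<open>{a..b}\<close> at time \<open>r\<close>, written without
  weak derivatives and thus continuous in \<open>r\<close>.\<close>

definition p where "p t y = \<tau> t y - mean (\<tau> t)"
definition flux where "flux t y = \<eta> * weak_D 1 (u t) y + p t y"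
definition flux_on where "flux_on r a b = \<eta> * (u r b - u r a) + (prim (p r) b - prim (p r) a)"

lemma jc_p: "jc p" unfolding p_def[abs_def] by (intro jc_intros cont)

lemma weak_D_u: "0 \<le> t \<Longrightarrow> weak_D 1 (u t) \<in> L2" "0 \<le> t \<Longrightarrow> has_weak_deriv 0 1 1 (u t) (weak_D 1 (u t))"
  using weak_D_props[OF H1_props(1)[OF u_H1] order_refl] by auto

lemma p_L2: "0 \<le> t \<Longrightarrow> p t \<in> L2"
  by (intro continuous_L2 jc_slice[OF jc_p])

lemma flux_L2: "0 \<le> t \<Longrightarrow> flux t \<in> L2"
  unfolding flux_def[abs_def] by (intro L2_add L2_cmult weak_D_u p_L2)

lemma prim_diff:
  assumes "continuous_on {0..1} g" "0 \<le> a" "a \<le> b" "b \<le> 1"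
  shows "prim g b - prim g a = integral {a..b} g"
proof -
  have "integral {0..a} g + integral {a..b} g = integral {0..b} g"
    using assms by (intro Henstock_Kurzweil_Integration.integral_combine integrable_continuous_real continuous_on_subset[OF assms(1)]) auto
  then show ?thesis by (simp add: prim_def)
qed

lemma integral_lin:
  assumes "g \<in> L2" "h \<in> L2" "0 \<le> a" "a \<le> b" "b \<le> 1"
  shows "integral {a..b} (\<lambda>y. k * g y + l * h y) = k * integral {a..b} g + l * integral {a..b} h"
  by (intro integral_unique has_integral_add has_integral_mult_right integrable_integral L2_HK assms)

lemma flux_interval:
  assumes "0 \<le> t" "0 \<le> a" "a \<le> b" "b \<le> 1"
  shows "integral {a..b} (flux t) = flux_on t a b"
proof -
  have "integral {a..b} (flux t) = integral {a..b} (\<lambda>y. \<eta> * weak_D 1 (u t) y + 1 * p t y)" by (simp add: flux_def[abs_def])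
  also have "\<dots> = \<eta> * integral {a..b} (weak_D 1 (u t)) + 1 * integral {a..b} (p t)"
    using assms by (intro integral_lin weak_D_u p_L2)
  also have "\<dots> = flux_on t a b"
    using weak_deriv_L2_increment[OF H1_props(3)[OF u_H1] weak_D_u, of t a b] prim_diff[OF jc_slice[OF jc_p], of t a b] assms
    by (simp add: flux_on_def)
  finally show ?thesis .
qed

lemma flux_on_shift_continuous:
  assumes "0 \<le> t" "0 \<le> a" "a \<le> b" "b \<le> 1"
  shows "continuous_on ({0..} \<times> {0..1}) (\<lambda>q. flux_on (t + fst q * snd q) a b)"
  unfolding flux_on_def
  by (intro continuous_intros jc_comp[OF cont(1)] jc_comp[OF jc_prim[OF jc_p]]) (use assms in auto)

lemma flux_on_slice_continuous:
  assumes "0 \<le> t" "0 \<le> h" "0 \<le> a" "a \<le> b" "b \<le> 1"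
  shows "continuous_on {0..1} (\<lambda>\<sigma>. flux_on (t + h * \<sigma>) a b)"
  unfolding flux_on_def
  by (intro continuous_intros jc_comp[OF cont(1)] jc_comp[OF jc_prim[OF jc_p]]) (use assms in auto)

text \<open>\<open>dq h v\<close> is the average of the flux over \<open>{t..t+h}\<close>, in the weak sense of integrals over intervals.\<close>

lemma dq_v_interval:
  assumes t: "0 \<le> t" and h: "0 < h" and ab: "0 \<le> a" "a \<le> b" "b \<le> 1"
  shows "integral {a..b} (dq h v t) = mean (\<lambda>\<sigma>. flux_on (t + h * \<sigma>) a b)"
proof -
  define U where "U y = integral {t..t+h} (\<lambda>r. u r y)" for y
  define P where "P y = integral {t..t+h} (\<lambda>r. p r y)" for y
  have th: "t \<le> t + h" "0 \<le> h" using h by auto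
  have cP: "continuous_on {0..1} P" unfolding P_def by (intro cont_time_integral jc_p t th)
  have v: "dq h v t y = (\<eta> * D t (t + h) y + P y) / h" if "y \<in> {0..1}" for y
    using pos by (simp add: dq_def D_def P_def p_def)
  have iD: "(D t (t + h) has_integral (U b - U a)) {a..b}"
  proof (rule fundamental_theorem_of_calculus[OF ab(2)])
    fix y assume y: "y \<in> {a..b}"
    then have "(U has_real_derivative D t (t+h) y) (at y within {a..b})"
      unfolding U_def[abs_def] by (intro has_field_derivative_subset[OF flow_u'[OF t th(1)]]) (use ab in auto)
    then show "(U has_vector_derivative D t (t + h) y) (at y within {a..b})"
      by (simp only: has_real_derivative_iff_has_vector_derivative)
  qed
  have iP: "(P has_integral (prim P b - prim P a)) {a..b}"
    using prim_diff[OF cP ab] ab by (simp add: integrable_integral integrable_continuous_real continuous_on_subset[OF cP])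
  have "integral {a..b} (dq h v t) = integral {a..b} (\<lambda>y. (\<eta> * D t (t + h) y + P y) / h)"
    by (rule Henstock_Kurzweil_Integration.integral_cong) (use v ab in auto)
  also have "\<dots> = (\<eta> * (U b - U a) + (prim P b - prim P a)) / h"
    by (intro integral_unique has_integral_divide has_integral_add has_integral_mult_right iD iP)
  also have "prim P b = integral {t..t+h} (\<lambda>r. prim (p r) b)" unfolding P_def
    using ab by (intro prim_time_integral[OF jc_p t]) auto
  also have "prim P a = integral {t..t+h} (\<lambda>r. prim (p r) a)" unfolding P_def
    using ab by (intro prim_time_integral[OF jc_p t]) auto
  also have "\<eta> * (U b - U a) + (integral {t..t+h} (\<lambda>r. prim (p r) b) - integral {t..t+h} (\<lambda>r. prim (p r) a)) = integral {t..t+h} (\<lambda>r. flux_on r a b)"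
    unfolding flux_on_def U_def
    by (rule integral_unique[symmetric])
       (intro has_integral_add has_integral_diff has_integral_mult_right integrable_integral
         jc_time_integrable[OF cont(1) t] jc_time_integrable[OF jc_prim[OF jc_p] t]; use ab in auto)
  also have "\<dots> = h * mean (\<lambda>\<sigma>. flux_on (t + h * \<sigma>) a b)"
    unfolding mean_def
  proof (rule integral_unit_scale[OF th(2)])
    have "continuous_on {t..t+h} (\<lambda>r. \<eta> * (u r b - u r a) + (prim (p r) b - prim (p r) a))"
      by (intro continuous_intros jc_comp[OF cont(1)] jc_comp[OF jc_prim[OF jc_p]]) (use ab t in auto)
    then show "continuous_on {t..t+h} (\<lambda>r. flux_on r a b)" by (simp add: flux_on_def)
  qed
  finally show ?thesis using h by simp
qed

text \<open>\<open>Qn\<close> of the difference quotient for \<open>h > 0\<close> and of the flux for \<open>h = 0\<close>, continuous in \<open>h\<close>.\<close>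

definition \<Phi> where "\<Phi> n t h = real (Suc n) * (\<Sum>i<Suc n. (mean (\<lambda>\<sigma>. flux_on (t + h * \<sigma>) (real i / real (Suc n)) (real (Suc i) / real (Suc n))))\<^sup>2)"

lemma \<Phi>_dq: "0 \<le> t \<Longrightarrow> 0 < h \<Longrightarrow> \<Phi> n t h = Qn n (dq h v t)"
  unfolding \<Phi>_def Qn_def using partition_subset[of _ n]
  by (intro arg_cong2[where f="(*)"] refl sum.cong) (simp add: dq_v_interval)

lemma \<Phi>_0: "0 \<le> t \<Longrightarrow> \<Phi> n t 0 = Qn n (flux t)"
  unfolding \<Phi>_def Qn_def using partition_subset[of _ n]
  by (intro arg_cong2[where f="(*)"] refl sum.cong) (simp add: flux_interval)

lemma \<Phi>_continuous:
  assumes t: "0 \<le> t" shows "continuous_on {0..} (\<Phi> n t)"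
proof -
  have "continuous_on {0..} (\<lambda>h. mean (\<lambda>\<sigma>. flux_on (t + h * \<sigma>) (real i / real (Suc n)) (real (Suc i) / real (Suc n))))" if "i < Suc n" for i
    unfolding mean_def using partition_subset[OF that] t
    by (intro continuous_on_space_integral flux_on_shift_continuous) auto
  then show ?thesis unfolding \<Phi>_def[abs_def] by (intro continuous_intros) auto
qed

text \<open>Lower semicontinuity of the norm: \<open>Qn\<close> passes to the limit \<open>h \<rightarrow> 0\<close> for every \<open>n\<close>, and these values
  determine the norm.\<close>

lemma flux_bound:
  assumes t: "0 \<le> t" and h1: "0 < h1" and M: "\<And>h. 0 < h \<Longrightarrow> h \<le> h1 \<Longrightarrow> mean (\<lambda>y. (dq h v t y)\<^sup>2) \<le> M"
  shows "L2_norm (flux t) \<le> sqrt M"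
proof (rule L2_norm_le_if_Qn[OF flux_L2[OF t]])
  have c: "continuous_on {0..1} (dq h v t)" if "0 \<le> h" for h using jc_slice[OF jc_dq[OF jc_v that] t] .
  have M0: "0 \<le> M"
  proof -
    have "0 \<le> mean (\<lambda>y. (dq h1 v t y)\<^sup>2)" using c[of h1] h1 by (intro mean_nonneg continuous_intros) auto
    then show ?thesis using M[OF h1 order_refl] by linarith
  qed
  then show "0 \<le> sqrt M" by simp
  fix n
  \<comment> \<open>\<open>min h h1\<close> extends the bound to all \<open>h > 0\<close>\<close>
  have "\<Phi> n t (min 0 h1) - M \<le> 0"
  proof (rule nonpos_at_0[where \<Phi>="\<lambda>h. \<Phi> n t (min h h1) - M"])
    show "continuous_on {0..} (\<lambda>h. \<Phi> n t (min h h1) - M)"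
      by (intro continuous_intros continuous_on_compose2[OF \<Phi>_continuous[OF t, of n]]) (use h1 in auto)
    fix h :: real assume h: "0 < h"
    have m: "0 < min h h1" "min h h1 \<le> h1" using h h1 by auto
    have "\<Phi> n t (min h h1) = Qn n (dq (min h h1) v t)" by (rule \<Phi>_dq[OF t m(1)])
    also have "\<dots> \<le> (L2_norm (dq (min h h1) v t))\<^sup>2" using c m by (intro Qn_le continuous_L2) auto
    also have "\<dots> = mean (\<lambda>y. (dq (min h h1) v t y)\<^sup>2)"
    proof -
      have "0 \<le> mean (\<lambda>y. (dq (min h h1) v t y)\<^sup>2)" using c[of "min h h1"] m by (intro mean_nonneg continuous_intros) auto
      then show ?thesis using L2_norm_continuous[OF c[of "min h h1"]] m by simp
    qed
    also have "\<dots> \<le> M" by (rule M[OF m])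
    finally show "\<Phi> n t (min h h1) - M \<le> 0" by simp
  qed
  then show "Qn n (flux t) \<le> (sqrt M)\<^sup>2" using h1 M0 \<Phi>_0[OF t] by simp
qed

text \<open>Near time \<open>t\<close> the flux is bounded in \<open>L\<^sup>2\<close>, by continuity of \<open>u\<close> in \<open>H\<^sup>1\<close>, and the difference quotient is an
  average of it. The bound is transported by \<open>Qn\<close> and Jensen's inequality, which avoids measurability of the
  weak derivative in time.\<close>

lemma initial_dq_bound:
  assumes t: "0 \<le> t"
  obtains h0 B where "0 < h0" "\<And>h. 0 < h \<Longrightarrow> h \<le> h0 \<Longrightarrow> mean (\<lambda>y. (dq h v t y)\<^sup>2) \<le> B"
proof -
  have "\<forall>\<^sub>F s in at t within {0..}. sobolev_norm 1 (\<lambda>y. u s y - u t y) < 1"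
    by (rule order_tendstoD(2)[OF u_cont_H1[OF t]]) simp
  then obtain d where d: "d > 0" "\<And>s. 0 \<le> s \<Longrightarrow> s \<noteq> t \<Longrightarrow> dist s t < d \<Longrightarrow> sobolev_norm 1 (\<lambda>y. u s y - u t y) < 1"
    unfolding eventually_at by auto
  define h0 where "h0 = d / 2"
  have h0: "0 < h0" "h0 < d" using d by (auto simp: h0_def)
  obtain M where M: "0 \<le> M" "\<And>t y. 0 \<le> t \<Longrightarrow> y \<in> {0..1} \<Longrightarrow> \<bar>\<tau> t y\<bar> \<le> M" using \<tau>_bounded by blast
  have pb: "\<bar>p r y\<bar> \<le> 2 * M" if r: "0 \<le> r" and y: "y \<in> {0..1}" for r y
  proof -
    have "mean (\<tau> r) \<le> mean (\<lambda>_. M)" "mean (\<lambda>_. - M) \<le> mean (\<tau> r)"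
      by (rule mean_mono; use M(2)[OF r] slices(2)[OF r] in \<open>force simp: abs_le_iff\<close>)+
    then show ?thesis using M(2)[OF r y] by (simp add: p_def abs_le_iff)
  qed
  define K where "K = L2_norm (flux t) + \<eta> + 4 * M"
  have K0: "0 \<le> K" using L2_norm_nonneg[of "flux t"] pos M by (simp add: K_def)
  have xK: "real (Suc n) * (\<Sum>i<Suc n. (flux_on r (real i / real (Suc n)) (real (Suc i) / real (Suc n)))\<^sup>2) \<le> K\<^sup>2"
    if r: "t \<le> r" "r \<le> t + h0" for r n
  proof -
    have r0: "0 \<le> r" using r t by simp
    define du where "du y = u r y - u t y" for y
    \<comment> \<open>the limit at \<open>t\<close> says nothing about \<open>r = t\<close> itself, where \<open>du\<close> is zero\<close>
    define g where "g = (if r = t then (\<lambda>_. 0) else weak_D 1 du)"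
    have duH: "du \<in> H1" unfolding du_def[abs_def] by (intro H1_diff u_H1 r0 t)
    have gL: "g \<in> L2" unfolding g_def using weak_D_props(1)[OF H1_props(1)[OF duH] order_refl] by (auto intro: continuous_L2)
    have gi: "du b - du a = integral {a..b} g" if "0 \<le> a" "a \<le> b" "b \<le> 1" for a b
      using weak_deriv_L2_increment[OF H1_props(3)[OF duH] weak_D_props[OF H1_props(1)[OF duH] order_refl] that]
      by (auto simp: g_def du_def)
    have gn: "L2_norm g \<le> 1"
    proof (cases "r = t")
      case True then show ?thesis by (simp add: g_def L2_norm_def)
    next
      case False
      have "sobolev_norm 1 du < 1" unfolding du_def[abs_def] using False r h0 r0 by (intro d(2)) (auto simp: dist_real_def)
      then show ?thesis using sobolev_norm_ge[of 1 1 du] False by (simp add: g_def)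
    qed
    define dp where "dp y = p r y - p t y" for y
    have dpc: "continuous_on {0..1} dp" unfolding dp_def by (intro continuous_intros jc_slice[OF jc_p] r0 t)
    have dpn: "L2_norm dp \<le> 4 * M"
    proof -
      have "mean (\<lambda>y. (dp y)\<^sup>2) \<le> mean (\<lambda>_. (4 * M)\<^sup>2)"
      proof (rule mean_mono)
        fix y :: real assume y: "y \<in> {0..1}"
        have "\<bar>dp y\<bar> \<le> 4 * M" using pb[OF r0 y] pb[OF t y] unfolding dp_def by linarith
        then have "\<bar>dp y\<bar>\<^sup>2 \<le> (4 * M)\<^sup>2" by (intro power_mono) auto
        then show "(dp y)\<^sup>2 \<le> (4 * M)\<^sup>2" by simp
      qed (intro continuous_intros dpc)+
      then have "sqrt (mean (\<lambda>y. (dp y)\<^sup>2)) \<le> 4 * M" using M by (intro real_le_lsqrt) auto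
      then show ?thesis by (simp add: L2_norm_continuous[OF dpc])
    qed
    define s where "s y = flux t y + (\<eta> * g y + dp y)" for y
    have sL: "s \<in> L2" unfolding s_def[abs_def] by (intro L2_add L2_cmult flux_L2 t gL continuous_L2 dpc)
    have "L2_norm s \<le> L2_norm (flux t) + L2_norm (\<lambda>y. \<eta> * g y + dp y)"
      unfolding s_def[abs_def] by (intro L2_norm_triangle L2_add L2_cmult flux_L2 t gL continuous_L2 dpc)
    also have "L2_norm (\<lambda>y. \<eta> * g y + dp y) \<le> L2_norm (\<lambda>y. \<eta> * g y) + L2_norm dp"
      by (intro L2_norm_triangle L2_cmult gL continuous_L2 dpc)
    also have "L2_norm (\<lambda>y. \<eta> * g y) \<le> \<eta>" using gn pos by (simp add: L2_norm_cmult mult_left_le)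
    finally have sK: "L2_norm s \<le> K" using dpn by (simp add: K_def)
    have si: "integral {a..b} s = flux_on r a b" if ab: "0 \<le> a" "a \<le> b" "b \<le> 1" for a b
    proof -
      have "integral {a..b} s = integral {a..b} (\<lambda>y. 1 * flux t y + 1 * (\<eta> * g y + 1 * dp y))" by (simp add: s_def[abs_def])
      also have "\<dots> = 1 * integral {a..b} (flux t) + 1 * integral {a..b} (\<lambda>y. \<eta> * g y + 1 * dp y)"
        by (intro integral_lin flux_L2 t L2_add L2_cmult gL continuous_L2 dpc ab)
      also have "integral {a..b} (\<lambda>y. \<eta> * g y + 1 * dp y) = \<eta> * integral {a..b} g + 1 * integral {a..b} dp"
        by (intro integral_lin gL continuous_L2 dpc ab)
      also have "integral {a..b} dp = integral {a..b} (\<lambda>y. 1 * p r y + (- 1) * p t y)" by (simp add: dp_def[abs_def])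
      also have "\<dots> = 1 * integral {a..b} (p r) + (- 1) * integral {a..b} (p t)"
        by (intro integral_lin p_L2 r0 t ab)
      moreover have "\<eta> * (u r b - u r a) = \<eta> * (u t b - u t a) + \<eta> * integral {a..b} g"
        using arg_cong[OF gi[OF ab], of "\<lambda>z. \<eta> * z"] by (simp add: du_def algebra_simps)
      ultimately show ?thesis
        using flux_interval[OF t ab] prim_diff[OF jc_slice[OF jc_p r0] ab] prim_diff[OF jc_slice[OF jc_p t] ab]
        by (simp add: flux_on_def)
    qed
    have "real (Suc n) * (\<Sum>i<Suc n. (flux_on r (real i / real (Suc n)) (real (Suc i) / real (Suc n)))\<^sup>2) = Qn n s"
      unfolding Qn_def using partition_subset[of _ n] by (intro arg_cong2[where f="(*)"] refl sum.cong) (simp add: si)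
    also have "\<dots> \<le> (L2_norm s)\<^sup>2" by (rule Qn_le[OF sL])
    also have "\<dots> \<le> K\<^sup>2" using sK L2_norm_nonneg by (intro power_mono) auto
    finally show ?thesis .
  qed
  show ?thesis
  proof (rule that[OF h0(1)])
    fix h assume h: "0 < h" "h \<le> h0"
    have c: "continuous_on {0..1} (dq h v t)" using jc_slice[OF jc_dq[OF jc_v] t] h by simp
    have "Qn n (dq h v t) \<le> K\<^sup>2" for n
    proof -
      let ?a = "\<lambda>i. real i / real (Suc n)" and ?b = "\<lambda>i. real (Suc i) / real (Suc n)"
      have cx: "continuous_on {0..1} (\<lambda>\<sigma>. flux_on (t + h * \<sigma>) (?a i) (?b i))" if "i < Suc n" for i
        using partition_subset[OF that] h t by (intro flux_on_slice_continuous) auto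
      have "Qn n (dq h v t) = \<Phi> n t h" using \<Phi>_dq[OF t h(1)] by simp
      also have "\<dots> \<le> real (Suc n) * (\<Sum>i<Suc n. mean (\<lambda>\<sigma>. (flux_on (t + h * \<sigma>) (?a i) (?b i))\<^sup>2))"
        unfolding \<Phi>_def using cx by (intro mult_left_mono sum_mono) (auto simp: mean_def intro!: square_integral_le)
      also have "\<dots> = mean (\<lambda>\<sigma>. real (Suc n) * (\<Sum>i<Suc n. (flux_on (t + h * \<sigma>) (?a i) (?b i))\<^sup>2))"
      proof -
        have "((\<lambda>\<sigma>. real (Suc n) * (\<Sum>i<Suc n. (flux_on (t + h * \<sigma>) (?a i) (?b i))\<^sup>2)) has_integral
            real (Suc n) * (\<Sum>i<Suc n. mean (\<lambda>\<sigma>. (flux_on (t + h * \<sigma>) (?a i) (?b i))\<^sup>2))) {0..1}"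
          unfolding mean_def using cx
          by (intro has_integral_mult_right has_integral_sum integrable_integral integrable_continuous_real continuous_intros) auto
        from integral_unique[OF this] show ?thesis unfolding mean_def by (rule sym)
      qed
      also have "\<dots> \<le> mean (\<lambda>\<sigma>. K\<^sup>2)"
      proof (rule mean_mono)
        show "continuous_on {0..1} (\<lambda>\<sigma>. real (Suc n) * (\<Sum>i<Suc n. (flux_on (t + h * \<sigma>) (?a i) (?b i))\<^sup>2))"
          using cx by (intro continuous_intros) auto
        fix \<sigma> :: real assume \<sigma>: "\<sigma> \<in> {0..1}"
        have "h * \<sigma> \<le> h * 1" using \<sigma> h by (intro mult_left_mono) auto
        then have "h * \<sigma> \<le> h0" using h by linarith
        then show "real (Suc n) * (\<Sum>i<Suc n. (flux_on (t + h * \<sigma>) (?a i) (?b i))\<^sup>2) \<le> K\<^sup>2"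
          using \<sigma> h by (intro xK) auto
      qed simp
      finally show ?thesis by simp
    qed
    from L2_norm_le_if_Qn[OF continuous_L2[OF c] K0 this] have "L2_norm (dq h v t) \<le> K" .
    then have "sqrt (mean (\<lambda>y. (dq h v t y)\<^sup>2)) \<le> K" by (simp add: L2_norm_continuous[OF c])
    then show "mean (\<lambda>y. (dq h v t y)\<^sup>2) \<le> K\<^sup>2" by (rule sqrt_le_D)
  qed
qed

section \<open>Decay of the solution\<close>

text \<open>The two functions have the same integrals over intervals.\<close>

lemma weak_D_0_le: "0 \<le> t \<Longrightarrow> L2_norm (weak_D 0 (u t)) \<le> L2_norm (u t)"
proof -
  assume t: "0 \<le> t"
  note H = H1_props[OF u_H1[OF t]]
  note w0 = weak_D_props[OF H(1), of 0, simplified]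
  have "Qn n (weak_D 0 (u t)) = Qn n (u t)" for n
    unfolding Qn_def using partition_subset[of _ n]
    by (intro arg_cong2[where f="(*)"] refl sum.cong) (simp add: weak_deriv_0_integral[OF H(2) w0])
  then show ?thesis using Qn_le[OF H(2)] by (intro L2_norm_le_if_Qn w0 L2_norm_nonneg) auto
qed

lemma u_norm_le: assumes t: "0 \<le> t" shows "L2_norm (u t) \<le> L2_norm (weak_D 1 (u t))"
proof -
  note H = H1_props[OF u_H1[OF t]]
  let ?K = "L2_norm (weak_D 1 (u t))"
  have "mean (\<lambda>y. (u t y)\<^sup>2) \<le> mean (\<lambda>_. ?K\<^sup>2)"
  proof (rule mean_mono)
    fix y :: real assume y: "y \<in> {0..1}"
    have "u t y - u t 0 = integral {0..y} (weak_D 1 (u t))"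
      using y by (intro weak_deriv_L2_increment[OF H(3) weak_D_u[OF t]]) auto
    then have "\<bar>u t y\<bar> \<le> ?K" using L2_integral_le[OF weak_D_u(1)[OF t], of 0 y] y u_bdry[OF t] by simp
    then have "\<bar>u t y\<bar>\<^sup>2 \<le> ?K\<^sup>2" by (intro power_mono) auto
    then show "(u t y)\<^sup>2 \<le> ?K\<^sup>2" by simp
  qed (intro continuous_intros H)+
  then show ?thesis using L2_norm_nonneg[of "weak_D 1 (u t)"] by (simp add: L2_norm_continuous[OF H(3)] real_le_lsqrt)
qed

text \<open>\<open>\<eta> \<partial>\<^sub>y u\<close> is the flux minus \<open>p\<close>, and \<open>u\<close> vanishes at the boundary.\<close>

lemma sobolev_norm_u_le:
  assumes t: "0 \<le> t" shows "sobolev_norm 1 (u t) \<le> 2 / \<eta> * (L2_norm (flux t) + L2_norm (p t))"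
proof -
  have "\<eta> * L2_norm (weak_D 1 (u t)) = L2_norm (\<lambda>y. flux t y + (- 1) * p t y)"
    using L2_norm_cmult[of \<eta> "weak_D 1 (u t)"] pos by (simp add: flux_def)
  also have "\<dots> \<le> L2_norm (flux t) + L2_norm (\<lambda>y. (- 1) * p t y)"
    by (intro L2_norm_triangle flux_L2 L2_cmult p_L2 t)
  also have "L2_norm (\<lambda>y. (- 1) * p t y) = L2_norm (p t)" using L2_norm_cmult[of "- 1" "p t"] by simp
  finally have "L2_norm (weak_D 1 (u t)) \<le> (L2_norm (flux t) + L2_norm (p t)) / \<eta>" using pos by (simp add: field_simps)
  moreover have "sobolev_norm 1 (u t) \<le> 2 * L2_norm (weak_D 1 (u t))"
    using sobolev_norm_1_le[of "u t"] weak_D_0_le[OF t] u_norm_le[OF t] by linarith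
  ultimately have "sobolev_norm 1 (u t) \<le> 2 * ((L2_norm (flux t) + L2_norm (p t)) / \<eta>)" by linarith
  then show ?thesis by (simp only: times_divide_eq_right times_divide_eq_left)
qed

lemma p_norm: "0 \<le> t \<Longrightarrow> L2_norm (p t) = sqrt (dev t)"
  using L2_norm_continuous[OF jc_slice[OF jc_p]] by (simp add: dev_def p_def)

lemma \<tau>_norm: "0 \<le> t \<Longrightarrow> L2_norm (\<tau> t) = sqrt ((mean (\<tau> t))\<^sup>2 + dev t)"
  using L2_norm_continuous[OF slices(2)] E_bounds(4) by simp

lemma sqrt_powr: "0 \<le> C \<Longrightarrow> 0 \<le> t \<Longrightarrow> sqrt (C * (1 + t) powr (- q)) = sqrt C * (1 + t) powr (- (q / 2))" for C t q :: real
  by (simp add: real_sqrt_mult powr_half_sqrt[symmetric] powr_powr)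

text \<open>The squared rates \<open>q\<close>, \<open>2 + q\<close> and \<open>4 + q\<close> of \<open>N\<close>, \<open>F\<close> and the difference quotients become \<open>b\<close>, \<open>1 + b\<close> and
  \<open>2 + b\<close>.\<close>

lemma long_time_behaviour:
  assumes \<alpha>: "0 < \<alpha>" "\<alpha> < 1"
  defines "b \<equiv> \<beta> / lam * (1 - \<alpha>)"
  shows "\<exists>t0\<ge>0. \<exists>\<kappa>.
    (\<forall>t>t0. L2_norm (\<tau> t) \<le> \<kappa> * (1 + t) powr (- b)) \<and>
    (\<forall>t>t0. L2_norm (p t) \<le> \<kappa> * (1 + t) powr (- (1 + b))) \<and>
    (\<forall>t>t0. sobolev_norm 1 (u t) \<le> \<kappa> * (1 + t) powr (- (1 + b))) \<and>
    (\<forall>t>t0. L2_norm (flux t) \<le> \<kappa> * (1 + t) powr (- (2 + b))) \<and>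
    (\<forall>t>t0. \<forall>y\<in>{0..1}. recip_bound (f t0 y) ((1 + \<alpha>) * (t - t0)) \<le> f t y \<and> f t y \<le> recip_bound (f t0 y) ((1 - \<alpha>) * (t - t0)))"
proof -
  define q where "q = 2 * b"
  have q0: "0 \<le> q" using \<beta>_pos pos \<alpha> by (simp add: q_def b_def)
  obtain T C where T: "0 \<le> T" and C: "0 \<le> C"
    and rate: "\<And>t y. T \<le> t \<Longrightarrow> y \<in> {0..1} \<Longrightarrow> 1 - \<alpha> \<le> rate t y \<and> rate t y \<le> 1 + \<alpha>"
    and f4: "\<And>t y. T \<le> t \<Longrightarrow> y \<in> {0..1} \<Longrightarrow> f t y \<le> 4 / (1 + t)"
    and N: "\<And>t. T \<le> t \<Longrightarrow> N t \<le> C * (1 + t) powr (- q)"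
    and F: "\<And>t. T \<le> t \<Longrightarrow> F t \<le> C * (1 + t) powr (- (2 + q))"
    using decay_rates[OF \<alpha>] unfolding q_def b_def by blast
  have rate': "0 \<le> rate t y \<and> rate t y \<le> 2" if "T \<le> t" "y \<in> {0..1}" for t y using rate[OF that] \<alpha> by auto
  obtain T1 where T1: "T \<le> T1" and dq: "\<And>h0 B. 0 < h0 \<Longrightarrow> (\<And>h. 0 < h \<Longrightarrow> h \<le> h0 \<Longrightarrow> mean (\<lambda>y. (dq h v T1 y)\<^sup>2) \<le> B) \<Longrightarrow>
      \<exists>K h1. 0 < h1 \<and> h1 \<le> h0 \<and> (\<forall>h t. 0 < h \<longrightarrow> h \<le> h1 \<longrightarrow> T1 \<le> t \<longrightarrow> mean (\<lambda>y. (dq h v t y)\<^sup>2) \<le> K * (1 + t) powr (- (4 + q)))"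
    using dq_rate[OF T C q0 rate' f4 N] by blast
  have T10: "0 \<le> T1" using T T1 by simp
  obtain h0 B where h0: "0 < h0" "\<And>h. 0 < h \<Longrightarrow> h \<le> h0 \<Longrightarrow> mean (\<lambda>y. (dq h v T1 y)\<^sup>2) \<le> B"
    using initial_dq_bound[OF T10] by blast
  obtain K h1 where h1: "0 < h1" and K: "\<And>h t. 0 < h \<Longrightarrow> h \<le> h1 \<Longrightarrow> T1 \<le> t \<Longrightarrow> mean (\<lambda>y. (dq h v t y)\<^sup>2) \<le> K * (1 + t) powr (- (4 + q))"
    using dq[OF h0] by blast
  define K' where "K' = max K 0"
  define k1 where "k1 = sqrt ((1 + dF) * C)"
  define k2 where "k2 = sqrt (dF * C)"
  define k3 where "k3 = sqrt K'"
  define \<kappa> where "\<kappa> = k1 + k2 + k3 + 2 / \<eta> * (k3 + k2)"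
  have kp: "0 \<le> k1" "0 \<le> k2" "0 \<le> k3" using C dF_pos by (auto simp: k1_def k2_def k3_def K'_def)
  then have kk: "k1 \<le> \<kappa>" "k2 \<le> \<kappa>" "k3 \<le> \<kappa>" "2 / \<eta> * (k3 + k2) \<le> \<kappa>" using pos by (auto simp: \<kappa>_def)
  have up: "k * (1 + t) powr r \<le> \<kappa> * (1 + t) powr r" if "k \<le> \<kappa>" for k t r using that by (intro mult_right_mono) auto
  have \<tau>: "L2_norm (\<tau> t) \<le> k1 * (1 + t) powr (- b)" if t: "T1 < t" for t
  proof -
    have t0: "0 \<le> t" "T \<le> t" using t T10 T1 by auto
    have "(mean (\<tau> t))\<^sup>2 + dev t \<le> (1 + dF) * N t"
    proof -
      have "0 \<le> dF * (mean (\<tau> t))\<^sup>2" "0 \<le> F t" using dF_pos F_nonneg[OF t0(1)] by auto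
      then show ?thesis using dev_le[OF t0(1)] by (simp add: N_def algebra_simps)
    qed
    also have "\<dots> \<le> (1 + dF) * (C * (1 + t) powr (- q))" using N[OF t0(2)] dF_pos by (intro mult_left_mono) auto
    finally have "sqrt ((mean (\<tau> t))\<^sup>2 + dev t) \<le> sqrt ((1 + dF) * C * (1 + t) powr (- q))" by (simp add: mult.assoc)
    moreover have "sqrt ((1 + dF) * C * (1 + t) powr (- q)) = k1 * (1 + t) powr (- b)"
      using sqrt_powr[of "(1 + dF) * C" t q] C dF_pos t0 by (simp add: k1_def q_def)
    ultimately show ?thesis by (simp only: \<tau>_norm[OF t0(1)])
  qed
  have p: "L2_norm (p t) \<le> k2 * (1 + t) powr (- (1 + b))" if t: "T1 < t" for t
  proof -
    have t0: "0 \<le> t" "T \<le> t" using t T10 T1 by auto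
    have "dev t \<le> dF * (C * (1 + t) powr (- (2 + q)))"
      using dev_le[OF t0(1)] mult_left_mono[OF F[OF t0(2)], of dF] dF_pos by linarith
    then have "sqrt (dev t) \<le> sqrt (dF * C * (1 + t) powr (- (2 + q)))" by (simp add: mult.assoc)
    moreover have "sqrt (dF * C * (1 + t) powr (- (2 + q))) = k2 * (1 + t) powr (- ((2 + q) / 2))"
      unfolding k2_def by (rule sqrt_powr) (use C dF_pos t0 in auto)
    moreover have "(2 + q) / 2 = 1 + b" by (simp add: q_def)
    ultimately show ?thesis by (simp only: p_norm[OF t0(1)])
  qed
  have fl: "L2_norm (flux t) \<le> k3 * (1 + t) powr (- (2 + b))" if t: "T1 < t" for t
  proof -
    have t0: "0 \<le> t" "T1 \<le> t" using t T10 T1 by auto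
    have "mean (\<lambda>y. (dq h v t y)\<^sup>2) \<le> K' * (1 + t) powr (- (4 + q))" if "0 < h" "h \<le> h1" for h
    proof -
      have "mean (\<lambda>y. (dq h v t y)\<^sup>2) \<le> K * (1 + t) powr (- (4 + q))" by (rule K[OF that t0(2)])
      also have "\<dots> \<le> K' * (1 + t) powr (- (4 + q))" by (intro mult_right_mono) (auto simp: K'_def)
      finally show ?thesis .
    qed
    from flux_bound[OF t0(1) h1 this] have "L2_norm (flux t) \<le> sqrt (K' * (1 + t) powr (- (4 + q)))" .
    moreover have "sqrt (K' * (1 + t) powr (- (4 + q))) = k3 * (1 + t) powr (- ((4 + q) / 2))"
      unfolding k3_def by (rule sqrt_powr) (use t0 in \<open>auto simp: K'_def\<close>)
    moreover have "(4 + q) / 2 = 2 + b" by (simp add: q_def)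
    ultimately show ?thesis by (simp only:)
  qed
  have su: "sobolev_norm 1 (u t) \<le> 2 / \<eta> * (k3 + k2) * (1 + t) powr (- (1 + b))" if t: "T1 < t" for t
  proof -
    have t0: "0 \<le> t" using t T10 by auto
    have "(1 + t) powr (- (2 + b)) \<le> (1 + t) powr (- (1 + b))" using t0 by (intro powr_mono) auto
    then have "k3 * (1 + t) powr (- (2 + b)) \<le> k3 * (1 + t) powr (- (1 + b))" using kp by (intro mult_left_mono)
    then have "L2_norm (flux t) + L2_norm (p t) \<le> (k3 + k2) * (1 + t) powr (- (1 + b))"
      using fl[OF t] p[OF t] unfolding distrib_right by linarith
    then have "2 / \<eta> * (L2_norm (flux t) + L2_norm (p t)) \<le> 2 / \<eta> * ((k3 + k2) * (1 + t) powr (- (1 + b)))"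
      using pos by (intro mult_left_mono) auto
    then show ?thesis using sobolev_norm_u_le[OF t0] unfolding mult.assoc by linarith
  qed
  have fb: "recip_bound (f T1 y) ((1 + \<alpha>) * (t - T1)) \<le> f t y \<and> f t y \<le> recip_bound (f T1 y) ((1 - \<alpha>) * (t - T1))"
    if t: "T1 < t" and y: "y \<in> {0..1}" for t y
    using f_recip_bounds[OF T10 less_imp_le[OF t] y \<alpha>] rate[OF _ y] T1 by auto
  show ?thesis
  proof (rule exI[of _ T1], intro conjI T10, rule exI[of _ \<kappa>], intro conjI allI impI ballI)
    fix t assume t: "T1 < t"
    show "L2_norm (\<tau> t) \<le> \<kappa> * (1 + t) powr (- b)" using \<tau>[OF t] up[OF kk(1)] by (rule order_trans)
    show "L2_norm (p t) \<le> \<kappa> * (1 + t) powr (- (1 + b))" using p[OF t] up[OF kk(2)] by (rule order_trans)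
    show "sobolev_norm 1 (u t) \<le> \<kappa> * (1 + t) powr (- (1 + b))" using su[OF t] up[OF kk(4)] by (rule order_trans)
    show "L2_norm (flux t) \<le> \<kappa> * (1 + t) powr (- (2 + b))" using fl[OF t] up[OF kk(3)] by (rule order_trans)
    fix y :: real assume y: "y \<in> {0..1}"
    show "recip_bound (f T1 y) ((1 + \<alpha>) * (t - T1)) \<le> f t y" "f t y \<le> recip_bound (f T1 y) ((1 - \<alpha>) * (t - T1))"
      using fb[OF t y] by auto
  qed
qed

end

theorem theorem3p2:
  fixes \<rho> \<eta> lam G \<xi> \<nu> \<beta> :: real
    and u0 \<tau>0 f0 :: "real \<Rightarrow> real"
    and u \<tau> f :: "real \<Rightarrow> real \<Rightarrow> real"
  assumes "\<rho> > 0" "\<eta> > 0" "lam > 0" "G > 0" "\<xi> > 0" "\<nu> > 0"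
    and "u0 \<in> H1" "\<tau>0 \<in> H1" "f0 \<in> H1"
    and "u0 0 = 0" "u0 1 = 0"
    and "\<forall>y\<in>{0..1}. f0 y \<ge> 0"
    and "\<exists>y\<in>{0..1}. f0 y \<noteq> 0"
    and "global_solution \<rho> \<eta> lam G \<xi> \<nu> u0 \<tau>0 f0 u \<tau> f"
    and "\<beta> = measure lebesgue {y\<in>{0..1}. f0 y > 0}"
  shows "\<forall>\<alpha>\<in>{0<..<1}. \<exists>t0\<ge>0.
    (\<exists>\<kappa>. \<forall>t>t0.
      sobolev_norm 1 (u t) + L2_norm (\<tau> t) \<le> \<kappa> * (1 + t) powr (- (\<beta> / lam) * (1 - \<alpha>))) \<and>
    (\<forall>t>t0. \<forall>y\<in>{0..1}.
      recip_bound (f t0 y) ((1 + \<alpha>) * (t - t0)) \<le> f t y \<and>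
      f t y \<le> recip_bound (f t0 y) ((1 - \<alpha>) * (t - t0))) \<and>
    (\<exists>\<kappa>. \<forall>t>t0.
      sobolev_norm 1 (u t) + L2_norm (\<lambda>y. \<tau> t y - space_avg (\<tau> t))
        \<le> \<kappa> * (1 + t) powr (- 1 - (\<beta> / lam) * (1 - \<alpha>)) \<and>
      L2_norm (\<lambda>y. \<eta> * weak_D 1 (u t) y + \<tau> t y - space_avg (\<tau> t))
        \<le> \<kappa> * (1 + t) powr (- 2 - (\<beta> / lam) * (1 - \<alpha>)))"
proof
  fix \<alpha> :: real assume "\<alpha> \<in> {0<..<1}"
  then have \<alpha>: "0 < \<alpha>" "\<alpha> < 1" by auto
  have uC: "u \<in> C_time T H1 (sobolev_norm 1)" if "0 < T" for T
    using assms(14) that unfolding global_solution_def by blast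
  have f0: "f 0 y = f0 y" if "y \<in> {0..1}" for y
    using assms(14) that unfolding global_solution_def by blast
  interpret aging_flow \<rho> \<eta> lam G u \<tau> f \<xi> \<nu>
    by (rule global_solution_imp_aging_flow[OF assms(1-6) assms(12-14)])
  interpret regular_aging_flow \<rho> \<eta> lam G u \<tau> f \<xi> \<nu>
    by unfold_locales (use C_time_H1_limit[OF uC] in auto)
  have "{y\<in>{0..1}. f 0 y > 0} = {y\<in>{0..1}. f0 y > 0}" using f0 by auto
  then have \<beta>: "aging_flow.\<beta> f = \<beta>" by (simp add: \<beta>_def assms(15))
  define b where "b = \<beta> / lam * (1 - \<alpha>)"
  obtain t0 \<kappa> where t0: "0 \<le> t0"
    and \<tau>: "\<And>t. t0 < t \<Longrightarrow> L2_norm (\<tau> t) \<le> \<kappa> * (1 + t) powr (- b)"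
    and p: "\<And>t. t0 < t \<Longrightarrow> L2_norm (p t) \<le> \<kappa> * (1 + t) powr (- (1 + b))"
    and su: "\<And>t. t0 < t \<Longrightarrow> sobolev_norm 1 (u t) \<le> \<kappa> * (1 + t) powr (- (1 + b))"
    and fl: "\<And>t. t0 < t \<Longrightarrow> L2_norm (flux t) \<le> \<kappa> * (1 + t) powr (- (2 + b))"
    and fb: "\<And>t y. t0 < t \<Longrightarrow> y \<in> {0..1} \<Longrightarrow> recip_bound (f t0 y) ((1 + \<alpha>) * (t - t0)) \<le> f t y \<and> f t y \<le> recip_bound (f t0 y) ((1 - \<alpha>) * (t - t0))"
    using long_time_behaviour[OF \<alpha>] unfolding \<beta> b_def[symmetric] by blast
  have avg: "space_avg (\<tau> t) = mean (\<tau> t)" if "t0 < t" for t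
    unfolding space_avg_def by (rule LINT_mean(2)[OF slices(2)]) (use that t0 in simp)
  have \<kappa>0: "0 \<le> \<kappa>"
  proof -
    have "0 \<le> \<kappa> * (1 + (t0 + 1)) powr (- b)" using \<tau>[of "t0 + 1"] L2_norm_nonneg[of "\<tau> (t0 + 1)"] by linarith
    moreover have "0 < (1 + (t0 + 1)) powr (- b)" using t0 by simp
    ultimately show ?thesis by (simp add: zero_le_mult_iff)
  qed
  have e1: "- (\<beta> / lam) * (1 - \<alpha>) = - b" "- 1 - (\<beta> / lam) * (1 - \<alpha>) = - (1 + b)" "- 2 - (\<beta> / lam) * (1 - \<alpha>) = - (2 + b)"
    by (simp_all add: b_def)
  have 1: "sobolev_norm 1 (u t) + L2_norm (\<tau> t) \<le> (2 * \<kappa>) * (1 + t) powr (- b)" if t: "t0 < t" for t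
  proof -
    have "(1 + t) powr (- (1 + b)) \<le> (1 + t) powr (- b)" using t t0 by (intro powr_mono) auto
    then have "\<kappa> * (1 + t) powr (- (1 + b)) \<le> \<kappa> * (1 + t) powr (- b)" using \<kappa>0 by (intro mult_left_mono)
    then show ?thesis using su[OF t] \<tau>[OF t] by linarith
  qed
  have 2: "sobolev_norm 1 (u t) + L2_norm (\<lambda>y. \<tau> t y - space_avg (\<tau> t)) \<le> (2 * \<kappa>) * (1 + t) powr (- (1 + b))" if t: "t0 < t" for t
  proof -
    have "(\<lambda>y. \<tau> t y - space_avg (\<tau> t)) = p t" by (simp add: p_def[abs_def] avg[OF t])
    then show ?thesis using su[OF t] p[OF t] by simp
  qed
  have 3: "L2_norm (\<lambda>y. \<eta> * weak_D 1 (u t) y + \<tau> t y - space_avg (\<tau> t)) \<le> (2 * \<kappa>) * (1 + t) powr (- (2 + b))" if t: "t0 < t" for t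
  proof -
    have "(\<lambda>y. \<eta> * weak_D 1 (u t) y + \<tau> t y - space_avg (\<tau> t)) = flux t" by (simp add: flux_def[abs_def] p_def avg[OF t] add_diff_eq)
    moreover have "\<kappa> * (1 + t) powr (- (2 + b)) \<le> (2 * \<kappa>) * (1 + t) powr (- (2 + b))" using \<kappa>0 by (intro mult_right_mono) auto
    ultimately show ?thesis using fl[OF t] by simp
  qed
  show "\<exists>t0\<ge>0.
    (\<exists>\<kappa>. \<forall>t>t0.
      sobolev_norm 1 (u t) + L2_norm (\<tau> t) \<le> \<kappa> * (1 + t) powr (- (\<beta> / lam) * (1 - \<alpha>))) \<and>
    (\<forall>t>t0. \<forall>y\<in>{0..1}.
      recip_bound (f t0 y) ((1 + \<alpha>) * (t - t0)) \<le> f t y \<and>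
      f t y \<le> recip_bound (f t0 y) ((1 - \<alpha>) * (t - t0))) \<and>
    (\<exists>\<kappa>. \<forall>t>t0.
      sobolev_norm 1 (u t) + L2_norm (\<lambda>y. \<tau> t y - space_avg (\<tau> t))
        \<le> \<kappa> * (1 + t) powr (- 1 - (\<beta> / lam) * (1 - \<alpha>)) \<and>
      L2_norm (\<lambda>y. \<eta> * weak_D 1 (u t) y + \<tau> t y - space_avg (\<tau> t))
        \<le> \<kappa> * (1 + t) powr (- 2 - (\<beta> / lam) * (1 - \<alpha>)))"
    unfolding e1
  proof (rule exI[of _ t0], intro conjI t0)
    show "\<exists>\<kappa>. \<forall>t>t0. sobolev_norm 1 (u t) + L2_norm (\<tau> t) \<le> \<kappa> * (1 + t) powr (- b)"
      using 1 by (intro exI[of _ "2 * \<kappa>"]) simp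
    show "\<forall>t>t0. \<forall>y\<in>{0..1}. recip_bound (f t0 y) ((1 + \<alpha>) * (t - t0)) \<le> f t y \<and> f t y \<le> recip_bound (f t0 y) ((1 - \<alpha>) * (t - t0))"
      using fb by simp
    show "\<exists>\<kappa>. \<forall>t>t0. sobolev_norm 1 (u t) + L2_norm (\<lambda>y. \<tau> t y - space_avg (\<tau> t)) \<le> \<kappa> * (1 + t) powr (- (1 + b)) \<and>
        L2_norm (\<lambda>y. \<eta> * weak_D 1 (u t) y + \<tau> t y - space_avg (\<tau> t)) \<le> \<kappa> * (1 + t) powr (- (2 + b))"
    proof (intro exI[of _ "2 * \<kappa>"] allI impI conjI)
      fix t assume t: "t0 < t"
      show "sobolev_norm 1 (u t) + L2_norm (\<lambda>y. \<tau> t y - space_avg (\<tau> t)) \<le> 2 * \<kappa> * (1 + t) powr (- (1 + b))" by (rule 2[OF t])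
      show "L2_norm (\<lambda>y. \<eta> * weak_D 1 (u t) y + \<tau> t y - space_avg (\<tau> t)) \<le> 2 * \<kappa> * (1 + t) powr (- (2 + b))" by (rule 3[OF t])
    qed
  qed
qed

end
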